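(* Let $n\ge1$ and $0\le\alpha<n$. If $\lambda>\max\{\frac{\alpha-1}{4},0\}$, then the maximal operator $S_*^\lambda(H)$ is bounded on $L^2(\mathbb R^n,(1+|x|)^{-\alpha}dx)$. Conversely, if $\lambda\ge0$ and $S_*^\lambda(H)$ is bounded on $L^2(\mathbb R^n,(1+|x|)^{-\alpha}dx)$, then $\lambda\ge\max\{\frac{\alpha-1}{4},0\}$.
   Context: $H=-\Delta+|x|^2$ on $\mathbb R^n$. Let $h_k(t)=(2^kk!\sqrt\pi)^{-1/2}H_k(t)e^{-t^2/2}$ with $H_k(t)=(-1)^ke^{t^2}\frac{d^k}{dt^k}e^{-t^2}$, and $\Phi_\mu(x)=\prod_{i=1}^nh_{\mu_i}(x_i)$ for $\mu\in\mathbb N_0^n$ (eigenfunctions of $H$ with eigenvalue $2|\mu|+n$, forming an orthonormal basis of $L^2(\mathbb R^n)$). $P_kf=\sum_{|\mu|=k}\langle f,\Phi_\mu\rangle\Phi_\mu$. For $R>0$, $\lambda\ge0$: $S_R^\lambda(H)f=\sum_{k\ge0}\big(1-\frac{2k+n}{R^2}\big)_+^\lambda P_kf$, and $S_*^\lambda(H)f(x)=\sup_{R>0}|S_R^\lambda(H)f(x)|$. *)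

theory Defs
  imports "HOL-Analysis.Analysis"
begin

definition hermite_H :: "nat \<Rightarrow> real \<Rightarrow> real" where
  "hermite_H k t = (-1) ^ k * exp (t\<^sup>2) * ((deriv ^^ k) (\<lambda>s. exp (- (s\<^sup>2))) t)"

definition hermite_fun :: "nat \<Rightarrow> real \<Rightarrow> real" where
  "hermite_fun k t = (2 ^ k * fact k * sqrt pi) powr (-1/2) * hermite_H k t * exp (- (t\<^sup>2) / 2)"

definition Phi :: "('n::finite \<Rightarrow> nat) \<Rightarrow> real^'n \<Rightarrow> real" where
  "Phi \<mu> x = (\<Prod>i\<in>UNIV. hermite_fun (\<mu> i) (x $ i))"

definition herm_proj :: "nat \<Rightarrow> (real^'n::finite \<Rightarrow> complex) \<Rightarrow> real^'n \<Rightarrow> complex" where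
  "herm_proj k f x =
     (\<Sum>\<mu>\<in>{\<mu>::'n \<Rightarrow> nat. sum \<mu> UNIV = k}.
        (LINT y|lborel. f y * complex_of_real (Phi \<mu> y)) * complex_of_real (Phi \<mu> x))"

text \<open>Bochner--Riesz means S_R^lambda(H) f = sum_k (1 - (2k+n)/R^2)_+^lambda P_k f.
  The positive part power (t)_+^lambda is (max 0 t) powr lambda; only the finitely many
  k with 2k+n < R^2 give nonzero terms.\<close>
definition BR_mean :: "real \<Rightarrow> real \<Rightarrow> (real^'n::finite \<Rightarrow> complex) \<Rightarrow> real^'n \<Rightarrow> complex" where
  "BR_mean lam R f x =
     (\<Sum>k\<in>{k::nat. real (2 * k + CARD('n)) < R\<^sup>2}.
        complex_of_real ((max 0 (1 - real (2 * k + CARD('n)) / R\<^sup>2)) powr lam) * herm_proj k f x)"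

definition BR_max :: "real \<Rightarrow> (real^'n::finite \<Rightarrow> complex) \<Rightarrow> real^'n \<Rightarrow> ennreal" where
  "BR_max lam f x = (SUP R\<in>{0<..}. ennreal (norm (BR_mean lam R f x)))"

definition weight :: "real \<Rightarrow> real^'n::finite \<Rightarrow> real" where
  "weight \<alpha> x = (1 + norm x) powr (- \<alpha>)"

definition L2w :: "real \<Rightarrow> (real^'n::finite \<Rightarrow> complex) set" where
  "L2w \<alpha> = {f. f \<in> borel_measurable lborel \<and>
               (\<integral>\<^sup>+ x. ennreal ((norm (f x))\<^sup>2 * weight \<alpha> x) \<partial>lborel) < \<infinity>}"

definition BR_max_bounded :: "'n::finite itself \<Rightarrow> real \<Rightarrow> real \<Rightarrow> bool" where
  "BR_max_bounded _ lam \<alpha> \<longleftrightarrow>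
     (\<exists>C::real. \<forall>f::real^'n \<Rightarrow> complex. f \<in> L2w \<alpha> \<longrightarrow>
        (\<integral>\<^sup>+ x. (BR_max lam f x)\<^sup>2 * ennreal (weight \<alpha> x) \<partial>lborel)
          \<le> ennreal C * (\<integral>\<^sup>+ x. ennreal ((norm (f x))\<^sup>2 * weight \<alpha> x) \<partial>lborel))"

end

theory Submission
  imports Defs "HOL-Probability.Distributions" "HOL-Computational_Algebra.Polynomial" "HOL-Real_Asymp.Real_Asymp"
begin

text \<open>Sufficiency. The power \<open>t powr lam\<close>, \<open>0 \<le> t \<le> 1\<close>, is an average over \<open>0 < d \<le> 1\<close> of bumps \<open>B (t / d)\<close> plus a polynomial
 vanishing to high order at 0. The polynomial and the bumps with \<open>d \<ge> 1/2\<close> are smooth multipliers; their kernels are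
 dominated by an approximate identity, since multiplication by \<open>x_i - y_i\<close> turns the kernel of a multiplier into the kernels of
 its differences. For small \<open>d\<close> the supremum over \<open>R = exp (y / 2)\<close> is controlled by a square function in \<open>y\<close> (Sobolev).
 On \<open>L\<^sup>2\<close> that square function has norm squared \<open>O(d)\<close>, the spectral projections gain \<open>k powr (- g / 2)\<close> in the weight
 \<open>(1 + |x|) powr (- g)\<close>, \<open>g < 1\<close> (virial identity), and the commutator identity again shows that the multiplier moves mass
 only by a controlled distance. Interpolating these three facts on unit blocks of \<open>y\<close> gives a loss of \<open>d\<close> to a power arbitrarily
 close to \<open>- max ((alpha - 1) / 2) 0\<close>, which is summable against \<open>d powr (2 * lam)\<close>.

 Necessity. Test on \<open>x_1 ^ m * Phi ((k + m) e_1)\<close>: its expansion starts at degree \<open>k\<close>, so for \<open>R\<^sup>2 = 2 * k + n + 1\<close> only one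
 term survives, and Hermite functions carry mass about \<open>k powr (- 1 / 2)\<close> near the origin.\<close>

text \<open>The exponent \<open>(al - 1) / 2\<close> comes from a balance. On the block exp y ~ E a
  bump of width d spreads mass over a distance a, with a^2 ~ E as long as E <= 1/d and a^2 ~ 1 /
  (d^2 E) beyond. Inside radius a the weight is exchanged for a trace weight of exponent just below
  1, which gains (1 + d E) E powr (- 1/2) and costs a powr al, the price of returning from the
  weight at scale a to the one at scale 1. Both regimes are worst at E = 1/d, where the loss is d
  powr (- (al - 1) / 2). The virial constant blows up as the trace exponent tends to 1; this and the
  logarithmic number of blocks force the arbitrarily small extra power. For al < 1 one interpolates
  between al = 0 and al = 1. Every operator is cut off at degree K, hence a finite sum; the final
  bounds are uniform in K, and K is released at the end by Fatou's lemma. The dyadic maximal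
  operator is truncated as well, because its bound arises by improving one that is already finite.
  In the smooth part the kernel absorbs the weight, so an unweighted maximal estimate
  suffices.\<close>

abbreviation nn_lborel :: "('a::euclidean_space => ennreal) => ennreal" (binder "NN " 10) where
 "nn_lborel F \<equiv> integral\<^sup>N lborel F"

abbreviation lint_lborel :: "('a::euclidean_space => 'b::{banach, second_countable_topology}) => 'b" (binder "LI " 10) where
 "lint_lborel F \<equiv> integral\<^sup>L lborel F"

abbreviation "cx \<equiv> complex_of_real"

abbreviation csq :: "complex => ennreal" where
 "csq z \<equiv> ennreal ((cmod z)^2)"

abbreviation csqw :: "complex => real => ennreal" where
 "csqw z w \<equiv> ennreal ((cmod z)^2 * w)"

type_synonym 'n cfun = "real^'n => complex"

abbreviation hsq :: "nat => real => real" where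
 "hsq k t \<equiv> (hermite_fun k t)^2"

section \<open>Hermite functions on the line\<close>

primrec herm_poly :: "nat => real poly" where
 "herm_poly 0 = 1"
| "herm_poly (Suc k) = [:0, 2:] * herm_poly k - pderiv (herm_poly k)"

lemma iterated_deriv_gauss:
 "(deriv ^^ k) (%s. exp (- (s\<^sup>2))) = (%t::real. (-1) ^ k * poly (herm_poly k) t * exp (- (t\<^sup>2)))"
proof (induction k)
 case (Suc k)
 have "((%t. (-1) ^ k * poly (herm_poly k) t * exp (- (t\<^sup>2))) has_field_derivative
   (-1) ^ Suc k * poly (herm_poly (Suc k)) t * exp (- (t\<^sup>2))) (at t)" for t :: real
  by (auto intro!: derivative_eq_intros poly_DERIV simp: algebra_simps)
 thus ?case
  by (auto simp: Suc.IH fun_eq_iff intro!: DERIV_imp_deriv simp del: herm_poly.simps)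
qed simp

lemma hermite_H_poly: "hermite_H k t = poly (herm_poly k) t"
proof -
 have "exp (t^2) * exp (- (t\<^sup>2)) = 1"
  by (simp add: exp_minus)
 moreover have "(-1::real) ^ k * (-1) ^ k = 1"
  by (simp add: power_mult_distrib[symmetric])
 ultimately show ?thesis
  unfolding hermite_H_def iterated_deriv_gauss by (simp add: mult_ac)
qed

lemma pderiv_herm_poly: "pderiv (herm_poly (Suc k)) = smult (2 * real (Suc k)) (herm_poly k)"
proof (induction k)
 case 0
 show ?case by (simp add: pderiv_pCons pderiv_mult)
next
 case (Suc k)
 have "pderiv (herm_poly (Suc (Suc k)))
   = pderiv ([:0, 2:] * herm_poly (Suc k)) - pderiv (pderiv (herm_poly (Suc k)))"
  by (simp add: pderiv_diff)
 also have "... = smult 2 (herm_poly (Suc k)) + [:0, 2:] * smult (2 * real (Suc k)) (herm_poly k)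
   - smult (2 * real (Suc k)) (pderiv (herm_poly k))"
  by (simp add: pderiv_mult Suc.IH pderiv_smult pderiv_pCons del: herm_poly.simps)
 also have "... = smult 2 (herm_poly (Suc k)) + smult (2 * real (Suc k)) (herm_poly (Suc k))"
  by (simp add: smult_diff_right)
 finally show ?case by (simp add: smult_add_left[symmetric] algebra_simps del: herm_poly.simps)
qed

lemma hermite_fun_poly:
 "hermite_fun k t = (2 ^ k * fact k * sqrt pi) powr (-1/2) * poly (herm_poly k) t * exp (- (t\<^sup>2) / 2)"
 by (simp add: hermite_fun_def hermite_H_poly)

lemma hermite_norm_Suc:
 "(2 ^ k * fact k * sqrt pi) powr (-1/2)
  = sqrt (2 * real (Suc k)) * (2 ^ Suc k * fact (Suc k) * sqrt pi) powr (-1/2)"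
proof -
 have "(2 ^ Suc k * fact (Suc k) * sqrt pi) powr (-1/2)
   = ((2 * real (Suc k)) * (2 ^ k * fact k * sqrt pi)) powr (-1/2)"
  by (simp add: algebra_simps)
 also have "... = (2 * real (Suc k)) powr (-1/2) * (2 ^ k * fact k * sqrt pi) powr (-1/2)"
  by (subst powr_mult) auto
 also have "(2 * real (Suc k)) powr (-1/2) = 1 / sqrt (2 * real (Suc k))"
  by (simp add: powr_minus powr_half_sqrt[symmetric] field_simps)
 finally show ?thesis by (simp add: field_simps)
qed

lemma hermite_fun_Suc_raw:
 "sqrt (2 * real (Suc k)) * hermite_fun (Suc k) t
  = (2 ^ k * fact k * sqrt pi) powr (-1/2) * poly (herm_poly (Suc k)) t * exp (- (t\<^sup>2) / 2)"
 unfolding hermite_fun_poly hermite_norm_Suc[of k] by simp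

text \<open>The truncated \<open>k - 1\<close> is harmless at \<open>k = 0\<close>, since the factor
  in front of it vanishes; every lowering relation below relies on this convention.\<close>

lemma hermite_fun_lower:
 "2 * real k * ((2 ^ k * fact k * sqrt pi) powr (-1/2) * poly (herm_poly (k - 1)) t * exp (- (t\<^sup>2) / 2))
  = sqrt (2 * real k) * hermite_fun (k - 1) t"
proof (cases k)
 case (Suc j)
 have "sqrt (2 * real (Suc j)) * (sqrt (2 * real (Suc j)) * x) = 2 * real (Suc j) * x" for x
  by (simp add: mult.assoc[symmetric])
 thus ?thesis
  unfolding Suc hermite_fun_poly diff_Suc_1 hermite_norm_Suc[of j] by (simp only: mult.assoc)
qed simp

lemma hermite_fun_has_derivative:
 "(hermite_fun k has_field_derivative
  t * hermite_fun k t - sqrt (2 * real (Suc k)) * hermite_fun (Suc k) t) (at t)"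
 unfolding hermite_fun_Suc_raw
 unfolding hermite_fun_poly[abs_def]
 by (auto intro!: derivative_eq_intros poly_DERIV simp: algebra_simps)

lemma hermite_fun_rec2:
 "2 * t * hermite_fun k t
  = sqrt (2 * real (Suc k)) * hermite_fun (Suc k) t + sqrt (2 * real k) * hermite_fun (k - 1) t"
proof (cases k)
 case 0
 show ?thesis unfolding hermite_fun_Suc_raw by (simp add: 0 hermite_fun_poly)
next
 case (Suc j)
 have "poly (herm_poly (Suc k)) t = 2 * t * poly (herm_poly k) t - 2 * real k * poly (herm_poly (k - 1)) t"
  unfolding Suc diff_Suc_1 herm_poly.simps(2)[of "Suc j"] pderiv_herm_poly poly_diff poly_mult poly_smult
  by simp
 thus ?thesis
  unfolding hermite_fun_Suc_raw hermite_fun_lower[symmetric]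
  by (simp add: hermite_fun_poly algebra_simps)
qed

lemma hermite_fun_rec:
 "t * hermite_fun k t
  = sqrt (real (Suc k) / 2) * hermite_fun (Suc k) t + sqrt (real k / 2) * hermite_fun (k - 1) t"
proof -
 have "sqrt (2 * x) = 2 * sqrt (x / 2)" for x :: real
 proof -
  have "sqrt (2 * x) = sqrt (2^2 * (x / 2))" by simp
  thus ?thesis by (simp only: real_sqrt_mult) simp
 qed
 thus ?thesis using hermite_fun_rec2[of t k]
  unfolding \<open>!!x. sqrt (2 * x) = 2 * sqrt (x / 2)\<close> by linarith
qed

lemma hermite_fun_has_derivative':
 "(hermite_fun k has_field_derivative
  sqrt (2 * real k) * hermite_fun (k - 1) t - t * hermite_fun k t) (at t)"
proof -
 have "t * hermite_fun k t - sqrt (2 * real (Suc k)) * hermite_fun (Suc k) t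
   = sqrt (2 * real k) * hermite_fun (k - 1) t - t * hermite_fun k t"
  using hermite_fun_rec2[of t k] by linarith
 thus ?thesis using hermite_fun_has_derivative[of k t] by (rule subst)
qed

lemma continuous_on_hermite_fun [continuous_intros]:
 "continuous_on A g ==> continuous_on A (%x. hermite_fun k (g x))"
 unfolding hermite_fun_poly by (auto intro!: continuous_intros)

lemma isCont_hermite_fun [continuous_intros, simp]:
 "isCont g x ==> isCont (%x. hermite_fun k (g x)) x"
 unfolding hermite_fun_poly by (auto intro!: continuous_intros)

lemma borel_measurable_hermite_fun [measurable]: "hermite_fun k \<in> borel_measurable borel"
 by (intro borel_measurable_continuous_onI continuous_intros)

section \<open>Rapid decay and orthonormality on the line\<close>

lemma abs_power_gauss_bounded: "\<exists>C\<ge>0. \<forall>t::real. \<bar>t\<bar> ^ m * exp (- (t\<^sup>2) / 2) <= C"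
proof -
 have "\<bar>t\<bar> ^ m * exp (- (t\<^sup>2) / 2) <= 1 + 2 ^ m * fact m" for t :: real
 proof -
  \<comment> \<open>A single term of the exponential series already beats the power.\<close>
  have "(t^2 / 2) ^ m / fact m <= exp (t^2 / 2)"
  proof -
   have "(t^2 / 2) ^ m /\<^sub>R fact m <= (\<Sum>n\<le>m. (t^2 / 2) ^ n /\<^sub>R fact n)"
    by (rule member_le_sum) auto
   also have "... <= exp (t^2 / 2)"
    unfolding exp_def by (rule sum_le_suminf[OF summable_exp_generic]) auto
   finally show ?thesis unfolding divide_inverse_commute real_scaleR_def .
  qed
  hence "t ^ (2 * m) * exp (- (t\<^sup>2) / 2) <= 2 ^ m * fact m"
   unfolding power_mult by (simp add: exp_minus field_simps)
  moreover have "\<bar>t\<bar> ^ m <= 1 + t ^ (2 * m)"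
  proof (cases "\<bar>t\<bar> <= 1")
   case True
   hence "\<bar>t\<bar> ^ m <= 1" by (simp add: power_le_one)
   thus ?thesis by (simp add: power_mult add_increasing2)
  next
   case False
   hence "\<bar>t\<bar> ^ m <= \<bar>t\<bar> ^ (2 * m)" by (intro power_increasing) auto
   also have "... = t ^ (2 * m)" by (simp add: power_mult)
   finally show ?thesis by simp
  qed
  hence "\<bar>t\<bar> ^ m * exp (- (t\<^sup>2) / 2) <= (1 + t ^ (2 * m)) * exp (- (t\<^sup>2) / 2)"
   by (rule mult_right_mono) simp
  moreover have "exp (- (t\<^sup>2) / 2) <= 1" by simp
  ultimately show ?thesis unfolding distrib_right mult_1_left by linarith
 qed
 thus ?thesis by (intro exI[of _ "1 + 2 ^ m * fact m"]) auto
qed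

lemma poly_gauss_bounded: "\<exists>C\<ge>0. \<forall>t::real. \<bar>poly p t\<bar> * exp (- (t\<^sup>2) / 2) <= C"
proof (induction p)
 case 0
 show ?case by (auto intro!: exI[of _ 0])
next
 case (pCons a p)
 obtain C where C: "C >= 0" "!!m t. m <= Suc (degree p) ==> \<bar>t::real\<bar> ^ m * exp (- (t\<^sup>2) / 2) <= C"
 proof -
  obtain c where c: "!!m. c m >= 0" "!!m t. \<bar>t::real\<bar> ^ m * exp (- (t\<^sup>2) / 2) <= c m"
   using abs_power_gauss_bounded by metis
  have "c m <= (\<Sum>m\<le>Suc (degree p). c m)" if "m <= Suc (degree p)" for m
   by (rule member_le_sum) (use that c in auto)
  with c(2) have "\<bar>t::real\<bar> ^ m * exp (- (t\<^sup>2) / 2) <= (\<Sum>m\<le>Suc (degree p). c m)"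
   if "m <= Suc (degree p)" for m t
   using that by (meson order_trans)
  thus ?thesis using c(1)
   by (intro that[of "\<Sum>m\<le>Suc (degree p). c m"]) (simp_all add: sum_nonneg del: sum.atMost_Suc)
 qed
 have "\<bar>poly (pCons a p) t\<bar> * exp (- (t\<^sup>2) / 2) <= \<bar>a\<bar> * C + (\<Sum>i\<le>degree p. \<bar>coeff p i\<bar> * C)" for t
 proof -
  have "\<bar>poly (pCons a p) t\<bar> <= \<bar>a\<bar> + \<bar>t * poly p t\<bar>" by simp
  also have "t * poly p t = (\<Sum>i\<le>degree p. coeff p i * t ^ Suc i)"
   by (simp add: poly_altdef sum_distrib_left mult_ac)
  also have "\<bar>...\<bar> <= (\<Sum>i\<le>degree p. \<bar>coeff p i\<bar> * \<bar>t\<bar> ^ Suc i)"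
   by (rule order_trans[OF sum_abs]) (simp add: abs_mult power_abs)
  finally have "\<bar>poly (pCons a p) t\<bar> * exp (- (t\<^sup>2) / 2)
    <= (\<bar>a\<bar> + (\<Sum>i\<le>degree p. \<bar>coeff p i\<bar> * \<bar>t\<bar> ^ Suc i)) * exp (- (t\<^sup>2) / 2)"
   by (simp add: mult_right_mono)
  also have "... = \<bar>a\<bar> * (\<bar>t\<bar> ^ 0 * exp (- (t\<^sup>2) / 2))
    + (\<Sum>i\<le>degree p. \<bar>coeff p i\<bar> * (\<bar>t\<bar> ^ Suc i * exp (- (t\<^sup>2) / 2)))"
   unfolding distrib_right sum_distrib_right mult.assoc power_0 mult_1_left ..
  also have "... <= \<bar>a\<bar> * C + (\<Sum>i\<le>degree p. \<bar>coeff p i\<bar> * C)"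
   by (intro add_mono mult_left_mono sum_mono C(2)) auto
  finally show ?thesis .
 qed
 thus ?case using C(1) by (intro exI[of _ "\<bar>a\<bar> * C + (\<Sum>i\<le>degree p. \<bar>coeff p i\<bar> * C)"])
   (auto intro!: add_nonneg_nonneg sum_nonneg)
qed

lemma hermite_fun_decay: "\<exists>C\<ge>0. \<forall>t. (1 + \<bar>t\<bar>) ^ m * \<bar>hermite_fun k t\<bar> <= C"
proof -
 let ?N = "(2 ^ k * fact k * sqrt pi) powr (-1/2)"
 obtain C where C: "C >= 0" "!!t. \<bar>poly ([:2, 0, 2:] ^ m * herm_poly k) t\<bar> * exp (- (t\<^sup>2) / 2) <= C"
  using poly_gauss_bounded by blast
 have "(1 + \<bar>t\<bar>) ^ m * \<bar>hermite_fun k t\<bar> <= C * ?N" for t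
 proof -
  \<comment> \<open>\<open>[:2, 0, 2:]\<close> is 2 (1 + t^2); it dominates 1 + |t|, so the weight
    becomes part of a polynomial times a Gaussian.\<close>
  have "1 + \<bar>t\<bar> <= (1 + t^2) * 2"
  proof (cases "\<bar>t\<bar> <= 1")
   case True
   thus ?thesis by (smt (verit) zero_le_power2)
  next
   case False
   hence "\<bar>t\<bar> * 1 <= \<bar>t\<bar> * \<bar>t\<bar>" by (intro mult_left_mono) auto
   thus ?thesis by (simp add: power2_eq_square)
  qed
  hence "(1 + \<bar>t\<bar>) ^ m <= ((1 + t^2) * 2) ^ m" by (intro power_mono) auto
  hence "(1 + \<bar>t\<bar>) ^ m * \<bar>hermite_fun k t\<bar> <= ((1 + t^2) * 2) ^ m * \<bar>hermite_fun k t\<bar>"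
   by (intro mult_right_mono) auto
  also have "... = ?N * (\<bar>poly ([:2, 0, 2:] ^ m * herm_poly k) t\<bar> * exp (- (t\<^sup>2) / 2))"
   by (simp add: hermite_fun_poly poly_power abs_mult power2_eq_square algebra_simps power_abs)
  also have "... <= ?N * C" by (intro mult_left_mono C) auto
  finally show ?thesis by (simp add: mult.commute)
 qed
 thus ?thesis using C(1) by (intro exI[of _ "C * ?N"]) auto
qed

lemma nn_integral_inverse_quadratic: "(NN (t::real). ennreal (1 / (1 + \<bar>t\<bar>) ^ 2)) = 2"
proof -
 have half: "(NN (t::real). ennreal (1 / (1 + t) ^ 2) * indicator {0..} t) = ennreal (0 - (- 1))"
 proof (rule nn_integral_FTC_atLeast[where F = "%t. - 1 / (1 + t)", THEN trans])
  show "((%t. - 1 / (1 + t)) \<longlongrightarrow> (0::real)) at_top"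
   by real_asymp
 qed (auto intro!: derivative_eq_intros simp: power2_eq_square)
 have "(NN (t::real). ennreal (1 / (1 + \<bar>t\<bar>) ^ 2))
   = (NN t. ennreal (1 / (1 + t) ^ 2) * indicator {0..} t
      + ennreal (1 / (1 - t) ^ 2) * indicator {..<0} t)"
  by (intro nn_integral_cong) (auto simp: indicator_def)
 also have "... = (NN t. ennreal (1 / (1 + t) ^ 2) * indicator {0..} t)
      + (NN t. ennreal (1 / (1 - t) ^ 2) * indicator {..<0} t)"
  by (rule nn_integral_add) auto
 also have "(NN (t::real). ennreal (1 / (1 - t) ^ 2) * indicator {..<0} t)
   = (NN (t::real). ennreal (1 / (1 + t) ^ 2) * indicator {0<..} t)"
  by (subst nn_integral_real_affine[of _ "-1" 0]) (auto intro!: nn_integral_cong simp: indicator_def)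
 also have "... = (NN (t::real). ennreal (1 / (1 + t) ^ 2) * indicator {0..} t)"
  by (rule nn_integral_cong_AE, rule eventually_mono[OF AE_lborel_singleton[of 0]]) (auto simp: indicator_def)
 finally show ?thesis unfolding half by (simp flip: ennreal_plus)
qed

lemma integrable_inverse_quadratic: "integrable lborel (%t::real. 1 / (1 + \<bar>t\<bar>) ^ 2)"
 by (rule integrableI_nonneg) (auto simp: nn_integral_inverse_quadratic)

text \<open>No decay of derivatives is demanded: wherever a derivative is integrated, it is written
  out and shown to be rapid itself.\<close>

definition rapid :: "(real => real) => bool" where
 "rapid u \<longleftrightarrow> continuous_on UNIV u \<and> (\<forall>m. \<exists>C. \<forall>t. (1 + \<bar>t\<bar>) ^ m * \<bar>u t\<bar> <= C)"

lemma rapid_bound: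
 assumes "rapid u"
 obtains C where "C >= 0" "!!t. (1 + \<bar>t\<bar>) ^ m * \<bar>u t\<bar> <= C"
proof -
 obtain C where C: "!!t. (1 + \<bar>t\<bar>) ^ m * \<bar>u t\<bar> <= C" using assms unfolding rapid_def by blast
 have "0 <= C" using C[of 0] by simp
 thus thesis using C that by blast
qed

lemma rapid_measurable [measurable_dest]: "rapid u ==> u \<in> borel_measurable borel"
 unfolding rapid_def by (auto intro: borel_measurable_continuous_onI)

lemma rapid_isCont: "rapid u ==> isCont u t"
 unfolding rapid_def by (simp add: continuous_on_eq_continuous_at)

lemma rapid_hermite: "rapid (hermite_fun k)"
 unfolding rapid_def by (meson continuous_on_hermite_fun[OF continuous_on_id] hermite_fun_decay)

lemma rapid_mult:
 assumes "rapid u" "continuous_on UNIV g" and g: "!!t. \<bar>g t\<bar> <= D * (1 + \<bar>t\<bar>) ^ l"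
 shows "rapid (%t. g t * u t)"
 unfolding rapid_def
proof (intro conjI allI)
 show "continuous_on UNIV (%t. g t * u t)"
  using assms by (auto simp: rapid_def intro!: continuous_intros)
 fix m
 obtain C where C: "C >= 0" "!!t. (1 + \<bar>t\<bar>) ^ (m + l) * \<bar>u t\<bar> <= C" using rapid_bound[OF assms(1)] by metis
 have D: "D >= 0" using g[of 0] abs_ge_zero[of "g 0"] by simp
 have "(1 + \<bar>t\<bar>) ^ m * \<bar>g t * u t\<bar> <= D * C" for t
 proof -
  have "(1 + \<bar>t\<bar>) ^ m * \<bar>g t * u t\<bar> = ((1 + \<bar>t\<bar>) ^ m * \<bar>u t\<bar>) * \<bar>g t\<bar>" by (simp add: abs_mult)
  also have "... <= ((1 + \<bar>t\<bar>) ^ m * \<bar>u t\<bar>) * (D * (1 + \<bar>t\<bar>) ^ l)"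
   by (intro mult_left_mono g) auto
  also have "... = D * ((1 + \<bar>t\<bar>) ^ (m + l) * \<bar>u t\<bar>)" unfolding power_add by simp
  also have "... <= D * C" by (intro mult_left_mono C D)
  finally show ?thesis .
 qed
 thus "\<exists>C. \<forall>t. (1 + \<bar>t\<bar>) ^ m * \<bar>g t * u t\<bar> <= C" by blast
qed

lemma rapid_times: "rapid u ==> rapid v ==> rapid (%t. u t * v t)"
 by (metis (no_types, lifting) rapid_mult[of v u _ 0] rapid_bound[of u 0] rapid_def mult_1 mult.right_neutral power_0)

lemma rapid_cmult: "rapid u ==> rapid (%t. c * u t)"
 by (rule rapid_mult[where D = "\<bar>c\<bar>" and l = 0]) (auto intro!: continuous_intros)

lemma rapid_power: "rapid u ==> rapid (%t. t ^ m * u t)"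
 by (rule rapid_mult[where D = 1 and l = m]) (auto intro!: continuous_intros power_mono simp: power_abs)

lemma rapid_add:
 assumes "rapid u" "rapid v" shows "rapid (%t. u t + v t)"
 unfolding rapid_def
proof (intro conjI allI)
 show "continuous_on UNIV (%t. u t + v t)"
  using assms by (auto simp: rapid_def intro!: continuous_intros)
 fix m
 obtain C where C: "!!t. (1 + \<bar>t\<bar>) ^ m * \<bar>u t\<bar> <= C" using rapid_bound[OF assms(1)] by metis
 obtain D where D: "!!t. (1 + \<bar>t\<bar>) ^ m * \<bar>v t\<bar> <= D" using rapid_bound[OF assms(2)] by metis
 have "(1 + \<bar>t\<bar>) ^ m * \<bar>u t + v t\<bar> <= C + D" for t
 proof -
  have "(1 + \<bar>t\<bar>) ^ m * \<bar>u t + v t\<bar> <= (1 + \<bar>t\<bar>) ^ m * (\<bar>u t\<bar> + \<bar>v t\<bar>)"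
   by (intro mult_left_mono abs_triangle_ineq) auto
  thus ?thesis using C[of t] D[of t] by (simp add: distrib_left)
 qed
 thus "\<exists>C. \<forall>t. (1 + \<bar>t\<bar>) ^ m * \<bar>u t + v t\<bar> <= C" by blast
qed

lemma rapid_diff: "rapid u ==> rapid v ==> rapid (%t. u t - v t)"
 using rapid_add[of u "%t. (-1) * v t"] rapid_cmult[of v "-1"] by simp

lemma rapid_integrable:
 assumes "rapid u" shows "integrable lborel u"
proof -
 obtain D where D: "D >= 0" "!!t. (1 + \<bar>t\<bar>) ^ 2 * \<bar>u t\<bar> <= D" using rapid_bound[OF assms] by metis
 show ?thesis
 proof (rule Bochner_Integration.integrable_bound)
  show "integrable lborel (%t::real. D * (1 / (1 + \<bar>t\<bar>) ^ 2))"
   by (intro integrable_mult_right integrable_inverse_quadratic)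
  show "AE t in lborel. norm (u t) <= norm (D * (1 / (1 + \<bar>t\<bar>)^2))"
   using D by (intro AE_I2) (auto simp: field_simps)
 qed (use assms in measurable)
qed

lemma rapid_tendsto:
 assumes "rapid u" shows "(u \<longlongrightarrow> 0) at_top" "(u \<longlongrightarrow> 0) at_bot"
proof -
 obtain D where D: "D >= 0" "!!t. (1 + \<bar>t\<bar>) ^ 1 * \<bar>u t\<bar> <= D" using rapid_bound[OF assms] by metis
 have *: "norm (u t) <= D * (1 / (1 + \<bar>t\<bar>))" for t
  using D(2)[of t] by (simp add: field_simps)
 have 1: "((%t::real. D * (1 / (1 + \<bar>t\<bar>))) \<longlongrightarrow> D * 0) at_top"
  by (intro tendsto_intros; real_asymp)
 have 2: "((%t::real. D * (1 / (1 + \<bar>t\<bar>))) \<longlongrightarrow> D * 0) at_bot"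
  by (intro tendsto_intros; real_asymp)
 show "(u \<longlongrightarrow> 0) at_top"
  by (rule Lim_null_comparison[OF always_eventually 1[simplified]]) (use * in auto)
 show "(u \<longlongrightarrow> 0) at_bot"
  by (rule Lim_null_comparison[OF always_eventually 2[simplified]]) (use * in auto)
qed

lemma integrable_hermite_mult:
 "integrable lborel (%t. hermite_fun j t * hermite_fun k t)"
 by (intro rapid_integrable rapid_times rapid_hermite)

text \<open>The form in which integration by parts is used on the line: orthonormality and the
  virial identities are read off from the vanishing integral of a total derivative.\<close>

lemma integral_derivative_eq_0:
 assumes F: "!!x. (F has_real_derivative f x) (at x)" and "rapid F" "rapid f"
 shows "(LI x. f x) = 0"
proof -
 have "(LBINT x=-\<infinity>..\<infinity>. f x) = 0 - 0"
 proof (rule interval_integral_FTC_integrable)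
  show "set_integrable lborel (einterval (-\<infinity>) \<infinity>) f"
   using rapid_integrable[OF \<open>rapid f\<close>] by (simp add: set_integrable_def)
  show "((F \<circ> real_of_ereal) \<longlongrightarrow> 0) (at_right (-\<infinity>))" "((F \<circ> real_of_ereal) \<longlongrightarrow> 0) (at_left \<infinity>)"
   using rapid_tendsto[OF \<open>rapid F\<close>] by (simp_all add: ereal_tendsto_simps1)
 qed (use F rapid_isCont[OF \<open>rapid f\<close>] in \<open>auto simp: has_real_derivative_iff_has_vector_derivative\<close>)
 thus ?thesis by (simp add: interval_integral_to_infinity_eq interval_lebesgue_integral_def set_lebesgue_integral_def)
qed

lemma hermite_orthonormal:
 "(LI t. hermite_fun j t * hermite_fun k t) = (if j = k then 1 else 0)"
proof -
 define I where "I j k = (LI t. hermite_fun j t * hermite_fun k t)" for j k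
 \<comment> \<open>Differentiating the product with the lowering form for \<open>j\<close> and the
   raising form for \<open>k\<close> makes the terms with \<open>t\<close> cancel. The relation
   lowers both indices, so the induction ends at \<open>I 0 0\<close> or at a zero
   coefficient.\<close>
 have step: "sqrt (2 * real (Suc k)) * I j (Suc k) = sqrt (2 * real j) * I (j - 1) k" for j k
 proof -
  have "(LI t. sqrt (2 * real j) * (hermite_fun (j - 1) t * hermite_fun k t)
    - sqrt (2 * real (Suc k)) * (hermite_fun j t * hermite_fun (Suc k) t)) = 0"
  proof (rule integral_derivative_eq_0[where F = "%t. hermite_fun j t * hermite_fun k t"])
   show "((%t. hermite_fun j t * hermite_fun k t) has_real_derivative
     sqrt (2 * real j) * (hermite_fun (j - 1) x * hermite_fun k x)
     - sqrt (2 * real (Suc k)) * (hermite_fun j x * hermite_fun (Suc k) x)) (at x)" for x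
    by (rule DERIV_cong[OF DERIV_mult[OF hermite_fun_has_derivative' hermite_fun_has_derivative]])
     (simp add: algebra_simps)
  qed (intro rapid_diff rapid_cmult rapid_times rapid_hermite)+
  thus ?thesis
   by (simp add: I_def integrable_hermite_mult)
 qed
 have sym: "I j k = I k j" for j k unfolding I_def by (simp add: mult.commute)
 have "I j k = (if j = k then 1 else 0)" for j k
 proof (induction k arbitrary: j)
  case (Suc k)
  show ?case
  proof (cases j)
   case 0
   thus ?thesis using step[of k 0] by simp
  next
   case (Suc i)
   have "sqrt (2 * real (Suc k)) * I (Suc i) (Suc k) = sqrt (2 * real (Suc i)) * (if i = k then 1 else 0)"
    using step[of k "Suc i"] Suc.IH[of i] by simp
   thus ?thesis using Suc by (auto split: if_splits)
  qed
 next
  case 0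
  show ?case
  proof (cases j)
   case 0
   have "has_bochner_integral lborel (%x::real. exp (- x\<^sup>2)) (2 * (sqrt pi / 2))"
    using has_bochner_integral_even_function[OF gaussian_moment_0] by simp
   hence "(LI x. exp (- x\<^sup>2)) = sqrt pi"
    by (simp add: has_bochner_integral_integral_eq)
   moreover have "hermite_fun 0 t * hermite_fun 0 t = (1 / sqrt pi) * exp (- t\<^sup>2)" for t
   proof -
    have "sqrt pi powr (-1/2) * sqrt pi powr (-1/2) = sqrt pi powr (-1)"
     by (simp add: powr_add[symmetric])
    also have "... = 1 / sqrt pi" by (simp add: powr_minus field_simps)
    finally have a: "sqrt pi powr (-1/2) * sqrt pi powr (-1/2) = 1 / sqrt pi" .
    have b: "exp (- (t\<^sup>2) / 2) * exp (- (t\<^sup>2) / 2) = exp (- t\<^sup>2)"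
     by (simp add: exp_add[symmetric])
    show ?thesis
     unfolding a[symmetric] b[symmetric] by (simp add: hermite_fun_poly)
   qed
   ultimately show ?thesis using 0 by (simp add: I_def)
  next
   case (Suc i)
   thus ?thesis using step[of i 0] sym[of "Suc i" 0] by simp
  qed
 qed
 thus ?thesis by (simp add: I_def)
qed

section \<open>Virial identities and weighted bounds on the line\<close>

definition hermite_fun_deriv :: "nat => real => real" where
 "hermite_fun_deriv k t = t * hermite_fun k t - sqrt (2 * real (Suc k)) * hermite_fun (Suc k) t"

lemma DERIV_hermite_fun: "(hermite_fun k has_real_derivative hermite_fun_deriv k t) (at t)"
 unfolding hermite_fun_deriv_def by (rule hermite_fun_has_derivative)

lemma DERIV_hermite_fun_deriv:
 "(hermite_fun_deriv k has_real_derivative (t^2 - (2 * real k + 1)) * hermite_fun k t) (at t)"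
 unfolding hermite_fun_deriv_def[abs_def]
proof (rule DERIV_cong[OF DERIV_diff[OF DERIV_mult[OF DERIV_ident DERIV_hermite_fun]
    DERIV_cmult[OF hermite_fun_has_derivative']]])
 have "sqrt (2 * real (Suc k)) * (sqrt (2 * real (Suc k)) * x) = (2 * real (Suc k)) * x" for x
  by (simp add: mult.assoc[symmetric])
 thus "1 * hermite_fun k t + hermite_fun_deriv k t * t
   - sqrt (2 * real (Suc k)) * (sqrt (2 * real (Suc k)) * hermite_fun (Suc k - 1) t - t * hermite_fun (Suc k) t)
  = (t^2 - (2 * real k + 1)) * hermite_fun k t"
  unfolding right_diff_distrib hermite_fun_deriv_def
  by (simp add: algebra_simps power2_eq_square)
qed

lemma rapid_hermite_deriv: "rapid (hermite_fun_deriv k)"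
 unfolding hermite_fun_deriv_def[abs_def]
 using rapid_power[OF rapid_hermite, of 1 k] by (intro rapid_diff rapid_cmult rapid_hermite) simp

lemma borel_measurable_hermite_fun_deriv [measurable]: "hermite_fun_deriv k \<in> borel_measurable borel"
 using rapid_hermite_deriv by (rule rapid_measurable)

lemma rapid_hermite_square: "rapid (%t. (hsq k t))"
 unfolding power2_eq_square by (intro rapid_times rapid_hermite)

lemma rapid_hermite_deriv_square: "rapid (%t. (hermite_fun_deriv k t)^2)"
 unfolding power2_eq_square by (intro rapid_times rapid_hermite_deriv)

lemma integral_hermite_square: "(LI t. (hsq k t)) = 1"
 using hermite_orthonormal[of k k] by (simp add: power2_eq_square)

text \<open>By the recursion each factor t^2 is traded for one step of the index, up or down. The
  base on the right depends on \<open>k + m\<close> only, which lets the induction absorb the step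
  upwards.\<close>

lemma hermite_moment_bound:
 "(LI t. t ^ (2 * m) * (hsq k t)) <= (2 * real (k + m) + 1) ^ m"
proof (induction m arbitrary: k)
 case 0
 show ?case by (simp add: integral_hermite_square)
next
 case (Suc m)
 have int: "integrable lborel (%t. t ^ (2 * m) * (hsq j t))" for j m
  by (intro rapid_integrable rapid_power rapid_hermite_square)
 have pw: "t ^ (2 * Suc m) * (hsq k t)
   <= real (Suc k) * (t ^ (2 * m) * (hsq (Suc k) t))
    + real k * (t ^ (2 * m) * (hsq (k - 1) t))" for t
 proof -
  define a where "a = sqrt (real (Suc k) / 2) * hermite_fun (Suc k) t"
  define b where "b = sqrt (real k / 2) * hermite_fun (k - 1) t"
  have "t ^ (2 * Suc m) * (hsq k t) = t ^ (2 * m) * (t * hermite_fun k t)^2"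
   by (simp add: power_mult_distrib power2_eq_square)
  also have "... = t ^ (2 * m) * (a + b)^2" by (simp add: hermite_fun_rec a_def b_def)
  also have "... <= t ^ (2 * m) * (2 * a^2 + 2 * b^2)"
  proof (rule mult_left_mono)
   show "(a + b)^2 <= 2 * a^2 + 2 * b^2"
    using zero_le_power2[of "a - b"] by (simp add: power2_sum power2_diff)
  qed (simp add: power_mult)
  also have "a^2 = real (Suc k) / 2 * (hsq (Suc k) t)"
   unfolding a_def power_mult_distrib by (subst real_sqrt_pow2) auto
  also have "b^2 = real k / 2 * (hsq (k - 1) t)"
   unfolding b_def power_mult_distrib by (subst real_sqrt_pow2) auto
  finally show ?thesis by (simp add: distrib_left mult.left_commute del: of_nat_Suc)
 qed
 have "(LI t. t ^ (2 * Suc m) * (hsq k t))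
   <= (LI t. real (Suc k) * (t ^ (2 * m) * (hsq (Suc k) t))
    + real k * (t ^ (2 * m) * (hsq (k - 1) t)))"
  by (intro integral_mono pw int Bochner_Integration.integrable_add integrable_mult_right)
 also have "... = real (Suc k) * (LI t. t ^ (2 * m) * (hsq (Suc k) t))
   + real k * (LI t. t ^ (2 * m) * (hsq (k - 1) t))"
  by (subst Bochner_Integration.integral_add) (auto intro!: int integrable_mult_right)
 also have "... <= real (Suc k) * (2 * real (Suc k + m) + 1) ^ m + real k * (2 * real (k - 1 + m) + 1) ^ m"
  by (intro add_mono mult_left_mono Suc.IH) auto
 also have "... <= real (Suc k) * (2 * real (k + Suc m) + 1) ^ m + real k * (2 * real (k + Suc m) + 1) ^ m"
  by (intro add_mono mult_left_mono power_mono) auto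
 also have "... = (2 * real k + 1) * (2 * real (k + Suc m) + 1) ^ m" by (simp add: algebra_simps)
 also have "... <= (2 * real (k + Suc m) + 1) * (2 * real (k + Suc m) + 1) ^ m"
  by (intro mult_right_mono) auto
 finally show ?case by simp
qed

lemma hermite_moment_2: "(LI t. t^2 * (hsq k t)) = (2 * real k + 1) / 2"
proof -
 have "t^2 * (hsq k t) = real (Suc k) / 2 * (hsq (Suc k) t)
   + real k / 2 * (hsq (k - 1) t)
   + 2 * (sqrt (real (Suc k) / 2) * sqrt (real k / 2)) * (hermite_fun (Suc k) t * hermite_fun (k - 1) t)" for t
 proof -
  have "t^2 * (hsq k t) = (t * hermite_fun k t)^2" by (simp add: power_mult_distrib)
  also have "... = (sqrt (real (Suc k) / 2))^2 * (hsq (Suc k) t)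
   + (sqrt (real k / 2))^2 * (hsq (k - 1) t)
   + 2 * (sqrt (real (Suc k) / 2) * sqrt (real k / 2)) * (hermite_fun (Suc k) t * hermite_fun (k - 1) t)"
   unfolding hermite_fun_rec power2_sum power_mult_distrib by (simp add: mult_ac)
  finally show ?thesis by simp
 qed
 hence "(LI t. t^2 * (hsq k t)) = (LI t. real (Suc k) / 2 * (hsq (Suc k) t)
   + real k / 2 * (hsq (k - 1) t)
   + 2 * (sqrt (real (Suc k) / 2) * sqrt (real k / 2)) * (hermite_fun (Suc k) t * hermite_fun (k - 1) t))"
  by presburger
 also have "... = real (Suc k) / 2 + real k / 2"
  using rapid_integrable[OF rapid_hermite_square] integrable_hermite_mult
  by (simp add: hermite_orthonormal integral_hermite_square del: of_nat_Suc)
 finally show ?thesis by (simp add: field_simps)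
qed

text \<open>The virial identity: along a solution of \<open>h'' = (t^2 - c) h\<close> the energy
 \<open>E = h'^2 + (c - t^2) h^2\<close> satisfies \<open>E' = - 2 t h^2\<close>.\<close>

lemma hermite_virial:
 assumes b: "!!t. (b has_real_derivative b' t) (at t)" and cb': "continuous_on UNIV b'"
  and bd: "!!t. \<bar>b t\<bar> <= C * (1 + \<bar>t\<bar>) ^ m" "!!t. \<bar>b' t\<bar> <= C * (1 + \<bar>t\<bar>) ^ m"
 shows "(LI t. b' t * ((hermite_fun_deriv k t)^2 + (2 * real k + 1 - t^2) * (hsq k t)))
  = 2 * (LI t. t * b t * (hsq k t))"
proof -
 define l where "l = 2 * real k + 1"
 define E where "E t = (hermite_fun_deriv k t)^2 + (l - t^2) * (hsq k t)" for t
 have cb: "continuous_on UNIV b" using b by (auto intro: DERIV_isCont simp: continuous_on_eq_continuous_at)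
 have E: "rapid E"
  unfolding E_def[abs_def] left_diff_distrib
  by (intro rapid_add rapid_diff rapid_hermite_square rapid_hermite_deriv_square rapid_power rapid_cmult)
 have tb: "rapid (%t. t * b t * (hsq k t))"
  using rapid_power[OF rapid_mult[OF rapid_hermite_square cb bd(1)], of 1] by (simp add: mult_ac)
 have 1: "rapid (%t. b' t * E t)" by (rule rapid_mult[OF E cb' bd(2)])
 have "(LI t. b' t * E t - 2 * (t * b t * (hsq k t))) = 0"
 proof (rule integral_derivative_eq_0[where F = "%t. b t * E t"])
  show "((%t. b t * E t) has_real_derivative b' t * E t - 2 * (t * b t * (hsq k t))) (at t)" for t
   unfolding E_def
   by (auto intro!: derivative_eq_intros b DERIV_hermite_fun DERIV_hermite_fun_deriv simp: l_def algebra_simps)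
    (simp add: power2_eq_square)?
  show "rapid (%t. b t * E t)" by (rule rapid_mult[OF E cb bd(1)])
  show "rapid (%t. b' t * E t - 2 * (t * b t * (hsq k t)))"
   by (intro rapid_diff rapid_cmult 1 tb)
 qed
 thus ?thesis
  using rapid_integrable[OF 1] rapid_integrable[OF tb] by (simp add: E_def l_def)
qed

text \<open>Virial identity with b(t) = t (1 + t^2) powr (- g / 2). Since b' >= (1 - g) W, the left
  side controls 2 k + 1 times the wanted integral; here \<open>g < 1\<close> enters. The right side
  is of order (2 k + 1) powr (1 - g / 2) by the second moment.\<close>

lemma hermite_weighted_upper:
 assumes g: "0 <= g" "g < 1"
 obtains C where "C > 0"
  "!!k. (LI t. (1 + t^2) powr (- g / 2) * (hsq k t)) <= C * real (k + 1) powr (- g / 2)"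
proof
 show "9 / (1 - g) > 0" using g by simp
 fix k
 define l where "l = 2 * real k + 1"
 have l: "l > 0" "real (k + 1) <= l" by (auto simp: l_def)
 define W where "W t = (1 + t^2) powr (- g / 2)" for t :: real
 define b where "b t = t * W t" for t
 define b' where "b' t = W t * (1 - g * (t^2 / (1 + t^2)))" for t
 have pos: "1 + t^2 > 0" for t :: real by (smt (verit) zero_le_power2)
 have W: "0 <= W t" "W t <= 1" for t
  unfolding W_def using g powr_mono2'[of "- g / 2" 1 "1 + t^2"] by auto
 have cW: "continuous_on UNIV W"
  unfolding W_def by (intro continuous_intros) (smt (verit) pos)
 have frac: "0 <= t^2 / (1 + t^2)" "t^2 / (1 + t^2) <= 1" for t :: real
  using pos[of t] by (auto simp: field_simps)
 have b'1: "(1 - g) * W t <= b' t" "b' t <= W t" for t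
 proof -
  have "g * (t^2 / (1 + t^2)) <= g * 1" by (intro mult_left_mono frac g)
  thus "(1 - g) * W t <= b' t"
   unfolding b'_def using W(1)[of t] by (simp add: mult.commute mult_left_mono)
  show "b' t <= W t"
   unfolding b'_def using W(1)[of t] frac[of t] g mult_left_mono[of "1 - g * (t^2 / (1 + t^2))" 1 "W t"] by simp
 qed
 have b'0: "0 <= b' t" for t using b'1(1)[of t] g W(1)[of t] by (smt (verit) mult_nonneg_nonneg)
 have db: "(b has_real_derivative b' t) (at t)" for t
 proof -
  have "(W has_real_derivative (- g / 2) * (1 + t^2) powr (- g / 2 - 1) * (2 * t)) (at t)"
   unfolding W_def using pos[of t] by (auto intro!: derivative_eq_intros)
  moreover have "(1 + t^2) powr (- g / 2 - 1) = W t / (1 + t^2)"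
   unfolding W_def using pos[of t] by (simp add: powr_diff)
  ultimately show ?thesis unfolding b_def[abs_def] b'_def
   by (auto intro!: derivative_eq_intros simp: algebra_simps power2_eq_square)
 qed
 have int: "integrable lborel (%t. W t * (hsq k t))"
  "integrable lborel (%t. t^2 * (W t * (hsq k t)))"
  using rapid_mult[OF rapid_hermite_square cW, of 1 0 k] W
  by (auto intro!: rapid_integrable rapid_power)
 have cb': "continuous_on UNIV b'"
  unfolding b'_def using cW by (intro continuous_intros) (use pos in \<open>auto simp: less_imp_neq[symmetric]\<close>)
 have bb: "\<bar>b t\<bar> <= 1 * (1 + \<bar>t\<bar>) ^ 1" "\<bar>b' t\<bar> <= 1 * (1 + \<bar>t\<bar>) ^ 1" for t
 proof -
  have "\<bar>t\<bar> * W t <= \<bar>t\<bar> * 1" by (intro mult_left_mono W) auto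
  thus "\<bar>b t\<bar> <= 1 * (1 + \<bar>t\<bar>) ^ 1" using W[of t] by (simp add: b_def abs_mult)
  show "\<bar>b' t\<bar> <= 1 * (1 + \<bar>t\<bar>) ^ 1" using b'0[of t] b'1(2)[of t] W[of t] by simp
 qed
 note vir = hermite_virial[of b b' 1 1 k, OF db cb' bb, folded l_def]
 have intb: "integrable lborel (%t. b' t * ((hermite_fun_deriv k t)^2 + (l - t^2) * (hsq k t)))"
  unfolding left_diff_distrib
  by (intro rapid_integrable rapid_mult[OF _ cb' bb(2)] rapid_add rapid_diff rapid_hermite_square
    rapid_hermite_deriv_square rapid_power rapid_cmult)
 \<comment> \<open>The kinetic term is nonnegative and is dropped. The part - t^2 b' with the wrong
   sign is bounded by b' <= W and joins the right side, which makes the factor 3.\<close>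
 have main: "l * (1 - g) * (LI t. W t * (hsq k t)) <= 3 * (LI t. t^2 * (W t * (hsq k t)))"
 proof -
  have "(LI t. l * (1 - g) * (W t * (hsq k t)) - t^2 * (W t * (hsq k t)))
    <= (LI t. b' t * ((hermite_fun_deriv k t)^2 + (l - t^2) * (hsq k t)))"
  proof (intro integral_mono intb Bochner_Integration.integrable_diff integrable_mult_right int)
   fix t
   have "l * (1 - g) * (W t * (hsq k t)) = l * (hsq k t) * ((1 - g) * W t)" by simp
   also have "... <= l * (hsq k t) * b' t" using l by (intro mult_left_mono b'1) auto
   finally have 1: "l * (1 - g) * (W t * (hsq k t)) <= l * (hsq k t) * b' t" .
   have 2: "t^2 * (hsq k t) * b' t <= t^2 * (hsq k t) * W t" by (intro mult_left_mono b'1) auto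
   have 3: "0 <= b' t * (hermite_fun_deriv k t)^2" using b'0 by simp
   show "l * (1 - g) * (W t * (hsq k t)) - t^2 * (W t * (hsq k t))
    <= b' t * ((hermite_fun_deriv k t)^2 + (l - t^2) * (hsq k t))"
    using 1 2 3 by (simp add: algebra_simps)
  qed
  also have "... = 2 * (LI t. t^2 * (W t * (hsq k t)))"
   unfolding vir by (simp add: b_def power2_eq_square mult_ac)
  also have "(LI t. l * (1 - g) * (W t * (hsq k t)) - t^2 * (W t * (hsq k t)))
    = l * (1 - g) * (LI t. W t * (hsq k t)) - (LI t. t^2 * (W t * (hsq k t)))"
   using int by simp
  finally show ?thesis by linarith
 qed
 have "(LI t. t^2 * (W t * (hsq k t)))
   <= (LI t. l powr (- g / 2) * (t^2 * (hsq k t)) + l powr (1 - g / 2) * (hsq k t))"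
 proof (intro integral_mono int Bochner_Integration.integrable_add integrable_mult_right)
  show "integrable lborel (%t. t^2 * (hsq k t))" "integrable lborel (%t. (hsq k t))"
   by (intro rapid_integrable rapid_power rapid_hermite_square)+
  fix t
  \<comment> \<open>Split at the turning point t^2 = l: below it t^2 W(t) is at most l powr (1 - g /
    2), beyond it W is at most l powr (- g / 2) and the second moment takes care of t^2.\<close>
  have "t^2 * W t <= l powr (- g / 2) * t^2 + l powr (1 - g / 2)"
  proof (cases "t^2 <= l")
   case True
   have "t^2 * W t <= l powr (1 - g / 2)"
   proof (cases "t = 0")
    case False
    have "W t <= (t^2) powr (- g / 2)" unfolding W_def using g False powr_mono2'[of "- g / 2" "t^2" "1 + t^2"] by auto
    hence "t^2 * W t <= t^2 * (t^2) powr (- g / 2)" by (intro mult_left_mono) auto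
    also have "... = (t^2) powr (1 - g / 2)" using False powr_add[of "t^2" 1 "- g / 2"] by simp
    also have "... <= l powr (1 - g / 2)" using True g by (intro powr_mono2) auto
    finally show ?thesis .
   qed auto
   thus ?thesis by (simp add: add_increasing)
  next
   case False
   hence "W t <= l powr (- g / 2)" unfolding W_def using g l powr_mono2'[of "- g / 2" l "1 + t^2"] by auto
   hence "t^2 * W t <= t^2 * l powr (- g / 2)" by (intro mult_left_mono) auto
   thus ?thesis by (smt (verit) mult.commute powr_ge_zero)
  qed
  hence "t^2 * W t * (hsq k t) <= (l powr (- g / 2) * t^2 + l powr (1 - g / 2)) * (hsq k t)"
   by (rule mult_right_mono) simp
  thus "t^2 * (W t * (hsq k t))
    <= l powr (- g / 2) * (t^2 * (hsq k t)) + l powr (1 - g / 2) * (hsq k t)"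
   by (simp add: algebra_simps)
 qed
 also have "... = l powr (- g / 2) * (l / 2) + l powr (1 - g / 2)"
 proof -
  have "integrable lborel (%t. t^2 * (hsq k t))" "integrable lborel (%t. (hsq k t))"
   by (intro rapid_integrable rapid_power rapid_hermite_square)+
  thus ?thesis by (simp add: hermite_moment_2 integral_hermite_square l_def)
 qed
 also have "l powr (1 - g / 2) = l * l powr (- g / 2)" using l powr_add[of l 1 "- g / 2"] by simp
 finally have "(LI t. t^2 * (W t * (hsq k t))) <= 3 / 2 * l * l powr (- g / 2)"
  by (simp add: algebra_simps)
 have "l * ((1 - g) * (LI t. W t * (hsq k t))) <= l * (9 * l powr (- g / 2))"
 proof -
  have "0 <= l * l powr (- g / 2)" using l by simp
  with main \<open>(LI t. t^2 * (W t * (hsq k t))) <= 3 / 2 * l * l powr (- g / 2)\<close>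
  show ?thesis unfolding mult.assoc by (simp add: mult.left_commute)
 qed
 hence "(1 - g) * (LI t. W t * (hsq k t)) <= 9 * l powr (- g / 2)"
  using l by (simp only: mult_le_cancel_left_pos)
 hence "(LI t. W t * (hsq k t)) <= 9 / (1 - g) * l powr (- g / 2)"
  using g by (simp add: field_simps)
 also have "... <= 9 / (1 - g) * real (k + 1) powr (- g / 2)"
 proof (intro mult_left_mono)
  show "l powr (- g / 2) <= real (k + 1) powr (- g / 2)"
   using powr_mono2'[of "- g / 2" "real (k + 1)" l] l g by simp
 qed (use g in auto)
 finally show "(LI t. (1 + t^2) powr (- g / 2) * (hsq k t)) <= 9 / (1 - g) * real (k + 1) powr (- g / 2)"
  unfolding W_def .
qed

section \<open>The diagonal of the summed Hermite kernel\<close>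

text \<open>The diagonal Christoffel-Darboux formula in differentiated form: with the derivative of
  \<open>hermite_fun K\<close> written by lowering and raising, the sum telescopes.\<close>

lemma DERIV_hermite_christoffel:
 "((%x. \<Sum>p<K. (hermite_fun p x)^2) has_real_derivative
  - (sqrt (2 * real K) * (hermite_fun (K - 1) x * hermite_fun K x))) (at x)"
proof (induction K)
 case (Suc K)
 have "((%x. (hermite_fun K x)^2) has_real_derivative 2 * hermite_fun K x * hermite_fun_deriv K x) (at x)"
  by (auto intro!: derivative_eq_intros DERIV_hermite_fun)
 moreover have "2 * hermite_fun_deriv K x = sqrt (2 * real K) * hermite_fun (K - 1) x
   - sqrt (2 * real (Suc K)) * hermite_fun (Suc K) x"
  unfolding hermite_fun_deriv_def using hermite_fun_rec2[of x K] by argo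
 moreover have "- (sqrt (2 * real K) * (hermite_fun (K - 1) x * hermite_fun K x))
   + hermite_fun K x * (2 * hermite_fun_deriv K x)
  = - (sqrt (2 * real (Suc K)) * (hermite_fun (Suc K - 1) x * hermite_fun (Suc K) x))"
  unfolding calculation(2) by (simp add: algebra_simps)
 ultimately show ?case
  using DERIV_add[OF Suc.IH, of "%x. (hermite_fun K x)^2" "2 * hermite_fun K x * hermite_fun_deriv K x"]
  by (simp only: sum.lessThan_Suc mult.left_commute[of 2] mult.assoc)
qed simp

lemma integral_abs_hermite_mult_le: "(LI t. \<bar>hermite_fun j t * hermite_fun k t\<bar>) <= 1"
proof -
 have "(LI t. \<bar>hermite_fun j t * hermite_fun k t\<bar>)
   <= (LI t. ((hsq j t) + (hsq k t)) / 2)"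
 proof (intro integral_mono integrable_abs integrable_hermite_mult)
  show "integrable lborel (%t. ((hsq j t) + (hsq k t)) / 2)"
   using rapid_integrable[OF rapid_hermite_square] by auto
  show "\<bar>hermite_fun j t * hermite_fun k t\<bar> <= ((hsq j t) + (hsq k t)) / 2" for t
   using zero_le_power2[of "\<bar>hermite_fun j t\<bar> - \<bar>hermite_fun k t\<bar>"]
   by (simp add: power2_diff abs_mult)
 qed
 thus ?thesis
  using rapid_integrable[OF rapid_hermite_square] by (simp add: integral_hermite_square)
qed

text \<open>Integrate the telescoped derivative from x to infinity; the product of neighbours has
  L^1 norm at most 1. This gives the right order sqrt K without pointwise asymptotics of Hermite
  functions.\<close>

lemma hermite_christoffel_bound: "(\<Sum>p<K. (hermite_fun p x)^2) <= sqrt (2 * real K)"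
proof -
 define S where "S x = (\<Sum>p<K. (hermite_fun p x)^2)" for x
 define u where "u t = sqrt (2 * real K) * (hermite_fun (K - 1) t * hermite_fun K t)" for t
 have u: "integrable lborel u" unfolding u_def by (intro integrable_mult_right integrable_hermite_mult)
 have bound: "S x - S y <= sqrt (2 * real K)" if "x <= y" for y
 proof -
  have "(LI t. (- u t) * indicator {x..y} t) = S y - S x"
  proof (rule integral_FTC_Icc_real[OF that])
   show "(S has_real_derivative - u t) (at t)" for t
    unfolding S_def u_def by (rule DERIV_hermite_christoffel)
   show "isCont (%t. - u t) t" for t unfolding u_def by (intro continuous_intros)
  qed
  hence "S x - S y = (LI t. u t * indicator {x..y} t)" by simp
  also have "... <= (LI t. \<bar>u t\<bar>)"
   using u integrable_real_mult_indicator[OF _ u, of "{x..y}"]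
   by (intro integral_mono) (auto simp: indicator_def mult.commute)
  also have "... = sqrt (2 * real K) * (LI t. \<bar>hermite_fun (K - 1) t * hermite_fun K t\<bar>)"
   unfolding u_def by (simp add: abs_mult)
  also have "... <= sqrt (2 * real K) * 1"
   by (intro mult_left_mono integral_abs_hermite_mult_le) auto
  finally show ?thesis by simp
 qed
 have "(S \<longlongrightarrow> 0) at_top"
  unfolding S_def by (intro tendsto_null_sum rapid_tendsto rapid_hermite_square)
 hence "((%y. S x - S y) \<longlongrightarrow> S x - 0) at_top" by (intro tendsto_intros)
 hence "S x - 0 <= sqrt (2 * real K)"
  by (rule tendsto_upperbound) (auto intro: eventually_mono[OF eventually_ge_at_top[of x]] bound)
 thus ?thesis by (simp add: S_def)
qed

section \<open>Lower bounds for the mass near the origin\<close>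

text \<open>The second moment is l / 2 with l = 2 k + 1, and the fourth moment keeps it from sitting
  far out: t^2 <= s |t| + t^4 / s^2.\<close>

lemma hermite_first_moment_lower:
 "sqrt (2 * real k + 1) / 40 <= (LI t. \<bar>t\<bar> * (hsq k t))"
proof -
 define l where "l = 2 * real k + 1"
 \<comment> \<open>The fourth moment is at most 25 l^2, so with s^2 = 100 l the far part is at most
   l / 4, half of the second moment.\<close>
 define s where "s = 10 * sqrt l"
 have l: "l >= 1" by (simp add: l_def)
 hence s: "s > 0" "s^2 = 100 * l" by (auto simp: s_def power_mult_distrib)
 have int: "integrable lborel (%t. \<bar>t\<bar> * (hsq k t))" "integrable lborel (%t. t ^ m * (hsq k t))" for m
  using rapid_mult[OF rapid_hermite_square continuous_on_rabs[OF continuous_on_id], of 1 1 k]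
  by (auto intro!: rapid_integrable rapid_power rapid_hermite_square)
 have "l / 2 = (LI t. t ^ 2 * (hsq k t))"
  by (simp add: hermite_moment_2 l_def)
 also have "... <= (LI t. s * (\<bar>t\<bar> * (hsq k t)) + 1 / s^2 * (t ^ 4 * (hsq k t)))"
 proof (intro integral_mono int Bochner_Integration.integrable_add integrable_mult_right)
  fix t
  have "t^2 <= s * \<bar>t\<bar> + 1 / s^2 * t ^ 4"
  proof (cases "\<bar>t\<bar> <= s")
   case True
   hence "\<bar>t\<bar> * \<bar>t\<bar> <= s * \<bar>t\<bar>" by (intro mult_right_mono) auto
   thus ?thesis by (simp add: power2_eq_square add_increasing2)
  next
   case False
   hence "s^2 <= t^2" using s power_mono[of s "\<bar>t\<bar>" 2] by simp
   hence "s^2 * t^2 <= t^2 * t^2" by (intro mult_right_mono) auto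
   hence "t^2 <= 1 / s^2 * t ^ 4" using s(1) by (simp add: pos_le_divide_eq mult.commute flip: power_add)
   thus ?thesis using s by (smt (verit) mult_nonneg_nonneg abs_ge_zero)
  qed
  hence "t^2 * (hsq k t) <= (s * \<bar>t\<bar> + 1 / s^2 * t ^ 4) * (hsq k t)"
   by (rule mult_right_mono) simp
  thus "t^2 * (hsq k t) <= s * (\<bar>t\<bar> * (hsq k t)) + 1 / s^2 * (t ^ 4 * (hsq k t))"
   by (simp add: algebra_simps)
 qed
 also have "... = s * (LI t. \<bar>t\<bar> * (hsq k t)) + 1 / s^2 * (LI t. t ^ 4 * (hsq k t))"
  using int(1) int(2)[of 4] by simp
 also have "... <= s * (LI t. \<bar>t\<bar> * (hsq k t)) + 1 / s^2 * (25 * l^2)"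
 proof -
  have "(LI t. t ^ 4 * (hsq k t)) <= (l + 4)^2"
   using hermite_moment_bound[of 2 k] by (simp add: l_def algebra_simps)
  also have "... <= (5 * l)^2" using l by (intro power_mono) auto
  finally show ?thesis using s l by (intro add_left_mono mult_left_mono) (auto simp: power_mult_distrib)
 qed
 also have "1 / s^2 * (25 * l^2) = l / 4" using s l by (simp add: power2_eq_square)
 finally have "l / 4 <= s * (LI t. \<bar>t\<bar> * (hsq k t))" by simp
 hence "sqrt l * (sqrt l / 40) <= sqrt l * (LI t. \<bar>t\<bar> * (hsq k t))"
  using l by (simp add: s_def)
 hence "sqrt l / 40 <= (LI t. \<bar>t\<bar> * (hsq k t))"
  by (rule mult_left_le_imp_le) (use l in auto)
 thus ?thesis by (simp add: l_def)
qed

text \<open>The left side is the derivative of tanh; decaying exponentially, it can stand in for the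
  weight from below in \<open>hermite_weighted_lower\<close>.\<close>

lemma sech_square_le: "\<exists>C>0. \<forall>t::real. 1 - (tanh t)^2 <= C * (1 + \<bar>t\<bar>) powr (- a)"
proof -
 obtain M :: nat where M: "a <= M" using real_arch_simple by blast
 have "1 - (tanh t)^2 <= 4 * fact M * exp 1 * (1 + \<bar>t\<bar>) powr (- a)" for t :: real
 proof -
  have c: "exp \<bar>t\<bar> / 2 <= cosh t" unfolding cosh_def by (auto simp: abs_if)
  have cp: "cosh t > 0" by (rule cosh_real_pos)
  have "1 - (tanh t)^2 = 1 / (cosh t)^2"
  proof -
   have "1 - (tanh t)^2 = ((cosh t)^2 - (sinh t)^2) / (cosh t)^2"
    using cp by (simp add: tanh_def power_divide diff_divide_distrib)
   thus ?thesis using cosh_square_eq[of t] by simp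
  qed
  also have "... <= 1 / (exp \<bar>t\<bar> / 2)^2"
   using c cp by (intro divide_left_mono power_mono mult_pos_pos) auto
  also have "... = 4 / (exp \<bar>t\<bar> * exp \<bar>t\<bar>)" by (simp add: power2_eq_square)
  also have "... <= 4 / (exp \<bar>t\<bar> * 1)" by (intro divide_left_mono mult_left_mono) auto
  finally have 1: "1 - (tanh t)^2 <= 4 / exp \<bar>t\<bar>" by simp
  have "(1 + \<bar>t\<bar>) powr a <= (1 + \<bar>t\<bar>) powr M" using M by (intro powr_mono) auto
  also have "... = (1 + \<bar>t\<bar>) ^ M" by (simp add: powr_realpow)
  also have "... <= fact M * exp (1 + \<bar>t\<bar>)"
  proof -
   have "(1 + \<bar>t\<bar>) ^ M /\<^sub>R fact M <= (\<Sum>n\<le>M. (1 + \<bar>t\<bar>) ^ n /\<^sub>R fact n)"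
    by (rule member_le_sum) auto
   also have "... <= exp (1 + \<bar>t\<bar>)"
    unfolding exp_def by (rule sum_le_suminf[OF summable_exp_generic]) auto
   finally have "(1 + \<bar>t\<bar>) ^ M / fact M <= exp (1 + \<bar>t\<bar>)" unfolding divide_inverse_commute real_scaleR_def .
   thus ?thesis by (simp add: field_simps)
  qed
  finally have 2: "(1 + \<bar>t\<bar>) powr a <= fact M * exp 1 * exp \<bar>t\<bar>" by (simp add: exp_add mult.assoc)
  have "4 / exp \<bar>t\<bar> * (1 + \<bar>t\<bar>) powr a <= 4 / exp \<bar>t\<bar> * (fact M * exp 1 * exp \<bar>t\<bar>)"
   by (intro mult_left_mono 2) auto
  hence "4 / exp \<bar>t\<bar> <= 4 * fact M * exp 1 / (1 + \<bar>t\<bar>) powr a"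
   by (simp add: field_simps)
  with 1 show ?thesis by (simp add: powr_minus divide_inverse)
 qed
 thus ?thesis by (intro exI[of _ "4 * fact M * exp 1"]) auto
qed

text \<open>Virial identity with b = tanh, whose derivative is concentrated near the origin; let B
  be the integral of b' against the squared Hermite function. The right side is at least a multiple
  of sqrt l by the first moment, and the left side is at most 2 l B + O(B); hence B is at least of
  order 1 / sqrt l.\<close>

lemma hermite_weighted_lower:
 obtains c where "c > 0" "!!k. k >= 6400 ==>
  c * real (k + 1) powr (- 1 / 2) <= (LI t. (1 + \<bar>t\<bar>) powr (- a) * (hsq k t))"
proof -
 define b where "b t = tanh t" for t :: real
 define b1 where "b1 t = 1 - (tanh t)^2" for t :: real
 define b2 where "b2 t = - 2 * tanh t * b1 t" for t :: real
 define b3 where "b3 t = b1 t * (6 * (tanh t)^2 - 2)" for t :: real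
 have cosh: "cosh t \<noteq> 0" for t :: real using cosh_real_pos[of t] by simp
 have d1: "(b has_real_derivative b1 t) (at t)" for t
  unfolding b_def b1_def by (auto intro!: derivative_eq_intros cosh)
 have d2: "(b1 has_real_derivative b2 t) (at t)" for t
  unfolding b1_def b2_def by (auto intro!: derivative_eq_intros cosh simp: b1_def)
 have d3: "(b2 has_real_derivative b3 t) (at t)" for t
  unfolding b2_def[abs_def] by (rule derivative_eq_intros d2 cosh refl)+
   (simp add: b1_def b2_def b3_def power2_eq_square algebra_simps)
 have th: "\<bar>tanh t\<bar> <= 1" for t :: real
  using tanh_real_lt_1[of t] tanh_real_gt_neg1[of t] by linarith
 have th2: "(tanh t)^2 <= 1" for t :: real using th[of t] by (simp add: abs_square_le_1)
 have b1: "0 <= b1 t" "b1 t <= 1" for t unfolding b1_def using th2 by auto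
 have bd: "\<bar>b t\<bar> <= 4 * (1 + \<bar>t\<bar>) ^ 0" "\<bar>b1 t\<bar> <= 4 * (1 + \<bar>t\<bar>) ^ 0" "\<bar>b2 t\<bar> <= 4 * (1 + \<bar>t\<bar>) ^ 0" for t
  using th[of t] b1[of t] mult_mono[OF th[of t] b1(2)[of t]] by (auto simp: b_def b2_def abs_mult mult.commute[of "b1 t"])
 have b3: "\<bar>b3 t\<bar> <= 4 * b1 t" for t
 proof -
  have "\<bar>6 * (tanh t)^2 - 2\<bar> <= 4" using th2[of t] zero_le_power2[of "tanh t"] by linarith
  hence "b1 t * \<bar>6 * (tanh t)^2 - 2\<bar> <= b1 t * 4" by (intro mult_left_mono b1)
  thus ?thesis using b1 by (simp add: b3_def abs_mult)
 qed
 have b3': "\<bar>b3 t\<bar> <= 4 * (1 + \<bar>t\<bar>) ^ 0" for t using b3[of t] b1[of t] by simp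
 have cont: "continuous_on UNIV b1" "continuous_on UNIV b2"
  using d2 d3 by (auto intro: DERIV_isCont simp: continuous_on_eq_continuous_at)
 have contb: "continuous_on UNIV b" using d1 by (auto intro: DERIV_isCont simp: continuous_on_eq_continuous_at)
 have cont3: "continuous_on UNIV b3"
  unfolding b3_def using cont(1) contb unfolding b_def
  by (intro continuous_on_mult continuous_on_diff continuous_on_power continuous_on_const)
 obtain C where C: "C > 0" "!!t. b1 t <= C * (1 + \<bar>t\<bar>) powr (- a)"
  unfolding b1_def using sech_square_le by blast
 have t1: "0 < tanh (1::real)" by simp
 show thesis
 proof
  show "tanh 1 / (320 * C) > 0" using C t1 by simp
  fix k :: nat
  assume k: "k >= 6400"
  define l where "l = 2 * real k + 1"
  have l: "l >= 6400" using k by (simp add: l_def)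
  define B where "B = (LI t. b1 t * (hsq k t))"
  note rsq = rapid_hermite_square[of k]
  have r1: "rapid (%t. b1 t * (hsq k t))" by (rule rapid_mult[OF rsq cont(1) bd(2)])
  have r2: "rapid (%t. t^2 * (b1 t * (hsq k t)))" by (rule rapid_power[OF r1])
  have r3: "rapid (%t. b3 t * (hsq k t))" by (rule rapid_mult[OF rsq cont3 b3'])
  have rd: "rapid (%t. b1 t * (hermite_fun_deriv k t)^2)"
   by (rule rapid_mult[OF rapid_hermite_deriv_square cont(1) bd(2)])
  have rtb: "rapid (%t. t * b t * (hsq k t))"
   using rapid_power[OF rapid_mult[OF rsq contb bd(1)], of 1] by (simp add: mult_ac)
  note int = rapid_integrable[OF r1] rapid_integrable[OF r2] rapid_integrable[OF r3] rapid_integrable[OF rd]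
   rapid_integrable[OF rtb]
  have eq1: "(LI t. b1 t * (hermite_fun_deriv k t)^2)
    + (l * B - (LI t. t^2 * (b1 t * (hsq k t)))) = 2 * (LI t. t * b t * (hsq k t))"
  proof -
   have "(LI t. b1 t * ((hermite_fun_deriv k t)^2 + (l - t^2) * (hsq k t)))
    = (LI t. b1 t * (hermite_fun_deriv k t)^2 + (l * (b1 t * (hsq k t)) - t^2 * (b1 t * (hsq k t))))"
    by (intro Bochner_Integration.integral_cong) (auto simp: algebra_simps)
   thus ?thesis using hermite_virial[OF d1 cont(1) bd(1,2), of k] int
    by (simp add: l_def[symmetric] B_def)
  qed
  \<comment> \<open>A second identity, from the total derivative of b' h h' - b'' h^2 / 2: it turns
    the kinetic term into the potential one plus a correction with b''', so that everything is
    controlled by B.\<close>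
  have eq2: "(LI t. b1 t * (hermite_fun_deriv k t)^2)
    = l * B - (LI t. t^2 * (b1 t * (hsq k t))) + (LI t. b3 t * (hsq k t)) / 2"
  proof -
   have "(LI t. b1 t * (hermite_fun_deriv k t)^2 - (l * (b1 t * (hsq k t)) - t^2 * (b1 t * (hsq k t)))
     - 1 / 2 * (b3 t * (hsq k t))) = 0"
   proof (rule integral_derivative_eq_0[where F = "%t. b1 t * (hermite_fun k t * hermite_fun_deriv k t) - 1 / 2 * (b2 t * (hsq k t))"])
    show "((%t. b1 t * (hermite_fun k t * hermite_fun_deriv k t) - 1 / 2 * (b2 t * (hsq k t))) has_real_derivative
     b1 t * (hermite_fun_deriv k t)^2 - (l * (b1 t * (hsq k t)) - t^2 * (b1 t * (hsq k t)))
     - 1 / 2 * (b3 t * (hsq k t))) (at t)" for t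
     by (rule derivative_eq_intros d2 d3 DERIV_hermite_fun DERIV_hermite_fun_deriv refl)+
      (simp add: l_def power2_eq_square algebra_simps)
    show "rapid (%t. b1 t * (hermite_fun k t * hermite_fun_deriv k t) - 1 / 2 * (b2 t * (hsq k t)))"
     by (intro rapid_diff rapid_cmult rapid_mult[OF _ cont(1) bd(2)] rapid_mult[OF _ cont(2) bd(3)]
       rapid_times rapid_hermite rapid_hermite_deriv rsq)
   qed (intro rapid_diff rapid_cmult rd r1 r2 r3)
   thus ?thesis using int by (simp add: B_def)
  qed
  have "2 * (LI t. t * b t * (hsq k t)) <= 2 * l * B + (LI t. b3 t * (hsq k t)) / 2"
  proof -
   have "0 <= (LI t. t^2 * (b1 t * (hsq k t)))"
    by (intro integral_nonneg_AE AE_I2) (use b1 in auto)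
   thus ?thesis using eq1 eq2 unfolding mult.assoc by linarith
  qed
  moreover have "(LI t. b3 t * (hsq k t)) <= 4 * B"
  proof -
   have "(LI t. b3 t * (hsq k t)) <= (LI t. 4 * (b1 t * (hsq k t)))"
   proof (intro integral_mono integrable_mult_right int)
    fix t
    have "b3 t * (hsq k t) <= (4 * b1 t) * (hsq k t)"
     using b3[of t] by (intro mult_right_mono) auto
    thus "b3 t * (hsq k t) <= 4 * (b1 t * (hsq k t))" by simp
   qed
   thus ?thesis by (simp add: B_def)
  qed
  moreover have "tanh 1 * (sqrt l / 40 - 1) <= (LI t. t * b t * (hsq k t))"
  proof -
   have ra: "rapid (%t. \<bar>t\<bar> * (hsq k t))"
    using rapid_mult[OF rsq continuous_on_rabs[OF continuous_on_id], of 1 1] by simp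
   have "tanh 1 * (sqrt l / 40 - 1) <= tanh 1 * ((LI t. \<bar>t\<bar> * (hsq k t)) - 1)"
    using hermite_first_moment_lower[of k] t1 by (intro mult_left_mono) (auto simp: l_def)
   also have "... = (LI t. tanh 1 * (\<bar>t\<bar> * (hsq k t) - (hsq k t)))"
    using rapid_integrable[OF ra] rapid_integrable[OF rsq] by (simp add: integral_hermite_square)
   also have "... <= (LI t. t * b t * (hsq k t))"
   proof (intro integral_mono int rapid_integrable rapid_cmult rapid_diff ra rsq)
    fix t :: real
    have ab: "t * tanh t = \<bar>t\<bar> * tanh \<bar>t\<bar>" by (auto simp: abs_if)
    have "tanh 1 * (\<bar>t\<bar> - 1) <= t * b t"
    proof (cases "\<bar>t\<bar> <= 1")
     case True
     hence "tanh 1 * (\<bar>t\<bar> - 1) <= 0" using t1 by (simp add: mult_nonneg_nonpos)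
     also have "0 <= t * b t" unfolding b_def ab by simp
     finally show ?thesis .
    next
     case False
     hence "tanh 1 <= tanh \<bar>t\<bar>" by (subst tanh_real_le_iff) simp
     hence "tanh 1 * (\<bar>t\<bar> - 1) <= tanh \<bar>t\<bar> * \<bar>t\<bar>" using False t1 by (intro mult_mono) auto
     thus ?thesis unfolding b_def ab by (simp add: mult.commute)
    qed
    hence "tanh 1 * (\<bar>t\<bar> - 1) * (hsq k t) <= t * b t * (hsq k t)"
     by (rule mult_right_mono) simp
    thus "tanh 1 * (\<bar>t\<bar> * (hsq k t) - (hsq k t)) <= t * b t * (hsq k t)"
     by (simp add: algebra_simps)
   qed
   finally show ?thesis .
  qed
  ultimately have "tanh 1 * (sqrt l / 40 - 1) <= (l + 1) * B" by (simp add: algebra_simps)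
  \<comment> \<open>6400 = 80^2 is the threshold from which sqrt l / 80 absorbs the subtracted
    1.\<close>
  moreover have "tanh 1 * (sqrt l / 80) <= tanh 1 * (sqrt l / 40 - 1)"
  proof (intro mult_left_mono)
   have "sqrt (80^2) <= sqrt l" using l by (intro real_sqrt_le_mono) simp
   thus "sqrt l / 80 <= sqrt l / 40 - 1" by simp
  qed (use t1 in auto)
  moreover have B0: "0 <= B" unfolding B_def by (intro integral_nonneg_AE AE_I2) (use b1 in auto)
  hence "(l + 1) * B <= (2 * l) * B" using l by (intro mult_right_mono) auto
  ultimately have "tanh 1 * (sqrt l / 80) <= 2 * l * B" by linarith
  hence "tanh 1 * sqrt l <= 160 * (sqrt l * sqrt l) * B" using l by simp
  hence "sqrt l * tanh 1 <= sqrt l * (160 * sqrt l * B)" by (simp only: mult_ac)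
  hence Bl: "tanh 1 <= 160 * sqrt l * B"
   by (rule mult_left_le_imp_le) (use l in auto)
  define q where "q = sqrt (real (k + 1))"
  have q: "q > 0" by (simp add: q_def)
  have sk: "sqrt l <= 2 * q"
  proof -
   have "sqrt l <= sqrt (4 * real (k + 1))" by (intro real_sqrt_le_mono) (simp add: l_def)
   also have "... = 2 * q" unfolding real_sqrt_mult q_def by simp
   finally show ?thesis .
  qed
  have "160 * sqrt l * B <= 160 * (2 * q) * B" by (intro mult_right_mono mult_left_mono sk B0) auto
  hence "tanh 1 <= 160 * (2 * q) * B" using Bl by linarith
  hence "tanh 1 / 320 * (1 / q) <= B" using q by (simp add: field_simps)
  moreover have "B <= C * (LI t. (1 + \<bar>t\<bar>) powr (- a) * (hsq k t))"
  proof -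
   obtain M :: nat where M: "- a <= M" using real_arch_simple by blast
   have bnd: "\<bar>(1 + \<bar>t\<bar>) powr (- a)\<bar> <= 1 * (1 + \<bar>t\<bar>) ^ M" for t :: real
    using powr_mono[OF M, of "1 + \<bar>t\<bar>"] by (simp add: powr_realpow)
   have "continuous_on UNIV (%t::real. (1 + \<bar>t\<bar>) powr (- a))" by (intro continuous_intros) auto
   hence ra: "rapid (%t. (1 + \<bar>t\<bar>) powr (- a) * (hsq k t))"
    by (rule rapid_mult[OF rsq _ bnd])
   have "B <= (LI t. C * ((1 + \<bar>t\<bar>) powr (- a) * (hsq k t)))"
    unfolding B_def
   proof (intro integral_mono int integrable_mult_right rapid_integrable[OF ra])
    show "b1 t * (hsq k t) <= C * ((1 + \<bar>t\<bar>) powr (- a) * (hsq k t))" for t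
     using mult_right_mono[OF C(2)[of t], of "(hsq k t)"] by simp
   qed
   thus ?thesis by simp
  qed
  ultimately have "tanh 1 / 320 * (1 / q) <= C * (LI t. (1 + \<bar>t\<bar>) powr (- a) * (hsq k t))"
   by linarith
  hence "tanh 1 / (320 * C) * (1 / q) <= (LI t. (1 + \<bar>t\<bar>) powr (- a) * (hsq k t))"
   using C(1) q by (simp add: field_simps)
  moreover have "real (k + 1) powr (- 1 / 2) = 1 / q"
   using powr_minus[of "real (k + 1)" "1 / 2"] by (simp add: q_def powr_half_sqrt inverse_eq_divide)
  ultimately show "tanh 1 / (320 * C) * real (k + 1) powr (- 1 / 2)
    <= (LI t. (1 + \<bar>t\<bar>) powr (- a) * (hsq k t))" by simp
 qed
qed

section \<open>Hermite functions in several variables\<close>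

lemma Basis_cart: "(Basis :: (real^'n) set) = range (%i. axis i 1)"
 by (auto simp: Basis_vec_def)

lemma inj_axis_1: "inj (%i::'n. axis i (1::real) :: real^'n)"
 by (auto simp: inj_on_def axis_eq_axis)

lemma cart_sum_axis:
 fixes f :: "real^'n => real"
 shows "(\<Sum>b\<in>Basis. f b *\<^sub>R b) $ i = f (axis i 1)"
proof -
 have "(\<Sum>b\<in>Basis. f b *\<^sub>R b) = (\<Sum>j\<in>UNIV. f (axis j 1) *\<^sub>R (axis j 1 :: real^'n))"
  unfolding Basis_cart by (subst sum.reindex[OF inj_axis_1]) simp
 thus ?thesis by (simp add: axis_def if_distrib cong: if_cong)
qed

lemma measurable_cart_sum:
 "(%f. \<Sum>b\<in>Basis. f b *\<^sub>R b) \<in> measurable (\<Pi>\<^sub>M b\<in>(Basis :: (real^'n) set). lborel) borel"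
 by measurable

interpretation lborel_PiM: product_sigma_finite "%_::real^'n. lborel :: real measure"
 by standard

lemma
 fixes F :: "'n::finite => real => real"
 assumes "!!i. integrable lborel (F i)"
 shows integral_cart_prod: "(LI x. (\<Prod>i\<in>UNIV. F i ((x::real^'n) $ i))) = (\<Prod>i\<in>UNIV. (LI t. F i t))"
  and integrable_cart_prod: "integrable lborel (%x::real^'n. \<Prod>i\<in>UNIV. F i (x $ i))"
proof -
 \<comment> \<open>The product measure behind \<open>lborel\<close> is indexed by basis vectors;
   \<open>G\<close> carries the factors over from coordinates to basis vectors.\<close>
 define G where "G b = F (SOME i. b = axis i 1)" for b :: "real^'n"
 have G: "G (axis i 1) = F i" for i
  unfolding G_def by (rule arg_cong[where f = F], rule some_equality) (auto simp: axis_eq_axis)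
 have [measurable]: "F i \<in> borel_measurable borel" for i using borel_measurable_integrable[OF assms[of i]] by simp
 have int: "integrable lborel (G b)" for b unfolding G_def by (rule assms)
 have eq: "(\<Prod>i\<in>UNIV. F i ((\<Sum>b\<in>Basis. f b *\<^sub>R b) $ i)) = (\<Prod>b\<in>Basis. G b (f b))" for f :: "real^'n => real"
  unfolding cart_sum_axis unfolding Basis_cart by (subst prod.reindex[OF inj_axis_1]) (simp add: G)
 have m: "(%x::real^'n. \<Prod>i\<in>UNIV. F i (x $ i)) \<in> borel_measurable borel" by measurable
 have "integrable (\<Pi>\<^sub>M b\<in>(Basis :: (real^'n) set). lborel) (%f. \<Prod>b\<in>Basis. G b (f b))"
  by (intro lborel_PiM.product_integrable_prod int) auto
 thus "integrable lborel (%x::real^'n. \<Prod>i\<in>UNIV. F i (x $ i))"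
  unfolding lborel_eq[where ?'a = "real^'n"] by (subst integrable_distr_eq[OF measurable_cart_sum m]) (simp only: eq)
 have "(LI x. (\<Prod>i\<in>UNIV. F i ((x::real^'n) $ i)))
   = (LINT f|(\<Pi>\<^sub>M b\<in>(Basis :: (real^'n) set). lborel). (\<Prod>b\<in>Basis. G b (f b)))"
  unfolding lborel_eq[where ?'a = "real^'n"] by (subst integral_distr[OF measurable_cart_sum m]) (simp only: eq)
 also have "... = (\<Prod>b\<in>Basis. (LI t. G b t))"
  by (intro lborel_PiM.product_integral_prod int) auto
 also have "... = (\<Prod>i\<in>UNIV. (LI t. F i t))"
  unfolding Basis_cart by (subst prod.reindex[OF inj_axis_1]) (simp add: G)
 finally show "(LI x. (\<Prod>i\<in>UNIV. F i ((x::real^'n) $ i))) = (\<Prod>i\<in>UNIV. (LI t. F i t))" .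
qed

lemma borel_measurable_Phi [measurable]: "Phi \<mu> \<in> borel_measurable borel"
 unfolding Phi_def by measurable

lemma integral_coordinate_weight:
 fixes i :: "'n::finite"
 assumes "continuous_on UNIV W" "!!t. \<bar>W t\<bar> <= C * (1 + \<bar>t\<bar>) ^ m"
 shows "integrable lborel (%x. W (x $ i) * (Phi \<mu> x * Phi \<nu> x))"
  and "(LI x. W (x $ i) * (Phi \<mu> x * Phi \<nu> x))
   = (if \<forall>j. j \<noteq> i --> \<mu> j = \<nu> j then (LI t. W t * (hermite_fun (\<mu> i) t * hermite_fun (\<nu> i) t)) else 0)"
proof -
 define F where "F j t = (if j = i then W t else 1) * (hermite_fun (\<mu> j) t * hermite_fun (\<nu> j) t)" for j t
 have F: "integrable lborel (F j)" for j
  unfolding F_def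
  using rapid_integrable[OF rapid_mult[OF rapid_times[OF rapid_hermite rapid_hermite] assms]]
  by (cases "j = i") (auto intro: integrable_hermite_mult)
 have eq: "W (x $ i) * (Phi \<mu> x * Phi \<nu> x) = (\<Prod>j\<in>UNIV. F j (x $ j))" for x
  unfolding F_def prod.distrib Phi_def by (simp add: prod.delta if_distrib)
 show "integrable lborel (%x. W (x $ i) * (Phi \<mu> x * Phi \<nu> x))"
  unfolding eq by (rule integrable_cart_prod[OF F])
 have "(LI x. W (x $ i) * (Phi \<mu> x * Phi \<nu> x)) = (\<Prod>j\<in>UNIV. (LI t. F j t))"
  unfolding eq by (rule integral_cart_prod[OF F])
 also have "... = (LI t. F i t) * (\<Prod>j\<in>UNIV - {i}. (LI t. F j t))"
  by (rule prod.remove) auto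
 also have "(\<Prod>j\<in>UNIV - {i}. (LI t. F j t)) = (\<Prod>j\<in>UNIV - {i}. if \<mu> j = \<nu> j then 1 else 0)"
  by (intro prod.cong) (auto simp: F_def hermite_orthonormal)
 also have "... = (if \<forall>j. j \<noteq> i --> \<mu> j = \<nu> j then 1 else 0)"
  by (auto intro: prod_zero)
 finally show "(LI x. W (x $ i) * (Phi \<mu> x * Phi \<nu> x))
   = (if \<forall>j. j \<noteq> i --> \<mu> j = \<nu> j then (LI t. W t * (hermite_fun (\<mu> i) t * hermite_fun (\<nu> i) t)) else 0)"
  by (auto simp: F_def)
qed

lemma
 shows integrable_Phi_mult: "integrable lborel (%x. Phi \<mu> x * Phi \<nu> x)"
  and Phi_orthonormal: "(LI x. Phi \<mu> x * Phi \<nu> x) = (if \<mu> = \<nu> then 1 else 0)"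
proof -
 have "(\<mu> = \<nu>) = ((\<forall>j. j \<noteq> undefined --> \<mu> j = \<nu> j) \<and> \<mu> undefined = \<nu> undefined)"
  by (metis ext)
 thus "integrable lborel (%x. Phi \<mu> x * Phi \<nu> x)"
  "(LI x. Phi \<mu> x * Phi \<nu> x) = (if \<mu> = \<nu> then 1 else 0)"
  using integral_coordinate_weight[of "%_. 1" 1 0 undefined \<mu> \<nu>]
  by (auto simp: hermite_orthonormal intro!: continuous_intros)
qed

lemma cmod_sum_square:
 "cx ((cmod (\<Sum>a\<in>S. d a * cx (u a)))^2)
  = (\<Sum>a\<in>S. \<Sum>b\<in>S. d a * cnj (d b) * cx (u a * u b))"
 unfolding complex_norm_square by (simp add: sum_product mult_ac)

lemma integral_cmod_sum_orthogonal:
 fixes u :: "'a => 'b => real" and W :: "'b => real"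
 assumes "finite S"
  and int: "!!a b. a \<in> S ==> b \<in> S ==> integrable M (%x. W x * (u a x * u b x))"
  and orth: "!!a b. a \<in> S ==> b \<in> S ==> a \<noteq> b ==> (LINT x|M. W x * (u a x * u b x)) = 0"
 shows "integrable M (%x. W x * (cmod (\<Sum>a\<in>S. d a * cx (u a x)))^2)" (is ?A)
  and "(LINT x|M. W x * (cmod (\<Sum>a\<in>S. d a * cx (u a x)))^2)
   = (\<Sum>a\<in>S. (cmod (d a))^2 * (LINT x|M. W x * (u a x * u a x)))" (is ?B)
proof -
 let ?f = "%x. W x * (cmod (\<Sum>a\<in>S. d a * cx (u a x)))^2"
 have eq: "cx (?f x) = (\<Sum>a\<in>S. \<Sum>b\<in>S. d a * cnj (d b) * cx (W x * (u a x * u b x)))" for x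
  unfolding of_real_mult[of "W x"] cmod_sum_square by (simp add: sum_distrib_left mult_ac)
 have 1: "integrable M (%x. cx (?f x))"
  unfolding eq by (intro Bochner_Integration.integrable_sum integrable_mult_right integrable_of_real int)
 thus ?A using integrable_Re[OF 1] by simp
 have "cx (LINT x|M. ?f x) = (LINT x|M. cx (?f x))"
  by (rule integral_complex_of_real[symmetric])
 also have "... = (\<Sum>a\<in>S. \<Sum>b\<in>S. d a * cnj (d b) * cx (LINT x|M. W x * (u a x * u b x)))"
  unfolding eq
  by (subst Bochner_Integration.integral_sum)
   (auto intro!: Bochner_Integration.integrable_sum integrable_mult_right integrable_of_real int sum.cong
    simp del: of_real_mult simp add: Bochner_Integration.integral_sum int)
 also have "... = (\<Sum>a\<in>S. \<Sum>b\<in>S. if b = a then d a * cnj (d a) * cx (LINT x|M. W x * (u a x * u a x)) else 0)"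
  by (intro sum.cong refl) (auto simp: orth)
 also have "... = (\<Sum>a\<in>S. d a * cnj (d a) * cx (LINT x|M. W x * (u a x * u a x)))"
  using \<open>finite S\<close> by (simp add: sum.delta)
 also have "... = cx (\<Sum>a\<in>S. (cmod (d a))^2 * (LINT x|M. W x * (u a x * u a x)))"
  by (simp only: of_real_sum of_real_mult complex_norm_square)
 finally show ?B by (simp only: of_real_eq_iff)
qed

text \<open>This makes a weight in the single coordinate \<open>i\<close> diagonal on an
  eigenspace.\<close>

lemma inj_on_sum_fixed:
 assumes "sum \<mu> UNIV = sum \<nu> (UNIV :: 'n::finite set)" "\<forall>j. j \<noteq> i --> \<mu> j = (\<nu> j :: nat)"
 shows "\<mu> = \<nu>"
proof -
 have "sum \<mu> (UNIV - {i}) = sum \<nu> (UNIV - {i})" using assms(2) by (intro sum.cong) auto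
 with assms(1) have "\<mu> i = \<nu> i" by (simp add: sum.remove[of UNIV i])
 with assms(2) show ?thesis by (auto simp: fun_eq_iff)
qed

text \<open>The radial weight is not diagonal in the Hermite basis, but a weight in one coordinate
  is, on each eigenspace. Every index of degree k has an entry of size at least k / n. Sort the
  indices by such a coordinate i, use (1 + |x|) powr (- g) <= (1 + x_i^2) powr (- g / 2) on its
  group, and apply the bound on the line.\<close>

lemma hermite_trace:
 assumes g: "0 <= g" "g < 1"
 obtains C where "C > 0" "!!(k::nat) S (d :: ('n::finite => nat) => complex). finite S ==> (!!\<mu>. \<mu> \<in> S ==> sum \<mu> UNIV = k) ==>
  (NN x. csqw (\<Sum>\<mu>\<in>S. d \<mu> * cx (Phi \<mu> x)) ((1 + norm x) powr (- g)))
   <= ennreal (C * real (k + 1) powr (- g / 2) * (\<Sum>\<mu>\<in>S. (cmod (d \<mu>))^2))"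
proof -
 define n where "n = real CARD('n)"
 have n: "n >= 1" unfolding n_def by (simp add: Suc_leI)
 obtain C where C: "C > 0"
  "!!k. (LI t. (1 + t^2) powr (- g / 2) * (hsq k t)) <= C * real (k + 1) powr (- g / 2)"
  using hermite_weighted_upper[OF g] by blast
 define W where "W t = (1 + t^2) powr (- g / 2)" for t :: real
 have pos: "1 + t^2 > 0" for t :: real by (smt (verit) zero_le_power2)
 have W: "\<bar>W t\<bar> <= 1 * (1 + \<bar>t\<bar>) ^ 0" for t
  unfolding W_def using g powr_mono2'[of "- g / 2" 1 "1 + t^2"] by auto
 have cW: "continuous_on UNIV W" unfolding W_def by (intro continuous_intros) (smt (verit) pos)
 show thesis
 proof
  show "n * (C * (1 / n) powr (- g / 2)) > 0" using C n by simp
  fix k :: nat and S :: "('n => nat) set" and d :: "('n => nat) => complex"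
  assume S: "finite S" "!!\<mu>. \<mu> \<in> S ==> sum \<mu> UNIV = k"
  have "\<exists>i. real k <= n * real (\<mu> i)" if "\<mu> \<in> S" for \<mu>
  proof (rule ccontr)
   assume "\<nexists>i. real k <= n * real (\<mu> i)"
   hence lt: "real (\<mu> i) < real k / n" for i using n by (auto simp: field_simps not_le)
   have "(\<Sum>i\<in>UNIV. real (\<mu> i)) < (\<Sum>i\<in>(UNIV::'n set). real k / n)"
    by (rule sum_strict_mono) (use lt in auto)
   thus False using S(2)[OF that] n by (simp add: n_def flip: of_nat_sum)
  qed
  then obtain \<iota> where \<iota>: "!!\<mu>. \<mu> \<in> S ==> real k <= n * real (\<mu> (\<iota> \<mu>))" by metis
  define S' where "S' i = {\<mu>\<in>S. \<iota> \<mu> = i}" for i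
  define u where "u i x = (\<Sum>\<mu>\<in>S' i. d \<mu> * cx (Phi \<mu> x))" for i x
  have fin: "finite (S' i)" for i using S(1) by (simp add: S'_def)
  have split: "(\<Sum>\<mu>\<in>S. d \<mu> * cx (Phi \<mu> x)) = (\<Sum>i\<in>UNIV. u i x)" for x
   unfolding u_def S'_def by (subst sum.group) (use S in auto)
  have pw: "(cmod (\<Sum>\<mu>\<in>S. d \<mu> * cx (Phi \<mu> x)))^2 * (1 + norm x) powr (- g)
    <= (\<Sum>i\<in>UNIV. n * (W (x $ i) * (cmod (u i x))^2))" for x
  proof -
   have "(cmod (\<Sum>i\<in>UNIV. u i x))^2 <= (\<Sum>i\<in>UNIV. cmod (u i x))^2"
    by (intro power_mono norm_sum) auto
   also have "... <= (\<Sum>i\<in>UNIV. (cmod (u i x))^2) * n"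
    unfolding n_def by (rule sum_squared_le_sum_of_squares)
   finally have "(cmod (\<Sum>i\<in>UNIV. u i x))^2 * (1 + norm x) powr (- g)
     <= ((\<Sum>i\<in>UNIV. (cmod (u i x))^2) * n) * (1 + norm x) powr (- g)"
    by (intro mult_right_mono) auto
   also have "... = (\<Sum>i\<in>UNIV. n * ((1 + norm x) powr (- g) * (cmod (u i x))^2))"
    by (simp add: sum_distrib_left sum_distrib_right mult_ac)
   also have "... <= (\<Sum>i\<in>UNIV. n * (W (x $ i) * (cmod (u i x))^2))"
   proof (intro sum_mono mult_left_mono mult_right_mono)
    fix i
    have "(x $ i)^2 <= (norm x)^2" using component_le_norm_cart[of x i] by (metis abs_le_square_iff abs_norm_cancel)
    hence "1 + (x $ i)^2 <= (1 + norm x)^2" by (simp add: power2_sum add_increasing2)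
    hence "((1 + norm x)^2) powr (- g / 2) <= W (x $ i)"
     unfolding W_def using g pos by (intro powr_mono2') auto
    moreover have "((1 + norm x)^2) powr (- g / 2) = (1 + norm x) powr (- g)"
    proof -
     have "(1 + norm x)^2 = (1 + norm x) powr 2" by (simp add: powr_numeral)
     thus ?thesis by (simp only: powr_powr) simp
    qed
    ultimately show "(1 + norm x) powr (- g) <= W (x $ i)" by simp
   qed (use n in auto)
   finally show ?thesis unfolding split .
  qed
  have int: "integrable lborel (%x. W (x $ i) * (cmod (u i x))^2)"
   and le: "(LI x. W (x $ i) * (cmod (u i x))^2)
    <= (\<Sum>\<mu>\<in>S' i. (cmod (d \<mu>))^2 * (C * (1 / n) powr (- g / 2) * real (k + 1) powr (- g / 2)))" for i
  proof -
   have i1: "integrable lborel (%x. W (x $ i) * (Phi a x * Phi b x))" for a b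
    by (rule integral_coordinate_weight(1)[OF cW W])
   have i2: "(LI x. W (x $ i) * (Phi a x * Phi b x)) = 0" if "a \<in> S' i" "b \<in> S' i" "a \<noteq> b" for a b
   proof -
    have "\<not> (\<forall>j. j \<noteq> i --> a j = b j)"
     using inj_on_sum_fixed[of a b i] that S(2) by (auto simp: S'_def)
    thus ?thesis unfolding integral_coordinate_weight(2)[OF cW W] by (rule if_not_P)
   qed
   note o = integral_cmod_sum_orthogonal[of "S' i" lborel "%x. W (x $ i)" Phi d, OF fin i1 i2, folded u_def]
   show "integrable lborel (%x. W (x $ i) * (cmod (u i x))^2)" by (rule o(1))
   have "(LI x. W (x $ i) * (cmod (u i x))^2)
     = (\<Sum>\<mu>\<in>S' i. (cmod (d \<mu>))^2 * (LI x. W (x $ i) * (Phi \<mu> x * Phi \<mu> x)))"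
    by (rule o(2))
   also have "... = (\<Sum>\<mu>\<in>S' i. (cmod (d \<mu>))^2 * (LI t. W t * (hsq (\<mu> i) t)))"
    unfolding integral_coordinate_weight(2)[OF cW W] by (simp add: power2_eq_square)
   also have "... <= (\<Sum>\<mu>\<in>S' i. (cmod (d \<mu>))^2 * (C * (1 / n) powr (- g / 2) * real (k + 1) powr (- g / 2)))"
   proof (intro sum_mono mult_left_mono)
    fix \<mu> assume "\<mu> \<in> S' i"
    hence "real k <= n * real (\<mu> i)" using \<iota> by (auto simp: S'_def)
    hence "1 / n * real (k + 1) <= real (\<mu> i + 1)" using n by (simp add: field_simps)
    hence "real (\<mu> i + 1) powr (- g / 2) <= (1 / n * real (k + 1)) powr (- g / 2)"
     using g n by (intro powr_mono2') auto
    also have "... = (1 / n) powr (- g / 2) * real (k + 1) powr (- g / 2)"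
     by (intro powr_mult)
    finally have "C * real (\<mu> i + 1) powr (- g / 2) <= C * (1 / n) powr (- g / 2) * real (k + 1) powr (- g / 2)"
     using C(1) by (simp add: mult.assoc)
    thus "(LI t. W t * (hsq (\<mu> i) t)) <= C * (1 / n) powr (- g / 2) * real (k + 1) powr (- g / 2)"
     using C(2)[of "\<mu> i"] unfolding W_def by linarith
   qed auto
   finally show "(LI x. W (x $ i) * (cmod (u i x))^2)
    <= (\<Sum>\<mu>\<in>S' i. (cmod (d \<mu>))^2 * (C * (1 / n) powr (- g / 2) * real (k + 1) powr (- g / 2)))" .
  qed
  have W0: "0 <= W t" for t by (simp add: W_def)
  have "(NN x. csqw (\<Sum>\<mu>\<in>S. d \<mu> * cx (Phi \<mu> x)) ((1 + norm x) powr (- g)))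
   <= (NN x. ennreal (\<Sum>i\<in>UNIV. n * (W (x $ i) * (cmod (u i x))^2)))"
   by (intro nn_integral_mono ennreal_leI pw)
  also have "... = ennreal (LI x. (\<Sum>i\<in>UNIV. n * (W (x $ i) * (cmod (u i x))^2)))"
   by (intro nn_integral_eq_integral Bochner_Integration.integrable_sum integrable_mult_right int)
    (use W0 n in \<open>auto intro!: sum_nonneg\<close>)
  also have "(LI x. (\<Sum>i\<in>UNIV. n * (W (x $ i) * (cmod (u i x))^2)))
    = (\<Sum>i\<in>UNIV. n * (LI x. W (x $ i) * (cmod (u i x))^2))"
   using int by (subst Bochner_Integration.integral_sum) auto
  also have "... <= (\<Sum>i\<in>UNIV. n * (\<Sum>\<mu>\<in>S' i. (cmod (d \<mu>))^2 * (C * (1 / n) powr (- g / 2) * real (k + 1) powr (- g / 2))))"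
   using n by (intro sum_mono mult_left_mono le) auto
  also have "... = n * (C * (1 / n) powr (- g / 2)) * real (k + 1) powr (- g / 2) * (\<Sum>i\<in>UNIV. \<Sum>\<mu>\<in>S' i. (cmod (d \<mu>))^2)"
   by (simp add: sum_distrib_left sum_distrib_right mult_ac)
  also have "(\<Sum>i\<in>UNIV. \<Sum>\<mu>\<in>S' i. (cmod (d \<mu>))^2) = (\<Sum>\<mu>\<in>S. (cmod (d \<mu>))^2)"
   unfolding S'_def by (rule sum.group) (use S in auto)
  finally show "(NN x. csqw (\<Sum>\<mu>\<in>S. d \<mu> * cx (Phi \<mu> x)) ((1 + norm x) powr (- g)))
   <= ennreal (n * (C * (1 / n) powr (- g / 2)) * real (k + 1) powr (- g / 2) * (\<Sum>\<mu>\<in>S. (cmod (d \<mu>))^2))"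
   by (simp add: ennreal_leI)
 qed
qed

section \<open>Commutators of coordinates with Hermite kernels\<close>

subsection \<open>The kernel identity\<close>

text \<open>Scaled so that the recursion is monic: raising has coefficient 1 and is a pure index
  shift. The factor 2 ^ p / p! in front of a product of two of these restores the normalised
  product.\<close>

definition hermite_unnorm :: "nat => real => real" where
 "hermite_unnorm p x = hermite_fun p x / sqrt (2 ^ p / fact p)"

lemma hermite_unnorm_rec:
 "x * hermite_unnorm p x = hermite_unnorm (Suc p) x + real p / 2 * hermite_unnorm (p - 1) x"
proof -
 define N where "N p = sqrt (2 ^ p / fact p :: real)" for p :: nat
 have N0: "N p > 0" for p by (simp add: N_def)
 have NS: "N (Suc p) * sqrt (real (Suc p) / 2) = N p" for p
  unfolding N_def real_sqrt_mult[symmetric] by (rule arg_cong[where f = sqrt]) (simp add: field_simps del: of_nat_Suc)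
 have 1: "sqrt (real (Suc p) / 2) / N p = 1 / N (Suc p)"
  using NS[of p] N0[of p] N0[of "Suc p"] by (simp add: field_simps)
 have 2: "sqrt (real p / 2) / N p = real p / 2 / N (p - 1)"
 proof (cases p)
  case (Suc q)
  have "sqrt (real p / 2) * N (p - 1) = N p * (sqrt (real p / 2) * sqrt (real p / 2))"
   unfolding Suc diff_Suc_1 NS[of q, symmetric] by (simp only: mult_ac)
  thus ?thesis using N0[of p] N0[of "p - 1"] by (simp add: field_simps)
 qed simp
 have "x * hermite_unnorm p x = sqrt (real (Suc p) / 2) / N p * hermite_fun (Suc p) x
   + sqrt (real p / 2) / N p * hermite_fun (p - 1) x"
  unfolding hermite_unnorm_def N_def[symmetric] times_divide_eq_right hermite_fun_rec
  by (simp add: add_divide_distrib)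
 thus ?thesis unfolding 1 2 hermite_unnorm_def N_def[symmetric] by simp
qed

text \<open>On \<open>herm_array x y\<close> this is the raising operator in x minus the one in y,
  in terms of which commutators with x - y are expressed.\<close>

definition antidiag :: "(nat => nat => real) => nat => nat => real" where
 "antidiag G s t = G (Suc s) t - G s (Suc t)"

abbreviation herm_array :: "real => real => nat => nat => real" where
 "herm_array x y s t \<equiv> hermite_unnorm s x * hermite_unnorm t y"

text \<open>For \<open>r = 0\<close> this is the recursion in x minus the one in y. Each further
  \<open>antidiag\<close> shifts the coefficients s / 2 and t / 2 by one half and so releases one
  extra copy of the previous power; after r steps there are r of them.\<close>

lemma antidiag_power_mult_diff:
 "(x - y) * (antidiag ^^ r) (herm_array x y) s t
  = (antidiag ^^ Suc r) (herm_array x y) s t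
   + real s / 2 * (antidiag ^^ r) (herm_array x y) (s - 1) t
   - real t / 2 * (antidiag ^^ r) (herm_array x y) s (t - 1)
   + real r * (antidiag ^^ (r - 1)) (herm_array x y) s t"
proof (induction r arbitrary: s t)
 case 0
 have "(x - y) * herm_array x y s t
   = (x * hermite_unnorm s x) * hermite_unnorm t y - hermite_unnorm s x * (y * hermite_unnorm t y)"
  by (simp add: algebra_simps)
 thus ?case unfolding hermite_unnorm_rec by (simp add: antidiag_def algebra_simps)
next
 case (Suc r)
 define A where "A r s t = (antidiag ^^ r) (herm_array x y) s t" for r s t
 have A: "A (Suc r) s t = A r (Suc s) t - A r s (Suc t)" for r s t
  by (simp add: A_def antidiag_def)
 have IH: "(x - y) * A r s t = A (Suc r) s t + real s / 2 * A r (s - 1) t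
   - real t / 2 * A r s (t - 1) + real r * A (r - 1) s t" for s t
  unfolding A_def by (rule Suc.IH)
 have "(x - y) * A (Suc r) s t = A (Suc (Suc r)) s t + real s / 2 * A (Suc r) (s - 1) t
   - real t / 2 * A (Suc r) s (t - 1) + real (Suc r) * A r s t"
 proof -
  have "(x - y) * A (Suc r) s t = (x - y) * A r (Suc s) t - (x - y) * A r s (Suc t)"
   unfolding A[of r] by (simp add: algebra_simps)
  also have "... = (A (Suc r) (Suc s) t - A (Suc r) s (Suc t))
    + (real (Suc s) / 2 * A r s t - real t / 2 * A r (Suc s) (t - 1))
    - (real s / 2 * A r (s - 1) (Suc t) - real (Suc t) / 2 * A r s t)
    + real r * (A (r - 1) (Suc s) t - A (r - 1) s (Suc t))"
   unfolding IH by (simp add: algebra_simps)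
  also have "A (Suc r) (Suc s) t - A (Suc r) s (Suc t) = A (Suc (Suc r)) s t" by (simp only: A)
  also have "real r * (A (r - 1) (Suc s) t - A (r - 1) s (Suc t)) = real r * A r s t"
   by (cases r) (auto simp: A)
  finally show ?thesis
   by (cases s; cases t) (simp_all add: A[of r] algebra_simps add_divide_distrib)
 qed
 thus ?case by (simp only: A_def diff_Suc_1)
qed

definition fdiff :: "(nat => real) => nat => real" where
 "fdiff \<eta> k = \<eta> (Suc k) - \<eta> k"

text \<open>For \<open>r = 0\<close> the kernel of the multiplier \<open>\<eta>\<close> on degrees
  below \<open>P\<close>; in general with r differences of raising operators inserted.\<close>

definition herm_ker1 :: "nat => nat => (nat => real) => real => real => real" where
 "herm_ker1 P r \<eta> x y = (\<Sum>p<P. \<eta> p * (2 ^ p / fact p * (antidiag ^^ r) (herm_array x y) p p))"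

text \<open>Summation by parts: on the diagonal the lowering terms at p are minus the raising term
  at p - 1, so the sum telescopes into a difference of \<open>\<eta>\<close>. The boundary term at
  \<open>P\<close> vanishes by assumption.\<close>

lemma herm_ker1_mult_diff:
 assumes "\<eta> P = 0"
 shows "(x - y) * herm_ker1 P r \<eta> x y
  = - herm_ker1 P (Suc r) (fdiff \<eta>) x y + real r * herm_ker1 P (r - 1) \<eta> x y"
proof -
 define A where "A p = 2 ^ p / fact p * (antidiag ^^ Suc r) (herm_array x y) p p" for p
 define B where "B p = (if p = 0 then 0 else A (p - 1))" for p
 have step: "(x - y) * (\<eta> p * (2 ^ p / fact p * (antidiag ^^ r) (herm_array x y) p p))
   = \<eta> p * A p - \<eta> p * B p
    + real r * (\<eta> p * (2 ^ p / fact p * (antidiag ^^ (r - 1)) (herm_array x y) p p))" for p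
 proof -
  have "2 ^ p / fact p * (real p / 2 * (antidiag ^^ r) (herm_array x y) (p - 1) p
     - real p / 2 * (antidiag ^^ r) (herm_array x y) p (p - 1)) = - B p"
  proof (cases p)
   case (Suc q)
   have "2 ^ p / fact p * (real p / 2) = (2 ^ q / fact q :: real)" using Suc by (simp add: field_simps del: of_nat_Suc)
   moreover have "(antidiag ^^ Suc r) (herm_array x y) q q
     = (antidiag ^^ r) (herm_array x y) p q - (antidiag ^^ r) (herm_array x y) q p"
    by (simp add: antidiag_def Suc)
   ultimately have "2 ^ p / fact p * (real p / 2) * ((antidiag ^^ r) (herm_array x y) q p - (antidiag ^^ r) (herm_array x y) p q)
     = - (2 ^ q / fact q * (antidiag ^^ Suc r) (herm_array x y) q q)"
    by (simp only: minus_diff_eq mult_minus_right[symmetric])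
   thus ?thesis unfolding B_def A_def using Suc by (simp add: right_diff_distrib mult.assoc)
  qed (simp add: B_def)
  moreover have "(x - y) * (\<eta> p * (2 ^ p / fact p * (antidiag ^^ r) (herm_array x y) p p))
    = \<eta> p * (2 ^ p / fact p * ((x - y) * (antidiag ^^ r) (herm_array x y) p p))" by simp
  moreover have "e * (c * (a + X - Y + q * Z)) = e * (c * a) - e * b + q * (e * (c * Z))"
   if "c * (X - Y) = - b" for a b c e q X Y Z :: real
  proof -
   have "e * (c * (a + X - Y + q * Z)) = e * (c * a) + e * (c * (X - Y)) + q * (e * (c * Z))"
    by (simp add: algebra_simps)
   thus ?thesis by (simp add: that)
  qed
  ultimately show ?thesis
   unfolding antidiag_power_mult_diff A_def by metis
 qed
 have tel: "(\<Sum>p<Q. \<eta> p * A p - \<eta> p * B p) = - (\<Sum>p<Q. fdiff \<eta> p * A p) + \<eta> Q * B Q" for Q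
  by (induction Q) (auto simp: B_def fdiff_def algebra_simps)
 have "(x - y) * herm_ker1 P r \<eta> x y = (\<Sum>p<P. \<eta> p * A p - \<eta> p * B p) + real r * herm_ker1 P (r - 1) \<eta> x y"
  unfolding herm_ker1_def sum_distrib_left step sum.distrib ..
 also have "(\<Sum>p<P. \<eta> p * A p - \<eta> p * B p) = - herm_ker1 P (Suc r) (fdiff \<eta>) x y"
  unfolding tel assms herm_ker1_def A_def[symmetric] by simp
 finally show ?thesis .
qed

section \<open>The kernel identity in several variables\<close>

definition midx :: "nat => ('n::finite => nat) set" where
 "midx K = {\<mu>. sum \<mu> UNIV < K}"

lemma finite_midx [simp]: "finite (midx K :: ('n::finite => nat) set)"
proof (rule finite_subset)
 show "midx K \<subseteq> (\<Pi>\<^sub>E i\<in>(UNIV::'n set). {..<K})"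
 proof
  fix \<mu> :: "'n => nat" assume "\<mu> \<in> midx K"
  moreover have "\<mu> i <= sum \<mu> UNIV" for i by (rule member_le_sum) auto
  ultimately show "\<mu> \<in> (\<Pi>\<^sub>E i\<in>UNIV. {..<K})" unfolding midx_def by (auto simp: PiE_iff intro: le_less_trans)
 qed
 show "finite (\<Pi>\<^sub>E i\<in>(UNIV::'n set). {..<K})" by (rule finite_PiE) simp_all
qed

lemma sum_fun_upd_UNIV:
 fixes \<mu> :: "'n::finite => nat"
 shows "sum (\<mu>(i := p)) UNIV = sum (\<mu>(i := 0)) UNIV + p"
proof -
 have "sum (\<mu>(i := p)) (UNIV - {i}) = sum (\<mu>(i := 0)) (UNIV - {i})" for p by (intro sum.cong) auto
 thus ?thesis by (simp add: sum.remove[of UNIV i])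
qed

lemma sum_midx_fiber:
 fixes f :: "('n::finite => nat) => 'a::comm_monoid_add"
 shows "(\<Sum>\<mu>\<in>midx K. f \<mu>) = (\<Sum>\<nu>\<in>{\<nu>\<in>midx K. \<nu> i = 0}. \<Sum>p<K - sum \<nu> UNIV. f (\<nu>(i := p)))"
proof -
 have upd0: "\<nu>(i := 0) = \<nu>" if "\<nu> i = 0" for \<nu> :: "'n => nat" using that by (auto simp: fun_eq_iff)
 have s: "sum (\<nu>(i := p)) UNIV = sum \<nu> UNIV + p" if "\<nu> i = 0" for \<nu> :: "'n => nat" and p
  using sum_fun_upd_UNIV[of \<nu> i p] upd0[of \<nu>, OF that] by simp
 have s2: "sum \<mu> UNIV = sum (\<mu>(i := 0)) UNIV + \<mu> i" for \<mu> :: "'n => nat"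
  using sum_fun_upd_UNIV[of \<mu> i "\<mu> i"] by simp
 have "(\<Sum>\<nu>\<in>{\<nu>\<in>midx K. \<nu> i = 0}. \<Sum>p<K - sum \<nu> UNIV. f (\<nu>(i := p)))
   = (\<Sum>(\<nu>, p)\<in>(SIGMA \<nu>:{\<nu>\<in>midx K. \<nu> i = 0}. {..<K - sum \<nu> UNIV}). f (\<nu>(i := p)))"
  by (rule sum.Sigma) auto
 also have "... = (\<Sum>\<mu>\<in>midx K. f \<mu>)"
 proof (rule sum.reindex_bij_witness[where i = "%\<mu>. (\<mu>(i := 0), \<mu> i)" and j = "%(\<nu>, p). \<nu>(i := p)"], goal_cases)
  case (1 a)
  thus ?case using upd0 by auto
 next
  case (2 a)
  then obtain \<nu> p where a: "a = (\<nu>, p)" "\<nu> \<in> midx K" "\<nu> i = 0" "p < K - sum \<nu> UNIV" by auto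
  thus ?case using s[of \<nu> p] by (auto simp: midx_def)
 next
  case (3 b)
  thus ?case by simp
 next
  case (4 b)
  thus ?case using s2[of b] by (auto simp: midx_def)
 next
  case (5 a)
  thus ?case by auto
 qed
 finally show ?thesis ..
qed

definition Phi_rest :: "'n::finite => ('n => nat) => real^'n => real" where
 "Phi_rest i \<nu> x = (\<Prod>j\<in>UNIV - {i}. hermite_fun (\<nu> j) (x $ j))"

lemma Phi_upd: "Phi (\<nu>(i := p)) x = hermite_fun p (x $ i) * Phi_rest i \<nu> x"
proof -
 have "(\<Prod>j\<in>UNIV - {i}. hermite_fun ((\<nu>(i := p)) j) (x $ j)) = Phi_rest i \<nu> x"
  unfolding Phi_rest_def by (intro prod.cong) auto
 thus ?thesis unfolding Phi_def by (simp add: prod.remove[of UNIV i])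
qed

text \<open>The index is sliced along coordinate \<open>i\<close>: off \<open>i\<close> the indices
  in x and y agree, and a slice of degree |\<nu>| sees the symbol shifted, and the cutoff reduced,
  by |\<nu>|.\<close>

definition herm_ker :: "nat => 'n::finite => nat => (nat => real) => real^'n => real^'n => real" where
 "herm_ker K i r \<eta> x y = (\<Sum>\<nu>\<in>{\<nu>\<in>midx K. \<nu> i = 0}. Phi_rest i \<nu> x * Phi_rest i \<nu> y
   * herm_ker1 (K - sum \<nu> UNIV) r (%p. \<eta> (sum \<nu> UNIV + p)) (x $ i) (y $ i))"

lemma herm_ker_mult_diff:
 assumes "!!k. k >= K ==> \<eta> k = 0"
 shows "(x $ i - y $ i) * herm_ker K i r \<eta> x y
  = - herm_ker K i (Suc r) (fdiff \<eta>) x y + real r * herm_ker K i (r - 1) \<eta> x y"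
proof -
 have step: "(x $ i - y $ i) * (Phi_rest i \<nu> x * Phi_rest i \<nu> y
   * herm_ker1 (K - sum \<nu> UNIV) r (%p. \<eta> (sum \<nu> UNIV + p)) (x $ i) (y $ i))
  = - (Phi_rest i \<nu> x * Phi_rest i \<nu> y
    * herm_ker1 (K - sum \<nu> UNIV) (Suc r) (%p. fdiff \<eta> (sum \<nu> UNIV + p)) (x $ i) (y $ i))
   + real r * (Phi_rest i \<nu> x * Phi_rest i \<nu> y
    * herm_ker1 (K - sum \<nu> UNIV) (r - 1) (%p. \<eta> (sum \<nu> UNIV + p)) (x $ i) (y $ i))" for \<nu>
 proof -
  have 1: "(%p. fdiff \<eta> (sum \<nu> UNIV + p)) = fdiff (%p. \<eta> (sum \<nu> UNIV + p))"
   by (simp add: fdiff_def fun_eq_iff)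
  have "(x $ i - y $ i) * (Phi_rest i \<nu> x * Phi_rest i \<nu> y
    * herm_ker1 (K - sum \<nu> UNIV) r (%p. \<eta> (sum \<nu> UNIV + p)) (x $ i) (y $ i))
   = Phi_rest i \<nu> x * Phi_rest i \<nu> y
    * ((x $ i - y $ i) * herm_ker1 (K - sum \<nu> UNIV) r (%p. \<eta> (sum \<nu> UNIV + p)) (x $ i) (y $ i))"
   by simp
  thus ?thesis unfolding 1 by (subst (asm) herm_ker1_mult_diff) (auto simp: assms algebra_simps)
 qed
 show ?thesis
  unfolding herm_ker_def sum_distrib_left sum_negf[symmetric] sum.distrib[symmetric] step ..
qed

text \<open>Each multiplication by x_i - y_i either takes one difference of the symbol and raises r
  by one, with a minus sign, or lowers r by one with factor r. After j multiplications with l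
  differences, r = l - (j - l) = 2 l - j.\<close>

fun ker_coeff :: "nat => nat => real" where
 "ker_coeff 0 l = (if l = 0 then 1 else 0)"
| "ker_coeff (Suc j) l = real (2 * l - j) * ker_coeff j l - (if l = 0 then 0 else ker_coeff j (l - 1))"

text \<open>Wherever the natural-number subtraction \<open>2 * l - j\<close> truncates, the
  coefficient is zero.\<close>

lemma ker_coeff_eq_0: "2 * l < j \<or> j < l ==> ker_coeff j l = 0"
proof (induction j arbitrary: l)
 case (Suc j)
 thus ?case by (cases l) auto
qed auto

lemma fdiff_power_eq_0: "(!!k. k >= K ==> \<eta> k = 0) ==> k >= K ==> (fdiff ^^ l) \<eta> k = 0"
proof (induction l arbitrary: k)
 case (Suc l)
 thus ?case using Suc.IH[of k] Suc.IH[of "Suc k"] by (simp add: fdiff_def)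
qed simp

lemma herm_ker_power:
 assumes "!!k. k >= K ==> \<psi> k = 0"
 shows "(x $ i - y $ i) ^ j * herm_ker K i 0 \<psi> x y
  = (\<Sum>l\<le>j. ker_coeff j l * herm_ker K i (2 * l - j) ((fdiff ^^ l) \<psi>) x y)"
proof (induction j)
 case (Suc j)
 let ?A = "%r l. herm_ker K i r ((fdiff ^^ l) \<psi>) x y"
 have "(x $ i - y $ i) ^ Suc j * herm_ker K i 0 \<psi> x y
   = (\<Sum>l\<le>j. ker_coeff j l * ((x $ i - y $ i) * ?A (2 * l - j) l))"
  unfolding power_Suc mult.assoc Suc.IH sum_distrib_left by (intro sum.cong) auto
 also have "... = (\<Sum>l\<le>j. - (ker_coeff j l * ?A (2 * Suc l - Suc j) (Suc l))
   + real (2 * l - j) * ker_coeff j l * ?A (2 * l - Suc j) l)"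
 proof (intro sum.cong refl)
  fix l
  have "ker_coeff j l = 0 \<or> Suc (2 * l - j) = 2 * Suc l - Suc j"
   using ker_coeff_eq_0[of l j] by (cases "2 * l < j") auto
  moreover have "(x $ i - y $ i) * ?A (2 * l - j) l
    = - ?A (Suc (2 * l - j)) (Suc l) + real (2 * l - j) * ?A (2 * l - j - 1) l"
   using herm_ker_mult_diff[of K "(fdiff ^^ l) \<psi>" x i y "2 * l - j"] fdiff_power_eq_0[OF assms, of K]
   by simp
  moreover have "2 * l - j - 1 = 2 * l - Suc j" by simp
  ultimately have "(x $ i - y $ i) * ?A (2 * l - j) l
    = - ?A (Suc (2 * l - j)) (Suc l) + real (2 * l - j) * ?A (2 * l - Suc j) l"
   and "ker_coeff j l * ?A (2 * Suc l - Suc j) (Suc l) = ker_coeff j l * ?A (Suc (2 * l - j)) (Suc l)"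
   by auto
  thus "ker_coeff j l * ((x $ i - y $ i) * ?A (2 * l - j) l)
    = - (ker_coeff j l * ?A (2 * Suc l - Suc j) (Suc l)) + real (2 * l - j) * ker_coeff j l * ?A (2 * l - Suc j) l"
   by (simp only: distrib_left mult_minus_right mult_ac)
 qed
 also have "... = (\<Sum>l\<le>j. real (2 * l - j) * ker_coeff j l * ?A (2 * l - Suc j) l)
   - (\<Sum>l\<le>j. ker_coeff j l * ?A (2 * Suc l - Suc j) (Suc l))"
  by (simp add: sum.distrib sum_negf sum_subtractf)
 also have "(\<Sum>l\<le>j. real (2 * l - j) * ker_coeff j l * ?A (2 * l - Suc j) l)
   = (\<Sum>l\<le>Suc j. real (2 * l - j) * ker_coeff j l * ?A (2 * l - Suc j) l)"
  by (simp add: ker_coeff_eq_0)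
 also have "(\<Sum>l\<le>j. ker_coeff j l * ?A (2 * Suc l - Suc j) (Suc l))
   = (\<Sum>l\<le>Suc j. (if l = 0 then 0 else ker_coeff j (l - 1)) * ?A (2 * l - Suc j) l)"
  by (subst sum.atMost_Suc_shift) simp
 finally show ?case
  by (simp only: sum_subtractf[symmetric] left_diff_distrib[symmetric] ker_coeff.simps)
qed simp

section \<open>Expansion of the kernels into shifted Hermite products\<close>

text \<open>The factor that s raisings produce when applied to the normalised function of degree
  p.\<close>

definition herm_rho :: "nat => nat => real" where
 "herm_rho p s = sqrt (fact (p + s) / (fact p * 2 ^ s))"

lemma hermite_unnorm_mult:
 "2 ^ p / fact p * (hermite_unnorm (p + a) x * hermite_unnorm (p + b) y)
  = herm_rho p a * herm_rho p b * (hermite_fun (p + a) x * hermite_fun (p + b) y)"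
proof -
 have *: "sqrt (2 ^ p / fact p) / sqrt (2 ^ (p + a) / fact (p + a)) = herm_rho p a" for a
  unfolding herm_rho_def real_sqrt_divide[symmetric]
  by (rule arg_cong[where f = sqrt]) (simp add: power_add field_simps)
 have "(2 ^ p / fact p :: real) = sqrt (2 ^ p / fact p) * sqrt (2 ^ p / fact p)" by simp
 thus ?thesis unfolding hermite_unnorm_def *[symmetric] by simp
qed

lemma antidiag_power:
 "(antidiag ^^ r) G s t = (\<Sum>q\<le>r. (-1) ^ q * real (r choose q) * G (s + (r - q)) (t + q))"
proof (induction r arbitrary: s t)
 case (Suc r)
 let ?g = "%q. G (s + (Suc r - q)) (t + q)"
 have 1: "(\<Sum>q\<le>r. (-1) ^ q * real (r choose q) * G (Suc s + (r - q)) (t + q))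
   = (\<Sum>q\<le>Suc r. (-1) ^ q * real (r choose q) * ?g q)"
  by (simp add: Suc_diff_le)
 have 2: "(\<Sum>q\<le>r. (-1) ^ q * real (r choose q) * G (s + (r - q)) (Suc t + q))
   = - (\<Sum>q\<le>Suc r. if q = 0 then 0 else (-1) ^ q * real (r choose (q - 1)) * ?g q)"
  by (subst sum.atMost_Suc_shift) (simp add: sum_negf[symmetric])
 have "(antidiag ^^ Suc r) G s t = (\<Sum>q\<le>Suc r. (-1) ^ q * real (r choose q) * ?g q)
   + (\<Sum>q\<le>Suc r. if q = 0 then 0 else (-1) ^ q * real (r choose (q - 1)) * ?g q)"
  by (simp only: funpow.simps o_def antidiag_def Suc.IH 1 2 diff_minus_eq_add)
 also have "... = (\<Sum>q\<le>Suc r. (-1) ^ q * real (Suc r choose q) * ?g q)"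
  unfolding sum.distrib[symmetric]
 proof (rule sum.cong)
  fix q
  show "(-1) ^ q * real (r choose q) * ?g q + (if q = 0 then 0 else (-1) ^ q * real (r choose (q - 1)) * ?g q)
    = (-1) ^ q * real (Suc r choose q) * ?g q"
   by (cases q) (auto simp: algebra_simps)
 qed simp
 finally show ?case .
qed simp

text \<open>Binomial expansion of the r-fold difference. For fixed s the index is shifted by r - s
  in x and by s in y, so the kernel stays a sum over orthonormal systems in both variables.\<close>

lemma herm_ker_expand:
 "herm_ker K i r \<eta> x y = (\<Sum>s\<le>r. (-1) ^ s * real (r choose s) * (\<Sum>\<mu>\<in>midx K. \<eta> (sum \<mu> UNIV)
   * (herm_rho (\<mu> i) (r - s) * herm_rho (\<mu> i) s)
   * (Phi (\<mu>(i := \<mu> i + (r - s))) x * Phi (\<mu>(i := \<mu> i + s)) y)))"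
proof -
 let ?f = "%s \<mu>. \<eta> (sum \<mu> UNIV) * (herm_rho (\<mu> i) (r - s) * herm_rho (\<mu> i) s)
   * (Phi (\<mu>(i := \<mu> i + (r - s))) x * Phi (\<mu>(i := \<mu> i + s)) y)"
 have upd: "sum (\<nu>(i := p)) UNIV = sum \<nu> UNIV + p" if "\<nu> i = 0" for \<nu> :: "'a => nat" and p
  using sum_fun_upd_UNIV[of \<nu> i p] fun_upd_idem[of \<nu> i 0] that by simp
 have "herm_ker K i r \<eta> x y = (\<Sum>\<nu>\<in>{\<nu>\<in>midx K. \<nu> i = 0}. \<Sum>p<K - sum \<nu> UNIV.
   \<Sum>s\<le>r. (-1) ^ s * real (r choose s) * ?f s (\<nu>(i := p)))"
  unfolding herm_ker_def
 proof (intro sum.cong refl)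
  fix \<nu> assume "\<nu> \<in> {\<nu> \<in> midx K. \<nu> i = 0}"
  hence \<nu>: "\<nu> i = 0" by simp
  have "2 ^ p / fact p * (antidiag ^^ r) (herm_array (x $ i) (y $ i)) p p
    = (\<Sum>s\<le>r. (-1) ^ s * real (r choose s) * (herm_rho p (r - s) * herm_rho p s
     * (hermite_fun (p + (r - s)) (x $ i) * hermite_fun (p + s) (y $ i))))" for p
   unfolding antidiag_power sum_distrib_left hermite_unnorm_mult[symmetric]
   by (intro sum.cong) auto
  thus "Phi_rest i \<nu> x * Phi_rest i \<nu> y
    * herm_ker1 (K - sum \<nu> UNIV) r (%p. \<eta> (sum \<nu> UNIV + p)) (x $ i) (y $ i)
   = (\<Sum>p<K - sum \<nu> UNIV. \<Sum>s\<le>r. (-1) ^ s * real (r choose s) * ?f s (\<nu>(i := p)))"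
   unfolding herm_ker1_def upd[of \<nu>, OF \<nu>] fun_upd_same fun_upd_upd Phi_upd
   by (simp add: sum_distrib_left mult_ac)
 qed
 also have "... = (\<Sum>\<mu>\<in>midx K. \<Sum>s\<le>r. (-1) ^ s * real (r choose s) * ?f s \<mu>)"
  by (rule sum_midx_fiber[symmetric])
 also have "... = (\<Sum>s\<le>r. \<Sum>\<mu>\<in>midx K. (-1) ^ s * real (r choose s) * ?f s \<mu>)" by (rule sum.swap)
 finally show ?thesis by (simp only: sum_distrib_left)
qed

text \<open>r raisings cost at most the power r / 2 of the degree; this is the origin of the weights
  \<open>real (k + 1) ^ l\<close> in the hypotheses on differences below.\<close>

lemma herm_rho_bound: "herm_rho p s * herm_rho p t <= sqrt ((real (p + (s + t))) ^ (s + t))"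
proof -
 have b: "fact (p + s) / (fact p * 2 ^ s) <= (real (p + s)) ^ s" for s
 proof (induction s)
  case (Suc s)
  have "fact (p + Suc s) / (fact p * 2 ^ Suc s) = real (p + Suc s) / 2 * (fact (p + s) / (fact p * 2 ^ s))"
   by (simp add: field_simps)
  also have "... <= real (p + Suc s) / 2 * (real (p + s)) ^ s"
   by (intro mult_left_mono Suc.IH) auto
  also have "... <= real (p + Suc s) * (real (p + Suc s)) ^ s"
   by (intro mult_mono power_mono) auto
  finally show ?case by simp
 qed simp
 have b': "fact (p + s) / (fact p * 2 ^ s) <= (real (p + (s + t))) ^ s" for s t
  using b[of s] by (rule order_trans) (intro power_mono, auto)
 have "herm_rho p s * herm_rho p t = sqrt (fact (p + s) / (fact p * 2 ^ s) * (fact (p + t) / (fact p * 2 ^ t)))"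
  unfolding herm_rho_def by (simp only: real_sqrt_mult)
 also have "... <= sqrt ((real (p + (s + t))) ^ s * (real (p + (t + s))) ^ t)"
  by (intro real_sqrt_le_mono mult_mono b') auto
 finally show ?thesis by (simp add: power_add add.commute)
qed

lemma herm_rho_nonneg [simp]: "0 <= herm_rho p s"
 by (simp add: herm_rho_def)

section \<open>Spectral multipliers\<close>

lemma one_plus_sum_le_prod:
 fixes a :: "'a => real"
 assumes "finite A" "!!i. i \<in> A ==> 0 <= a i"
 shows "1 + sum a A <= (\<Prod>i\<in>A. 1 + a i)"
 using assms
proof (induction A rule: finite_induct)
 case (insert i A)
 have "1 + sum a (insert i A) <= (1 + sum a A) + a i * 1" using insert by simp
 also have "... <= (\<Prod>i\<in>A. 1 + a i) + a i * (\<Prod>i\<in>A. 1 + a i)"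
 proof (intro add_mono mult_left_mono)
  show "1 + sum a A <= (\<Prod>i\<in>A. 1 + a i)" using insert by auto
  thus "1 <= (\<Prod>i\<in>A. 1 + a i)" using sum_nonneg[of A a] insert by force
 qed (use insert in auto)
 finally show ?case using insert by (simp add: algebra_simps)
qed simp

lemma norm_le_prod_coordinates: "1 + norm (x::real^'n) <= (\<Prod>i\<in>UNIV. 1 + \<bar>x $ i\<bar>)"
 using one_plus_sum_le_prod[of UNIV "%i. \<bar>x $ i\<bar>"] norm_le_l1_cart[of x] by simp

lemma integrable_inverse_norm_power:
 "integrable lborel (%x::real^'n. 1 / (1 + norm x) ^ (2 * CARD('n)))"
proof (rule Bochner_Integration.integrable_bound)
 show "integrable lborel (%x::real^'n. \<Prod>i\<in>UNIV. 1 / (1 + \<bar>x $ i\<bar>) ^ 2)"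
  by (intro integrable_cart_prod integrable_inverse_quadratic)
 have "1 / (1 + norm x) ^ (2 * CARD('n)) <= (\<Prod>i\<in>UNIV. 1 / (1 + \<bar>x $ i\<bar>) ^ 2)" for x :: "real^'n"
 proof -
  have "(\<Prod>i\<in>(UNIV::'n set). 1 / (1 + norm x)^2) <= (\<Prod>i\<in>UNIV. 1 / (1 + \<bar>x $ i\<bar>)^2)"
   by (intro prod_mono conjI divide_left_mono power_mono add_left_mono component_le_norm_cart)
    (auto intro!: mult_pos_pos zero_less_power add_pos_nonneg)
  thus ?thesis by (simp add: power_mult power_one_over)
 qed
 thus "AE x in lborel. norm (1 / (1 + norm (x::real^'n)) ^ (2 * CARD('n))) <= norm (\<Prod>i\<in>UNIV. 1 / (1 + \<bar>x $ i\<bar>) ^ 2)"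
  by (intro AE_I2) (auto simp: abs_prod intro: order_trans)
qed measurable

section \<open>Tempered functions and their Hermite coefficients\<close>

text \<open>A domain on which all Hermite coefficients exist, containing the weighted spaces and
  stable under multiplication by polynomials and indicators.\<close>

definition tempered_L2 :: "(real^'n::finite => complex) => bool" where
 "tempered_L2 f \<longleftrightarrow> f \<in> borel_measurable borel \<and>
  (\<exists>N. (NN x. ennreal ((norm (f x))^2 / (1 + norm x) ^ N)) < \<infinity>)"

lemma tempered_L2_measurable [measurable_dest]: "tempered_L2 f ==> f \<in> borel_measurable borel"
 by (simp add: tempered_L2_def)

lemma tempered_L2_mult:
 assumes "tempered_L2 f" and [measurable]: "p \<in> borel_measurable borel"
  and p: "!!x. \<bar>p x\<bar> <= C * (1 + norm x) ^ m"
 shows "tempered_L2 (%x. cx (p x) * f x)"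
proof -
 obtain N where N: "(NN x. ennreal ((norm (f x))^2 / (1 + norm x) ^ N)) < \<infinity>"
  and [measurable]: "f \<in> borel_measurable borel"
  using assms(1) by (auto simp: tempered_L2_def)
 have "(NN x. ennreal ((norm (cx (p x) * f x))^2 / (1 + norm x) ^ (N + 2 * m)))
   <= (NN x. ennreal (C^2) * ennreal ((norm (f x))^2 / (1 + norm x) ^ N))"
 proof (intro nn_integral_mono)
  fix x
  have "(p x)^2 <= (C * (1 + norm x) ^ m)^2" using p[of x] by (metis abs_ge_zero power2_abs power_mono)
  hence "(norm (f x))^2 * (p x)^2 <= (norm (f x))^2 * (C^2 * (1 + norm x) ^ (2 * m))"
   by (intro mult_left_mono) (simp_all add: power_mult_distrib power_even_eq)
  hence "(norm (f x))^2 * (p x)^2 / (1 + norm x) ^ (N + 2 * m)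
    <= (norm (f x))^2 * (C^2 * (1 + norm x) ^ (2 * m)) / (1 + norm x) ^ (N + 2 * m)"
   by (intro divide_right_mono) auto
  also have "... = C^2 * ((norm (f x))^2 / (1 + norm x) ^ N)"
  proof -
   have "1 + norm x \<noteq> 0" by (smt (verit) norm_ge_zero)
   thus ?thesis by (simp add: power_add)
  qed
  finally show "ennreal ((norm (cx (p x) * f x))^2 / (1 + norm x) ^ (N + 2 * m))
    <= ennreal (C^2) * ennreal ((norm (f x))^2 / (1 + norm x) ^ N)"
   by (subst ennreal_mult[symmetric]) (auto simp: norm_mult power_mult_distrib mult.commute intro!: ennreal_leI)
 qed
 also have "... < \<infinity>" using N by (subst nn_integral_cmult) (auto simp: ennreal_mult_less_top)
 finally show ?thesis unfolding tempered_L2_def by auto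
qed

lemma tempered_L2_indicator:
 assumes "tempered_L2 f" "S \<in> sets borel"
 shows "tempered_L2 (%x. indicator S x * f x)"
proof -
 have "tempered_L2 (%x. cx (indicator S x) * f x)"
  by (rule tempered_L2_mult[where C = 1 and m = 0]) (use assms in \<open>auto simp: indicator_def\<close>)
 moreover have "cx (indicator S x) = indicator S x" for x by (simp add: indicator_def)
 ultimately show ?thesis by simp
qed

lemma L2_tempered:
 assumes "f \<in> borel_measurable borel" "(NN x. csq (f x)) < \<infinity>"
 shows "tempered_L2 f"
 unfolding tempered_L2_def using assms by (auto intro!: exI[of _ 0])

lemma tempered_L2_integrable:
 fixes f :: "'n::finite cfun"
 assumes "tempered_L2 f" and [measurable]: "g \<in> borel_measurable borel"
  and g: "!!m. \<exists>C. \<forall>y. (1 + norm y) ^ m * \<bar>g y\<bar> <= C"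
 shows "integrable lborel (%y. f y * cx (g y))"
proof -
 obtain N where N: "(NN x. ennreal ((norm (f x))^2 / (1 + norm x) ^ N)) < \<infinity>"
  and [measurable]: "f \<in> borel_measurable borel"
  using assms(1) by (auto simp: tempered_L2_def)
 obtain C where C: "!!y. (1 + norm y) ^ (N + 2 * CARD('n)) * \<bar>g y\<bar> <= C" using g by blast
 have C0: "0 <= C" using C[of 0] by simp
 have i1: "integrable lborel (%x. (norm (f x))^2 / (1 + norm x) ^ N)"
  by (rule integrableI_nonneg) (use N in auto)
 have i2: "integrable lborel (%x::real^'n. C^2 * (1 / (1 + norm x) ^ (2 * CARD('n))))"
  by (intro integrable_mult_right integrable_inverse_norm_power)
 show ?thesis
 proof (rule Bochner_Integration.integrable_bound[OF Bochner_Integration.integrable_add[OF i1 i2]])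
  have "norm (f x * cx (g x))
    <= (norm (f x))^2 / (1 + norm x) ^ N + C^2 * (1 / (1 + norm x) ^ (2 * CARD('n)))" for x
  proof -
   define q where "q = 1 + norm x"
   have q: "q >= 1" by (simp add: q_def)
   have ag: "norm (f x) * \<bar>g x\<bar> <= (norm (f x))^2 / q ^ N + \<bar>g x\<bar>^2 * q ^ N"
   proof -
    \<comment> \<open>The arithmetic-geometric inequality, with the growth factor q ^ N moved from f
      to g.\<close>
    define s where "s = sqrt (q ^ N)"
    have s: "s > 0" "s^2 = q ^ N" using q by (auto simp: s_def)
    have "2 * ((norm (f x) / s) * (\<bar>g x\<bar> * s)) <= (norm (f x) / s)^2 + (\<bar>g x\<bar> * s)^2"
     using sum_squares_bound[of "norm (f x) / s" "\<bar>g x\<bar> * s"] by (simp only: mult.assoc)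
    hence "2 * (norm (f x) * \<bar>g x\<bar>) <= (norm (f x))^2 / s^2 + \<bar>g x\<bar>^2 * s^2"
     using s(1) by (simp add: power_divide power_mult_distrib)
    moreover have "0 <= norm (f x) * \<bar>g x\<bar>" by simp
    ultimately show ?thesis unfolding s(2) by linarith
   qed
   have "\<bar>g x\<bar>^2 * q ^ N <= C^2 * (1 / q ^ (2 * CARD('n)))"
   proof -
    have "(q ^ (N + 2 * CARD('n)) * \<bar>g x\<bar>)^2 <= C^2"
     using C[of x] q by (intro power_mono) (auto simp: q_def)
    hence "\<bar>g x\<bar>^2 * (q ^ (N + 2 * CARD('n)))^2 <= C^2" by (simp add: power_mult_distrib mult.commute)
    moreover have "\<bar>g x\<bar>^2 * (q ^ N * q ^ (2 * CARD('n))) <= \<bar>g x\<bar>^2 * (q ^ (N + 2 * CARD('n)))^2"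
     unfolding power_add[symmetric] power_mult[symmetric] using q
     by (intro mult_left_mono power_increasing) auto
    ultimately show ?thesis using q by (simp add: field_simps)
   qed
   with ag show ?thesis by (simp add: norm_mult q_def)
  qed
  thus "AE x in lborel. norm (f x * cx (g x))
    <= norm ((norm (f x))^2 / (1 + norm x) ^ N + C^2 * (1 / (1 + norm x) ^ (2 * CARD('n))))"
   by (intro AE_I2) (metis abs_ge_self order_trans real_norm_def)
 qed measurable
qed

lemma Phi_decay: "\<exists>C. \<forall>y. (1 + norm y) ^ m * \<bar>Phi \<mu> y\<bar> <= C"
proof -
 obtain c where c: "!!k. c k >= 0" "!!k t. (1 + \<bar>t\<bar>) ^ m * \<bar>hermite_fun k t\<bar> <= c k"
  using hermite_fun_decay[of m] by metis
 have "(1 + norm y) ^ m * \<bar>Phi \<mu> y\<bar> <= (\<Prod>i\<in>UNIV. c (\<mu> i))" for y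
 proof -
  have "(1 + norm y) ^ m * \<bar>Phi \<mu> y\<bar> <= (\<Prod>i\<in>UNIV. 1 + \<bar>y $ i\<bar>) ^ m * \<bar>Phi \<mu> y\<bar>"
   by (intro mult_right_mono power_mono norm_le_prod_coordinates) auto
  also have "... = (\<Prod>i\<in>UNIV. (1 + \<bar>y $ i\<bar>) ^ m * \<bar>hermite_fun (\<mu> i) (y $ i)\<bar>)"
   by (simp add: Phi_def abs_prod prod.distrib prod_power_distrib)
  also have "... <= (\<Prod>i\<in>UNIV. c (\<mu> i))" by (intro prod_mono) (use c in auto)
  finally show ?thesis .
 qed
 thus ?thesis by blast
qed

lemma integrable_tempered_Phi:
 "tempered_L2 f ==> integrable lborel (%y. f y * cx (Phi \<mu> y))"
 by (rule tempered_L2_integrable) (auto intro: Phi_decay)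

definition hcoef :: "(real^'n::finite => complex) => ('n => nat) => complex" where
 "hcoef f \<mu> = (LI y. f y * cx (Phi \<mu> y))"

lemma hcoef_add:
 "tempered_L2 f ==> tempered_L2 g ==> hcoef (%x. f x + g x) \<mu> = hcoef f \<mu> + hcoef g \<mu>"
 unfolding hcoef_def by (simp add: distrib_right integrable_tempered_Phi)

lemma hcoef_cmult: "hcoef (%x. c * f x) \<mu> = c * hcoef f \<mu>"
 unfolding hcoef_def by (simp add: mult.assoc)

lemma hermite_bessel:
 fixes g :: "'n::finite cfun"
 assumes [measurable]: "g \<in> borel_measurable borel" and S: "finite S"
 shows "ennreal (\<Sum>\<mu>\<in>S. (norm (hcoef g \<mu>))^2) <= (NN x. csq (g x))"
proof (cases "(NN x. csq (g x)) < \<infinity>")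
 case True
 have temp: "tempered_L2 g" by (rule L2_tempered) (use True in auto)
 have ig: "integrable lborel (%x. (norm (g x))^2)" by (rule integrableI_nonneg) (use True in auto)
 define h where "h x = (\<Sum>\<mu>\<in>S. hcoef g \<mu> * cx (Phi \<mu> x))" for x
 define s where "s = (\<Sum>\<mu>\<in>S. (norm (hcoef g \<mu>))^2)"
 have hh: "integrable lborel (%x. (norm (h x))^2)" "(LI x. (norm (h x))^2) = s"
  using integral_cmod_sum_orthogonal[of S lborel "%_. 1" Phi "hcoef g", OF S]
  by (simp_all add: integrable_Phi_mult Phi_orthonormal h_def s_def)
 have gh: "g x * cnj (h x) = (\<Sum>\<mu>\<in>S. cnj (hcoef g \<mu>) * (g x * cx (Phi \<mu> x)))" for x
  by (simp add: h_def sum_distrib_left mult_ac)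
 have igh: "integrable lborel (%x. g x * cnj (h x))"
  unfolding gh by (intro Bochner_Integration.integrable_sum integrable_mult_right integrable_tempered_Phi temp)
 have "(LI x. g x * cnj (h x)) = (\<Sum>\<mu>\<in>S. cnj (hcoef g \<mu>) * hcoef g \<mu>)"
  unfolding gh hcoef_def
  by (subst Bochner_Integration.integral_sum) (auto intro!: integrable_mult_right integrable_tempered_Phi temp)
 also have "... = cx s" unfolding s_def of_real_sum complex_norm_square by (simp add: mult.commute)
 finally have ghs: "(LI x. Re (g x * cnj (h x))) = s"
  unfolding integral_Re[OF igh] by simp
 have "norm (z - w) ^ 2 = norm z ^ 2 - 2 * Re (z * cnj w) + norm w ^ 2" for z w :: complex
  unfolding cmod_power2 by (simp add: power2_diff algebra_simps)
 define u where "u x = Re (g x * cnj (h x))" for x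
 have u: "integrable lborel u" "(LI x. u x) = s"
  unfolding u_def using integrable_Re[OF igh] ghs by blast+
 have eq: "(norm (g x - h x))^2 = (norm (g x))^2 - 2 * u x + (norm (h x))^2" for x
  unfolding u_def by fact
 have "0 <= (LI x. (norm (g x - h x))^2)" by simp
 also have "... = (LI x. (norm (g x))^2) - 2 * s + s"
  unfolding eq using ig hh u by simp
 finally have "s <= (LI x. (norm (g x))^2)" by simp
 thus ?thesis
  using ig by (subst nn_integral_eq_integral) (auto simp: s_def intro!: ennreal_leI)
qed (simp add: not_less top_unique)

section \<open>Multiplier operators and their kernels\<close>

text \<open>The cutoff \<open>K\<close> keeps every sum finite; it is placed beyond the support of
  the symbol, and the square-function bounds are uniform in it.\<close>

definition hmult :: "nat => (nat => real) => (real^'n::finite => complex) => real^'n => complex" where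
 "hmult K \<psi> f x = (\<Sum>\<mu>\<in>midx K. cx (\<psi> (sum \<mu> UNIV)) * hcoef f \<mu> * cx (Phi \<mu> x))"

lemma borel_measurable_hmult [measurable]: "hmult K \<psi> f \<in> borel_measurable borel"
 unfolding hmult_def by measurable

lemma hmult_add:
 "tempered_L2 f ==> tempered_L2 g ==> hmult K \<psi> (%x. f x + g x) y = hmult K \<psi> f y + hmult K \<psi> g y"
 unfolding hmult_def by (simp add: hcoef_add algebra_simps sum.distrib)

lemma hmult_cmult: "hmult K \<psi> (%x. c * f x) y = c * hmult K \<psi> f y"
 unfolding hmult_def by (simp add: hcoef_cmult sum_distrib_left mult_ac)

lemma hmult_herm_proj: "hmult K \<psi> f x = (\<Sum>k<K. cx (\<psi> k) * herm_proj k f x)"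
proof -
 have "(\<Sum>k<K. cx (\<psi> k) * herm_proj k f x)
   = (\<Sum>k<K. \<Sum>\<mu>\<in>{\<mu>\<in>midx K. sum \<mu> UNIV = k}.
     cx (\<psi> (sum \<mu> UNIV)) * hcoef f \<mu> * cx (Phi \<mu> x))"
  unfolding herm_proj_def sum_distrib_left hcoef_def
  by (intro sum.cong) (auto simp: midx_def mult.assoc)
 also have "... = hmult K \<psi> f x"
  unfolding hmult_def by (rule sum.group[OF finite_midx]) (auto simp: midx_def)
 finally show ?thesis ..
qed

text \<open>The operator with kernel \<open>herm_ker\<close>, written through coefficients: the
  input index is shifted by s and the output index by r - s.\<close>

definition hker_op :: "nat => 'n::finite => nat => (nat => real) => (real^'n => complex) => real^'n => complex" where
 "hker_op K i r \<eta> g x = (\<Sum>s\<le>r. \<Sum>\<mu>\<in>midx K.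
   (cx ((-1) ^ s * real (r choose s) * (\<eta> (sum \<mu> UNIV) * (herm_rho (\<mu> i) (r - s) * herm_rho (\<mu> i) s)))
    * hcoef g (\<mu>(i := \<mu> i + s))) * cx (Phi (\<mu>(i := \<mu> i + (r - s))) x))"

lemma borel_measurable_hker_op [measurable]: "hker_op K i r \<eta> g \<in> borel_measurable borel"
 unfolding hker_op_def by measurable

lemma
 assumes "tempered_L2 g"
 shows integrable_herm_ker: "integrable lborel (%y. g y * cx (herm_ker K i r \<eta> x y))"
  and integral_herm_ker: "(LI y. g y * cx (herm_ker K i r \<eta> x y)) = hker_op K i r \<eta> g x"
proof -
 have eq: "g y * cx (herm_ker K i r \<eta> x y) = (\<Sum>s\<le>r. \<Sum>\<mu>\<in>midx K.
   (cx ((-1) ^ s * real (r choose s) * (\<eta> (sum \<mu> UNIV) * (herm_rho (\<mu> i) (r - s) * herm_rho (\<mu> i) s)))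
    * cx (Phi (\<mu>(i := \<mu> i + (r - s))) x)) * (g y * cx (Phi (\<mu>(i := \<mu> i + s)) y)))" for y
  unfolding herm_ker_expand of_real_sum of_real_mult sum_distrib_left
  by (intro sum.cong refl) (simp only: mult_ac of_real_mult)
 show "integrable lborel (%y. g y * cx (herm_ker K i r \<eta> x y))"
  unfolding eq
  by (intro Bochner_Integration.integrable_sum integrable_mult_right integrable_tempered_Phi assms)
 show "(LI y. g y * cx (herm_ker K i r \<eta> x y)) = hker_op K i r \<eta> g x"
  unfolding eq hker_op_def
  by (subst Bochner_Integration.integral_sum,
    intro Bochner_Integration.integrable_sum integrable_mult_right integrable_tempered_Phi assms,
    intro sum.cong refl, subst Bochner_Integration.integral_sum,
    intro integrable_mult_right integrable_tempered_Phi assms)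
   (intro sum.cong refl, unfold integral_mult_right_zero, simp only: hcoef_def mult_ac)
qed

lemma hmult_eq_hker_op: "hmult K \<psi> f x = hker_op K i 0 \<psi> f x"
 unfolding hmult_def hker_op_def by (simp add: herm_rho_def)

text \<open>Expand y_i = x_i - (x_i - y_i) binomially and absorb the powers of x_i - y_i by
  \<open>herm_ker_power\<close>: a power weight on the input becomes lower powers on the output plus
  differences of the symbol.\<close>

lemma hker_op_power:
 assumes g: "tempered_L2 g" and "!!k. k >= K ==> \<psi> k = 0"
 shows "hmult K \<psi> (%y. cx ((y $ i) ^ m) * g y) x
  = (\<Sum>j\<le>m. \<Sum>l\<le>j. cx (real (m choose j) * (-1) ^ j * (x $ i) ^ (m - j) * ker_coeff j l)
    * hker_op K i (2 * l - j) ((fdiff ^^ l) \<psi>) g x)"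
proof -
 have temp: "tempered_L2 (%y. cx ((y $ i) ^ m) * g y)"
 proof (rule tempered_L2_mult[OF g, where C = 1 and m = m])
  show "\<bar>(x $ i) ^ m\<bar> <= 1 * (1 + norm x) ^ m" for x
   using component_le_norm_cart[of x i] by (auto simp: power_abs intro!: power_mono)
 qed measurable
 have pw: "(y $ i) ^ m * herm_ker K i 0 \<psi> x y = (\<Sum>j\<le>m. \<Sum>l\<le>j. (real (m choose j) * (-1) ^ j * (x $ i) ^ (m - j) * ker_coeff j l)
    * herm_ker K i (2 * l - j) ((fdiff ^^ l) \<psi>) x y)" for y
 proof -
  have "y $ i = (-1) * (x $ i - y $ i) + x $ i" by simp
  hence "(y $ i) ^ m = ((-1) * (x $ i - y $ i) + x $ i) ^ m" by simp
  also have "... = (\<Sum>j\<le>m. real (m choose j) * (-1) ^ j * (x $ i) ^ (m - j) * (x $ i - y $ i) ^ j)"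
   unfolding binomial_ring power_mult_distrib by (intro sum.cong refl) (simp only: mult_ac)
  finally have eq: "(y $ i) ^ m = (\<Sum>j\<le>m. real (m choose j) * (-1) ^ j * (x $ i) ^ (m - j) * (x $ i - y $ i) ^ j)" .
  have "(y $ i) ^ m * herm_ker K i 0 \<psi> x y = (\<Sum>j\<le>m. real (m choose j) * (-1) ^ j * (x $ i) ^ (m - j)
    * ((x $ i - y $ i) ^ j * herm_ker K i 0 \<psi> x y))"
   unfolding eq sum_distrib_right by (simp only: mult.assoc)
  also have "... = (\<Sum>j\<le>m. real (m choose j) * (-1) ^ j * (x $ i) ^ (m - j)
    * (\<Sum>l\<le>j. ker_coeff j l * herm_ker K i (2 * l - j) ((fdiff ^^ l) \<psi>) x y))"
   by (intro sum.cong refl arg_cong2[where f = "(*)"] herm_ker_power assms(2))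
  finally show ?thesis by (simp only: sum_distrib_left mult.assoc)
 qed
 have "hmult K \<psi> (%y. cx ((y $ i) ^ m) * g y) x
   = (LI y. cx ((y $ i) ^ m) * g y * cx (herm_ker K i 0 \<psi> x y))"
  unfolding hmult_eq_hker_op[of K \<psi> _ x i] integral_herm_ker[OF temp] ..
 also have "... = (LI y. (\<Sum>j\<le>m. \<Sum>l\<le>j. cx (real (m choose j) * (-1) ^ j * (x $ i) ^ (m - j) * ker_coeff j l)
    * (g y * cx (herm_ker K i (2 * l - j) ((fdiff ^^ l) \<psi>) x y))))"
 proof (rule Bochner_Integration.integral_cong[OF refl])
  fix y
  have "cx ((y $ i) ^ m) * g y * cx (herm_ker K i 0 \<psi> x y)
    = g y * cx ((y $ i) ^ m * herm_ker K i 0 \<psi> x y)" by simp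
  thus "cx ((y $ i) ^ m) * g y * cx (herm_ker K i 0 \<psi> x y)
    = (\<Sum>j\<le>m. \<Sum>l\<le>j. cx (real (m choose j) * (-1) ^ j * (x $ i) ^ (m - j) * ker_coeff j l)
    * (g y * cx (herm_ker K i (2 * l - j) ((fdiff ^^ l) \<psi>) x y)))"
   unfolding pw of_real_sum sum_distrib_left of_real_mult[of _ "herm_ker _ _ _ _ _ _"]
   by (simp only: mult.left_commute)
 qed
 also have "... = (\<Sum>j\<le>m. \<Sum>l\<le>j. cx (real (m choose j) * (-1) ^ j * (x $ i) ^ (m - j) * ker_coeff j l)
    * hker_op K i (2 * l - j) ((fdiff ^^ l) \<psi>) g x)"
  by (subst Bochner_Integration.integral_sum,
    intro Bochner_Integration.integrable_sum integrable_mult_right integrable_herm_ker g,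
    intro sum.cong refl, subst Bochner_Integration.integral_sum,
    intro integrable_mult_right integrable_herm_ker g)
   (intro sum.cong refl, unfold integral_mult_right_zero, simp only: integral_herm_ker[OF g])
 finally show ?thesis .
qed

lemma nn_integral_cmod_sum_Phi_inj:
 assumes "finite S" "inj_on \<sigma> S"
 shows "(NN x. csq (\<Sum>a\<in>S. d a * cx (Phi (\<sigma> a) x)))
  = ennreal (\<Sum>a\<in>S. (cmod (d a))^2)"
proof -
 have "\<sigma> a \<noteq> \<sigma> b" if "a \<in> S" "b \<in> S" "a \<noteq> b" for a b using that assms(2) by (auto dest: inj_onD)
 hence "integrable lborel (%x. (cmod (\<Sum>a\<in>S. d a * cx (Phi (\<sigma> a) x)))^2)"
  "(LI x. (cmod (\<Sum>a\<in>S. d a * cx (Phi (\<sigma> a) x)))^2) = (\<Sum>a\<in>S. (cmod (d a))^2)"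
  using integral_cmod_sum_orthogonal[of S lborel "%_. 1" "%a. Phi (\<sigma> a)" d, OF assms(1)]
  by (simp_all add: integrable_Phi_mult Phi_orthonormal)
 thus ?thesis by (subst nn_integral_eq_integral) auto
qed

lemma inj_shift_index: "inj_on (%\<mu>::'n => nat. \<mu>(i := \<mu> i + s)) S"
proof (rule inj_onI)
 fix \<mu> \<nu> :: "'n => nat" assume eq: "\<mu>(i := \<mu> i + s) = \<nu>(i := \<nu> i + s)"
 show "\<mu> = \<nu>"
 proof
  fix j show "\<mu> j = \<nu> j" using fun_cong[OF eq, of j] by (cases "j = i") auto
 qed
qed

lemma cmod_sum_square_le: "(cmod (\<Sum>a\<in>S. z a))^2 <= real (card S) * (\<Sum>a\<in>S. (cmod (z a))^2)"
proof -
 have "(cmod (\<Sum>a\<in>S. z a))^2 <= (\<Sum>a\<in>S. cmod (z a))^2" by (intro power_mono norm_sum) auto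
 also have "... <= (\<Sum>a\<in>S. (cmod (z a))^2) * real (card S)" by (rule sum_squared_le_sum_of_squares)
 finally show ?thesis by (simp add: mult.commute)
qed

text \<open>For each s the shifted output indices are distinct, so the L^2 norm is a sum over
  coefficients. The dependence on \<open>\<eta>\<close> stays in a separate factor, ready to be
  integrated over a parameter.\<close>

lemma hker_op_L2:
 fixes g :: "'n::finite cfun"
 shows "(NN x. csq (hker_op K i r \<eta> g x))
  <= (\<Sum>s\<le>r. \<Sum>\<mu>\<in>midx K. ennreal (real (Suc r) * 4 ^ r * real (Suc r) ^ r * (cmod (hcoef g (\<mu>(i := \<mu> i + s))))^2)
    * ennreal ((\<eta> (sum \<mu> UNIV))^2 * real (sum \<mu> UNIV + 1) ^ r))"
proof -
 define d where "d s \<mu> = cx ((-1) ^ s * real (r choose s) * (\<eta> (sum \<mu> UNIV) * (herm_rho (\<mu> i) (r - s) * herm_rho (\<mu> i) s)))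
   * hcoef g (\<mu>(i := \<mu> i + s))" for s \<mu>
 have d: "(cmod (d s \<mu>))^2 <= 4 ^ r * real (Suc r) ^ r * (cmod (hcoef g (\<mu>(i := \<mu> i + s))))^2
   * ((\<eta> (sum \<mu> UNIV))^2 * real (sum \<mu> UNIV + 1) ^ r)" if "s <= r" for s \<mu>
 proof -
  define c where "c = cmod (hcoef g (\<mu>(i := \<mu> i + s)))"
  define e where "e = \<eta> (sum \<mu> UNIV)"
  have "real (r choose s) <= 2 ^ r"
   using binomial_le_pow2[of r s] by (metis of_nat_le_iff of_nat_numeral of_nat_power)
  hence b: "(real (r choose s))^2 <= 4 ^ r"
   using power_mono[of "real (r choose s)" "2 ^ r" 2] by (simp add: power2_eq_square flip: power_mult_distrib)
  have "\<mu> i <= sum \<mu> UNIV" by (rule member_le_sum) auto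
  hence "real (\<mu> i + r) <= real (Suc r) * real (sum \<mu> UNIV + 1)"
  proof -
   have "\<mu> i + r <= sum \<mu> UNIV + r" using \<open>\<mu> i <= sum \<mu> UNIV\<close> by simp
   also have "... <= Suc r * (sum \<mu> UNIV + 1)" by simp
   finally show ?thesis by (metis of_nat_le_iff of_nat_mult)
  qed
  hence p: "real (\<mu> i + r) ^ r <= real (Suc r) ^ r * real (sum \<mu> UNIV + 1) ^ r"
   unfolding power_mult_distrib[symmetric] by (intro power_mono) auto
  have rho: "(herm_rho (\<mu> i) (r - s) * herm_rho (\<mu> i) s)^2 <= real (\<mu> i + r) ^ r"
  proof -
   have "(herm_rho (\<mu> i) (r - s) * herm_rho (\<mu> i) s)^2 <= (sqrt (real (\<mu> i + r) ^ r))^2"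
    using herm_rho_bound[of "\<mu> i" "r - s" s] that by (intro power_mono) auto
   thus ?thesis by simp
  qed
  have "(cmod (d s \<mu>))^2 = (real (r choose s))^2 * (e^2 * (herm_rho (\<mu> i) (r - s) * herm_rho (\<mu> i) s)^2) * c^2"
   unfolding d_def c_def e_def by (simp add: norm_mult norm_power power_mult_distrib abs_mult)
  also have "... <= 4 ^ r * (e^2 * (real (Suc r) ^ r * real (sum \<mu> UNIV + 1) ^ r)) * c^2"
   by (intro mult_mono[OF mult_mono[OF b mult_left_mono[OF order_trans[OF rho p]]] order_refl]
     mult_nonneg_nonneg zero_le_power of_nat_0_le_iff zero_le_power2) auto
  finally show ?thesis by (simp add: c_def e_def mult_ac)
 qed
 have "(NN x. csq (hker_op K i r \<eta> g x))
   <= (NN x. (\<Sum>s\<le>r. ennreal (real (Suc r)) * csq (\<Sum>\<mu>\<in>midx K. d s \<mu> * cx (Phi (\<mu>(i := \<mu> i + (r - s))) x))))"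
 proof (rule nn_integral_mono)
  fix x
  have "(cmod (hker_op K i r \<eta> g x))^2 <= real (card {..r})
    * (\<Sum>s\<le>r. (cmod (\<Sum>\<mu>\<in>midx K. d s \<mu> * cx (Phi (\<mu>(i := \<mu> i + (r - s))) x)))^2)"
   unfolding hker_op_def d_def[symmetric] by (rule cmod_sum_square_le)
  also have "... = (\<Sum>s\<le>r. real (Suc r) * (cmod (\<Sum>\<mu>\<in>midx K. d s \<mu> * cx (Phi (\<mu>(i := \<mu> i + (r - s))) x)))^2)"
   by (simp only: card_atMost sum_distrib_left)
  finally show "csq (hker_op K i r \<eta> g x)
    <= (\<Sum>s\<le>r. ennreal (real (Suc r)) * csq (\<Sum>\<mu>\<in>midx K. d s \<mu> * cx (Phi (\<mu>(i := \<mu> i + (r - s))) x)))"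
   by (subst ennreal_mult[symmetric], simp, simp, subst sum_ennreal) (auto intro!: ennreal_leI simp del: of_nat_Suc)
 qed
 also have "... = (\<Sum>s\<le>r. ennreal (real (Suc r)) * ennreal (\<Sum>\<mu>\<in>midx K. (cmod (d s \<mu>))^2))"
  by (subst nn_integral_sum, measurable, intro sum.cong refl, subst nn_integral_cmult, measurable,
    subst nn_integral_cmod_sum_Phi_inj[OF finite_midx inj_shift_index], rule refl)
 also have "... <= (\<Sum>s\<le>r. \<Sum>\<mu>\<in>midx K. ennreal (real (Suc r) * 4 ^ r * real (Suc r) ^ r * (cmod (hcoef g (\<mu>(i := \<mu> i + s))))^2)
    * ennreal ((\<eta> (sum \<mu> UNIV))^2 * real (sum \<mu> UNIV + 1) ^ r))"
 proof (rule sum_mono)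
  fix s assume "s \<in> {..r}"
  hence s: "s <= r" by simp
  have "real (Suc r) * (\<Sum>\<mu>\<in>midx K. (cmod (d s \<mu>))^2)
    <= (\<Sum>\<mu>\<in>midx K. (real (Suc r) * 4 ^ r * real (Suc r) ^ r * (cmod (hcoef g (\<mu>(i := \<mu> i + s))))^2)
      * ((\<eta> (sum \<mu> UNIV))^2 * real (sum \<mu> UNIV + 1) ^ r))"
   unfolding sum_distrib_left
  proof (rule sum_mono)
   fix \<mu> :: "'n => nat"
   show "real (Suc r) * (cmod (d s \<mu>))^2 <= (real (Suc r) * 4 ^ r * real (Suc r) ^ r * (cmod (hcoef g (\<mu>(i := \<mu> i + s))))^2)
      * ((\<eta> (sum \<mu> UNIV))^2 * real (sum \<mu> UNIV + 1) ^ r)"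
    using mult_left_mono[OF d[OF s, of \<mu>], of "real (Suc r)"] by (simp only: mult.assoc of_nat_0_le_iff)
  qed
  thus "ennreal (real (Suc r)) * ennreal (\<Sum>\<mu>\<in>midx K. (cmod (d s \<mu>))^2)
    <= (\<Sum>\<mu>\<in>midx K. ennreal (real (Suc r) * 4 ^ r * real (Suc r) ^ r * (cmod (hcoef g (\<mu>(i := \<mu> i + s))))^2)
     * ennreal ((\<eta> (sum \<mu> UNIV))^2 * real (sum \<mu> UNIV + 1) ^ r))"
   by (subst (1 2) ennreal_mult[symmetric]) (auto simp: sum_nonneg sum_ennreal intro!: ennreal_leI simp del: of_nat_Suc)
 qed
 finally show ?thesis .
qed

text \<open>By orthogonality a square function over the parameter space needs only, for each single
  degree, the integral of the squared symbol; Bessel's inequality sums the coefficients.\<close>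

lemma hker_op_family_L2:
 fixes g :: "'n::finite cfun" and N :: "'p measure"
 assumes [measurable]: "g \<in> borel_measurable borel" "!!k. (%y. \<eta> y k) \<in> borel_measurable N"
  and B: "!!k. k < K ==> (\<integral>\<^sup>+y. ennreal ((\<eta> y k)^2 * real (k + 1) ^ r) \<partial>N) <= B"
 shows "(\<integral>\<^sup>+y. (NN x. csq (hker_op K i r (\<eta> y) g x)) \<partial>N)
  <= ennreal (real (Suc r) ^ 2 * 4 ^ r * real (Suc r) ^ r) * B * (NN x. csq (g x))"
proof -
 define c where "c = real (Suc r) * 4 ^ r * real (Suc r) ^ r"
 have c: "c >= 0" by (simp add: c_def)
 define G where "G = (NN x. csq (g x))"
 have "(\<integral>\<^sup>+y. (NN x. csq (hker_op K i r (\<eta> y) g x)) \<partial>N)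
   <= (\<integral>\<^sup>+y. (\<Sum>s\<le>r. \<Sum>\<mu>\<in>midx K. ennreal (c * (cmod (hcoef g (\<mu>(i := \<mu> i + s))))^2)
    * ennreal ((\<eta> y (sum \<mu> UNIV))^2 * real (sum \<mu> UNIV + 1) ^ r)) \<partial>N)"
  unfolding c_def by (intro nn_integral_mono hker_op_L2)
 also have "... = (\<Sum>s\<le>r. \<Sum>\<mu>\<in>midx K. ennreal (c * (cmod (hcoef g (\<mu>(i := \<mu> i + s))))^2)
    * (\<integral>\<^sup>+y. ennreal ((\<eta> y (sum \<mu> UNIV))^2 * real (sum \<mu> UNIV + 1) ^ r) \<partial>N))"
  by (simp add: nn_integral_sum nn_integral_cmult)
 also have "... <= (\<Sum>s\<le>r. \<Sum>\<mu>\<in>midx K. ennreal (c * (cmod (hcoef g (\<mu>(i := \<mu> i + s))))^2) * B)"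
  by (intro sum_mono mult_left_mono B) (auto simp: midx_def)
 also have "... = (\<Sum>s\<le>r. ennreal c * B * ennreal (\<Sum>\<mu>\<in>midx K. (cmod (hcoef g (\<mu>(i := \<mu> i + s))))^2))"
 proof (intro sum.cong refl)
  fix s
  have "(\<Sum>\<mu>\<in>midx K. ennreal (c * (cmod (hcoef g (\<mu>(i := \<mu> i + s))))^2) * B)
    = (\<Sum>\<mu>\<in>midx K. ennreal c * B * csq (hcoef g (\<mu>(i := \<mu> i + s))))"
   using c by (simp add: ennreal_mult mult_ac)
  thus "(\<Sum>\<mu>\<in>midx K. ennreal (c * (cmod (hcoef g (\<mu>(i := \<mu> i + s))))^2) * B)
    = ennreal c * B * ennreal (\<Sum>\<mu>\<in>midx K. (cmod (hcoef g (\<mu>(i := \<mu> i + s))))^2)"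
   by (simp add: sum_distrib_left[symmetric] sum_ennreal)
 qed
 also have "... <= (\<Sum>s\<le>r. ennreal c * B * G)"
 proof (intro sum_mono mult_left_mono)
  fix s
  have "ennreal (\<Sum>\<mu>\<in>(%\<mu>. \<mu>(i := \<mu> i + s)) ` midx K. (cmod (hcoef g \<mu>))^2) <= G"
   unfolding G_def by (rule hermite_bessel) auto
  thus "ennreal (\<Sum>\<mu>\<in>midx K. (cmod (hcoef g (\<mu>(i := \<mu> i + s))))^2) <= G"
   by (subst (asm) sum.reindex[OF inj_shift_index]) (simp add: o_def)
 qed auto
 also have "... = ennreal (real (Suc r)) * (ennreal c * B * G)"
  by (simp del: of_nat_Suc add: ennreal_of_nat_eq_real_of_nat)
 also have "... = ennreal (real (Suc r) ^ 2 * 4 ^ r * real (Suc r) ^ r) * B * G"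
 proof -
  have "ennreal (real (Suc r) ^ 2 * 4 ^ r * real (Suc r) ^ r) = ennreal (real (Suc r)) * ennreal c"
   by (subst ennreal_mult[symmetric]) (auto simp: c_def power2_eq_square mult_ac simp del: of_nat_Suc)
  thus ?thesis by (simp only: mult.assoc)
 qed
 finally show ?thesis unfolding G_def .
qed

text \<open>The shifted simplex lies in a cube, over which the sum factors into one-dimensional
  Christoffel sums.\<close>

lemma midx_shift_square_sum:
 fixes x :: "real^'n::finite"
 assumes "a <= r"
 shows "(\<Sum>\<mu>\<in>midx K. (Phi (\<mu>(i := \<mu> i + a)) x)^2) <= sqrt (2 * real (K + r)) ^ CARD('n)"
proof -
 let ?P = "\<Pi>\<^sub>E j\<in>(UNIV::'n set). {..<K + r}"
 have "(\<Sum>\<mu>\<in>midx K. (Phi (\<mu>(i := \<mu> i + a)) x)^2) = (\<Sum>\<mu>\<in>(%\<mu>. \<mu>(i := \<mu> i + a)) ` midx K. (Phi \<mu> x)^2)"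
  by (subst sum.reindex[OF inj_shift_index]) (simp add: o_def)
 also have "... <= (\<Sum>\<mu>\<in>?P. (Phi \<mu> x)^2)"
 proof (rule sum_mono2)
  show "finite ?P" by (rule finite_PiE) simp_all
  show "(%\<mu>. \<mu>(i := \<mu> i + a)) ` midx K \<subseteq> ?P"
  proof
   fix \<kappa> assume "\<kappa> \<in> (%\<mu>. \<mu>(i := \<mu> i + a)) ` midx K"
   then obtain \<mu> where \<mu>: "\<mu> \<in> midx K" "\<kappa> = \<mu>(i := \<mu> i + a)" by auto
   have "\<mu> j <= sum \<mu> UNIV" for j by (rule member_le_sum) auto
   hence "\<mu> j < K" for j using \<mu>(1) by (auto simp: midx_def intro: le_less_trans)
   hence "\<kappa> j < K + r" for j using assms \<mu>(2) by (auto simp: add_less_le_mono trans_less_add1)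
   thus "\<kappa> \<in> ?P" by (auto simp: PiE_iff)
  qed
 qed auto
 also have "... = (\<Prod>j\<in>UNIV. \<Sum>p<K + r. (hermite_fun p (x $ j))^2)"
  by (subst prod_sum_PiE) (auto simp: Phi_def prod_power_distrib)
 also have "... <= (\<Prod>j\<in>(UNIV::'n set). sqrt (2 * real (K + r)))"
  by (intro prod_mono conjI hermite_christoffel_bound sum_nonneg) auto
 finally show ?thesis by simp
qed

text \<open>The arithmetic-geometric inequality separates x from y and reduces the bound to
  \<open>midx_shift_square_sum\<close>.\<close>

lemma herm_ker_bound:
 fixes x y :: "real^'n::finite"
 assumes \<eta>: "!!k. k < K ==> \<bar>\<eta> k\<bar> <= M" and "M >= 0"
 shows "\<bar>herm_ker K i r \<eta> x y\<bar> <= 2 ^ r * M * sqrt (real (K + r) ^ r) * sqrt (2 * real (K + r)) ^ CARD('n)"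
proof -
 define b where "b = sqrt (2 * real (K + r)) ^ CARD('n)"
 define q where "q = M * sqrt (real (K + r) ^ r)"
 have q: "q >= 0" using assms(2) by (simp add: q_def)
 have inner: "\<bar>\<Sum>\<mu>\<in>midx K. \<eta> (sum \<mu> UNIV) * (herm_rho (\<mu> i) (r - s) * herm_rho (\<mu> i) s)
   * (Phi (\<mu>(i := \<mu> i + (r - s))) x * Phi (\<mu>(i := \<mu> i + s)) y)\<bar> <= q * b" if s: "s <= r" for s
 proof -
  have t: "\<bar>\<eta> (sum \<mu> UNIV) * (herm_rho (\<mu> i) (r - s) * herm_rho (\<mu> i) s)
    * (Phi (\<mu>(i := \<mu> i + (r - s))) x * Phi (\<mu>(i := \<mu> i + s)) y)\<bar>
   <= q * ((1 / 2) * ((Phi (\<mu>(i := \<mu> i + (r - s))) x)^2 + (Phi (\<mu>(i := \<mu> i + s)) y)^2))" if "\<mu> \<in> midx K" for \<mu>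
  proof -
   have "\<mu> i <= sum \<mu> UNIV" by (rule member_le_sum) auto
   hence "herm_rho (\<mu> i) (r - s) * herm_rho (\<mu> i) s <= sqrt (real (K + r) ^ r)"
    using herm_rho_bound[of "\<mu> i" "r - s" s] s that
    by (auto simp: midx_def elim!: order_trans intro!: real_sqrt_le_mono power_mono)
   hence 1: "\<bar>\<eta> (sum \<mu> UNIV) * (herm_rho (\<mu> i) (r - s) * herm_rho (\<mu> i) s)\<bar> <= q"
    unfolding q_def abs_mult using \<eta>[of "sum \<mu> UNIV"] that by (intro mult_mono) (auto simp: midx_def)
   define u v where "u = \<bar>Phi (\<mu>(i := \<mu> i + (r - s))) x\<bar>" and "v = \<bar>Phi (\<mu>(i := \<mu> i + s)) y\<bar>"
   have uv: "u * v <= (1 / 2) * (u^2 + v^2)" using sum_squares_bound[of u v] by simp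
   have "\<bar>\<eta> (sum \<mu> UNIV) * (herm_rho (\<mu> i) (r - s) * herm_rho (\<mu> i) s)\<bar> * (u * v) <= q * ((1 / 2) * (u^2 + v^2))"
    by (rule mult_mono[OF 1 uv q]) (auto simp: u_def v_def)
   thus ?thesis by (simp add: u_def v_def abs_mult)
  qed
  have "\<bar>\<Sum>\<mu>\<in>midx K. \<eta> (sum \<mu> UNIV) * (herm_rho (\<mu> i) (r - s) * herm_rho (\<mu> i) s)
   * (Phi (\<mu>(i := \<mu> i + (r - s))) x * Phi (\<mu>(i := \<mu> i + s)) y)\<bar>
   <= (\<Sum>\<mu>\<in>midx K. q * ((1 / 2) * ((Phi (\<mu>(i := \<mu> i + (r - s))) x)^2 + (Phi (\<mu>(i := \<mu> i + s)) y)^2)))"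
   by (rule order_trans[OF sum_abs sum_mono]) (rule t)
  also have "... = q * ((1 / 2) * ((\<Sum>\<mu>\<in>midx K. (Phi (\<mu>(i := \<mu> i + (r - s))) x)^2) + (\<Sum>\<mu>\<in>midx K. (Phi (\<mu>(i := \<mu> i + s)) y)^2)))"
   by (simp only: sum_distrib_left[symmetric] sum.distrib)
  also have "... <= q * ((1 / 2) * (b + b))"
   unfolding b_def using q s by (intro mult_left_mono add_mono midx_shift_square_sum) auto
  finally show ?thesis by simp
 qed
 have "\<bar>herm_ker K i r \<eta> x y\<bar> <= (\<Sum>s\<le>r. real (r choose s) * (q * b))"
  unfolding herm_ker_expand
 proof (rule order_trans[OF sum_abs sum_mono])
  fix s assume "s \<in> {..r}"
  hence "s <= r" by simp
  from mult_left_mono[OF inner[OF this], of "real (r choose s)"]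
  show "\<bar>(-1) ^ s * real (r choose s) * (\<Sum>\<mu>\<in>midx K. \<eta> (sum \<mu> UNIV) * (herm_rho (\<mu> i) (r - s) * herm_rho (\<mu> i) s)
   * (Phi (\<mu>(i := \<mu> i + (r - s))) x * Phi (\<mu>(i := \<mu> i + s)) y))\<bar> <= real (r choose s) * (q * b)"
   unfolding abs_mult[of "_ * _" "sum _ _"] by (simp only: abs_mult power_abs abs_minus_cancel abs_one power_one mult_1 abs_of_nat of_nat_0_le_iff)
 qed
 also have "... = 2 ^ r * (q * b)"
  using choose_row_sum[of r] by (simp add: sum_distrib_right[symmetric] flip: of_nat_sum)
 finally show ?thesis by (simp add: q_def b_def mult_ac)
qed

section \<open>Multiplier families and polynomial weights\<close>

lemma ennreal_mult3:
 "0 <= x ==> 0 <= y ==> 0 <= z ==> ennreal x * (ennreal y * ennreal z * G) = ennreal (x * (y * z)) * G"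
 by (simp add: ennreal_mult mult.assoc)

lemma measurable_fdiff_power:
 assumes "!!k. (%y. \<psi> y k) \<in> borel_measurable N"
 shows "(%y. (fdiff ^^ l) (\<psi> y) k) \<in> borel_measurable N"
proof (induction l arbitrary: k)
 case (Suc l)
 thus ?case by (simp add: fdiff_def)
qed (simp add: assms)

lemma measurable_hker_op_param:
 assumes [measurable]: "!!k. (%y. \<eta> y k) \<in> borel_measurable N"
 shows "(%(y, x). hker_op K i r (\<eta> y) g x) \<in> borel_measurable (N \<Otimes>\<^sub>M lborel)"
 unfolding hker_op_def by measurable

lemma measurable_hmult_param:
 assumes [measurable]: "!!k. (%y. \<psi> y k) \<in> borel_measurable N"
 shows "(%(y, x). hmult K (\<psi> y) f x) \<in> borel_measurable (N \<Otimes>\<^sub>M lborel)"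
 unfolding hmult_def by measurable

abbreviation xpow :: "'n::finite => nat => 'n cfun => real^'n => complex" where
 "xpow i m g z \<equiv> cx ((z $ i) ^ m) * g z"

lemma tempered_L2_coordinate_power:
 "tempered_L2 g ==> tempered_L2 (%y. cx ((y $ i) ^ m) * g y)"
proof (rule tempered_L2_mult[where C = 1 and m = m])
 show "\<bar>(x $ i) ^ m\<bar> <= 1 * (1 + norm x) ^ m" for x
  using component_le_norm_cart[of x i] by (auto simp: power_abs intro!: power_mono)
qed measurable

lemma tempered_L2_cmult: "tempered_L2 g ==> tempered_L2 (%y. cx c * g y)"
 by (rule tempered_L2_mult[where C = "\<bar>c\<bar>" and m = 0]) auto

lemma tempered_L2_add:
 fixes f g :: "'n::finite cfun"
 assumes "tempered_L2 f" "tempered_L2 g"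
 shows "tempered_L2 (%x. f x + g x)"
proof -
 obtain N where N: "(NN x. ennreal ((norm (f x))^2 / (1 + norm x) ^ N)) < \<infinity>"
  and [measurable]: "f \<in> borel_measurable borel"
  using assms(1) by (auto simp: tempered_L2_def)
 obtain M where M: "(NN x. ennreal ((norm (g x))^2 / (1 + norm x) ^ M)) < \<infinity>"
  and [measurable]: "g \<in> borel_measurable borel"
  using assms(2) by (auto simp: tempered_L2_def)
 have "(NN x. ennreal ((norm (f x + g x))^2 / (1 + norm x) ^ (N + M)))
   <= (NN x. 2 * ennreal ((norm (f x))^2 / (1 + norm x) ^ N) + 2 * ennreal ((norm (g x))^2 / (1 + norm x) ^ M))"
 proof (rule nn_integral_mono)
  fix x :: "real^'n"
  define q where "q = 1 + norm x"
  have q: "q >= 1" by (simp add: q_def)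
  have "(norm (f x + g x))^2 <= (norm (f x) + norm (g x))^2" by (intro power_mono norm_triangle_ineq) auto
  also have "... <= 2 * (norm (f x))^2 + 2 * (norm (g x))^2"
   using sum_squares_bound[of "norm (f x)" "norm (g x)"] by (simp add: power2_sum)
  finally have "(norm (f x + g x))^2 / q ^ (N + M) <= (2 * (norm (f x))^2 + 2 * (norm (g x))^2) / q ^ (N + M)"
   using q by (intro divide_right_mono) auto
  also have "... <= 2 * ((norm (f x))^2 / q ^ N) + 2 * ((norm (g x))^2 / q ^ M)"
   unfolding add_divide_distrib times_divide_eq_right using q
   by (intro add_mono divide_left_mono power_increasing) (auto intro!: mult_pos_pos)
  finally show "ennreal ((norm (f x + g x))^2 / (1 + norm x) ^ (N + M))
    <= 2 * ennreal ((norm (f x))^2 / (1 + norm x) ^ N) + 2 * ennreal ((norm (g x))^2 / (1 + norm x) ^ M)"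
   using q unfolding q_def[symmetric]
   by (simp add: ennreal_mult[of 2, simplified, symmetric] ennreal_plus[symmetric] del: ennreal_plus)
 qed
 also have "... < \<infinity>" using N M by (subst nn_integral_add) (auto simp: nn_integral_cmult ennreal_mult_less_top)
 finally show ?thesis unfolding tempered_L2_def by auto
qed

lemma tempered_L2_sum:
 "finite S ==> (!!i. i \<in> S ==> tempered_L2 (f i)) ==> tempered_L2 (%x. \<Sum>i\<in>S. f i x)"
proof (induction S rule: finite_induct)
 case empty
 show ?case by (simp add: tempered_L2_def)
next
 case (insert i S)
 thus ?case by (simp add: tempered_L2_add)
qed

lemma hmult_sum:
 "finite S ==> (!!i. i \<in> S ==> tempered_L2 (f i)) ==>
  hmult K \<psi> (%x. \<Sum>i\<in>S. f i x) y = (\<Sum>i\<in>S. hmult K \<psi> (f i) y)"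
proof (induction S rule: finite_induct)
 case empty
 show ?case by (simp add: hmult_def hcoef_def)
next
 case (insert i S)
 thus ?case by (simp add: hmult_add tempered_L2_sum)
qed

text \<open>In \<open>hker_op_power\<close> a term carries x_i ^ (m - j) and a kernel with l <= j
  differences. After squaring, the weight pays for the power of x_i and leaves a ^ (- 2 j), while
  the operator contributes a constant times A a ^ (2 l) <= A a ^ (2 j).\<close>

lemma movement_coordinate:
 fixes i :: "'n::finite"
 obtains C where "C > 0" "!!(N::real measure) K \<psi> a A (g :: real^'n => complex).
  (!!k. (%y. \<psi> y k) \<in> borel_measurable N) ==> (!!y k. k >= K ==> \<psi> y k = 0) ==> a >= 1 ==> A >= 0 ==> tempered_L2 g ==>
  (!!l k. l <= m ==> k < K ==> (\<integral>\<^sup>+y. ennreal (((fdiff ^^ l) (\<psi> y) k)^2 * real (k + 1) ^ l) \<partial>N) <= ennreal (A * a ^ (2 * l))) ==>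
  (\<integral>\<^sup>+y. (NN x. ennreal ((cmod (hmult K (\<psi> y) (%z. xpow i m g z) x))^2
    / (a ^ (2 * m) * (1 + norm x / a) ^ (2 * m)))) \<partial>N)
   <= ennreal (C * A) * (NN x. csq (g x))"
proof -
 define e where "e j l = (real (m choose j) * ker_coeff j l)^2" for j l
 define c where "c r = real (Suc r) ^ 2 * 4 ^ r * real (Suc r) ^ r" for r
 define M where "M = real (Suc m) ^ 2"
 define C where "C = (\<Sum>j\<le>m. \<Sum>l\<le>j. M * e j l * c (2 * l - j)) + 1"
 have e0: "0 <= e j l" for j l by (simp add: e_def)
 have c0: "0 <= c r" for r by (simp add: c_def)
 have M0: "0 <= M" by (simp add: M_def)
 have "C >= 1" unfolding C_def using e0 c0 M0 by (simp add: sum_nonneg)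
 show thesis
 proof
  show "C > 0" using \<open>C >= 1\<close> by simp
  fix N :: "real measure" and K \<psi> a A and g :: "'n cfun"
  assume mes[measurable]: "!!k. (%y. \<psi> y k) \<in> borel_measurable N" and van: "!!y k. k >= K ==> \<psi> y k = 0"
   and a: "a >= (1::real)" and A: "A >= (0::real)" and g: "tempered_L2 g"
   and H: "!!l k. l <= m ==> k < K ==> (\<integral>\<^sup>+y. ennreal (((fdiff ^^ l) (\<psi> y) k)^2 * real (k + 1) ^ l) \<partial>N) <= ennreal (A * a ^ (2 * l))"
  have [measurable]: "g \<in> borel_measurable borel" using g by measurable
  note [measurable] = measurable_fdiff_power[OF mes]
  define G where "G = (NN x. csq (g x))"
  define Z where "Z j l y x = (cmod (hker_op K i (2 * l - j) ((fdiff ^^ l) (\<psi> y)) g x))^2" for j l y x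
  have Zm: "(%(y, x). Z j l y x) \<in> borel_measurable (N \<Otimes>\<^sub>M lborel)" for j l
  proof -
   have "(%(y, x). hker_op K i (2 * l - j) ((fdiff ^^ l) (\<psi> y)) g x) \<in> borel_measurable (N \<Otimes>\<^sub>M lborel)"
    by (rule measurable_hker_op_param[where \<eta> = "%y. (fdiff ^^ l) (\<psi> y)"]) (rule measurable_fdiff_power[OF mes])
   thus ?thesis unfolding Z_def by (simp add: split_beta')
  qed
  have Zm'[measurable]: "(%y. (NN x. ennreal (Z j l y x))) \<in> borel_measurable N" for j l
   using lborel.borel_measurable_nn_integral[of "%y x. ennreal (Z j l y x)" N] Zm[of j l] by (simp add: split_beta')
  have Zx[measurable]: "Z j l y \<in> borel_measurable borel" for j l y unfolding Z_def by measurable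
  have pw: "(cmod (hmult K (\<psi> y) (%z. xpow i m g z) x))^2 / (a ^ (2 * m) * (1 + norm x / a) ^ (2 * m))
    <= (\<Sum>j\<le>m. \<Sum>l\<le>j. M * e j l / a ^ (2 * j) * Z j l y x)" for y x
  proof -
   define d where "d = a ^ (2 * m) * (1 + norm x / a) ^ (2 * m)"
   have q1: "1 + norm x / a >= 1" using a by simp
   hence d: "d > 0" unfolding d_def using a by (intro mult_pos_pos zero_less_power) linarith+
   define t where "t j l = cx (real (m choose j) * (-1) ^ j * (x $ i) ^ (m - j) * ker_coeff j l)
     * hker_op K i (2 * l - j) ((fdiff ^^ l) (\<psi> y)) g x" for j l
   have "(cmod (hmult K (\<psi> y) (%z. xpow i m g z) x))^2 = (cmod (\<Sum>j\<le>m. \<Sum>l\<le>j. t j l))^2"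
    unfolding t_def using hker_op_power[OF g, of K "\<psi> y" i m x] van by simp
   also have "... <= real (card {..m}) * (\<Sum>j\<le>m. (cmod (\<Sum>l\<le>j. t j l))^2)" by (rule cmod_sum_square_le)
   also have "... <= real (Suc m) * (\<Sum>j\<le>m. real (Suc m) * (\<Sum>l\<le>j. (cmod (t j l))^2))"
    unfolding card_atMost
   proof (intro mult_left_mono sum_mono)
    fix j assume "j \<in> {..m}"
    have "(cmod (\<Sum>l\<le>j. t j l))^2 <= real (card {..j}) * (\<Sum>l\<le>j. (cmod (t j l))^2)" by (rule cmod_sum_square_le)
    also have "... <= real (Suc m) * (\<Sum>l\<le>j. (cmod (t j l))^2)"
     using \<open>j \<in> {..m}\<close> by (intro mult_right_mono sum_nonneg) auto
    finally show "(cmod (\<Sum>l\<le>j. t j l))^2 <= real (Suc m) * (\<Sum>l\<le>j. (cmod (t j l))^2)" .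
   qed simp
   also have "... = (\<Sum>j\<le>m. \<Sum>l\<le>j. M * (cmod (t j l))^2)"
    by (simp add: sum_distrib_left M_def power2_eq_square mult.assoc del: of_nat_Suc)
   finally have "(cmod (hmult K (\<psi> y) (%z. xpow i m g z) x))^2 / d
     <= (\<Sum>j\<le>m. \<Sum>l\<le>j. M * (cmod (t j l))^2) / d"
    using d by (intro divide_right_mono) auto
   also have "... = (\<Sum>j\<le>m. \<Sum>l\<le>j. M * (cmod (t j l))^2 / d)" by (simp add: sum_divide_distrib)
   also have "... <= (\<Sum>j\<le>m. \<Sum>l\<le>j. M * e j l / a ^ (2 * j) * Z j l y x)"
   proof (intro sum_mono)
    fix j l assume "j \<in> {..m}"
    hence j: "j <= m" by simp
    have t2: "(cmod (t j l))^2 = e j l * (\<bar>x $ i\<bar> ^ (2 * (m - j))) * Z j l y x"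
     unfolding t_def e_def Z_def power_even_eq
     by (simp add: norm_mult norm_power power_mult_distrib abs_mult power_abs)
    have "\<bar>x $ i\<bar> ^ (2 * (m - j)) * a ^ (2 * j) <= d"
    proof -
     have "a * (1 + norm x / a) = a + norm x" using a by (simp add: distrib_left)
     hence "\<bar>x $ i\<bar> <= a * (1 + norm x / a)" using component_le_norm_cart[of x i] a by simp
     hence "\<bar>x $ i\<bar> ^ (2 * (m - j)) <= (a * (1 + norm x / a)) ^ (2 * (m - j))" by (intro power_mono) auto
     hence "\<bar>x $ i\<bar> ^ (2 * (m - j)) * a ^ (2 * j) <= (a * (1 + norm x / a)) ^ (2 * (m - j)) * a ^ (2 * j)"
      using a by (intro mult_right_mono) auto
     also have "... = (a ^ (2 * (m - j)) * a ^ (2 * j)) * (1 + norm x / a) ^ (2 * (m - j))"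
      by (simp only: power_mult_distrib mult_ac)
     also have "a ^ (2 * (m - j)) * a ^ (2 * j) = a ^ (2 * m)"
     proof -
      have "2 * (m - j) + 2 * j = 2 * m" using j by simp
      thus ?thesis by (simp only: power_add[symmetric])
     qed
     also have "a ^ (2 * m) * (1 + norm x / a) ^ (2 * (m - j)) <= d"
      unfolding d_def using a q1 by (intro mult_left_mono power_increasing) auto
     finally show ?thesis .
    qed
    hence "\<bar>x $ i\<bar> ^ (2 * (m - j)) / d <= 1 / a ^ (2 * j)"
     using d a by (simp add: field_simps)
    hence "(M * e j l * Z j l y x) * (\<bar>x $ i\<bar> ^ (2 * (m - j)) / d) <= (M * e j l * Z j l y x) * (1 / a ^ (2 * j))"
     by (intro mult_left_mono mult_nonneg_nonneg M0 e0) (auto simp: Z_def)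
    thus "M * (cmod (t j l))^2 / d <= M * e j l / a ^ (2 * j) * Z j l y x"
     unfolding t2 by (simp add: mult_ac)
   qed
   finally show ?thesis unfolding d_def .
  qed
  have coef0: "0 <= M * e j l / a ^ (2 * j)" for j l using M0 e0 a by simp
  have "(\<integral>\<^sup>+y. (NN x. ennreal ((cmod (hmult K (\<psi> y) (%z. xpow i m g z) x))^2
    / (a ^ (2 * m) * (1 + norm x / a) ^ (2 * m)))) \<partial>N)
   <= (\<integral>\<^sup>+y. (NN x. (\<Sum>j\<le>m. \<Sum>l\<le>j. ennreal (M * e j l / a ^ (2 * j)) * ennreal (Z j l y x))) \<partial>N)"
  proof (intro nn_integral_mono)
   fix y x
   have "(\<Sum>j\<le>m. \<Sum>l\<le>j. ennreal (M * e j l / a ^ (2 * j)) * ennreal (Z j l y x))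
     = ennreal (\<Sum>j\<le>m. \<Sum>l\<le>j. M * e j l / a ^ (2 * j) * Z j l y x)"
   proof -
    have nn: "0 <= M * e j l / a ^ (2 * j) * Z j l y x" for j l
     by (intro mult_nonneg_nonneg coef0) (simp add: Z_def)
    have em: "ennreal (M * e j l / a ^ (2 * j)) * ennreal (Z j l y x) = ennreal (M * e j l / a ^ (2 * j) * Z j l y x)" for j l
     by (rule ennreal_mult[symmetric]) (use coef0 in \<open>auto simp: Z_def\<close>)
    show ?thesis unfolding em by (simp only: sum_ennreal nn sum_nonneg)
   qed
   thus "ennreal ((cmod (hmult K (\<psi> y) (%z. xpow i m g z) x))^2
    / (a ^ (2 * m) * (1 + norm x / a) ^ (2 * m))) <= (\<Sum>j\<le>m. \<Sum>l\<le>j. ennreal (M * e j l / a ^ (2 * j)) * ennreal (Z j l y x))"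
    by (simp only:) (intro ennreal_leI pw)
  qed
  also have "... = (\<Sum>j\<le>m. \<Sum>l\<le>j. ennreal (M * e j l / a ^ (2 * j)) * (\<integral>\<^sup>+y. (NN x. ennreal (Z j l y x)) \<partial>N))"
   by (simp add: nn_integral_sum nn_integral_cmult)
  also have "... <= (\<Sum>j\<le>m. \<Sum>l\<le>j. ennreal (M * e j l * c (2 * l - j) * A) * G)"
  proof (intro sum_mono)
   fix j l assume "j \<in> {..m}" "l \<in> {..j}"
   hence jl: "j <= m" "l <= j" by auto
   show "ennreal (M * e j l / a ^ (2 * j)) * (\<integral>\<^sup>+y. (NN x. ennreal (Z j l y x)) \<partial>N)
     <= ennreal (M * e j l * c (2 * l - j) * A) * G"
   proof (cases "2 * l < j")
    case True
    hence "e j l = 0" by (simp add: e_def ker_coeff_eq_0)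
    thus ?thesis by simp
   next
    case False
    have "(\<integral>\<^sup>+y. (NN x. ennreal (Z j l y x)) \<partial>N) <= ennreal (c (2 * l - j)) * ennreal (A * a ^ (2 * j)) * G"
     unfolding Z_def G_def c_def
    proof (rule hker_op_family_L2)
     \<comment> \<open>Only 2 l - j powers of the degree occur, and 2 l - j <= l because l <= j, so
       the hypothesis at order l suffices.\<close>
     fix k assume k: "k < K"
     have "(\<integral>\<^sup>+y. ennreal (((fdiff ^^ l) (\<psi> y) k)^2 * real (k + 1) ^ (2 * l - j)) \<partial>N)
       <= (\<integral>\<^sup>+y. ennreal (((fdiff ^^ l) (\<psi> y) k)^2 * real (k + 1) ^ l) \<partial>N)"
      using jl by (intro nn_integral_mono ennreal_leI mult_left_mono power_increasing) auto
     also have "... <= ennreal (A * a ^ (2 * l))" using jl k by (intro H) auto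
     also have "... <= ennreal (A * a ^ (2 * j))"
      using jl a A by (intro ennreal_leI mult_left_mono power_increasing) auto
     finally show "(\<integral>\<^sup>+y. ennreal (((fdiff ^^ l) (\<psi> y) k)^2 * real (k + 1) ^ (2 * l - j)) \<partial>N) <= ennreal (A * a ^ (2 * j))" .
    qed measurable
    hence "ennreal (M * e j l / a ^ (2 * j)) * (\<integral>\<^sup>+y. (NN x. ennreal (Z j l y x)) \<partial>N)
      <= ennreal (M * e j l / a ^ (2 * j)) * (ennreal (c (2 * l - j)) * ennreal (A * a ^ (2 * j)) * G)"
     by (intro mult_left_mono) auto
    also have "... = ennreal (M * e j l / a ^ (2 * j) * (c (2 * l - j) * (A * a ^ (2 * j)))) * G"
     by (rule ennreal_mult3) (use coef0 c0 A a in auto)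
    also have "M * e j l / a ^ (2 * j) * (c (2 * l - j) * (A * a ^ (2 * j))) = M * e j l * c (2 * l - j) * A"
     using a by (simp add: field_simps)
    finally show ?thesis .
   qed
  qed
  also have "... = ennreal (\<Sum>j\<le>m. \<Sum>l\<le>j. M * e j l * c (2 * l - j) * A) * G"
   using M0 e0 c0 A by (simp add: sum_distrib_right[symmetric] sum_ennreal sum_nonneg)
  also have "... <= ennreal (C * A) * G"
   unfolding C_def sum_distrib_right[symmetric] using A by (intro mult_right_mono ennreal_leI) (auto simp: distrib_right)
  finally show "(\<integral>\<^sup>+y. (NN x. ennreal ((cmod (hmult K (\<psi> y) (%z. xpow i m g z) x))^2
    / (a ^ (2 * m) * (1 + norm x / a) ^ (2 * m)))) \<partial>N)
   <= ennreal (C * A) * (NN x. csq (g x))" unfolding G_def .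
 qed
qed

text \<open>For even m, pure powers of the coordinates control the power of the norm, so only
  multiplications by a single x_i ^ m have to be commuted with the multiplier.\<close>

lemma power_one_plus_norm_le:
 fixes x :: "real^'n::finite"
 assumes "a > 0" "even m"
 shows "(1 + norm x / a) ^ m <= real (CARD('n) + 1) ^ m * (1 + (\<Sum>i\<in>UNIV. (x $ i / a) ^ m))"
proof -
 define b where "b i = \<bar>x $ i\<bar> / a" for i
 have b: "0 <= b i" for i using assms by (simp add: b_def)
 define t where "t = Max (insert 1 (range b))"
 have t: "1 <= t" "!!i. b i <= t" unfolding t_def by (rule Max_ge; simp)+
 have "norm x / a <= (\<Sum>i\<in>UNIV. \<bar>x $ i\<bar>) / a"
  using assms norm_le_l1_cart[of x] by (intro divide_right_mono) auto
 also have "... = (\<Sum>i\<in>UNIV. b i)" by (simp add: b_def sum_divide_distrib)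
 also have "... <= (\<Sum>i\<in>(UNIV::'n set). t)" by (intro sum_mono t)
 finally have "1 + norm x / a <= real (CARD('n) + 1) * t" using t by (simp add: algebra_simps)
 hence "(1 + norm x / a) ^ m <= (real (CARD('n) + 1) * t) ^ m"
  using assms by (intro power_mono) auto
 also have "... = real (CARD('n) + 1) ^ m * t ^ m" by (rule power_mult_distrib)
 also have "... <= real (CARD('n) + 1) ^ m * (1 + (\<Sum>i\<in>UNIV. (x $ i / a) ^ m))"
 proof (rule mult_left_mono)
  have eq: "(x $ i / a) ^ m = b i ^ m" for i
   using assms power_even_abs[of m "x $ i / a"] by (simp add: b_def)
  have "t \<in> insert 1 (range b)" unfolding t_def by (rule Max_in) auto
  thus "t ^ m <= 1 + (\<Sum>i\<in>UNIV. (x $ i / a) ^ m)"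
  proof
   assume "t = 1"
   thus ?thesis using b by (simp add: eq sum_nonneg)
  next
   assume "t \<in> range b"
   then obtain i where "t = b i" by auto
   moreover have "b i ^ m <= (\<Sum>i\<in>UNIV. b i ^ m)" by (rule member_le_sum) (use b in auto)
   ultimately show ?thesis by (simp add: eq)
  qed
 qed simp
 finally show ?thesis .
qed

text \<open>A family of multipliers whose \<open>l\<close>-th differences are of size \<open>(a / \<surd>k) ^ l\<close> moves mass by a distance
 at most \<open>a\<close>.\<close>

theorem movement:
 assumes "even m"
 obtains C where "C > 0" "!!(N::real measure) K \<psi> a A (f :: 'n::finite cfun).
  (!!k. (%y. \<psi> y k) \<in> borel_measurable N) ==> (!!y k. k >= K ==> \<psi> y k = 0) ==> a >= 1 ==> A >= 0 ==> tempered_L2 f ==>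
  (!!l k. l <= m ==> k < K ==> (\<integral>\<^sup>+y. ennreal (((fdiff ^^ l) (\<psi> y) k)^2 * real (k + 1) ^ l) \<partial>N) <= ennreal (A * a ^ (2 * l))) ==>
  (\<integral>\<^sup>+y. (NN x. ennreal ((cmod (hmult K (\<psi> y) f x))^2 / (1 + norm x / a) ^ (2 * m))) \<partial>N)
   <= ennreal (C * A) * (NN x. ennreal ((cmod (f x))^2 / (1 + norm x / a) ^ (2 * m)))"
proof -
 have "\<exists>C. \<forall>i::'n. C i > 0 \<and> (\<forall>(N::real measure) K \<psi> a A (g :: real^'n => complex).
  (\<forall>k. (%y. \<psi> y k) \<in> borel_measurable N) --> (\<forall>y k. k >= K --> \<psi> y k = 0) --> a >= 1 --> A >= 0 --> tempered_L2 g -->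
  (\<forall>l k. l <= m --> k < K --> (\<integral>\<^sup>+y. ennreal (((fdiff ^^ l) (\<psi> y) k)^2 * real (k + 1) ^ l) \<partial>N) <= ennreal (A * a ^ (2 * l))) -->
  (\<integral>\<^sup>+y. (NN x. ennreal ((cmod (hmult K (\<psi> y) (%z. xpow i m g z) x))^2
    / (a ^ (2 * m) * (1 + norm x / a) ^ (2 * m)))) \<partial>N)
   <= ennreal (C i * A) * (NN x. csq (g x)))"
  by (rule choice, rule allI, rule_tac i = i and m = m in movement_coordinate) blast
 then obtain C where C0: "!!i::'n. C i > 0" and C: "!!i (N::real measure) K \<psi> a A (g :: real^'n => complex).
  (!!k. (%y. \<psi> y k) \<in> borel_measurable N) ==> (!!y k. k >= K ==> \<psi> y k = 0) ==> a >= 1 ==> A >= 0 ==> tempered_L2 g ==>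
  (!!l k. l <= m ==> k < K ==> (\<integral>\<^sup>+y. ennreal (((fdiff ^^ l) (\<psi> y) k)^2 * real (k + 1) ^ l) \<partial>N) <= ennreal (A * a ^ (2 * l))) ==>
  (\<integral>\<^sup>+y. (NN x. ennreal ((cmod (hmult K (\<psi> y) (%z. xpow i m g z) x))^2
    / (a ^ (2 * m) * (1 + norm x / a) ^ (2 * m)))) \<partial>N)
   <= ennreal (C i * A) * (NN x. csq (g x))"
  by blast
 define n1 where "n1 = real (CARD('n) + 1)"
 have n1: "n1 >= 0" by (simp add: n1_def)
 define D where "D = n1 * (1 + (\<Sum>i\<in>UNIV. C i)) * (n1 ^ (2 * m))"
 show thesis
 proof
  have "1 + (\<Sum>i\<in>UNIV. C i) > 0" using C0 by (intro add_pos_nonneg sum_nonneg) (auto intro: less_imp_le)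
  thus "D > 0" unfolding D_def n1_def by (intro mult_pos_pos zero_less_power) auto
  fix N :: "real measure" and K \<psi> a A and f :: "'n cfun"
  assume mes[measurable]: "!!k. (%y. \<psi> y k) \<in> borel_measurable N" and van: "!!y k. k >= K ==> \<psi> y k = 0"
   and a: "a >= (1::real)" and A: "A >= (0::real)" and f: "tempered_L2 f"
   and H: "!!l k. l <= m ==> k < K ==> (\<integral>\<^sup>+y. ennreal (((fdiff ^^ l) (\<psi> y) k)^2 * real (k + 1) ^ l) \<partial>N) <= ennreal (A * a ^ (2 * l))"
  have [measurable]: "f \<in> borel_measurable borel" using f by measurable
  define q where "q x = 1 + (\<Sum>i\<in>UNIV. (x $ i / a) ^ m)" for x :: "real^'n"
  have q: "q x >= 1" for x unfolding q_def using assms by (simp add: sum_nonneg zero_le_even_power)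
  have [measurable]: "q \<in> borel_measurable borel" unfolding q_def by measurable
  \<comment> \<open>Dividing by q puts the weight into the function: f is g plus the sum of (x_i /
    a) ^ m g, and the plain L^2 norm of g is controlled by the weighted norm of f.\<close>
  define g where "g x = cx (1 / q x) * f x" for x
  have "\<bar>1 / q x\<bar> <= 1 * (1 + norm x) ^ 0" for x using q[of x] by simp
  hence g: "tempered_L2 g" unfolding g_def by (intro tempered_L2_mult[OF f, where C = 1 and m = 0]) measurable
  have [measurable]: "g \<in> borel_measurable borel" using g by measurable
  define G where "G = (NN x. csq (g x))"
  define F where "F = (NN x. ennreal ((cmod (f x))^2 / (1 + norm x / a) ^ (2 * m)))"
  have ap: "0 < 1 + norm x / a" for x :: "real^'n" using a by (intro add_pos_nonneg) auto
  have GF: "G <= ennreal (n1 ^ (2 * m)) * F"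
  proof -
   have "G <= (NN x. ennreal (n1 ^ (2 * m)) * ennreal ((cmod (f x))^2 / (1 + norm x / a) ^ (2 * m)))"
    unfolding G_def
   proof (rule nn_integral_mono)
    fix x
    have "(1 + norm x / a) ^ m <= n1 ^ m * q x"
     unfolding n1_def q_def using power_one_plus_norm_le[of a m x] assms a by simp
    hence "((1 + norm x / a) ^ m)^2 <= (n1 ^ m * q x)^2" using ap[of x] by (intro power_mono) auto
    hence "(1 + norm x / a) ^ (2 * m) <= n1 ^ (2 * m) * (q x)^2"
     by (simp add: power_mult_distrib power_even_eq)
    hence "1 / (q x)^2 <= n1 ^ (2 * m) / (1 + norm x / a) ^ (2 * m)"
     using q[of x] zero_less_power[OF ap[of x], of "2 * m"] by (simp add: field_simps)
    hence "(cmod (f x))^2 * (1 / (q x)^2) <= (cmod (f x))^2 * (n1 ^ (2 * m) / (1 + norm x / a) ^ (2 * m))"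
     by (rule mult_left_mono) simp
    moreover have "(cmod (g x))^2 = (cmod (f x))^2 * (1 / (q x)^2)"
     by (simp add: g_def norm_mult norm_divide power_divide)
    ultimately show "csq (g x) <= ennreal (n1 ^ (2 * m)) * ennreal ((cmod (f x))^2 / (1 + norm x / a) ^ (2 * m))"
     using ap[of x] n1 by (subst ennreal_mult[symmetric]) (auto intro!: ennreal_leI simp: mult_ac less_imp_le)
   qed
   thus ?thesis unfolding F_def by (simp add: nn_integral_cmult)
  qed
  define u where "u i x = cx (1 / a ^ m) * (cx ((x $ i) ^ m) * g x)" for i x
  have u: "tempered_L2 (u i)" for i
   unfolding u_def by (intro tempered_L2_cmult tempered_L2_coordinate_power g)
  have fu: "f = (%x. g x + (\<Sum>i\<in>UNIV. u i x))"
  proof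
   fix x
   have "g x + (\<Sum>i\<in>UNIV. u i x) = cx (q x) * g x"
    unfolding u_def q_def by (simp add: distrib_right sum_distrib_right power_divide)
   also have "... = f x" unfolding g_def using q[of x] by simp
   finally show "f x = g x + (\<Sum>i\<in>UNIV. u i x)" ..
  qed
  define I where "I i = (\<integral>\<^sup>+y. (NN x. ennreal ((cmod (hmult K (\<psi> y) (%z. xpow i m g z) x))^2
    / (a ^ (2 * m) * (1 + norm x / a) ^ (2 * m)))) \<partial>N)" for i
  have I: "I i <= ennreal (C i * A) * G" for i
   unfolding I_def G_def by (rule C) (use mes van a A g H in auto)
  have I0: "(\<integral>\<^sup>+y. (NN x. csq (hmult K (\<psi> y) g x)) \<partial>N) <= ennreal A * G"
  proof -
   have "(\<integral>\<^sup>+y. (NN x. csq (hker_op K i 0 (\<psi> y) g x)) \<partial>N)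
     <= ennreal (real (Suc 0) ^ 2 * 4 ^ 0 * real (Suc 0) ^ 0) * ennreal A * G" for i
    unfolding G_def by (rule hker_op_family_L2) (use mes H[of 0] in auto)
   thus ?thesis by (simp add: hmult_eq_hker_op[symmetric])
  qed
  have mh: "(%(y, x). hmult K (\<psi> y) h x) \<in> borel_measurable (N \<Otimes>\<^sub>M lborel)" for h :: "'n cfun"
   by (rule measurable_hmult_param[OF mes])
  have m1[measurable]: "(%y. (NN x. csq (hmult K (\<psi> y) g x))) \<in> borel_measurable N"
   using lborel.borel_measurable_nn_integral[of "%y x. csq (hmult K (\<psi> y) g x)" N] mh[of g]
   by (simp add: split_beta')
  have m2[measurable]: "(%y. (NN x. ennreal ((cmod (hmult K (\<psi> y) (%z. xpow i m g z) x))^2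
    / (a ^ (2 * m) * (1 + norm x / a) ^ (2 * m))))) \<in> borel_measurable N" for i
   using lborel.borel_measurable_nn_integral[of "%y x. ennreal ((cmod (hmult K (\<psi> y) (%z. xpow i m g z) x))^2
    / (a ^ (2 * m) * (1 + norm x / a) ^ (2 * m)))" N] mh[of "%z. xpow i m g z"]
   by (simp add: split_beta')
  have "(\<integral>\<^sup>+y. (NN x. ennreal ((cmod (hmult K (\<psi> y) f x))^2 / (1 + norm x / a) ^ (2 * m))) \<partial>N)
   <= (\<integral>\<^sup>+y. (NN x. ennreal n1 * (csq (hmult K (\<psi> y) g x)
    + (\<Sum>i\<in>UNIV. ennreal ((cmod (hmult K (\<psi> y) (%z. xpow i m g z) x))^2
    / (a ^ (2 * m) * (1 + norm x / a) ^ (2 * m)))))) \<partial>N)"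
  proof (intro nn_integral_mono)
   fix y x
   define h where "h j = (case j of None => hmult K (\<psi> y) g x | Some i => hmult K (\<psi> y) (u i) x)" for j
   define d where "d = (1 + norm x / a) ^ (2 * m)"
   have d: "d >= 1" unfolding d_def using a by (intro one_le_power) auto
   have so: "(\<Sum>j\<in>(UNIV :: 'n option set). z j) = z None + (\<Sum>i\<in>UNIV. z (Some i))" for z :: "'n option => 'z::comm_monoid_add"
    by (simp add: UNIV_option_conv sum.reindex)
   have co: "real (card (UNIV :: 'n option set)) = n1" unfolding n1_def by (simp add: card_UNIV_option)
   have "hmult K (\<psi> y) f x = (\<Sum>j\<in>UNIV. h j)"
    unfolding so h_def option.case
    by (subst (1) fu) (simp add: hmult_add[OF g tempered_L2_sum] hmult_sum u)
   hence "(cmod (hmult K (\<psi> y) f x))^2 <= n1 * ((cmod (hmult K (\<psi> y) g x))^2 + (\<Sum>i\<in>UNIV. (cmod (hmult K (\<psi> y) (u i) x))^2))"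
    using cmod_sum_square_le[of h UNIV] unfolding so co by (simp add: h_def)
   hence "(cmod (hmult K (\<psi> y) f x))^2 / d <= n1 * ((cmod (hmult K (\<psi> y) g x))^2 + (\<Sum>i\<in>UNIV. (cmod (hmult K (\<psi> y) (u i) x))^2)) / d"
    using d by (intro divide_right_mono) auto
   also have "... = n1 * ((cmod (hmult K (\<psi> y) g x))^2 / d + (\<Sum>i\<in>UNIV. (cmod (hmult K (\<psi> y) (u i) x))^2 / d))"
    unfolding sum_divide_distrib[symmetric] add_divide_distrib[symmetric] times_divide_eq_right ..
   also have "... <= n1 * ((cmod (hmult K (\<psi> y) g x))^2
     + (\<Sum>i\<in>UNIV. (cmod (hmult K (\<psi> y) (%z. xpow i m g z) x))^2 / (a ^ (2 * m) * d)))"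
   proof (intro mult_left_mono add_mono sum_mono n1)
    show "(cmod (hmult K (\<psi> y) g x))^2 / d <= (cmod (hmult K (\<psi> y) g x))^2"
     using d by (simp add: divide_le_eq mult_right_mono mult_le_cancel_left1)
    show "(cmod (hmult K (\<psi> y) (u i) x))^2 / d
      <= (cmod (hmult K (\<psi> y) (%z. xpow i m g z) x))^2 / (a ^ (2 * m) * d)" for i
     unfolding u_def hmult_cmult using a
     by (simp add: norm_mult norm_divide norm_power power_mult_distrib power_divide power_even_eq)
   qed
   finally have "(cmod (hmult K (\<psi> y) f x))^2 / d <= n1 * ((cmod (hmult K (\<psi> y) g x))^2
     + (\<Sum>i\<in>UNIV. (cmod (hmult K (\<psi> y) (%z. xpow i m g z) x))^2 / (a ^ (2 * m) * d)))" .
   moreover have "ennreal n1 * (csq (hmult K (\<psi> y) g x)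
     + (\<Sum>i\<in>UNIV. ennreal ((cmod (hmult K (\<psi> y) (%z. xpow i m g z) x))^2 / (a ^ (2 * m) * d))))
     = ennreal (n1 * ((cmod (hmult K (\<psi> y) g x))^2
     + (\<Sum>i\<in>UNIV. (cmod (hmult K (\<psi> y) (%z. xpow i m g z) x))^2 / (a ^ (2 * m) * d))))"
    using n1 d a by (simp add: ennreal_mult ennreal_plus sum_ennreal sum_nonneg)
   ultimately show "ennreal ((cmod (hmult K (\<psi> y) f x))^2 / (1 + norm x / a) ^ (2 * m))
    <= ennreal n1 * (csq (hmult K (\<psi> y) g x)
    + (\<Sum>i\<in>UNIV. ennreal ((cmod (hmult K (\<psi> y) (%z. xpow i m g z) x))^2
    / (a ^ (2 * m) * (1 + norm x / a) ^ (2 * m)))))"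
    unfolding d_def[symmetric] by (simp only: ennreal_leI)
  qed
  also have "... = ennreal n1 * ((\<integral>\<^sup>+y. (NN x. csq (hmult K (\<psi> y) g x)) \<partial>N) + (\<Sum>i\<in>UNIV. I i))"
  proof -
   define Q where "Q i y x = ennreal ((cmod (hmult K (\<psi> y) (%z. xpow i m g z) x))^2
    / (a ^ (2 * m) * (1 + norm x / a) ^ (2 * m)))" for i y x
   have [measurable]: "Q i y \<in> borel_measurable borel" for i y unfolding Q_def by measurable
   have [measurable]: "(%y. (NN x. Q i y x)) \<in> borel_measurable N" for i unfolding Q_def by (rule m2)
   show ?thesis
    unfolding I_def unfolding Q_def[symmetric]
    by (simp add: nn_integral_cmult nn_integral_add nn_integral_sum)
  qed
  also have "... <= ennreal n1 * (ennreal A * G + (\<Sum>i\<in>UNIV. ennreal (C i * A) * G))"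
   by (intro mult_left_mono add_mono sum_mono I I0) auto
  also have "... = ennreal (n1 * (1 + (\<Sum>i\<in>UNIV. C i)) * A) * G"
  proof -
   have "(\<Sum>i\<in>UNIV. ennreal (C i * A) * G) = ennreal ((\<Sum>i\<in>UNIV. C i) * A) * G"
    using C0 A by (simp add: sum_distrib_right sum_ennreal less_imp_le flip: sum_distrib_right[of _ _ G])
   moreover have "0 <= (\<Sum>i\<in>UNIV. C i)" using C0 by (simp add: sum_nonneg less_imp_le)
   ultimately show ?thesis using n1 A
    by (simp add: ennreal_mult ennreal_plus distrib_right distrib_left mult_ac)
  qed
  also have "... <= ennreal (n1 * (1 + (\<Sum>i\<in>UNIV. C i)) * A) * (ennreal (n1 ^ (2 * m)) * F)"
   by (intro mult_left_mono GF) auto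
  also have "... = ennreal (D * A) * F"
   unfolding D_def using n1 A \<open>1 + (\<Sum>i\<in>UNIV. C i) > 0\<close>
   by (simp add: ennreal_mult[symmetric] mult.assoc[symmetric]) (simp add: mult_ac)
  finally show "(\<integral>\<^sup>+y. (NN x. ennreal ((cmod (hmult K (\<psi> y) f x))^2 / (1 + norm x / a) ^ (2 * m))) \<partial>N)
   <= ennreal (D * A) * (NN x. ennreal ((cmod (f x))^2 / (1 + norm x / a) ^ (2 * m)))" unfolding F_def .
 qed
qed

section \<open>Interpolation with change of weights\<close>

definition min_powr_const :: "real => ennreal" where
 "min_powr_const th = (NN t. ennreal (min 1 t * t powr (- th - 1)) * indicator {0<..} t)"

lemma nn_integral_min_powr:
 assumes "0 < a" "0 < b"
 shows "(NN t. ennreal (min a (t * b) * t powr (- th - 1)) * indicator {0<..} t)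
  = ennreal (a powr (1 - th) * b powr th) * min_powr_const th"
proof -
 define c where "c = a / b"
 have c: "c > 0" using assms by (simp add: c_def)
 have "(NN t. ennreal (min a (t * b) * t powr (- th - 1)) * indicator {0<..} t)
   = ennreal \<bar>c\<bar> * (NN t. ennreal (min a ((0 + c * t) * b) * (0 + c * t) powr (- th - 1)) * indicator {0<..} (0 + c * t))"
  by (rule nn_integral_real_affine) (use c in auto)
 also have "(NN t. ennreal (min a ((0 + c * t) * b) * (0 + c * t) powr (- th - 1)) * indicator {0<..} (0 + c * t))
   = (NN t. ennreal (a * c powr (- th - 1)) * (ennreal (min 1 t * t powr (- th - 1)) * indicator {0<..} t))"
 proof (intro nn_integral_cong)
  fix t :: real
  show "ennreal (min a ((0 + c * t) * b) * (0 + c * t) powr (- th - 1)) * indicator {0<..} (0 + c * t)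
    = ennreal (a * c powr (- th - 1)) * (ennreal (min 1 t * t powr (- th - 1)) * indicator {0<..} t)"
  proof (cases "t > 0")
   case True
   have "min a (c * t * b) = a * min 1 t"
    using assms True by (simp add: c_def min_def)
   moreover have "(c * t) powr (- th - 1) = c powr (- th - 1) * t powr (- th - 1)" using c True by (simp add: powr_mult)
   ultimately have "min a ((0 + c * t) * b) * (0 + c * t) powr (- th - 1) = (a * c powr (- th - 1)) * (min 1 t * t powr (- th - 1))"
    by (simp add: mult_ac)
   moreover have "ennreal ((a * c powr (- th - 1)) * (min 1 t * t powr (- th - 1)))
     = ennreal (a * c powr (- th - 1)) * ennreal (min 1 t * t powr (- th - 1))"
    by (rule ennreal_mult) (use assms True in auto)
   ultimately show ?thesis using True c by simp
  next
   case False
   hence "\<not> 0 < c * t" using c by (simp add: zero_less_mult_iff)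
   thus ?thesis using False by simp
  qed
 qed
 also have "... = ennreal (a * c powr (- th - 1)) * min_powr_const th"
  unfolding min_powr_const_def by (rule nn_integral_cmult) measurable
 also have "ennreal \<bar>c\<bar> * (ennreal (a * c powr (- th - 1)) * min_powr_const th) = ennreal (c * (a * c powr (- th - 1))) * min_powr_const th"
  using c assms by (simp add: ennreal_mult mult.assoc)
 also have "c * (a * c powr (- th - 1)) = a powr (1 - th) * b powr th"
 proof -
  have "c * c powr (- th - 1) = c powr (- th)" using c powr_add[of c 1 "- th - 1"] by simp
  also have "... = a powr (- th) * b powr th"
   using assms by (simp add: c_def powr_divide powr_minus_divide)
  finally have "c * (a * c powr (- th - 1)) = a * a powr (- th) * b powr th" by (simp add: mult_ac)
  also have "a * a powr (- th) = a powr (1 - th)" using assms powr_add[of a 1 "- th"] by simp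
  finally show ?thesis .
 qed
 finally show ?thesis .
qed

lemma min_powr_const_finite:
 assumes "0 < th" "th < 1"
 shows "min_powr_const th \<noteq> \<infinity>" "min_powr_const th \<noteq> 0"
proof -
 have "min_powr_const th <= (NN t. ennreal (indicator {0..1} t * t powr (- th)) + ennreal (indicator {1..} t * t powr (- th - 1)))"
  unfolding min_powr_const_def
 proof (rule nn_integral_mono)
  fix t :: real
  show "ennreal (min 1 t * t powr (- th - 1)) * indicator {0<..} t
    <= ennreal (indicator {0..1} t * t powr (- th)) + ennreal (indicator {1..} t * t powr (- th - 1))"
  proof (cases "t > 0")
   case True
   have "t * t powr (- th - 1) = t powr (- th)" using True powr_add[of t 1 "- th - 1"] by simp
   thus ?thesis using True by (cases "t <= 1") (auto simp: min_def)
  qed simp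
 qed
 also have "... = (NN t. ennreal (indicator {0..1} t * t powr (- th))) + (NN t. ennreal (indicator {1..} t * t powr (- th - 1)))"
  by (rule nn_integral_add) auto
 also have "(NN t. ennreal (indicator {0..1} t * t powr (- th))) = ennreal (1 powr (- th + 1) / (- th + 1))"
  by (rule nn_integral_has_integral_lebesgue) (use assms has_integral_powr_from_0[of "- th" 1] in auto)
 also have "(NN t. ennreal (indicator {1..} t * t powr (- th - 1))) = ennreal (- (1 powr (- th - 1 + 1)) / (- th - 1 + 1))"
  by (rule nn_integral_has_integral_lebesgue) (use assms has_integral_powr_to_inf[of "- th - 1" 1] in auto)
 finally show "min_powr_const th \<noteq> \<infinity>" by (auto simp: top_unique simp flip: ennreal_plus)
 have "ennreal (2 powr (- th - 1)) = (NN t. ennreal (2 powr (- th - 1)) * indicator {1..2::real} t)"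
  by (subst nn_integral_cmult) auto
 also have "... <= min_powr_const th"
  unfolding min_powr_const_def
 proof (rule nn_integral_mono)
  fix t :: real
  have "2 powr (- th - 1) <= t powr (- th - 1)" if "1 <= t" "t <= 2" using that assms by (intro powr_mono2') auto
  thus "ennreal (2 powr (- th - 1)) * indicator {1..2} t <= ennreal (min 1 t * t powr (- th - 1)) * indicator {0<..} t"
   by (auto simp: indicator_def min_def intro!: ennreal_leI)
 qed
 finally show "min_powr_const th \<noteq> 0" by auto
qed

text \<open>Interpolation with change of weights (Stein and Weiss): splitting \<open>f\<close> where \<open>v0 <= t v1\<close> bounds
 \<open>q f\<close> in the weight \<open>min w0 (t w1)\<close>, and \<open>\<integral> min a (t b) t\<^bsup>-th-1\<^esup> dt\<close> is a multiple of \<open>a\<^bsup>1-th\<^esup> b\<^bsup>th\<^esup>\<close>.\<close>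

theorem weight_interpolation:
 fixes q :: "(real^'n::finite => complex) => real^'n => ennreal"
 assumes th: "0 < th" "th < 1" and A: "A0 > 0" "A1 > 0"
  and [measurable]: "v0 \<in> borel_measurable borel" "v1 \<in> borel_measurable borel" "w0 \<in> borel_measurable borel" "w1 \<in> borel_measurable borel"
  and pos: "!!x. v0 x > 0" "!!x. v1 x > 0" "!!x. w0 x > 0" "!!x. w1 x > 0"
  and qm: "!!f. tempered_L2 f ==> q f \<in> borel_measurable borel"
  and qs: "!!f S x. tempered_L2 f ==> S \<in> sets borel ==> q f x <= 2 * q (%x. indicator S x * f x) x + 2 * q (%x. indicator (- S) x * f x) x"
  and b0: "!!f. tempered_L2 f ==> (NN x. q f x * ennreal (w0 x)) <= ennreal A0 * (NN x. csqw (f x) (v0 x))"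
  and b1: "!!f. tempered_L2 f ==> (NN x. q f x * ennreal (w1 x)) <= ennreal A1 * (NN x. csqw (f x) (v1 x))"
  and f: "tempered_L2 f"
 shows "(NN x. q f x * ennreal (w0 x powr (1 - th) * w1 x powr th))
  <= ennreal (2 * (A0 powr (1 - th) * A1 powr th)) * (NN x. csqw (f x) (v0 x powr (1 - th) * v1 x powr th))"
proof -
 note [measurable] = qm[OF f]
 have [measurable]: "f \<in> borel_measurable borel" using f by measurable
 define k where "k t = ennreal (t powr (- th - 1)) * indicator {0<..} t" for t :: real
 have [measurable]: "k \<in> borel_measurable borel" unfolding k_def by measurable
 \<comment> \<open>Dividing the weights by \<open>A0\<close> and \<open>A1\<close> gives both
   endpoint bounds constant 1; the factor 2 is that of \<open>qs\<close>.\<close>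
 have slice: "(NN x. q f x * ennreal (min (w0 x / A0) (t * (w1 x / A1))))
   <= 2 * (NN x. csqw (f x) (min (v0 x) (t * v1 x)))" if t: "t > 0" for t
 proof -
  define S where "S = {x. v0 x <= t * v1 x}"
  have [measurable]: "S \<in> sets borel" unfolding S_def by measurable
  define f0 f1 where "f0 x = indicator S x * f x" and "f1 x = indicator (- S) x * f x" for x
  have f01: "tempered_L2 f0" "tempered_L2 f1"
   unfolding f0_def f1_def by (intro tempered_L2_indicator f; measurable)+
  note [measurable] = qm[OF f01(1)] qm[OF f01(2)]
  have [measurable]: "f0 \<in> borel_measurable borel" "f1 \<in> borel_measurable borel" using f01 by measurable
  have cm: "ennreal (w / B) = ennreal (1 / B) * ennreal w" if "B > 0" "w > 0" for w B :: real
   using that by (subst ennreal_mult[symmetric]) auto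
  have canc: "ennreal (1 / B) * (ennreal B * X) = X" if "B > 0" for B X
   using that by (simp add: mult.assoc[symmetric] ennreal_mult[symmetric])
  have 0: "(NN x. q f0 x * ennreal (w0 x / A0)) <= (NN x. csqw (f0 x) (v0 x))"
  proof -
   have "(NN x. q f0 x * ennreal (w0 x / A0)) = (NN x. ennreal (1 / A0) * (q f0 x * ennreal (w0 x)))"
    by (intro nn_integral_cong) (simp only: cm[OF A(1) pos(3)] mult_ac)
   also have "... = ennreal (1 / A0) * (NN x. q f0 x * ennreal (w0 x))"
    by (rule nn_integral_cmult) measurable
   also have "... <= ennreal (1 / A0) * (ennreal A0 * (NN x. csqw (f0 x) (v0 x)))"
    by (intro mult_left_mono b0 f01) auto
   finally show ?thesis using canc[OF A(1)] by simp
  qed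
  have 1: "(NN x. q f1 x * ennreal (t * (w1 x / A1))) <= ennreal t * (NN x. csqw (f1 x) (v1 x))"
  proof -
   have "(NN x. q f1 x * ennreal (t * (w1 x / A1))) = (NN x. ennreal t * (ennreal (1 / A1) * (q f1 x * ennreal (w1 x))))"
   proof (intro nn_integral_cong)
    fix x
    have "ennreal (t * (w1 x / A1)) = ennreal t * (ennreal (1 / A1) * ennreal (w1 x))"
     using A(2) pos(4)[of x] t by (subst ennreal_mult) (auto simp only: cm[OF A(2) pos(4)] intro!: less_imp_le divide_pos_pos)
    thus "q f1 x * ennreal (t * (w1 x / A1)) = ennreal t * (ennreal (1 / A1) * (q f1 x * ennreal (w1 x)))"
     by (simp only: mult_ac)
   qed
   also have "... = ennreal t * (ennreal (1 / A1) * (NN x. q f1 x * ennreal (w1 x)))"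
    by (subst nn_integral_cmult, measurable, subst nn_integral_cmult, measurable)
   also have "... <= ennreal t * (ennreal (1 / A1) * (ennreal A1 * (NN x. csqw (f1 x) (v1 x))))"
    by (intro mult_left_mono b1 f01) auto
   finally show ?thesis using canc[OF A(2)] by simp
  qed
  have "(NN x. q f x * ennreal (min (w0 x / A0) (t * (w1 x / A1))))
    <= (NN x. 2 * (q f0 x * ennreal (w0 x / A0)) + 2 * (q f1 x * ennreal (t * (w1 x / A1))))"
  proof (rule nn_integral_mono)
   fix x
   define m where "m = ennreal (min (w0 x / A0) (t * (w1 x / A1)))"
   have "q f x <= 2 * q f0 x + 2 * q f1 x" using qs[OF f, of S x] by (simp add: f0_def[abs_def] f1_def[abs_def])
   hence "q f x * m <= (2 * q f0 x + 2 * q f1 x) * m" by (rule mult_right_mono) simp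
   also have "... = 2 * (q f0 x * m) + 2 * (q f1 x * m)" by (simp add: distrib_right mult.assoc)
   also have "... <= 2 * (q f0 x * ennreal (w0 x / A0)) + 2 * (q f1 x * ennreal (t * (w1 x / A1)))"
    unfolding m_def by (intro add_mono mult_left_mono ennreal_leI) auto
   finally show "q f x * ennreal (min (w0 x / A0) (t * (w1 x / A1)))
     <= 2 * (q f0 x * ennreal (w0 x / A0)) + 2 * (q f1 x * ennreal (t * (w1 x / A1)))" unfolding m_def .
  qed
  also have "... = 2 * (NN x. q f0 x * ennreal (w0 x / A0)) + 2 * (NN x. q f1 x * ennreal (t * (w1 x / A1)))"
   by (subst nn_integral_add) (auto simp: nn_integral_cmult)
  also have "... <= 2 * (NN x. csqw (f0 x) (v0 x)) + 2 * (ennreal t * (NN x. csqw (f1 x) (v1 x)))"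
   by (intro add_mono mult_left_mono 0 1) auto
  also have "... = 2 * (NN x. csqw (f0 x) (v0 x) + ennreal t * csqw (f1 x) (v1 x))"
   by (subst nn_integral_add) (auto simp: nn_integral_cmult distrib_left)
  also have "(%x. csqw (f0 x) (v0 x) + ennreal t * csqw (f1 x) (v1 x))
    = (%x. csqw (f x) (min (v0 x) (t * v1 x)))"
  proof
   fix x
   show "csqw (f0 x) (v0 x) + ennreal t * csqw (f1 x) (v1 x)
    = csqw (f x) (min (v0 x) (t * v1 x))"
    using t pos(2)[of x]
    by (cases "x \<in> S") (auto simp: f0_def f1_def S_def min_def ennreal_mult[symmetric] less_imp_le mult_ac)
  qed
  finally show ?thesis .
 qed
 have L: "(NN t. (NN x. q f x * ennreal (min (w0 x / A0) (t * (w1 x / A1)))) * k t)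
   = (NN x. q f x * ennreal ((w0 x / A0) powr (1 - th) * (w1 x / A1) powr th)) * min_powr_const th"
 proof -
  have "(NN t. (NN x. q f x * ennreal (min (w0 x / A0) (t * (w1 x / A1)))) * k t)
    = (NN t. (NN x. q f x * ennreal (min (w0 x / A0) (t * (w1 x / A1))) * k t))"
   by (intro nn_integral_cong nn_integral_multc[symmetric]) measurable
  also have "... = (NN x. (NN t. q f x * ennreal (min (w0 x / A0) (t * (w1 x / A1))) * k t))"
   by (rule lborel_pair.Fubini') measurable
  also have "... = (NN x. q f x * (ennreal ((w0 x / A0) powr (1 - th) * (w1 x / A1) powr th) * min_powr_const th))"
  proof (intro nn_integral_cong)
   fix x
   have "(NN t. q f x * ennreal (min (w0 x / A0) (t * (w1 x / A1))) * k t)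
     = (NN t. q f x * (ennreal (min (w0 x / A0) (t * (w1 x / A1)) * t powr (- th - 1)) * indicator {0<..} t))"
   proof (intro nn_integral_cong)
    fix t :: real
    show "q f x * ennreal (min (w0 x / A0) (t * (w1 x / A1))) * k t
      = q f x * (ennreal (min (w0 x / A0) (t * (w1 x / A1)) * t powr (- th - 1)) * indicator {0<..} t)"
     using pos(3,4)[of x] A by (cases "t > 0") (auto simp: k_def ennreal_mult less_imp_le mult.assoc)
   qed
   also have "... = q f x * (ennreal ((w0 x / A0) powr (1 - th) * (w1 x / A1) powr th) * min_powr_const th)"
    by (subst nn_integral_cmult, measurable, subst nn_integral_min_powr) (use pos(3,4)[of x] A in auto)
   finally show "(NN t. q f x * ennreal (min (w0 x / A0) (t * (w1 x / A1))) * k t)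
     = q f x * (ennreal ((w0 x / A0) powr (1 - th) * (w1 x / A1) powr th) * min_powr_const th)" .
  qed
  finally show ?thesis unfolding mult.assoc[symmetric] by (subst (asm) nn_integral_multc) auto
 qed
 have R: "(NN t. (2 * (NN x. csqw (f x) (min (v0 x) (t * v1 x)))) * k t)
   = 2 * (NN x. csqw (f x) (v0 x powr (1 - th) * v1 x powr th)) * min_powr_const th"
 proof -
  have "(NN t. (2 * (NN x. csqw (f x) (min (v0 x) (t * v1 x)))) * k t)
    = (NN t. 2 * ((NN x. csqw (f x) (min (v0 x) (t * v1 x))) * k t))"
   by (simp only: mult.assoc)
  also have "... = 2 * (NN t. (NN x. csqw (f x) (min (v0 x) (t * v1 x))) * k t)"
   by (rule nn_integral_cmult) measurable
  also have "(NN t. (NN x. csqw (f x) (min (v0 x) (t * v1 x))) * k t)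
    = (NN t. (NN x. csqw (f x) (min (v0 x) (t * v1 x)) * k t))"
   by (intro nn_integral_cong nn_integral_multc[symmetric]) measurable
  also have "... = (NN x. (NN t. csqw (f x) (min (v0 x) (t * v1 x)) * k t))"
   by (rule lborel_pair.Fubini') measurable
  also have "... = (NN x. csqw (f x) (v0 x powr (1 - th) * v1 x powr th) * min_powr_const th)"
  proof (intro nn_integral_cong)
   fix x
   have "(NN t. csqw (f x) (min (v0 x) (t * v1 x)) * k t)
     = (NN t. csq (f x) * (ennreal (min (v0 x) (t * v1 x) * t powr (- th - 1)) * indicator {0<..} t))"
   proof (intro nn_integral_cong)
    fix t :: real
    show "csqw (f x) (min (v0 x) (t * v1 x)) * k t
      = csq (f x) * (ennreal (min (v0 x) (t * v1 x) * t powr (- th - 1)) * indicator {0<..} t)"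
     using pos(1,2)[of x] by (cases "t > 0") (auto simp: k_def ennreal_mult less_imp_le mult.assoc)
   qed
   also have "... = csq (f x) * (ennreal (v0 x powr (1 - th) * v1 x powr th) * min_powr_const th)"
    by (subst nn_integral_cmult, measurable, subst nn_integral_min_powr) (use pos(1,2)[of x] in auto)
   finally show "(NN t. csqw (f x) (min (v0 x) (t * v1 x)) * k t)
     = csqw (f x) (v0 x powr (1 - th) * v1 x powr th) * min_powr_const th"
    by (simp add: ennreal_mult mult.assoc)
  qed
  finally show ?thesis by (subst (asm) nn_integral_multc) (auto simp: mult.assoc)
 qed
 have "(NN t. (NN x. q f x * ennreal (min (w0 x / A0) (t * (w1 x / A1)))) * k t)
   <= (NN t. (2 * (NN x. csqw (f x) (min (v0 x) (t * v1 x)))) * k t)"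
 proof (rule nn_integral_mono)
  fix t :: real
  show "(NN x. q f x * ennreal (min (w0 x / A0) (t * (w1 x / A1)))) * k t
    <= (2 * (NN x. csqw (f x) (min (v0 x) (t * v1 x)))) * k t"
  proof (cases "t > 0")
   case True
   show ?thesis by (rule mult_right_mono[OF slice[OF True]]) simp
  qed (simp add: k_def)
 qed
 \<comment> \<open>\<open>min_powr_const th\<close> is cancelled on both sides, being neither zero
   nor infinite.\<close>
 hence main: "(NN x. q f x * ennreal ((w0 x / A0) powr (1 - th) * (w1 x / A1) powr th))
   <= 2 * (NN x. csqw (f x) (v0 x powr (1 - th) * v1 x powr th))"
  unfolding L R using min_powr_const_finite[OF th] by (simp add: ennreal_mult_le_mult_iff mult.commute[of _ "min_powr_const th"])
 define c where "c = A0 powr (1 - th) * A1 powr th"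
 have c: "c > 0" using A by (simp add: c_def)
 have "(NN x. q f x * ennreal (w0 x powr (1 - th) * w1 x powr th))
   = (NN x. ennreal c * (q f x * ennreal ((w0 x / A0) powr (1 - th) * (w1 x / A1) powr th)))"
 proof (intro nn_integral_cong)
  fix x
  have "w0 x powr (1 - th) * w1 x powr th = c * ((w0 x / A0) powr (1 - th) * (w1 x / A1) powr th)"
   using A pos(3,4)[of x] by (simp add: c_def powr_divide)
  thus "q f x * ennreal (w0 x powr (1 - th) * w1 x powr th) = ennreal c * (q f x * ennreal ((w0 x / A0) powr (1 - th) * (w1 x / A1) powr th))"
   using c by (simp only: ennreal_mult[OF less_imp_le[OF c]] mult_nonneg_nonneg powr_ge_zero) (simp only: mult_ac)
 qed
 also have "... = ennreal c * (NN x. q f x * ennreal ((w0 x / A0) powr (1 - th) * (w1 x / A1) powr th))"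
  by (rule nn_integral_cmult) measurable
 also have "... <= ennreal c * (2 * (NN x. csqw (f x) (v0 x powr (1 - th) * v1 x powr th)))"
  by (intro mult_left_mono main) auto
 also have "... = ennreal (2 * c) * (NN x. csqw (f x) (v0 x powr (1 - th) * v1 x powr th))"
  using c by (simp add: ennreal_mult mult_ac)
 finally show ?thesis unfolding c_def .
qed

section \<open>A maximal function\<close>

lemma nn_integral_lborel_affine:
 fixes f :: "'a::euclidean_space => ennreal" and t :: 'a
 assumes [measurable]: "f \<in> borel_measurable borel" and "c \<noteq> 0"
 shows "(NN x. f x) = (NN x. ennreal (\<bar>c\<bar> ^ DIM('a)) * f (t + c *\<^sub>R x))"
 by (subst lborel_affine[OF \<open>c \<noteq> 0\<close>, of t]) (simp add: nn_integral_density nn_integral_distr)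

text \<open>An approximate identity whose tail has exponent 2 n: it is integrable, and the tail R ^
  (- n) |x| ^ (- 2 n) decreases as R grows, which \<open>pker_mult_le\<close> exploits.\<close>

definition pker :: "real => real^'n::finite => real" where
 "pker R x = R ^ CARD('n) / (1 + R * norm x) ^ (2 * CARD('n))"

lemma pker_nonneg: "R >= 0 ==> 0 <= pker R x"
 by (simp add: pker_def)

lemma pker_minus: "pker R (x - y) = pker R (y - x)"
 by (simp add: pker_def norm_minus_commute)

lemma measurable_pker [measurable (raw)]:
 assumes [measurable]: "g \<in> borel_measurable M" "h \<in> borel_measurable M"
 shows "(%x. pker (g x) (h x)) \<in> borel_measurable M"
 unfolding pker_def by measurable

definition pker_mass :: "'n::finite itself => real" where
 "pker_mass _ = (LI x. 1 / (1 + norm (x::real^'n)) ^ (2 * CARD('n)))"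

lemma pker_mass_nonneg: "0 <= pker_mass TYPE('n::finite)"
 unfolding pker_mass_def by simp

lemma nn_integral_pker:
 fixes x :: "real^'n::finite"
 assumes R: "R > 0"
 shows "(NN y. ennreal (pker R (x - y))) = ennreal (pker_mass TYPE('n))"
proof -
 have "(NN y. ennreal (pker R (x - y)))
   = (NN y. ennreal (\<bar>- 1 / R\<bar> ^ DIM(real^'n)) * ennreal (pker R (x - (x + (- 1 / R) *\<^sub>R y))))"
  by (rule nn_integral_lborel_affine) (use R in auto)
 also have "... = (NN (y::real^'n). ennreal (1 / (1 + norm y) ^ (2 * CARD('n))))"
 proof (intro nn_integral_cong)
  fix y :: "real^'n"
  have "R * norm (x - (x + (- 1 / R) *\<^sub>R y)) = norm y" using R by simp
  hence "\<bar>- 1 / R\<bar> ^ DIM(real^'n) * pker R (x - (x + (- 1 / R) *\<^sub>R y)) = 1 / (1 + norm y) ^ (2 * CARD('n))"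
   unfolding pker_def using R by (simp add: power_divide)
  thus "ennreal (\<bar>- 1 / R\<bar> ^ DIM(real^'n)) * ennreal (pker R (x - (x + (- 1 / R) *\<^sub>R y))) = ennreal (1 / (1 + norm y) ^ (2 * CARD('n)))"
   using R by (subst ennreal_mult[symmetric]) (auto simp: pker_nonneg)
 qed
 also have "... = ennreal (pker_mass TYPE('n))"
  unfolding pker_mass_def by (intro nn_integral_eq_integral integrable_inverse_norm_power) auto
 finally show ?thesis .
qed

text \<open>One leg of the path x, z, y is at least half as long as |x - y|. If it is x - z, or if R
  |x - y| <= 1, the coarse kernel at x - z is at most a multiple of the one at x - y. Otherwise the
  tail of the finer kernel at z - y lies below that of the coarse one. The constant is 16 = 4^2,
  from a loss of 4 in the base of the power 2 n.\<close>

lemma pker_mult_le: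
 fixes x y z :: "real^'n::finite"
 assumes R: "R > 0" "R <= R'"
 shows "pker R (x - z) * pker R' (z - y) <= 16 ^ CARD('n) * pker R (x - y) * (pker R (x - z) + pker R' (z - y))"
proof -
 define n where "n = CARD('n)"
 define D where "D = norm (x - y)"
 define \<rho> where "\<rho> = norm (z - y)"
 define \<sigma> where "\<sigma> = norm (x - z)"
 have tri: "D <= \<rho> + \<sigma>" unfolding D_def \<rho>_def \<sigma>_def
  using norm_triangle_ineq[of "x - z" "z - y"] by simp
 have nn: "0 <= D" "0 <= \<rho>" "0 <= \<sigma>" by (simp_all add: D_def \<rho>_def \<sigma>_def)
 have R': "R' > 0" using R by simp
 define p where "p = pker R (x - y)"
 define a where "a = pker R (x - z)"
 define b where "b = pker R' (z - y)"
 have pos: "0 <= p" "0 <= a" "0 <= b" unfolding p_def a_def b_def using R R' by (simp_all add: pker_nonneg)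
 have pe: "p = R ^ n / (1 + R * D) ^ (2 * n)" "a = R ^ n / (1 + R * \<sigma>) ^ (2 * n)" "b = R' ^ n / (1 + R' * \<rho>) ^ (2 * n)"
  unfolding p_def a_def b_def pker_def n_def D_def \<rho>_def \<sigma>_def by auto
 have aux: "R ^ n / q ^ (2 * n) <= 16 ^ n * p" if "(1 + R * D) / 4 <= q" for q
 proof -
  have RD: "0 < 1 + R * D" using R nn by (intro add_pos_nonneg) auto
  have "((1 + R * D) / 4) ^ (2 * n) <= q ^ (2 * n)" using that RD by (intro power_mono) auto
  hence "R ^ n / q ^ (2 * n) <= R ^ n / ((1 + R * D) / 4) ^ (2 * n)"
   using RD R that by (intro divide_left_mono mult_pos_pos zero_less_power) auto
  also have "... = 4 ^ (2 * n) * (R ^ n / (1 + R * D) ^ (2 * n))" by (simp add: power_divide)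
  also have "(4::real) ^ (2 * n) = 16 ^ n" by (simp add: power_mult)
  finally show ?thesis by (simp add: pe)
 qed
 have "a <= 16 ^ n * p \<or> b <= 16 ^ n * p"
 proof (cases "\<rho> <= D / 2 \<or> R * D <= 1")
  case True
  have "(1 + R * D) / 4 <= 1 + R * \<sigma>"
  proof (cases "\<rho> <= D / 2")
   case True
   hence "D / 2 <= \<sigma>" using tri by linarith
   hence "R * (D / 2) <= R * \<sigma>" using R by (intro mult_left_mono) auto
   moreover have "0 <= R * D" using R nn by simp
   ultimately show ?thesis by simp
  next
   case False
   hence "R * D <= 1" using True by simp
   moreover have "0 <= R * \<sigma>" using R nn by simp
   ultimately show ?thesis by simp
  qed
  thus ?thesis using aux[of "1 + R * \<sigma>"] by (simp add: pe)
 next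
  case False
  hence rD: "D / 2 < \<rho>" "1 < R * D" by auto
  have D0: "D > 0" using rD R nn by (cases "D = 0") auto
  have "b <= R' ^ n / (R' * \<rho>) ^ (2 * n)"
   unfolding pe using R' rD D0 by (intro divide_left_mono power_mono mult_pos_pos zero_less_power) (auto intro!: add_pos_pos)
  also have "... = 1 / (R' ^ n * \<rho> ^ (2 * n))"
   using R' by (simp add: power_mult_distrib mult_2 power_add)
  also have "... <= 1 / (R ^ n * (D / 2) ^ (2 * n))"
   using R R' rD D0 by (intro divide_left_mono mult_mono power_mono mult_pos_pos zero_less_power) auto
  also have "... = R ^ n / (R * (D / 2)) ^ (2 * n)"
  proof -
   have "(R * (D / 2)) ^ (2 * n) = R ^ n * (R ^ n * (D / 2) ^ (2 * n))"
    unfolding power_mult_distrib by (simp add: mult_2 power_add)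
   thus ?thesis using R by simp
  qed
  also have "... <= 16 ^ n * p" using rD by (intro aux) (simp add: mult.commute)
  finally show ?thesis by simp
 qed
 hence "a * b <= (16 ^ n * p) * (a + b)"
 proof
  assume "a <= 16 ^ n * p"
  hence "a * b <= (16 ^ n * p) * b" using pos by (intro mult_right_mono) auto
  also have "... <= (16 ^ n * p) * (a + b)" using pos by (intro mult_left_mono) auto
  finally show ?thesis .
 next
  assume "b <= 16 ^ n * p"
  hence "a * b <= a * (16 ^ n * p)" using pos by (intro mult_left_mono) auto
  also have "... = (16 ^ n * p) * a" by simp
  also have "... <= (16 ^ n * p) * (a + b)" using pos by (intro mult_left_mono) auto
  finally show ?thesis .
 qed
 thus ?thesis by (simp add: p_def a_def b_def n_def)
qed

lemma pker_compose:
 fixes x y :: "real^'n::finite"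
 assumes R: "R > 0" "R <= R'"
 shows "(NN z. ennreal (pker R (x - z)) * ennreal (pker R' (y - z)))
  <= ennreal (16 ^ CARD('n) * 2 * pker_mass TYPE('n)) * ennreal (pker R (x - y))"
proof -
 have R': "R' > 0" using R by simp
 define c where "c = 16 ^ CARD('n) * pker R (x - y)"
 have c: "c >= 0" using R by (simp add: c_def pker_nonneg)
 have "(NN z. ennreal (pker R (x - z)) * ennreal (pker R' (y - z)))
   <= (NN z. ennreal c * (ennreal (pker R (x - z)) + ennreal (pker R' (y - z))))"
 proof (rule nn_integral_mono)
  fix z
  have "pker R (x - z) * pker R' (y - z) <= c * (pker R (x - z) + pker R' (y - z))"
   using pker_mult_le[OF R, of x z y] by (simp add: c_def pker_minus[of R' z y])
  thus "ennreal (pker R (x - z)) * ennreal (pker R' (y - z)) <= ennreal c * (ennreal (pker R (x - z)) + ennreal (pker R' (y - z)))"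
   using R R' c by (simp add: ennreal_mult[symmetric] ennreal_plus[symmetric] pker_nonneg less_imp_le del: ennreal_plus)
 qed
 also have "... = ennreal c * (ennreal (pker_mass TYPE('n)) + ennreal (pker_mass TYPE('n)))"
  using R R' by (simp add: nn_integral_cmult nn_integral_add nn_integral_pker)
 also have "... = ennreal (16 ^ CARD('n) * 2 * pker_mass TYPE('n)) * ennreal (pker R (x - y))"
  unfolding c_def using R pker_mass_nonneg[where ?'n = 'n]
  by (simp add: ennreal_mult[symmetric] ennreal_plus[symmetric] pker_nonneg less_imp_le mult_ac del: ennreal_plus)
 finally show ?thesis .
qed

definition pavg :: "nat => (real^'n::finite => ennreal) => real^'n => ennreal" where
 "pavg j f x = (NN y. ennreal (pker (2 ^ j) (x - y)) * f y)"

text \<open>Only finitely many scales, so that some finite bound is known in advance; the constant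
  in \<open>pmax_L2\<close> does not depend on \<open>J\<close>.\<close>

definition pmax :: "nat => (real^'n::finite => ennreal) => real^'n => ennreal" where
 "pmax J f x = (MAX j\<in>{..J}. pavg j f x)"

lemma measurable_pavg [measurable]:
 assumes [measurable]: "f \<in> borel_measurable borel"
 shows "pavg j f \<in> borel_measurable borel"
 unfolding pavg_def by measurable

lemma pavg_le_pmax: "j <= J ==> pavg j f x <= pmax J f x"
 unfolding pmax_def by (intro Max_ge) auto

lemma pmax_attained: "\<exists>j\<le>J. pavg j f x = pmax J f x"
proof -
 have "pmax J f x \<in> (%j. pavg j f x) ` {..J}" unfolding pmax_def by (rule Max_in) auto
 thus ?thesis by auto
qed

lemma measurable_pmax [measurable]:
 assumes [measurable]: "f \<in> borel_measurable borel"
 shows "pmax J f \<in> borel_measurable borel"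
proof -
 have "pmax J f x = (SUP j\<in>{..J}. pavg j f x)" for x
  unfolding pmax_def by (rule Max_Sup) auto
 hence "pmax J f = (%x. SUP j\<in>{..J}. pavg j f x)" by auto
 also have "... \<in> borel_measurable borel" by (rule borel_measurable_SUP) auto
 finally show ?thesis .
qed

lemma pavg_L2:
 fixes f :: "real^'n::finite => ennreal"
 assumes [measurable]: "f \<in> borel_measurable borel"
 shows "(NN x. (pavg j f x)^2) <= ennreal ((pker_mass TYPE('n))^2) * (NN x. (f x)^2)"
proof -
 define c where "c = ennreal (pker_mass TYPE('n))"
 define P where "P x y = ennreal (pker (2 ^ j) (x - y :: real^'n))" for x y
 have [measurable]: "(%(x, y). P x y) \<in> borel_measurable (borel \<Otimes>\<^sub>M borel)" unfolding P_def by measurable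
 have [measurable]: "P x \<in> borel_measurable borel" "(%x. P x y) \<in> borel_measurable borel" for x y unfolding P_def by measurable
 have c1: "(NN y. P x y) = c" for x unfolding P_def c_def by (rule nn_integral_pker) simp
 have c2: "(NN x. P x y) = c" for y unfolding P_def c_def by (subst pker_minus, rule nn_integral_pker) simp
 have pw: "(pavg j f x)^2 <= c * (NN y. P x y * (f y)^2)" for x
 proof -
  define s where "s y = ennreal (sqrt (pker (2 ^ j) (x - y)))" for y
  have [measurable]: "s \<in> borel_measurable borel" unfolding s_def by measurable
  have s2: "(s y)^2 = P x y" for y unfolding s_def P_def by (simp add: ennreal_power pker_nonneg)
  have "pavg j f x = (NN y. s y * (s y * f y))"
   unfolding pavg_def P_def[symmetric] s2[symmetric] by (simp add: power2_eq_square mult.assoc)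
  hence "(pavg j f x)^2 <= (NN y. (s y)^2) * (NN y. (s y * f y)^2)"
   using Cauchy_Schwarz_nn_integral[of s lborel "%y. s y * f y"] by simp
  thus ?thesis by (simp add: s2 c1 power_mult_distrib)
 qed
 have "(NN x. (pavg j f x)^2) <= (NN x. c * (NN y. P x y * (f y)^2))"
  by (intro nn_integral_mono pw)
 also have "... = c * (NN x. (NN y. P x y * (f y)^2))" by (rule nn_integral_cmult) measurable
 also have "(NN x. (NN y. P x y * (f y)^2)) = (NN y. (NN x. P x y * (f y)^2))"
  by (rule lborel_pair.Fubini') measurable
 also have "... = (NN y. c * (f y)^2)" by (simp add: nn_integral_multc c2)
 also have "... = c * (NN y. (f y)^2)" by (rule nn_integral_cmult) measurable
 also have "c * (c * (NN y. (f y)^2)) = ennreal ((pker_mass TYPE('n))^2) * (NN x. (f x)^2)"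
  unfolding c_def by (simp add: power2_eq_square ennreal_mult pker_mass_nonneg mult.assoc)
 finally show ?thesis .
qed

text \<open>The linearised maximal operator \<open>T\<close> satisfies \<open>T T\<^sup>* <= C (T + T\<^sup>*)\<close> by \<open>pker_compose\<close>, hence its norm
 satisfies \<open>\<parallel>T\<parallel>^2 <= 2 C \<parallel>T\<parallel>\<close>.\<close>

lemma pmax_selfimprove:
 fixes f :: "real^'n::finite => ennreal"
 assumes [measurable]: "f \<in> borel_measurable borel"
  and b: "b >= 0" "!!f :: real^'n => ennreal. f \<in> borel_measurable borel ==> (NN x. (f x)^2) < \<infinity> ==>
   (NN x. (pmax J f x)^2) <= ennreal b * (NN x. (f x)^2)"
  and fin: "(NN x. (f x)^2) < \<infinity>"
 defines "C \<equiv> 16 ^ CARD('n) * 2 * pker_mass TYPE('n)"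
 shows "(NN x. (pmax J f x)^2) <= ennreal (2 * C * sqrt b) * (NN x. (f x)^2)"
proof -
 define g where "g = pmax J f"
 have [measurable]: "g \<in> borel_measurable borel" unfolding g_def by measurable
 \<comment> \<open>Linearisation: a measurable choice of the scale at which the maximum is attained
   turns the maximal operator into integration against \<open>K\<close>.\<close>
 define sel where "sel x = (LEAST j. j <= J \<and> pavg j f x = g x)" for x
 have [measurable]: "sel \<in> measurable borel (count_space UNIV)" unfolding sel_def by measurable
 have sel: "sel x <= J" "pavg (sel x) f x = g x" for x
  using LeastI_ex[OF pmax_attained[of J f x]] unfolding sel_def g_def by auto
 define K where "K x y = ennreal (pker (2 ^ sel x) (x - y :: real^'n))" for x y
 have [measurable]: "(%x. (2::real) ^ sel x) \<in> borel_measurable borel" by measurable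
 have Km[measurable]: "(%(x, y). K x y) \<in> borel_measurable (borel \<Otimes>\<^sub>M borel)" unfolding K_def by measurable
 have [measurable]: "K x \<in> borel_measurable borel" "(%x. K x y) \<in> borel_measurable borel" for x y unfolding K_def by measurable
 have gK: "g x = (NN y. K x y * f y)" for x using sel(2)[of x] by (simp add: pavg_def K_def)
 have Kle: "(NN y. K x y * h y) <= pmax J h x" for h x
  using pavg_le_pmax[OF sel(1)[of x], of h x] by (simp add: pavg_def K_def)
 define G where "G = (NN x. (g x)^2)"
 define Y where "Y = (NN x. (f x)^2)"
 define ts where "ts y = (NN x. g x * K x y)" for y
 have [measurable]: "ts \<in> borel_measurable borel" unfolding ts_def by measurable
 define W where "W = (NN y. (ts y)^2)"
 have C: "C >= 0" by (simp add: C_def pker_mass_nonneg)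
 have 1: "G^2 <= Y * W"
 proof -
  have "G = (NN x. (NN y. g x * (K x y * f y)))"
   unfolding G_def power2_eq_square by (subst (2) gK) (simp add: nn_integral_cmult)
  also have "... = (NN y. (NN x. g x * (K x y * f y)))"
   by (rule lborel_pair.Fubini') measurable
  also have "... = (NN y. f y * ts y)"
   unfolding ts_def by (simp add: mult.assoc[symmetric] nn_integral_multc mult.commute[of "f _"])
  finally show ?thesis unfolding Y_def W_def using Cauchy_Schwarz_nn_integral[of f lborel ts] by simp
 qed
 have 2: "W <= ennreal (2 * C) * (NN x. g x * pmax J g x)"
 proof -
  define V where "V = (NN x. g x * (NN x'. K x x' * g x'))"
  have e1: "(NN x. (NN x'. ennreal C * (g x * (K x x' * g x')))) = ennreal C * V"
   unfolding V_def by (simp add: nn_integral_cmult)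
  have "(NN x. (NN x'. ennreal C * (g x' * (K x' x * g x))))
    = (NN x'. (NN x. ennreal C * (g x' * (K x' x * g x))))"
   by (rule lborel_pair.Fubini') measurable
  hence e2: "(NN x. (NN x'. ennreal C * (g x' * (K x' x * g x)))) = ennreal C * V"
   unfolding e1 .
  have "(ts y)^2 = (NN x. (NN x'. g x * g x' * (K x y * K x' y)))" for y
  proof -
   have "(ts y)^2 = (NN x. g x * K x y * ts y)"
    unfolding power2_eq_square by (subst (1) ts_def) (simp add: nn_integral_multc)
   also have "... = (NN x. (NN x'. g x * K x y * (g x' * K x' y)))"
    unfolding ts_def by (simp add: nn_integral_cmult)
   finally show ?thesis by (simp add: mult_ac)
  qed
  hence "W = (NN y. (NN x. (NN x'. g x * g x' * (K x y * K x' y))))" unfolding W_def by simp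
  also have "... = (NN x. (NN y. (NN x'. g x * g x' * (K x y * K x' y))))"
   by (rule lborel_pair.Fubini') measurable
  also have "... = (NN x. (NN x'. (NN y. g x * g x' * (K x y * K x' y))))"
   by (intro nn_integral_cong lborel_pair.Fubini') measurable
  also have "... <= (NN x. (NN x'. ennreal C * (g x * (K x x' * g x')) + ennreal C * (g x' * (K x' x * g x))))"
  proof (intro nn_integral_mono)
   fix x x' :: "real^'n"
   \<comment> \<open>In the composition the coarser scale survives; depending on which point carries
     it, this is the kernel of the operator or of its adjoint.\<close>
   have "(NN y. K x y * K x' y) <= ennreal C * K x x' + ennreal C * K x' x"
   proof (cases "sel x <= sel x'")
    case True
    hence "(NN y. K x y * K x' y) <= ennreal C * K x x'"
     unfolding K_def C_def by (intro pker_compose) (auto intro: power_increasing)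
    thus ?thesis by (simp add: add_increasing2)
   next
    case False
    hence "(NN y. K x' y * K x y) <= ennreal C * K x' x"
     unfolding K_def C_def by (intro pker_compose) (auto intro: power_increasing)
    thus ?thesis by (simp add: add_increasing mult.commute)
   qed
   hence "g x * g x' * (NN y. K x y * K x' y) <= g x * g x' * (ennreal C * K x x' + ennreal C * K x' x)"
    by (rule mult_left_mono) simp
   thus "(NN y. g x * g x' * (K x y * K x' y)) <= ennreal C * (g x * (K x x' * g x')) + ennreal C * (g x' * (K x' x * g x))"
    by (subst nn_integral_cmult, measurable) (simp add: distrib_left mult_ac)
  qed
  also have "... = (NN x. (NN x'. ennreal C * (g x * (K x x' * g x'))))
    + (NN x. (NN x'. ennreal C * (g x' * (K x' x * g x))))"
   by (simp add: nn_integral_add)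
  finally have Wle: "W <= ennreal C * V + ennreal C * V" unfolding e1 e2 .
  have eq: "ennreal C * V + ennreal C * V = ennreal (2 * C) * V"
  proof -
   have "ennreal (2 * C) = ennreal C + ennreal C" using C by (simp flip: ennreal_plus)
   thus ?thesis by (simp only: distrib_right)
  qed
  have "V <= (NN x. g x * pmax J g x)"
   unfolding V_def by (intro nn_integral_mono mult_left_mono[OF Kle[of _ g]]) simp
  hence "ennreal (2 * C) * V <= ennreal (2 * C) * (NN x. g x * pmax J g x)"
   by (rule mult_left_mono) simp
  with Wle show ?thesis unfolding eq by (rule order_trans)
 qed
 have Gle: "G <= ennreal b * Y" unfolding G_def Y_def g_def by (rule b) (use fin in auto)
 also have "... < \<infinity>" using fin unfolding Y_def by (simp add: ennreal_mult_less_top)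
 finally have Gf: "G < \<infinity>" .
 have "(NN x. g x * pmax J g x)^2 <= G * (NN x. (pmax J g x)^2)"
  unfolding G_def by (rule Cauchy_Schwarz_nn_integral) measurable
 also have "... <= G * (ennreal b * G)"
  using Gf unfolding G_def by (intro mult_left_mono b) auto
 finally have 3: "(NN x. g x * pmax J g x)^2 <= G * (ennreal b * G)" .
 obtain y where y: "Y = ennreal y" "y >= 0" using fin unfolding Y_def by (metis ennreal_cases infinity_ennreal_def less_irrefl)
 obtain \<gamma> where \<gamma>: "G = ennreal \<gamma>" "\<gamma> >= 0" using Gf by (metis ennreal_cases infinity_ennreal_def less_irrefl)
 define p where "p = (NN x. g x * pmax J g x)"
 have p2: "p^2 <= ennreal (b * \<gamma>^2)" using 3 b(1) \<gamma> unfolding p_def[symmetric]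
  by (simp add: ennreal_mult[symmetric] power2_eq_square mult_ac)
 hence "p \<noteq> \<infinity>" by (auto simp: top_unique power2_eq_square ennreal_top_mult)
 then obtain \<pi>' where \<pi>: "p = ennreal \<pi>'" "\<pi>' >= 0" by (metis ennreal_cases infinity_ennreal_def)
 have "\<pi>'^2 <= b * \<gamma>^2" using p2 b(1) unfolding \<pi>(1) using \<pi>(2) by (simp add: ennreal_power)
 hence "\<pi>' <= sqrt (b * \<gamma>^2)" by (rule real_le_rsqrt)
 hence \<pi>le: "\<pi>' <= sqrt b * \<gamma>" using \<gamma> by (simp add: real_sqrt_mult)
 have "G^2 <= Y * (ennreal (2 * C) * p)"
  using 1 2 unfolding p_def[symmetric] by (meson mult_left_mono order_trans zero_le)
 hence "\<gamma>^2 <= y * (2 * C * \<pi>')"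
  unfolding \<gamma>(1) y(1) \<pi>(1) using \<gamma>(2) y(2) \<pi>(2) C by (simp add: ennreal_mult[symmetric] ennreal_power)
 also have "... <= y * (2 * C * (sqrt b * \<gamma>))" using y C \<pi>le by (intro mult_left_mono) auto
 finally have "\<gamma> * \<gamma> <= (2 * C * sqrt b * y) * \<gamma>" by (simp add: power2_eq_square mult_ac)
 hence "\<gamma> <= 2 * C * sqrt b * y"
  using \<gamma>(2) C b(1) y(2) by (cases "\<gamma> = 0") auto
 hence "G <= ennreal (2 * C * sqrt b) * Y"
  unfolding \<gamma>(1) y(1) using C b(1) y(2) by (subst ennreal_mult[symmetric]) (auto intro!: ennreal_leI)
 thus ?thesis unfolding G_def Y_def g_def .
qed

text \<open>Self-improvement applied to the best constant b gives b <= 2 C sqrt b, hence b <= 4 C^2,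
  free of \<open>J\<close>.\<close>

theorem pmax_L2:
 obtains C where "C > 0" "!!J (f :: real^'n::finite => ennreal). f \<in> borel_measurable borel ==>
  (NN x. (pmax J f x)^2) <= ennreal C * (NN x. (f x)^2)"
proof -
 define C where "C = 16 ^ CARD('n) * 2 * pker_mass TYPE('n)"
 have C: "C >= 0" by (simp add: C_def pker_mass_nonneg)
 have main: "(NN x. (pmax J f x)^2) <= ennreal (4 * C^2) * (NN x. (f x)^2)"
  if [measurable]: "f \<in> borel_measurable borel" and fin: "(NN x. (f x)^2) < \<infinity>" for J and f :: "real^'n => ennreal"
 proof -
  define S where "S = {b. b >= 0 \<and> (\<forall>f :: real^'n => ennreal. f \<in> borel_measurable borel --> (NN x. (f x)^2) < \<infinity> -->
   (NN x. (pmax J f x)^2) <= ennreal b * (NN x. (f x)^2))}"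
  have S0: "real (Suc J) * (pker_mass TYPE('n))^2 \<in> S"
   unfolding S_def
  proof (intro CollectI conjI allI impI)
   fix f :: "real^'n => ennreal" assume [measurable]: "f \<in> borel_measurable borel"
   have "(pmax J f x)^2 <= (\<Sum>j\<le>J. (pavg j f x)^2)" for x
   proof -
    obtain j where j: "j <= J" "pavg j f x = pmax J f x" using pmax_attained by blast
    have "(pavg j f x)^2 <= (\<Sum>j\<le>J. (pavg j f x)^2)" by (rule member_le_sum) (use j in auto)
    thus ?thesis unfolding j(2) .
   qed
   hence "(NN x. (pmax J f x)^2) <= (NN x. (\<Sum>j\<le>J. (pavg j f x)^2))" by (intro nn_integral_mono)
   also have "... = (\<Sum>j\<le>J. (NN x. (pavg j f x)^2))" by (rule nn_integral_sum) measurable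
   also have "... <= (\<Sum>j\<le>J. ennreal ((pker_mass TYPE('n))^2) * (NN x. (f x)^2))"
    by (intro sum_mono pavg_L2) measurable
   also have "... = ennreal (real (Suc J) * (pker_mass TYPE('n))^2) * (NN x. (f x)^2)"
    by (simp add: ennreal_mult ennreal_of_nat_eq_real_of_nat mult.assoc del: of_nat_Suc)
   finally show "(NN x. (pmax J f x)^2) <= ennreal (real (Suc J) * (pker_mass TYPE('n))^2) * (NN x. (f x)^2)" .
  qed simp
  have bdd: "bdd_below S" unfolding S_def by (intro bdd_belowI[of _ 0]) auto
  define b where "b = Inf S"
  have ne: "S \<noteq> {}" using S0 by blast
  have Spos: "0 <= s" if "s \<in> S" for s using that by (simp add: S_def)
  have b0: "b >= 0" unfolding b_def by (rule cInf_greatest[OF ne Spos])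
  \<comment> \<open>The infimum is itself an admissible constant, as the self-improvement
    requires.\<close>
  have ball: "(NN x. (pmax J f x)^2) <= ennreal b * (NN x. (f x)^2)"
   if [measurable]: "f \<in> borel_measurable borel" and fin: "(NN x. (f x)^2) < \<infinity>" for f :: "real^'n => ennreal"
  proof -
   obtain y where y: "(NN x. (f x)^2) = ennreal y" "y >= 0" using fin by (metis ennreal_cases infinity_ennreal_def less_irrefl)
   have le: "(NN x. (pmax J f x)^2) <= ennreal (s * y)" if "s \<in> S" for s
   proof -
    have "(NN x. (pmax J f x)^2) <= ennreal s * (NN x. (f x)^2)" "s >= 0"
     using that fin \<open>f \<in> borel_measurable borel\<close> unfolding S_def by blast+
    thus ?thesis using y by (simp add: ennreal_mult)
   qed
   obtain z where z: "(NN x. (pmax J f x)^2) = ennreal z" "z >= 0"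
    using le[OF S0] by (metis ennreal_cases ennreal_less_top infinity_ennreal_def less_irrefl order_le_less_trans)
   have zle: "z <= s * y" if "s \<in> S" for s
   proof -
    have "0 <= s * y" using that y(2) by (simp add: S_def)
    thus ?thesis using le[OF that] unfolding z(1) by (simp add: ennreal_le_iff)
   qed
   have "z <= b * y"
   proof (cases "y = 0")
    case False
    hence "z / y <= s" if "s \<in> S" for s using zle[OF that] y(2) by (simp add: field_simps)
    hence "z / y <= b" unfolding b_def by (rule cInf_greatest[OF ne])
    thus ?thesis using False y(2) by (simp add: field_simps)
   qed (use zle[OF S0] in auto)
   thus ?thesis unfolding z(1) y(1) using b0 y(2) by (subst ennreal_mult[symmetric]) (auto intro: ennreal_leI)
  qed
  have "2 * C * sqrt b \<in> S"
   unfolding S_def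
  proof (intro CollectI conjI allI impI)
   show "0 <= 2 * C * sqrt b" using b0 C by simp
   fix f :: "real^'n => ennreal"
   assume f: "f \<in> borel_measurable borel" "(NN x. (f x)^2) < \<infinity>"
   show "(NN x. (pmax J f x)^2) <= ennreal (2 * C * sqrt b) * (NN x. (f x)^2)"
    unfolding C_def by (rule pmax_selfimprove[OF f(1) b0 ball f(2)])
  qed
  hence "b <= 2 * C * sqrt b" unfolding b_def by (intro cInf_lower bdd)
  hence "sqrt b * sqrt b <= (2 * C) * sqrt b" using b0 by simp
  hence "sqrt b <= 2 * C" using b0 C mult_right_le_imp_le[of "sqrt b" "sqrt b" "2 * C"] by (cases "b = 0") auto
  hence "(sqrt b)^2 <= (2 * C)^2" using b0 by (intro power_mono) auto
  hence "b <= 4 * C^2" using b0 by (simp add: power_mult_distrib)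
  hence "ennreal b * (NN x. (f x)^2) <= ennreal (4 * C^2) * (NN x. (f x)^2)"
   by (intro mult_right_mono ennreal_leI) auto
  with ball[OF that] show ?thesis by (rule order_trans)
 qed
 show thesis
 proof
  \<comment> \<open>The extra 1 keeps the constant nonzero, so that the bound also holds when the
    right-hand integral is infinite.\<close>
  show "4 * C^2 + 1 > 0" by (simp add: add_nonneg_pos)
  fix J and f :: "real^'n => ennreal" assume [measurable]: "f \<in> borel_measurable borel"
  show "(NN x. (pmax J f x)^2) <= ennreal (4 * C^2 + 1) * (NN x. (f x)^2)"
  proof (cases "(NN x. (f x)^2) < \<infinity>")
   case True
   have "(NN x. (pmax J f x)^2) <= ennreal (4 * C^2) * (NN x. (f x)^2)"
    by (rule main) (use True in auto)
   also have "... <= ennreal (4 * C^2 + 1) * (NN x. (f x)^2)"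
    by (intro mult_right_mono ennreal_leI) auto
   finally show ?thesis .
  next
   case False
   hence "(NN x. (f x)^2) = \<infinity>" by (simp add: top_unique not_less)
   moreover have "ennreal (4 * C^2 + 1) \<noteq> 0" by (simp add: add_nonneg_pos)
   ultimately show ?thesis by (simp add: ennreal_mult_top)
  qed
 qed
qed

section \<open>Multipliers supported near the boundary of the spectral ball\<close>

text \<open>The mean value theorem, once per difference. The eigenvalues advance in steps of 2, so
  each difference costs a factor 2 and one derivative; \<open>G j\<close> plays the j-th
  derivative.\<close>

lemma fdiff_power_bound:
 assumes "!!j x. j < l ==> (G j has_real_derivative G (Suc j) x) (at x)"
  and "!!x. 2 * real k + c <= x ==> x <= 2 * real (k + l) + c ==> \<bar>G l x\<bar> <= M"
 shows "\<bar>(fdiff ^^ l) (%k. G 0 (2 * real k + c)) k\<bar> <= 2 ^ l * M"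
 using assms
proof (induction l arbitrary: G M)
 case 0
 thus ?case by simp
next
 case (Suc l)
 define H where "H j x = G j (x + 2) - G j x" for j x
 have "fdiff (%k. G 0 (2 * real k + c)) = (%k. H 0 (2 * real k + c))"
  by (auto simp: fdiff_def H_def algebra_simps)
 hence eq: "(fdiff ^^ Suc l) (%k. G 0 (2 * real k + c)) k = (fdiff ^^ l) (%k. H 0 (2 * real k + c)) k"
  by (simp only: funpow_Suc_right o_def)
 have "\<bar>(fdiff ^^ l) (%k. H 0 (2 * real k + c)) k\<bar> <= 2 ^ l * (2 * M)"
 proof (rule Suc.IH)
  fix j x assume "j < l"
  hence D: "(G j has_real_derivative G (Suc j) x) (at x)" for x using Suc.prems(1)[of j x] by simp
  have "((%x. G j (x + 2)) has_real_derivative G (Suc j) (x + 2)) (at x)"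
   using DERIV_shift[of "G j" "G (Suc j) (x + 2)" x 2] D[of "x + 2"] by simp
  thus "(H j has_real_derivative H (Suc j) x) (at x)"
   unfolding H_def[abs_def] by (intro DERIV_diff D)
 next
  fix x assume x: "2 * real k + c <= x" "x <= 2 * real (k + l) + c"
  obtain z where z: "x < z" "z < x + 2" "G l (x + 2) - G l x = (x + 2 - x) * G (Suc l) z"
   using MVT2[of x "x + 2" "G l" "G (Suc l)"] Suc.prems(1)[OF lessI] by (metis less_add_same_cancel1 zero_less_numeral)
  have "\<bar>G (Suc l) z\<bar> <= M" by (rule Suc.prems(2)) (use x z in auto)
  thus "\<bar>H l x\<bar> <= 2 * M" unfolding H_def z(3) by simp
 qed
 thus ?case unfolding eq by (simp add: mult_ac)
qed

text \<open>A crude bound without smoothness, which serves the low energies.\<close>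

lemma fdiff_power_square_le: "((fdiff ^^ l) \<psi> k)^2 <= 4 ^ l * (\<Sum>j\<le>l. (\<psi> (k + j))^2)"
proof (induction l arbitrary: k)
 case (Suc l)
 have "((fdiff ^^ Suc l) \<psi> k)^2 <= 2 * ((fdiff ^^ l) \<psi> (Suc k))^2 + 2 * ((fdiff ^^ l) \<psi> k)^2"
  using sum_squares_bound[of "(fdiff ^^ l) \<psi> (Suc k)" "- (fdiff ^^ l) \<psi> k"]
  by (simp add: fdiff_def power2_diff)
 also have "... <= 2 * (4 ^ l * (\<Sum>j\<le>l. (\<psi> (Suc k + j))^2)) + 2 * (4 ^ l * (\<Sum>j\<le>l. (\<psi> (k + j))^2))"
  by (intro add_mono mult_left_mono Suc.IH) auto
 also have "... <= 2 * (4 ^ l * (\<Sum>j\<le>Suc l. (\<psi> (k + j))^2)) + 2 * (4 ^ l * (\<Sum>j\<le>Suc l. (\<psi> (k + j))^2))"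
 proof (intro add_mono mult_left_mono)
  show "(\<Sum>j\<le>l. (\<psi> (Suc k + j))^2) <= (\<Sum>j\<le>Suc l. (\<psi> (k + j))^2)"
   by (subst sum.atMost_Suc_shift) simp
 qed auto
 finally show ?case by (simp del: sum.atMost_Suc)
qed simp

text \<open>\<open>g 0\<close> is a bump supported in the unit interval and \<open>g l\<close> its
  l-th derivative; carrying the derivatives along as a sequence makes their existence and bounds
  explicit.\<close>

definition profile :: "nat => real => (nat => real => real) => bool" where
 "profile m M g \<longleftrightarrow> M >= 0 \<and> (\<forall>l v. l < m --> (g l has_real_derivative g (Suc l) v) (at v))
  \<and> (\<forall>l v. l <= m --> \<bar>g l v\<bar> <= M) \<and> (\<forall>l v. l <= m --> v <= 0 \<or> 1 <= v --> g l v = 0)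
  \<and> continuous_on UNIV (g 0)"

text \<open>With R = exp (y / 2) the argument is (1 - (2 k + n) / R^2) / dl: a profile selects the
  eigenvalues between (1 - dl) R^2 and R^2.\<close>

definition br_mult :: "(real => real) => real => nat => real => nat => real" where
 "br_mult g dl n y k = g ((1 - (2 * real k + real n) * exp (- y)) / dl)"

lemma measurable_br_mult [measurable]:
 assumes "profile m M g"
 shows "(%y. br_mult (g 0) dl n y k) \<in> borel_measurable borel"
proof -
 have [measurable]: "g 0 \<in> borel_measurable borel"
  using assms by (auto simp: profile_def intro: borel_measurable_continuous_onI)
 show ?thesis unfolding br_mult_def by measurable
qed

lemma br_mult_le: "profile m M g ==> \<bar>br_mult (g 0) dl n y k\<bar> <= M"
 by (simp add: br_mult_def profile_def)

lemma br_mult_support: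
 assumes "profile m M g" "dl > 0" "br_mult (g 0) dl n y k \<noteq> 0"
 shows "2 * real k + real n < exp y" "(1 - dl) * exp y < 2 * real k + real n"
proof -
 define v where "v = (1 - (2 * real k + real n) * exp (- y)) / dl"
 have "\<not> (v <= 0 \<or> 1 <= v)" using assms unfolding profile_def br_mult_def v_def by blast
 hence v: "0 < v" "v < 1" by auto
 hence "0 < 1 - (2 * real k + real n) * exp (- y)" "1 - (2 * real k + real n) * exp (- y) < dl"
  using assms(2) by (simp_all add: v_def field_simps zero_less_divide_iff)
 thus "2 * real k + real n < exp y" "(1 - dl) * exp y < 2 * real k + real n"
  by (simp_all add: exp_minus field_simps)
qed

lemma fdiff_br_mult_bound:
 assumes g: "profile m M g" and dl: "dl > 0" and l: "l <= m"
 shows "\<bar>(fdiff ^^ l) (br_mult (g 0) dl n y) k\<bar> <= (2 * exp (- y) / dl) ^ l * M"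
  and "exp y <= 2 * real k + real n \<or> 2 * real (k + l) + real n <= (1 - dl) * exp y ==> (fdiff ^^ l) (br_mult (g 0) dl n y) k = 0"
proof -
 define G where "G j x = (- exp (- y) / dl) ^ j * g j ((1 - x * exp (- y)) / dl)" for j x
 have D: "(G j has_real_derivative G (Suc j) x) (at x)" if "j < l" for j x
 proof -
  have gd: "(g j has_real_derivative g (Suc j) v) (at v)" for v using g that l by (simp add: profile_def)
  have "((%x. (1 - x * exp (- y)) / dl) has_real_derivative - exp (- y) / dl) (at x)"
   using dl by (auto intro!: derivative_eq_intros)
  hence "((%x. g j ((1 - x * exp (- y)) / dl)) has_real_derivative g (Suc j) ((1 - x * exp (- y)) / dl) * (- exp (- y) / dl)) (at x)"
   by (rule DERIV_chain2[OF gd])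
  from DERIV_cmult[OF this, of "(- exp (- y) / dl) ^ j"]
  show ?thesis unfolding G_def[abs_def] by (simp only: power_Suc mult_ac)
 qed
 have psi: "br_mult (g 0) dl n y = (%k. G 0 (2 * real k + real n))"
  by (simp add: br_mult_def G_def fun_eq_iff)
 have pw: "\<bar>(- exp (- y) / dl) ^ l\<bar> = (exp (- y) / dl) ^ l" using dl by (simp add: power_abs)
 have "\<bar>(fdiff ^^ l) (%k. G 0 (2 * real k + real n)) k\<bar> <= 2 ^ l * ((exp (- y) / dl) ^ l * M)"
 proof (rule fdiff_power_bound[where G = G, OF D])
  fix x
  show "\<bar>G l x\<bar> <= (exp (- y) / dl) ^ l * M"
   unfolding G_def abs_mult pw using g l dl by (intro mult_left_mono) (auto simp: profile_def)
 qed
 thus "\<bar>(fdiff ^^ l) (br_mult (g 0) dl n y) k\<bar> <= (2 * exp (- y) / dl) ^ l * M"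
  unfolding psi by (simp add: power_mult_distrib power_divide mult.assoc)
 assume as: "exp y <= 2 * real k + real n \<or> 2 * real (k + l) + real n <= (1 - dl) * exp y"
 have "\<bar>(fdiff ^^ l) (%k. G 0 (2 * real k + real n)) k\<bar> <= 2 ^ l * 0"
 proof (rule fdiff_power_bound[where G = G, OF D])
  fix x assume x: "2 * real k + real n <= x" "x <= 2 * real (k + l) + real n"
  have "(1 - x * exp (- y)) / dl <= 0 \<or> 1 <= (1 - x * exp (- y)) / dl"
   using as
  proof
   assume "exp y <= 2 * real k + real n"
   hence "exp y <= x" using x by simp
   hence "1 <= x * exp (- y)" by (simp add: exp_minus field_simps)
   thus ?thesis using dl by (simp add: divide_nonpos_pos)
  next
   assume "2 * real (k + l) + real n <= (1 - dl) * exp y"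
   hence "x <= (1 - dl) * exp y" using x by simp
   hence "x * exp (- y) <= 1 - dl" by (simp add: exp_minus field_simps)
   thus ?thesis using dl by (simp add: field_simps)
  qed
  hence "g l ((1 - x * exp (- y)) / dl) = 0" using g l unfolding profile_def by blast
  thus "\<bar>G l x\<bar> <= 0" by (simp add: G_def)
 qed
 thus "(fdiff ^^ l) (br_mult (g 0) dl n y) k = 0" unfolding psi by simp
qed

lemma minus_ln_one_minus_le: "0 <= dl ==> dl <= 1 / 2 ==> - ln (1 - dl) <= 2 * (dl::real)"
 using ln_one_minus_pos_lower_bound[of dl] mult_right_mono[of dl "1 / 2" dl] by (simp add: power2_eq_square)

text \<open>In the logarithmic variable y the condition cuts out an interval of length about dl + c
  / L; c makes room for the extra nodes of a difference.\<close>

lemma window_length: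
 fixes L dl c :: real
 assumes "L > 0" "0 < dl" "dl <= 1 / 2" "W \<subseteq> {y. L < exp y \<and> (1 - dl) * exp y < L + c}" "c >= 0"
 shows "\<exists>a b. a <= b \<and> W \<subseteq> {a..b} \<and> b - a <= 2 * dl + c / L"
proof (intro exI conjI)
 let ?a = "ln L" and ?b = "ln ((L + c) / (1 - dl))"
 have "L <= (L + c) / (1 - dl)"
  using assms mult_nonneg_nonneg[of L dl] by (subst pos_le_divide_eq) (auto simp: algebra_simps)
 thus "?a <= ?b" using assms by simp
 show "W \<subseteq> {?a..?b}"
 proof
  fix y assume "y \<in> W"
  hence y: "L < exp y" "(1 - dl) * exp y < L + c" using assms(4) by auto
  have "ln L <= ln (exp y)" using y assms by (subst ln_le_cancel_iff) auto
  moreover have "ln (exp y) <= ?b" using y assms by (subst ln_le_cancel_iff) (auto simp: field_simps)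
  ultimately show "y \<in> {?a..?b}" by simp
 qed
 have "?b = ln (L + c) - ln (1 - dl)" using assms by (simp add: ln_div)
 also have "ln (L + c) = ln L + ln (1 + c / L)"
 proof -
  have "L + c = L * (1 + c / L)" using assms by (simp add: field_simps)
  moreover have "0 < 1 + c / L" using assms by (simp add: add_pos_nonneg)
  ultimately show ?thesis using ln_mult_pos[of L "1 + c / L"] assms(1) by metis
 qed
 finally show "?b - ?a <= 2 * dl + c / L"
  using minus_ln_one_minus_le[of dl] ln_add_one_self_le_self[of "c / L"] assms by simp
qed

lemma nn_integral_window_le:
 assumes "W \<subseteq> {a..b}" "a <= b" "M >= 0" "!!y. y \<notin> W ==> F y = 0" "!!y. y \<in> W ==> F y <= ennreal M"
 shows "(NN y. F y) <= ennreal (M * (b - a))"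
proof -
 have "(NN y. F y) <= (NN y. ennreal M * indicator {a..b} y)"
 proof (rule nn_integral_mono)
  fix y
  show "F y <= ennreal M * indicator {a..b} y"
   using assms(1) assms(4,5)[of y] by (cases "y \<in> W") auto
 qed
 also have "... = ennreal M * ennreal (b - a)" using assms by (simp add: nn_integral_cmult)
 finally show ?thesis using assms by (simp add: ennreal_mult)
qed

text \<open>A fixed degree meets the bump only for y in a window of length 2 dl; this is the source
  of the factor dl in all square-function bounds.\<close>

lemma br_mult_integral:
 assumes g: "profile m M g" and dl: "0 < dl" "dl <= 1 / 2" and n: "n >= 1"
 shows "(NN y. ennreal ((br_mult (g 0) dl n y k)^2)) <= ennreal (2 * dl * M^2)"
proof -
 define W where "W = {y. br_mult (g 0) dl n y k \<noteq> 0}"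
 have "W \<subseteq> {y. 2 * real k + real n < exp y \<and> (1 - dl) * exp y < 2 * real k + real n + 0}"
  unfolding W_def using br_mult_support[OF g dl(1)] by auto
 from window_length[OF _ dl this] n
 obtain a b where ab: "a <= b" "W \<subseteq> {a..b}" "b - a <= 2 * dl" by auto
 have "(NN y. ennreal ((br_mult (g 0) dl n y k)^2)) <= ennreal (M^2 * (b - a))"
 proof (rule nn_integral_window_le[OF ab(2,1)])
  fix y
  show "y \<notin> W ==> ennreal ((br_mult (g 0) dl n y k)^2) = 0" by (simp add: W_def)
  have "\<bar>br_mult (g 0) dl n y k\<bar>^2 <= M^2" by (intro power_mono br_mult_le[OF g]) auto
  thus "ennreal ((br_mult (g 0) dl n y k)^2) <= ennreal (M^2)" by (intro ennreal_leI) simp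
 qed simp
 also have "... <= ennreal (2 * dl * M^2)" using ab mult_left_mono[OF ab(3), of "M^2"] by (intro ennreal_leI) (simp add: mult.commute)
 finally show ?thesis .
qed

text \<open>When exp y <= a^2, every degree in the support is below a^2, so the weight
  \<open>real (k + 1) ^ l\<close> is paid by a ^ (2 l) and smoothness plays no part.\<close>

lemma fdiff_br_mult_low:
 assumes g: "profile m M g" and dl: "0 < dl" "dl <= 1 / 2" and n: "n >= 1" and l: "l <= m"
  and Y: "Y \<in> sets borel" "!!y. y \<in> Y ==> exp y <= a^2" and a: "a >= 1"
 shows "(NN y. ennreal (((fdiff ^^ l) (br_mult (g 0) dl n y) k)^2 * real (k + 1) ^ l) * indicator Y y)
  <= ennreal ((4 ^ m * real (m + 1) * 2 * M^2 * dl) * a ^ (2 * l))"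
proof -
 note [measurable] = measurable_br_mult[OF g] Y(1)
 have pw: "ennreal (((fdiff ^^ l) (br_mult (g 0) dl n y) k)^2 * real (k + 1) ^ l) * indicator Y y
   <= (\<Sum>j\<le>l. ennreal (4 ^ l * a ^ (2 * l)) * ennreal ((br_mult (g 0) dl n y (k + j))^2))" for y
 proof (cases "y \<in> Y")
  case True
  have "((fdiff ^^ l) (br_mult (g 0) dl n y) k)^2 * real (k + 1) ^ l
    <= (4 ^ l * (\<Sum>j\<le>l. (br_mult (g 0) dl n y (k + j))^2)) * real (k + 1) ^ l"
   by (intro mult_right_mono fdiff_power_square_le) auto
  also have "... = (\<Sum>j\<le>l. 4 ^ l * ((br_mult (g 0) dl n y (k + j))^2 * real (k + 1) ^ l))"
   by (simp add: sum_distrib_left sum_distrib_right mult_ac)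
  also have "... <= (\<Sum>j\<le>l. 4 ^ l * a ^ (2 * l) * (br_mult (g 0) dl n y (k + j))^2)"
  proof (rule sum_mono)
   fix j
   show "4 ^ l * ((br_mult (g 0) dl n y (k + j))^2 * real (k + 1) ^ l) <= 4 ^ l * a ^ (2 * l) * (br_mult (g 0) dl n y (k + j))^2"
   proof (cases "br_mult (g 0) dl n y (k + j) = 0")
    case False
    have "real (k + 1) <= 2 * real (k + j) + real n" using n by simp
    also have "... < exp y" by (rule br_mult_support(1)[OF g dl(1) False])
    also have "... <= a^2" by (rule Y(2)[OF True])
    finally have "real (k + 1) ^ l <= (a^2) ^ l" by (intro power_mono) auto
    hence "(4 ^ l * (br_mult (g 0) dl n y (k + j))^2) * real (k + 1) ^ l <= (4 ^ l * (br_mult (g 0) dl n y (k + j))^2) * a ^ (2 * l)"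
     by (intro mult_left_mono) (auto simp: power_mult)
    thus ?thesis by (simp add: mult_ac)
   qed simp
  qed
  finally show ?thesis using True a by (simp add: ennreal_mult[symmetric] sum_nonneg)
 qed simp
 have "(NN y. ennreal (((fdiff ^^ l) (br_mult (g 0) dl n y) k)^2 * real (k + 1) ^ l) * indicator Y y)
   <= (NN y. (\<Sum>j\<le>l. ennreal (4 ^ l * a ^ (2 * l)) * ennreal ((br_mult (g 0) dl n y (k + j))^2)))"
  by (intro nn_integral_mono pw)
 also have "... = (\<Sum>j\<le>l. ennreal (4 ^ l * a ^ (2 * l)) * (NN y. ennreal ((br_mult (g 0) dl n y (k + j))^2)))"
  by (simp add: nn_integral_sum nn_integral_cmult)
 also have "... <= (\<Sum>j\<le>l. ennreal (4 ^ l * a ^ (2 * l)) * ennreal (2 * dl * M^2))"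
  by (intro sum_mono mult_left_mono br_mult_integral[OF g dl n]) auto
 also have "... = ennreal (real (Suc l) * (4 ^ l * a ^ (2 * l) * (2 * dl * M^2)))"
  using a dl by (simp add: ennreal_mult ennreal_of_nat_eq_real_of_nat del: of_nat_Suc)
 also have "... <= ennreal ((4 ^ m * real (m + 1) * 2 * M^2 * dl) * a ^ (2 * l))"
 proof (rule ennreal_leI)
  have "real (Suc l) * 4 ^ l <= real (m + 1) * 4 ^ m" using l by (intro mult_mono power_increasing) auto
  hence "real (Suc l) * 4 ^ l * (a ^ (2 * l) * (2 * dl * M^2)) <= real (m + 1) * 4 ^ m * (a ^ (2 * l) * (2 * dl * M^2))"
   using a dl by (intro mult_right_mono) auto
  thus "real (Suc l) * (4 ^ l * a ^ (2 * l) * (2 * dl * M^2)) <= (4 ^ m * real (m + 1) * 2 * M^2 * dl) * a ^ (2 * l)"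
   by (simp only: mult_ac)
 qed
 finally show ?thesis .
qed

text \<open>An l-th difference has size (exp (- y) / dl) ^ l and the degree is at most exp y, so the
  weighted square is of order (exp (- y) / dl^2) ^ l <= a ^ (2 l). The condition 1 / dl <= exp y
  keeps the window of length O(dl) although l extra nodes widen it.\<close>

lemma fdiff_br_mult_high:
 assumes g: "profile m M g" and dl: "0 < dl" "dl <= 1 / 2" and n: "n >= 1" and l: "l <= m"
  and Y: "!!y. y \<in> Y ==> 1 / dl <= exp y" "!!y. y \<in> Y ==> exp (- y) / dl^2 <= a^2" and a: "a >= 1"
 shows "(NN y. ennreal (((fdiff ^^ l) (br_mult (g 0) dl n y) k)^2 * real (k + 1) ^ l) * indicator Y y)
  <= ennreal ((4 ^ m * (2 + 4 * real m * (2 * real m + 1)) * M^2 * dl) * a ^ (2 * l))"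
proof -
 define L where "L = 2 * real k + real n"
 have L: "L >= 1" "real (k + 1) <= L" using n by (auto simp: L_def)
 have M: "M >= 0" using g by (simp add: profile_def)
 define W where "W = {y \<in> Y. (fdiff ^^ l) (br_mult (g 0) dl n y) k \<noteq> 0}"
 have W: "L < exp y" "(1 - dl) * exp y < L + 2 * real l" if "y \<in> W" for y
  using fdiff_br_mult_bound(2)[OF g dl(1) l, of y k n] that unfolding W_def L_def by (fastforce simp: not_le[symmetric])+
 define B where "B = (4 ^ l * M^2) * a ^ (2 * l)"
 have B: "B >= 0" using a by (simp add: B_def)
 have bd: "((fdiff ^^ l) (br_mult (g 0) dl n y) k)^2 * real (k + 1) ^ l <= B" if "y \<in> W" for y
 proof -
  have yY: "y \<in> Y" using that by (simp add: W_def)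
  have "((fdiff ^^ l) (br_mult (g 0) dl n y) k)^2 <= ((2 * exp (- y) / dl) ^ l * M)^2"
   using fdiff_br_mult_bound(1)[OF g dl(1) l, of n y k] by (metis abs_ge_zero power2_abs power_mono)
  moreover have "real (k + 1) ^ l <= exp y ^ l" using L W(1)[OF that] by (intro power_mono) auto
  ultimately have "((fdiff ^^ l) (br_mult (g 0) dl n y) k)^2 * real (k + 1) ^ l <= ((2 * exp (- y) / dl) ^ l * M)^2 * exp y ^ l"
   by (intro mult_mono) auto
  also have "... = (4 ^ l * M^2) * (exp (- y) / dl^2) ^ l"
  proof -
   have "(2 * exp (- y) / dl)^2 * exp y = 4 * (exp (- y) / dl^2)"
    by (simp add: power_divide power_mult_distrib power2_eq_square exp_minus field_simps)
   moreover have "((2 * exp (- y) / dl) ^ l * M)^2 * exp y ^ l = M^2 * ((2 * exp (- y) / dl)^2 * exp y) ^ l"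
    by (simp add: power_mult_distrib mult_ac flip: power_mult)
   ultimately show ?thesis by (simp only: power_mult_distrib mult_ac)
  qed
  also have "... <= (4 ^ l * M^2) * (a^2) ^ l"
   using Y(2)[OF yY] dl by (intro mult_left_mono power_mono) auto
  finally show ?thesis by (simp add: B_def power_mult)
 qed
 have main: "(NN y. ennreal (((fdiff ^^ l) (br_mult (g 0) dl n y) k)^2 * real (k + 1) ^ l) * indicator Y y)
   <= ennreal (B * ((2 + 4 * real l * (2 * real l + 1)) * dl))"
 proof (cases "W = {}")
  case True
  hence "(NN y. ennreal (((fdiff ^^ l) (br_mult (g 0) dl n y) k)^2 * real (k + 1) ^ l) * indicator Y y) = (NN (y::real). 0)"
   by (intro nn_integral_cong) (auto simp: W_def indicator_def)
  thus ?thesis by simp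
 next
  case False
  then obtain y0 where y0: "y0 \<in> W" by auto
  \<comment> \<open>At a point of the window L is at least a multiple of exp y, hence of 1 / dl, so
    the extra nodes widen the window by O(dl) only.\<close>
  have "1 / (2 * dl) <= (1 - dl) * exp y0"
  proof -
   have "1 / 2 * (1 / dl) <= (1 - dl) * exp y0" using Y(1)[of y0] y0 dl by (intro mult_mono) (auto simp: W_def)
   thus ?thesis by simp
  qed
  also have "... <= L + 2 * real l" using W(2)[OF y0] by simp
  also have "... <= L * (2 * real l + 1)" using L mult_right_mono[OF L(1), of "2 * real l"] by (simp add: algebra_simps)
  finally have "1 / L <= 2 * (2 * real l + 1) * dl" using dl L by (simp add: field_simps)
  hence "2 * real l * (1 / L) <= 2 * real l * (2 * (2 * real l + 1) * dl)" by (intro mult_left_mono) auto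
  hence cL: "2 * real l / L <= 4 * real l * (2 * real l + 1) * dl" by (simp add: mult_ac)
  have "W \<subseteq> {y. L < exp y \<and> (1 - dl) * exp y < L + 2 * real l}" using W by auto
  from window_length[OF _ dl this] L
  obtain u v where uv: "u <= v" "W \<subseteq> {u..v}" "v - u <= 2 * dl + 2 * real l / L" by auto
  have "(NN y. ennreal (((fdiff ^^ l) (br_mult (g 0) dl n y) k)^2 * real (k + 1) ^ l) * indicator Y y) <= ennreal (B * (v - u))"
  proof (rule nn_integral_window_le[OF uv(2,1) B])
   fix y
   show "y \<notin> W ==> ennreal (((fdiff ^^ l) (br_mult (g 0) dl n y) k)^2 * real (k + 1) ^ l) * indicator Y y = 0"
    by (auto simp: W_def indicator_def)
   show "y \<in> W ==> ennreal (((fdiff ^^ l) (br_mult (g 0) dl n y) k)^2 * real (k + 1) ^ l) * indicator Y y <= ennreal B"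
    using bd[of y] by (auto simp: W_def intro!: ennreal_leI)
  qed
  also have "... <= ennreal (B * ((2 + 4 * real l * (2 * real l + 1)) * dl))"
  proof (intro ennreal_leI mult_left_mono B)
   show "v - u <= (2 + 4 * real l * (2 * real l + 1)) * dl" using uv(3) cL by (simp add: distrib_right)
  qed
  finally show ?thesis .
 qed
 also have "... <= ennreal ((4 ^ m * (2 + 4 * real m * (2 * real m + 1)) * M^2 * dl) * a ^ (2 * l))"
 proof (rule ennreal_leI)
  have "4 ^ l * (2 + 4 * real l * (2 * real l + 1)) <= 4 ^ m * (2 + 4 * real m * (2 * real m + 1))"
   using l by (intro mult_mono add_mono power_increasing) auto
  hence "(4 ^ l * (2 + 4 * real l * (2 * real l + 1))) * (M^2 * dl * a ^ (2 * l)) <= (4 ^ m * (2 + 4 * real m * (2 * real m + 1))) * (M^2 * dl * a ^ (2 * l))"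
   using dl a by (intro mult_right_mono) auto
  thus "B * ((2 + 4 * real l * (2 * real l + 1)) * dl) <= (4 ^ m * (2 + 4 * real m * (2 * real m + 1)) * M^2 * dl) * a ^ (2 * l)"
   unfolding B_def by (simp only: mult_ac)
 qed
 finally show ?thesis .
qed

section \<open>Square functions\<close>

text \<open>Here y stands for ln (R^2), and no root is taken: this is the square of the usual square
  function.\<close>

definition sqf :: "nat => (real => nat => real) => (real^'n::finite => complex) => real^'n => ennreal" where
 "sqf K \<psi> f x = (NN y. csq (hmult K (\<psi> y) f x))"

lemma measurable_sqf [measurable]:
 assumes [measurable]: "!!k. (%y. \<psi> y k) \<in> borel_measurable borel"
 shows "sqf K \<psi> f \<in> borel_measurable borel"
 unfolding sqf_def hmult_def by measurable

lemma sqf_weight: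
 fixes w :: "real^'n::finite => real"
 assumes [measurable]: "!!k. (%y. \<psi> y k) \<in> borel_measurable borel" "w \<in> borel_measurable borel"
  and w: "!!x. w x >= 0"
 shows "(NN x. sqf K \<psi> f x * ennreal (w x))
  = (NN y. (NN x. csqw (hmult K (\<psi> y) f x) (w x)))"
proof -
 have [measurable]: "(%y. csq (hmult K (\<psi> y) f x)) \<in> borel_measurable borel" for x
  unfolding hmult_def by measurable
 have m: "(%(y, x). csqw (hmult K (\<psi> y) f x) (w x)) \<in> borel_measurable (lborel \<Otimes>\<^sub>M lborel)"
  unfolding hmult_def by measurable
 have "(NN x. sqf K \<psi> f x * ennreal (w x))
   = (NN x. (NN y. csqw (hmult K (\<psi> y) f x) (w x)))"
  unfolding sqf_def by (intro nn_integral_cong) (subst nn_integral_multc[symmetric], simp_all only: ennreal_mult w zero_le_power2, measurable)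
 also have "... = (NN y. (NN x. csqw (hmult K (\<psi> y) f x) (w x)))"
  by (rule lborel_pair.Fubini'[OF m])
 finally show ?thesis .
qed

lemma sqf_split:
 assumes [measurable]: "!!k. (%y. \<psi> y k) \<in> borel_measurable borel" and f: "tempered_L2 f" and S: "S \<in> sets borel"
 shows "sqf K \<psi> f x <= 2 * sqf K \<psi> (%x. indicator S x * f x) x + 2 * sqf K \<psi> (%x. indicator (- S) x * f x) x"
proof -
 have [measurable]: "(%y. csq (hmult K (\<psi> y) f x)) \<in> borel_measurable borel" for x f
  unfolding hmult_def by measurable
 define f0 f1 where "f0 x = indicator S x * f x" and "f1 x = indicator (- S) x * f x" for x
 have t: "tempered_L2 f0" "tempered_L2 f1"
  unfolding f0_def f1_def using f S by (auto intro!: tempered_L2_indicator)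
 have "f = (%x. f0 x + f1 x)" by (auto simp: f0_def f1_def indicator_def)
 hence "hmult K (\<psi> y) f x = hmult K (\<psi> y) f0 x + hmult K (\<psi> y) f1 x" for y using hmult_add[OF t] by metis
 hence "(cmod (hmult K (\<psi> y) f x))^2 <= 2 * (cmod (hmult K (\<psi> y) f0 x))^2 + 2 * (cmod (hmult K (\<psi> y) f1 x))^2" for y
 proof -
  have "(cmod (hmult K (\<psi> y) f x))^2 <= (cmod (hmult K (\<psi> y) f0 x) + cmod (hmult K (\<psi> y) f1 x))^2"
   using \<open>hmult K (\<psi> y) f x = _\<close> by (simp add: norm_triangle_ineq power_mono)
  also have "... <= 2 * (cmod (hmult K (\<psi> y) f0 x))^2 + 2 * (cmod (hmult K (\<psi> y) f1 x))^2"
   using sum_squares_bound[of "cmod (hmult K (\<psi> y) f0 x)" "cmod (hmult K (\<psi> y) f1 x)"] by (simp add: power2_sum)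
  finally show ?thesis .
 qed
 hence "sqf K \<psi> f x <= (NN y. 2 * csq (hmult K (\<psi> y) f0 x) + 2 * csq (hmult K (\<psi> y) f1 x))"
  unfolding sqf_def
 proof (intro nn_integral_mono)
  fix y
  have "csq (hmult K (\<psi> y) f x) <= ennreal (2 * (cmod (hmult K (\<psi> y) f0 x))^2 + 2 * (cmod (hmult K (\<psi> y) f1 x))^2)"
   by (rule ennreal_leI) fact
  thus "csq (hmult K (\<psi> y) f x) <= 2 * csq (hmult K (\<psi> y) f0 x) + 2 * csq (hmult K (\<psi> y) f1 x)"
   by (simp add: ennreal_plus ennreal_mult')
 qed
 also have "... = 2 * sqf K \<psi> f0 x + 2 * sqf K \<psi> f1 x"
  unfolding sqf_def by (subst nn_integral_add, measurable, subst (1 2) nn_integral_cmult, measurable)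
 finally show ?thesis unfolding f0_def f1_def .
qed

lemma sqf_interpolation:
 fixes f :: "'n::finite cfun"
 assumes mes: "!!k. (%y. \<psi> y k) \<in> borel_measurable borel"
  and "0 < th" "th < 1" "A0 > 0" "A1 > 0"
  "v0 \<in> borel_measurable borel" "v1 \<in> borel_measurable borel" "w0 \<in> borel_measurable borel" "w1 \<in> borel_measurable borel"
  "!!x. v0 x > 0" "!!x. v1 x > 0" "!!x. w0 x > 0" "!!x. w1 x > 0"
  "!!f :: real^'n => complex. tempered_L2 f ==> (NN x. sqf K \<psi> f x * ennreal (w0 x)) <= ennreal A0 * (NN x. csqw (f x) (v0 x))"
  "!!f :: real^'n => complex. tempered_L2 f ==> (NN x. sqf K \<psi> f x * ennreal (w1 x)) <= ennreal A1 * (NN x. csqw (f x) (v1 x))"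
  "tempered_L2 f"
 shows "(NN x. sqf K \<psi> f x * ennreal (w0 x powr (1 - th) * w1 x powr th))
  <= ennreal (2 * (A0 powr (1 - th) * A1 powr th)) * (NN x. csqw (f x) (v0 x powr (1 - th) * v1 x powr th))"
 by (rule weight_interpolation[where q = "sqf K \<psi>", OF assms(2-13) _ _ assms(14-16)])
  (use mes in \<open>auto intro: sqf_split\<close>)

abbreviation upto_deg :: "nat => nat => real set" where
 "upto_deg K n \<equiv> {..ln (2 * real K + real n)}"

text \<open>The two regimes in which a is an admissible propagation distance: energies up to a^2,
  where the classically allowed region has radius a, and energies above 1 / dl, where the smoothness
  of the bump decides.\<close>

abbreviation scale_ok :: "real => real => real set => bool" where
 "scale_ok dl a Y \<equiv> (\<forall>y\<in>Y. exp y <= a^2) \<or> (\<forall>y\<in>Y. 1 / dl <= exp y \<and> exp (- y) / dl^2 <= a^2)"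

abbreviation wnorm :: "real => 'n::finite cfun => ennreal" where
 "wnorm al f \<equiv> (NN x. csqw (f x) ((1 + norm x) powr (- al)))"

abbreviation wnorm' :: "real => 'n::finite cfun => ennreal" where
 "wnorm' al f \<equiv> (NN x. csqw (f x) (weight al x))"

abbreviation sqle :: "nat => (real => nat => real) => 'n::finite cfun => real => real => bool" where
 "sqle K \<psi> f al A \<equiv> (NN x. sqf K \<psi> f x * ennreal ((1 + norm x) powr (- al))) <= ennreal A * wnorm al f"

abbreviation sqle_a :: "nat => (real => nat => real) => 'n::finite cfun => real => real => real => bool" where
 "sqle_a K \<psi> f a al A \<equiv> (NN x. sqf K \<psi> f x * ennreal ((1 + norm x / a) powr (- al)))
  <= ennreal A * (NN x. csqw (f x) ((1 + norm x / a) powr (- al)))"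

abbreviation sqle_m :: "nat => (real => nat => real) => 'n::finite cfun => real => nat => real => bool" where
 "sqle_m K \<psi> f a m A \<equiv> (NN x. sqf K \<psi> f x * ennreal (1 / (1 + norm x / a) ^ (2 * m)))
  <= ennreal A * (NN x. csqw (f x) (1 / (1 + norm x / a) ^ (2 * m)))"

definition br_cut :: "(real => real) => real => nat => real set => real => nat => real" where
 "br_cut g dl n Y y k = indicator Y y * br_mult g dl n y k"

lemma measurable_br_cut [measurable]:
 assumes "profile m M g" "Y \<in> sets borel"
 shows "(%y. br_cut (g 0) dl n Y y k) \<in> borel_measurable borel"
 unfolding br_cut_def using measurable_br_mult[OF assms(1)] assms(2) by measurable

lemma fdiff_br_cut: "(fdiff ^^ l) (br_cut g dl n Y y) k = indicator Y y * (fdiff ^^ l) (br_mult g dl n y) k"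
proof (induction l arbitrary: k)
 case (Suc l)
 thus ?case by (simp add: fdiff_def algebra_simps)
qed (simp add: br_cut_def)

text \<open>The upper limit in \<open>upto_deg\<close> is chosen for this: degrees from
  \<open>K\<close> on are never met, so the cutoff changes nothing.\<close>

lemma br_cut_eq_0:
 assumes "profile m M g" "dl > 0" "Y \<subseteq> {..ln (2 * real K + real n)}" "k >= K" "n >= 1"
 shows "br_cut (g 0) dl n Y y k = 0"
proof (rule ccontr)
 assume "br_cut (g 0) dl n Y y k \<noteq> 0"
 hence y: "y \<in> Y" and "br_mult (g 0) dl n y k \<noteq> 0" by (auto simp: br_cut_def indicator_def split: if_splits)
 from br_mult_support(1)[OF assms(1,2) this(2)] have "2 * real k + real n < exp y" .
 also have "... <= exp (ln (2 * real K + real n))" using y assms(3) by auto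
 also have "... = 2 * real K + real n" using assms(5) by simp
 finally show False using assms(4) by simp
qed

lemma integral_br_cut:
 assumes g: "profile m M g" and dl: "0 < dl" "dl <= 1 / 2" and n: "n >= 1"
 shows "(NN y. ennreal ((br_cut (g 0) dl n Y y k)^2)) <= ennreal (2 * dl * M^2)"
proof -
 have "(NN y. ennreal ((br_cut (g 0) dl n Y y k)^2)) <= (NN y. ennreal ((br_mult (g 0) dl n y k)^2))"
  by (intro nn_integral_mono ennreal_leI) (auto simp: br_cut_def indicator_def)
 also have "... <= ennreal (2 * dl * M^2)" by (rule br_mult_integral[OF g dl n])
 finally show ?thesis .
qed

lemma sqf_L2:
 fixes f :: "'n::finite cfun"
 assumes g: "profile m M g" and dl: "0 < dl" "dl <= 1 / 2" and Y: "Y \<in> sets borel" and f: "tempered_L2 f"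
 shows "(NN x. sqf K (br_cut (g 0) dl CARD('n) Y) f x) <= ennreal (2 * M^2 * dl) * (NN x. csq (f x))"
proof -
 note [measurable] = measurable_br_cut[OF g Y] f
 have "(NN y. (NN x. csq (hker_op K i 0 (br_cut (g 0) dl CARD('n) Y y) f x)))
  <= ennreal (real (Suc 0) ^ 2 * 4 ^ 0 * real (Suc 0) ^ 0) * ennreal (2 * dl * M^2) * (NN x. csq (f x))" for i
  by (rule hker_op_family_L2) (use integral_br_cut[OF g dl, of "CARD('n)"] in \<open>auto simp: Suc_leI\<close>)
 thus ?thesis
  using sqf_weight[of "br_cut (g 0) dl CARD('n) Y" "%_. 1" K f] by (simp add: hmult_eq_hker_op[symmetric] mult_ac)
qed

lemma sqf_movement:
 assumes "even m"
 obtains C where "C > 0" "!!g M dl Y K a (f :: 'n::finite cfun). profile m M g ==> 0 < dl ==> dl <= 1 / 2 ==>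
  Y \<in> sets borel ==> Y \<subseteq> (upto_deg K CARD('n)) ==> a >= 1 ==>
  scale_ok dl a Y ==> tempered_L2 f ==>
  sqle_m K (br_cut (g 0) dl CARD('n) Y) f a m (C * M^2 * dl)"
proof -
 obtain C where C: "C > 0" "!!(N::real measure) K \<psi> a A (f :: 'n::finite cfun).
  (!!k. (%y. \<psi> y k) \<in> borel_measurable N) ==> (!!y k. k >= K ==> \<psi> y k = 0) ==> a >= 1 ==> A >= 0 ==> tempered_L2 f ==>
  (!!l k. l <= m ==> k < K ==> (\<integral>\<^sup>+y. ennreal (((fdiff ^^ l) (\<psi> y) k)^2 * real (k + 1) ^ l) \<partial>N) <= ennreal (A * a ^ (2 * l))) ==>
  (\<integral>\<^sup>+y. (NN x. ennreal ((cmod (hmult K (\<psi> y) f x))^2 / (1 + norm x / a) ^ (2 * m))) \<partial>N)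
   <= ennreal (C * A) * (NN x. ennreal ((cmod (f x))^2 / (1 + norm x / a) ^ (2 * m)))"
  using movement[OF assms, where ?'n = 'n] by blast
 define D1 where "D1 = 4 ^ m * real (m + 1) * 2"
 define D2 where "D2 = 4 ^ m * (2 + 4 * real m * (2 * real m + 1))"
 have D: "D1 > 0" "D2 > 0" unfolding D1_def D2_def by (auto intro!: mult_pos_pos add_pos_nonneg)
 show ?thesis
 proof (rule that)
  show "C * (D1 + D2) > 0" using C(1) D by simp
  fix g M Y K and a dl :: real and f :: "'n::finite cfun"
  assume g: "profile m M g" and dl: "0 < dl" "dl <= 1 / 2" and Y: "Y \<in> sets borel" "Y \<subseteq> (upto_deg K CARD('n))"
   and a: "a >= 1" and alt: "scale_ok dl a Y" and f: "tempered_L2 f"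
  note [measurable] = measurable_br_cut[OF g Y(1)] f
  have n: "CARD('n) >= 1" by (simp add: Suc_leI)
  have pos: "0 <= 1 / (1 + norm x / a) ^ (2 * m)" for x :: "real^'n" using a by simp
  have "(NN y. (NN x. ennreal ((cmod (hmult K (br_cut (g 0) dl CARD('n) Y y) f x))^2 / (1 + norm x / a) ^ (2 * m))))
   <= ennreal (C * ((D1 + D2) * M^2 * dl)) * (NN x. ennreal ((cmod (f x))^2 / (1 + norm x / a) ^ (2 * m)))"
  proof (rule C(2))
   show "(%y. br_cut (g 0) dl CARD('n) Y y k) \<in> borel_measurable lborel" for k by simp
   show "br_cut (g 0) dl CARD('n) Y y k = 0" if "k >= K" for y k by (rule br_cut_eq_0[OF g dl(1) Y(2) that n])
   show "0 <= (D1 + D2) * M^2 * dl" using D dl by simp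
   fix l k assume l: "l <= m"
   have "(NN y. ennreal (((fdiff ^^ l) (br_cut (g 0) dl CARD('n) Y y) k)^2 * real (k + 1) ^ l))
    = (NN y. ennreal (((fdiff ^^ l) (br_mult (g 0) dl CARD('n) y) k)^2 * real (k + 1) ^ l) * indicator Y y)"
    by (intro nn_integral_cong) (auto simp: fdiff_br_cut indicator_def)
   also have "... <= ennreal ((D1 + D2) * M^2 * dl * a ^ (2 * l))"
    using alt
   proof
    assume "\<forall>y\<in>Y. exp y <= a^2"
    hence "(NN y. ennreal (((fdiff ^^ l) (br_mult (g 0) dl CARD('n) y) k)^2 * real (k + 1) ^ l) * indicator Y y)
     <= ennreal ((D1 * M^2 * dl) * a ^ (2 * l))"
     unfolding D1_def by (intro fdiff_br_mult_low[OF g dl n l Y(1) _ a]) auto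
    also have "... <= ennreal ((D1 + D2) * M^2 * dl * a ^ (2 * l))"
     using D dl a by (intro ennreal_leI mult_right_mono) auto
    finally show ?thesis .
   next
    assume "\<forall>y\<in>Y. 1 / dl <= exp y \<and> exp (- y) / dl^2 <= a^2"
    hence "(NN y. ennreal (((fdiff ^^ l) (br_mult (g 0) dl CARD('n) y) k)^2 * real (k + 1) ^ l) * indicator Y y)
     <= ennreal ((D2 * M^2 * dl) * a ^ (2 * l))"
     unfolding D2_def by (intro fdiff_br_mult_high[OF g dl n l _ _ a]) auto
    also have "... <= ennreal ((D1 + D2) * M^2 * dl * a ^ (2 * l))"
     using D dl a by (intro ennreal_leI mult_right_mono) auto
    finally show ?thesis .
   qed
   finally show "(NN y. ennreal (((fdiff ^^ l) (br_cut (g 0) dl CARD('n) Y y) k)^2 * real (k + 1) ^ l))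
    <= ennreal ((D1 + D2) * M^2 * dl * a ^ (2 * l))" .
  qed (use a f in auto)
  moreover have "C * ((D1 + D2) * M^2 * dl) = C * (D1 + D2) * M^2 * dl" by (simp only: mult_ac)
  ultimately show "sqle_m K (br_cut (g 0) dl CARD('n) Y) f a m (C * (D1 + D2) * M^2 * dl)"
   by (subst sqf_weight[OF _ _ pos]) simp_all
 qed
qed

lemma card_nat_between_le:
 assumes "finite S" "!!k. k \<in> S ==> u <= real k \<and> real k <= v" "u <= v"
 shows "real (card S) <= v - u + 1"
proof (cases "S = {}")
 case False
 have "card S <= card {Min S..Max S}" using assms(1) by (intro card_mono) auto
 moreover have "real (Max S) <= v" "u <= real (Min S)" using assms False by auto
 moreover have "Min S <= Max S" using assms(1) False by simp
 ultimately show ?thesis by (simp add: of_nat_diff)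
qed (use assms in simp)

text \<open>For fixed y at most a multiple of 1 + dl exp y degrees contribute, and Cauchy-Schwarz
  over them costs this factor. \<open>hermite_trace\<close> gains the power - \<gamma> / 2 of the
  degree, which is comparable to exp i, and integration in y gives the factor dl.\<close>

lemma sqf_trace:
 assumes \<gamma>: "0 <= \<gamma>" "\<gamma> < 1"
 obtains C where "C > 0" "!!m g M dl Y K i (f :: 'n::finite cfun). profile m M g ==> 0 < dl ==> dl <= 1 / 2 ==>
  Y \<in> sets borel ==> Y \<subseteq> {real i..real i + 1} ==> tempered_L2 f ==>
  (NN x. sqf K (br_cut (g 0) dl CARD('n) Y) f x * ennreal ((1 + norm x) powr (- \<gamma>)))
   <= ennreal (C * M^2 * (dl * (1 + dl * exp (real i)) * exp (real i) powr (- \<gamma> / 2))) * (NN x. csq (f x))"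
proof -
 define n where "n = CARD('n)"
 have n: "n >= 1" by (simp add: n_def Suc_leI)
 obtain C where C: "C > 0" "!!(k::nat) S (d :: ('n => nat) => complex). finite S ==> (!!\<mu>. \<mu> \<in> S ==> sum \<mu> UNIV = k) ==>
  (NN x. csqw (\<Sum>\<mu>\<in>S. d \<mu> * cx (Phi \<mu> x)) ((1 + norm x) powr (- \<gamma>)))
   <= ennreal (C * real (k + 1) powr (- \<gamma> / 2) * (\<Sum>\<mu>\<in>S. (cmod (d \<mu>))^2))"
  using hermite_trace[OF \<gamma>, where ?'n = 'n] by blast
 define D where "D = 2 * (C * (2 * (real n + 2)) * 2)"
 show ?thesis
 proof (rule that)
  show "D > 0" using C(1) by (simp add: D_def add_pos_pos)
  fix m g M Y K i and dl :: real and f :: "'n::finite cfun"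
  assume g: "profile m M g" and dl: "0 < dl" "dl <= 1 / 2" and Y: "Y \<in> sets borel" "Y \<subseteq> {real i..real i + 1}" and f: "tempered_L2 f"
  define \<psi> where "\<psi> = br_cut (g 0) dl n Y"
  have [measurable]: "(%y. \<psi> y k) \<in> borel_measurable borel" for k unfolding \<psi>_def by (rule measurable_br_cut[OF g Y(1)])
  note [measurable] = f
  define E where "E = exp (real i)"
  have E: "E > 0" by (simp add: E_def)
  define P where "P k = {\<mu>::'n => nat. sum \<mu> UNIV = k}" for k
  have fP: "finite (P k)" for k
   by (rule finite_subset[OF _ finite_midx[of "Suc k"]]) (auto simp: P_def midx_def)
  define s where "s k = (\<Sum>\<mu>\<in>P k. (cmod (hcoef f \<mu>))^2)" for k
  have s0: "s k >= 0" for k by (simp add: s_def sum_nonneg)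
  have supp: "y \<in> Y" "2 * real k + real n < exp y" "(1 - dl) * exp y < 2 * real k + real n" if "\<psi> y k \<noteq> 0" for y k
   using that br_mult_support[OF g dl(1), of n y k] by (auto simp: \<psi>_def br_cut_def indicator_def split: if_splits)
  have crd: "real (card {k\<in>{..<K}. \<psi> y k \<noteq> 0}) <= 2 * (1 + dl * E)" for y
  proof (cases "y \<in> Y")
   case True
   have "real (card {k\<in>{..<K}. \<psi> y k \<noteq> 0}) <= (exp y - real n) / 2 - ((1 - dl) * exp y - real n) / 2 + 1"
   proof (rule card_nat_between_le)
    show "((1 - dl) * exp y - real n) / 2 <= real k \<and> real k <= (exp y - real n) / 2" if "k \<in> {k\<in>{..<K}. \<psi> y k \<noteq> 0}" for k
     using supp[of y k] that by auto
    show "((1 - dl) * exp y - real n) / 2 <= (exp y - real n) / 2"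
     using dl mult_right_mono[of "1 - dl" 1 "exp y"] by (intro divide_right_mono diff_right_mono) auto
   qed simp
   also have "... = dl * exp y / 2 + 1" by (simp add: field_simps)
   also have "exp y <= exp 1 * E" unfolding E_def exp_add[symmetric] using True Y(2) by auto
   also have "exp 1 * E <= 4 * E" using exp_le E by (intro mult_right_mono) auto
   finally show ?thesis using dl E by (simp add: algebra_simps)
  next
   case False
   hence none: "{k\<in>{..<K}. \<psi> y k \<noteq> 0} = {}" using supp(1) by auto
   show ?thesis unfolding none using dl E by simp
  qed
  have low: "real (k + 1) powr (- \<gamma> / 2) <= (2 * (real n + 2)) * E powr (- \<gamma> / 2)" if "\<psi> y k \<noteq> 0" for y k
  proof -
   have "E <= exp y" using supp(1)[OF that] Y(2) by (auto simp: E_def)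
   hence "1 / 2 * E <= (1 - dl) * exp y" using dl E by (intro mult_mono) auto
   also have "... <= 2 * real k + real n" using supp(3)[OF that] by simp
   also have "... <= (real n + 2) * real (k + 1)" by (simp add: algebra_simps)
   finally have "E / (2 * (real n + 2)) <= real (k + 1)" by (simp add: field_simps)
   hence "real (k + 1) powr (- \<gamma> / 2) <= (E / (2 * (real n + 2))) powr (- \<gamma> / 2)"
    using E \<gamma> by (intro powr_mono2') auto
   also have "... = (2 * (real n + 2)) powr (\<gamma> / 2) * E powr (- \<gamma> / 2)"
    using E by (simp add: powr_divide powr_minus field_simps)
   also have "... <= (2 * (real n + 2)) powr 1 * E powr (- \<gamma> / 2)"
    using \<gamma> by (intro mult_right_mono powr_mono) auto
   finally show ?thesis by simp
  qed
  have slice: "(NN x. csqw (hmult K (\<psi> y) f x) ((1 + norm x) powr (- \<gamma>)))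
    <= (\<Sum>k<K. ennreal (2 * (1 + dl * E) * (C * (2 * (real n + 2)) * E powr (- \<gamma> / 2)) * s k) * ennreal ((\<psi> y k)^2))" for y
  proof -
   define S where "S = {k\<in>{..<K}. \<psi> y k \<noteq> 0}"
   define p where "p k x = (\<Sum>\<mu>\<in>P k. hcoef f \<mu> * cx (Phi \<mu> x))" for k x
   have [measurable]: "p k \<in> borel_measurable borel" for k unfolding p_def by measurable
   have "hmult K (\<psi> y) f x = (\<Sum>k\<in>S. cx (\<psi> y k) * p k x)" for x
    unfolding hmult_herm_proj S_def p_def herm_proj_def hcoef_def P_def
    by (rule sum.mono_neutral_right) auto
   hence "(cmod (hmult K (\<psi> y) f x))^2 <= 2 * (1 + dl * E) * (\<Sum>k\<in>S. (\<psi> y k)^2 * (cmod (p k x))^2)" for x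
   proof -
    have "(cmod (hmult K (\<psi> y) f x))^2 <= real (card S) * (\<Sum>k\<in>S. (cmod (cx (\<psi> y k) * p k x))^2)"
     unfolding \<open>hmult K (\<psi> y) f x = _\<close> by (rule cmod_sum_square_le)
    also have "... <= 2 * (1 + dl * E) * (\<Sum>k\<in>S. (cmod (cx (\<psi> y k) * p k x))^2)"
     using crd[of y] unfolding S_def[symmetric] by (intro mult_right_mono sum_nonneg) auto
    finally show ?thesis by (simp add: norm_mult power_mult_distrib)
   qed
   hence "(cmod (hmult K (\<psi> y) f x))^2 * (1 + norm x) powr (- \<gamma>)
     <= 2 * (1 + dl * E) * (\<Sum>k\<in>S. (\<psi> y k)^2 * (cmod (p k x))^2) * (1 + norm x) powr (- \<gamma>)" for x
    by (rule mult_right_mono) simp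
   hence "csqw (hmult K (\<psi> y) f x) ((1 + norm x) powr (- \<gamma>))
     <= (\<Sum>k\<in>S. ennreal (2 * (1 + dl * E) * (\<psi> y k)^2) * csqw (p k x) ((1 + norm x) powr (- \<gamma>)))" for x
    using dl E by (simp add: ennreal_mult[symmetric] sum_nonneg sum_distrib_left sum_distrib_right mult_ac ennreal_leI)
   hence "(NN x. csqw (hmult K (\<psi> y) f x) ((1 + norm x) powr (- \<gamma>)))
     <= (NN x. (\<Sum>k\<in>S. ennreal (2 * (1 + dl * E) * (\<psi> y k)^2) * csqw (p k x) ((1 + norm x) powr (- \<gamma>))))"
    by (intro nn_integral_mono)
   also have "... = (\<Sum>k\<in>S. ennreal (2 * (1 + dl * E) * (\<psi> y k)^2) * (NN x. csqw (p k x) ((1 + norm x) powr (- \<gamma>))))"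
    by (simp add: nn_integral_sum nn_integral_cmult)
   also have "... <= (\<Sum>k\<in>S. ennreal (2 * (1 + dl * E) * (\<psi> y k)^2) * ennreal (C * (2 * (real n + 2)) * E powr (- \<gamma> / 2) * s k))"
   proof (intro sum_mono mult_left_mono)
    fix k assume "k \<in> S"
    hence k: "\<psi> y k \<noteq> 0" by (simp add: S_def)
    have "(NN x. csqw (p k x) ((1 + norm x) powr (- \<gamma>))) <= ennreal (C * real (k + 1) powr (- \<gamma> / 2) * s k)"
     unfolding p_def s_def by (rule C(2)[OF fP]) (simp add: P_def)
    also have "... <= ennreal (C * ((2 * (real n + 2)) * E powr (- \<gamma> / 2)) * s k)"
     using low[OF k] C(1) s0 by (intro ennreal_leI mult_right_mono mult_left_mono) auto
    finally show "(NN x. csqw (p k x) ((1 + norm x) powr (- \<gamma>)))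
     <= ennreal (C * (2 * (real n + 2)) * E powr (- \<gamma> / 2) * s k)" by (simp only: mult.assoc)
   qed auto
   also have "... = (\<Sum>k\<in>S. ennreal (2 * (1 + dl * E) * (C * (2 * (real n + 2)) * E powr (- \<gamma> / 2)) * s k) * ennreal ((\<psi> y k)^2))"
   proof (rule sum.cong[OF refl])
    fix k
    have "0 <= 2 * (1 + dl * E) * (\<psi> y k)^2" "0 <= C * (2 * (real n + 2)) * E powr (- \<gamma> / 2) * s k"
     "0 <= 2 * (1 + dl * E) * (C * (2 * (real n + 2)) * E powr (- \<gamma> / 2)) * s k"
     using dl E C(1) s0 by auto
    thus "ennreal (2 * (1 + dl * E) * (\<psi> y k)^2) * ennreal (C * (2 * (real n + 2)) * E powr (- \<gamma> / 2) * s k)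
     = ennreal (2 * (1 + dl * E) * (C * (2 * (real n + 2)) * E powr (- \<gamma> / 2)) * s k) * ennreal ((\<psi> y k)^2)"
     by (simp only: ennreal_mult[symmetric] zero_le_power2) (simp only: mult_ac)
   qed
   also have "... <= (\<Sum>k<K. ennreal (2 * (1 + dl * E) * (C * (2 * (real n + 2)) * E powr (- \<gamma> / 2)) * s k) * ennreal ((\<psi> y k)^2))"
    by (rule sum_mono2) (auto simp: S_def)
   finally show ?thesis .
  qed
  have nonneg: "0 <= (1 + norm x) powr (- \<gamma>)" for x :: "real^'n" by simp
  have "(NN x. sqf K \<psi> f x * ennreal ((1 + norm x) powr (- \<gamma>)))
    = (NN y. (NN x. csqw (hmult K (\<psi> y) f x) ((1 + norm x) powr (- \<gamma>))))"
   by (rule sqf_weight[OF _ _ nonneg]) simp_all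
  also have "... <= (NN y. (\<Sum>k<K. ennreal (2 * (1 + dl * E) * (C * (2 * (real n + 2)) * E powr (- \<gamma> / 2)) * s k) * ennreal ((\<psi> y k)^2)))"
   by (intro nn_integral_mono slice)
  also have "... = (\<Sum>k<K. ennreal (2 * (1 + dl * E) * (C * (2 * (real n + 2)) * E powr (- \<gamma> / 2)) * s k) * (NN y. ennreal ((\<psi> y k)^2)))"
   by (simp add: nn_integral_sum nn_integral_cmult)
  also have "... <= (\<Sum>k<K. ennreal (2 * (1 + dl * E) * (C * (2 * (real n + 2)) * E powr (- \<gamma> / 2)) * s k) * ennreal (2 * dl * M^2))"
   unfolding \<psi>_def by (intro sum_mono mult_left_mono integral_br_cut[OF g dl n]) auto
  also have "... = (\<Sum>k<K. ennreal (D * M^2 * (dl * (1 + dl * E) * E powr (- \<gamma> / 2))) * ennreal (s k))"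
  proof (rule sum.cong[OF refl])
   fix k
   have "0 <= 2 * (1 + dl * E) * (C * (2 * (real n + 2)) * E powr (- \<gamma> / 2)) * s k" "0 <= 2 * dl * M^2"
    "0 <= D * M^2 * (dl * (1 + dl * E) * E powr (- \<gamma> / 2))"
    using dl E C(1) s0 \<open>D > 0\<close> by auto
   thus "ennreal (2 * (1 + dl * E) * (C * (2 * (real n + 2)) * E powr (- \<gamma> / 2)) * s k) * ennreal (2 * dl * M^2)
    = ennreal (D * M^2 * (dl * (1 + dl * E) * E powr (- \<gamma> / 2))) * ennreal (s k)"
    by (simp only: ennreal_mult[symmetric] s0) (simp only: mult_ac D_def)
  qed
  also have "... = ennreal (D * M^2 * (dl * (1 + dl * E) * E powr (- \<gamma> / 2))) * ennreal (\<Sum>k<K. s k)"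
   by (simp add: sum_distrib_left[symmetric] s0)
  also have "(\<Sum>k<K. s k) = (\<Sum>\<mu>\<in>midx K. (cmod (hcoef f \<mu>))^2)"
  proof -
   have "(\<Sum>k<K. s k) = (\<Sum>k<K. \<Sum>\<mu>\<in>{\<mu>\<in>midx K. sum \<mu> UNIV = k}. (cmod (hcoef f \<mu>))^2)"
    unfolding s_def P_def by (intro sum.cong) (auto simp: midx_def)
   also have "... = (\<Sum>\<mu>\<in>midx K. (cmod (hcoef f \<mu>))^2)"
    by (rule sum.group[OF finite_midx]) (auto simp: midx_def)
   finally show ?thesis .
  qed
  also have "ennreal (D * M^2 * (dl * (1 + dl * E) * E powr (- \<gamma> / 2))) * ennreal (\<Sum>\<mu>\<in>midx K. (cmod (hcoef f \<mu>))^2)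
    <= ennreal (D * M^2 * (dl * (1 + dl * E) * E powr (- \<gamma> / 2))) * (NN x. csq (f x))"
   by (intro mult_left_mono hermite_bessel finite_midx) (use f in auto)
  finally show "(NN x. sqf K (br_cut (g 0) dl CARD('n) Y) f x * ennreal ((1 + norm x) powr (- \<gamma>)))
   <= ennreal (D * M^2 * (dl * (1 + dl * exp (real i)) * exp (real i) powr (- \<gamma> / 2))) * (NN x. csq (f x))"
   unfolding \<psi>_def n_def E_def .
 qed
qed

section \<open>Weighted square functions on one block\<close>

lemma powr_interpolate: "p > 0 ==> X > 0 ==> (p * X) powr (1 - th) * p powr th = p * X powr (1 - th)" for p X th :: real
proof -
 assume p: "p > 0" "X > 0"
 have "(p * X) powr (1 - th) * p powr th = (p powr (1 - th) * p powr th) * X powr (1 - th)"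
  using p by (simp add: powr_mult)
 also have "p powr (1 - th) * p powr th = p" using p by (simp flip: powr_add)
 finally show ?thesis .
qed

lemma inverse_power_powr: "b > 0 ==> m > 0 ==> (1 / b ^ (2 * m)) powr (al / (2 * real m)) = b powr (- al)" for b al :: real
 by (simp add: powr_divide powr_powr powr_minus_divide flip: powr_realpow)

lemma ennreal_mult_right_mono_le: "A <= ennreal p * F ==> p <= q ==> A <= ennreal q * F"
 by (meson ennreal_leI mult_right_mono order_trans zero_le)

text \<open>The movement theorem handles the exponent \<open>2 * m\<close>; interpolation with the
  unweighted bound reaches every smaller one, and the constant keeps its form since both endpoints
  have size M^2 dl.\<close>

lemma sqf_movement_weighted:
 assumes "even m" "0 < al" "al < 2 * real m"
 obtains C where "C > 0" "!!g M dl Y K a (f :: 'n::finite cfun). profile m M g ==> M > 0 ==> 0 < dl ==> dl <= 1 / 2 ==>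
  Y \<in> sets borel ==> Y \<subseteq> (upto_deg K CARD('n)) ==> a >= 1 ==>
  scale_ok dl a Y ==> tempered_L2 f ==>
  sqle_a K (br_cut (g 0) dl CARD('n) Y) f a al (C * M^2 * dl)"
proof -
 obtain C1 where C1: "C1 > 0" "!!g M dl Y K a (f :: 'n::finite cfun). profile m M g ==> 0 < dl ==> dl <= 1 / 2 ==>
  Y \<in> sets borel ==> Y \<subseteq> (upto_deg K CARD('n)) ==> a >= 1 ==>
  scale_ok dl a Y ==> tempered_L2 f ==>
  sqle_m K (br_cut (g 0) dl CARD('n) Y) f a m (C1 * M^2 * dl)"
  using sqf_movement[OF assms(1), where ?'n = 'n] by blast
 define th where "th = al / (2 * real m)"
 have m: "m > 0" using assms by (cases m) auto
 have th: "0 < th" "th < 1" using assms m by (auto simp: th_def)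
 define D where "D = C1 + 2"
 show ?thesis
 proof (rule that)
  show "2 * D > 0" using C1(1) by (simp add: D_def)
  fix g M Y K and a dl :: real and f :: "'n cfun"
  assume g: "profile m M g" and M: "M > 0" and dl: "0 < dl" "dl <= 1 / 2" and Y: "Y \<in> sets borel" "Y \<subseteq> (upto_deg K CARD('n))"
   and a: "a >= 1" and alt: "scale_ok dl a Y" and f: "tempered_L2 f"
  define p where "p = D * M^2 * dl"
  have p: "p > 0" using C1(1) M dl by (simp add: p_def D_def)
  have pos: "0 < 1 + norm x / a" for x :: "real^'n" using a by (intro add_pos_nonneg) auto
  have "(NN x. sqf K (br_cut (g 0) dl CARD('n) Y) f x * ennreal (1 powr (1 - th) * (1 / (1 + norm x / a) ^ (2 * m)) powr th))
   <= ennreal (2 * (p powr (1 - th) * p powr th)) * (NN x. csqw (f x) (1 powr (1 - th) * (1 / (1 + norm x / a) ^ (2 * m)) powr th))"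
  proof (rule sqf_interpolation[where ?v0.0 = "%_. 1" and ?w0.0 = "%_. 1"])
   show "(%y. br_cut (g 0) dl CARD('n) Y y k) \<in> borel_measurable borel" for k by (rule measurable_br_cut[OF g Y(1)])
   fix f :: "'n cfun" assume f: "tempered_L2 f"
   have "2 * M^2 * dl <= p" "C1 * M^2 * dl <= p"
    unfolding p_def D_def using C1(1) dl by (auto intro!: mult_right_mono)
   with sqf_L2[OF g dl Y(1) f, of K] C1(2)[OF g dl Y a alt f]
   show "(NN x. sqf K (br_cut (g 0) dl CARD('n) Y) f x * ennreal 1) <= ennreal p * (NN x. csqw (f x) 1)"
    "sqle_m K (br_cut (g 0) dl CARD('n) Y) f a m p"
    by (simp_all only: ennreal_1 mult_1_right ennreal_mult_right_mono_le)
  qed (use th p pos f in auto)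
  moreover have "2 * (p powr (1 - th) * p powr th) = 2 * D * M^2 * dl"
   using powr_interpolate[OF p, of 1 th] by (simp add: p_def)
  moreover have "(1 / (1 + norm x / a) ^ (2 * m)) powr th = (1 + norm x / a) powr (- al)" for x :: "real^'n"
   unfolding th_def by (rule inverse_power_powr[OF pos m])
  ultimately show "sqle_a K (br_cut (g 0) dl CARD('n) Y) f a al (2 * D * M^2 * dl)"
   by simp
 qed
qed

text \<open>Interpolates the trace bound at exponent 1 - th with the movement bound at exponent 2 m.
  At parameter th the far decay is exactly al, while the near weight keeps the exponent (1 - th)^2,
  close to 1 for large m. Reusing th keeps the trace exponent below 1 with a single
  parameter.\<close>

lemma sqf_trace_weighted:
 assumes "even m" "0 < al" "al < 2 * real m" and th: "th = al / (2 * real m)"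
 obtains C where "C > 0" "!!g M dl Y K a i (f :: 'n::finite cfun). profile m M g ==> M > 0 ==> 0 < dl ==> dl <= 1 / 2 ==>
  Y \<in> sets borel ==> Y \<subseteq> (upto_deg K CARD('n)) ==> Y \<subseteq> {real i..real i + 1} ==> a >= 1 ==>
  scale_ok dl a Y ==> tempered_L2 f ==>
  (NN x. sqf K (br_cut (g 0) dl CARD('n) Y) f x * ennreal (((1 + norm x) powr (- (1 - th))) powr (1 - th) * (1 + norm x / a) powr (- al)))
   <= ennreal (C * M^2 * dl * ((1 + dl * exp (real i)) * exp (real i) powr (- (1 - th) / 2)) powr (1 - th))
    * (NN x. csqw (f x) ((1 + norm x / a) powr (- al)))"
proof -
 obtain C1 where C1: "C1 > 0" "!!g M dl Y K a (f :: 'n::finite cfun). profile m M g ==> 0 < dl ==> dl <= 1 / 2 ==>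
  Y \<in> sets borel ==> Y \<subseteq> (upto_deg K CARD('n)) ==> a >= 1 ==>
  scale_ok dl a Y ==> tempered_L2 f ==>
  sqle_m K (br_cut (g 0) dl CARD('n) Y) f a m (C1 * M^2 * dl)"
  using sqf_movement[OF assms(1), where ?'n = 'n] by blast
 have m: "m > 0" using assms by (cases m) auto
 have th01: "0 < th" "th < 1" using assms m by (auto simp: th)
 have "0 <= 1 - th" "1 - th < 1" using th01 by auto
 from sqf_trace[OF this, where ?'n = 'n] obtain C0 where C0: "C0 > 0" "!!m g M dl Y K i (f :: 'n::finite cfun). profile m M g ==> 0 < dl ==> dl <= 1 / 2 ==>
  Y \<in> sets borel ==> Y \<subseteq> {real i..real i + 1} ==> tempered_L2 f ==>
  (NN x. sqf K (br_cut (g 0) dl CARD('n) Y) f x * ennreal ((1 + norm x) powr (- (1 - th))))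
   <= ennreal (C0 * M^2 * (dl * (1 + dl * exp (real i)) * exp (real i) powr (- (1 - th) / 2))) * (NN x. csq (f x))"
  by blast
 define D where "D = C1 + C0"
 show ?thesis
 proof (rule that)
  show "2 * D > 0" using C1(1) C0(1) by (simp add: D_def)
  fix g M Y K i and a dl :: real and f :: "'n cfun"
  assume g: "profile m M g" and M: "M > 0" and dl: "0 < dl" "dl <= 1 / 2" and Y: "Y \<in> sets borel" "Y \<subseteq> (upto_deg K CARD('n))"
   and Yi: "Y \<subseteq> {real i..real i + 1}"
   and a: "a >= 1" and alt: "scale_ok dl a Y" and f: "tempered_L2 f"
  define p where "p = D * M^2 * dl"
  have p: "p > 0" using C1(1) C0(1) M dl by (simp add: p_def D_def)
  define X where "X = (1 + dl * exp (real i)) * exp (real i) powr (- (1 - th) / 2)"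
  have X: "X > 0" unfolding X_def using dl by (intro mult_pos_pos add_pos_pos) auto
  have pos: "0 < 1 + norm x / a" for x :: "real^'n" using a by (intro add_pos_nonneg) auto
  have pos1: "0 < (1 + norm x) powr (- (1 - th))" for x :: "real^'n" by (simp add: add_pos_nonneg less_imp_neq[symmetric])
  have "(NN x. sqf K (br_cut (g 0) dl CARD('n) Y) f x * ennreal (((1 + norm x) powr (- (1 - th))) powr (1 - th) * (1 / (1 + norm x / a) ^ (2 * m)) powr th))
   <= ennreal (2 * ((p * X) powr (1 - th) * p powr th)) * (NN x. csqw (f x) (1 powr (1 - th) * (1 / (1 + norm x / a) ^ (2 * m)) powr th))"
  proof (rule sqf_interpolation[where ?v0.0 = "%_. 1"])
   show "(%y. br_cut (g 0) dl CARD('n) Y y k) \<in> borel_measurable borel" for k by (rule measurable_br_cut[OF g Y(1)])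
   fix f :: "'n cfun" assume f: "tempered_L2 f"
   have "(C0 * M^2 * dl) * X <= p * X" "C1 * M^2 * dl <= p"
    unfolding p_def D_def using C0(1) C1(1) dl X by (auto intro!: mult_right_mono)
   moreover have "(C0 * M^2 * dl) * X = C0 * M^2 * (dl * (1 + dl * exp (real i)) * exp (real i) powr (- (1 - th) / 2))"
    unfolding X_def by (simp only: mult.assoc)
   ultimately show "(NN x. sqf K (br_cut (g 0) dl CARD('n) Y) f x * ennreal ((1 + norm x) powr (- (1 - th)))) <= ennreal (p * X) * (NN x. csqw (f x) 1)"
    "sqle_m K (br_cut (g 0) dl CARD('n) Y) f a m p"
    using C0(2)[OF g dl Y(1) Yi f, of K] C1(2)[OF g dl Y a alt f]
    by (simp_all only: mult_1_right ennreal_mult_right_mono_le)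
  qed (use th01 p X pos pos1 f in auto)
  moreover have "2 * ((p * X) powr (1 - th) * p powr th) = 2 * D * M^2 * dl * X powr (1 - th)"
   unfolding powr_interpolate[OF p X] by (simp add: p_def)
  moreover have "(1 / (1 + norm x / a) ^ (2 * m)) powr th = (1 + norm x / a) powr (- al)" for x :: "real^'n"
   unfolding th by (rule inverse_power_powr[OF pos m])
  ultimately show "(NN x. sqf K (br_cut (g 0) dl CARD('n) Y) f x * ennreal (((1 + norm x) powr (- (1 - th))) powr (1 - th) * (1 + norm x / a) powr (- al)))
   <= ennreal (2 * D * M^2 * dl * ((1 + dl * exp (real i)) * exp (real i) powr (- (1 - th) / 2)) powr (1 - th))
    * (NN x. csqw (f x) ((1 + norm x / a) powr (- al)))"
   unfolding X_def by (simp only: powr_one_eq_one mult_1)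
 qed
qed

lemma mult_left_le_le: "1 <= y ==> 0 <= x ==> x <= x * (y::real)"
 using mult_left_mono[of 1 y x] by simp

text \<open>Within radius a the near weight wins, because (1 - th)^2 <= 1 <= al and the scaled
  factor is bounded below there. Outside, 1 + |x| >= (a + |x|) / 2, and the weight is up to a
  constant a powr (- al) times its scaled version.\<close>

lemma weight_le_local_far:
 assumes "1 <= al" "0 <= th" "th <= 1" "a >= 1"
 shows "(1 + norm x) powr (- al) <= 2 powr al * (((1 + norm x) powr (- (1 - th))) powr (1 - th) * (1 + norm x / a) powr (- al)
  + a powr (- al) * (1 + norm x / a) powr (- al))"
proof -
 define r where "r = norm x"
 have r: "r >= 0" by (simp add: r_def)
 have "(1 + r) powr (- al) <= 2 powr al * (((1 + r) powr (- (1 - th))) powr (1 - th) * (1 + r / a) powr (- al)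
  + a powr (- al) * (1 + r / a) powr (- al))"
 proof (cases "r <= a")
  case True
  have "(1 + r) powr (- al) <= (1 + r) powr (- ((1 - th) * (1 - th)))"
   using assms r mult_mono[of "1 - th" 1 "1 - th" 1] by (intro powr_mono) auto
  also have "... = ((1 + r) powr (- (1 - th))) powr (1 - th)" by (simp add: powr_powr algebra_simps)
  also have "... <= ((1 + r) powr (- (1 - th))) powr (1 - th) * (2 powr al * (1 + r / a) powr (- al))"
  proof (rule mult_left_le_le)
   have "2 powr (- al) <= (1 + r / a) powr (- al)" using assms r True by (intro powr_mono2') (auto simp: add_pos_nonneg)
   hence "2 powr al * 2 powr (- al) <= 2 powr al * (1 + r / a) powr (- al)" by (rule mult_left_mono) simp
   thus "1 <= 2 powr al * (1 + r / a) powr (- al)" by (simp flip: powr_add)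
  qed simp
  finally have "(1 + r) powr (- al) <= 2 powr al * (((1 + r) powr (- (1 - th))) powr (1 - th) * (1 + r / a) powr (- al))" by (simp only: mult_ac)
  also have "... <= 2 powr al * (((1 + r) powr (- (1 - th))) powr (1 - th) * (1 + r / a) powr (- al)
   + a powr (- al) * (1 + r / a) powr (- al))" by (intro mult_left_mono) auto
  finally show ?thesis .
 next
  case False
  hence "(a + r) / 2 <= 1 + r" by simp
  hence "(1 + r) powr (- al) <= ((a + r) / 2) powr (- al)" using assms r by (intro powr_mono2') auto
  also have "(a + r) / 2 = 1 / 2 * (a * (1 + r / a))" using assms by (simp add: field_simps)
  also have "... powr (- al) = 2 powr al * (a powr (- al) * (1 + r / a) powr (- al))"
  proof -
   have half: "(1 / 2) powr (- al) = 2 powr al" by (simp add: powr_divide powr_minus_divide)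
   have "0 <= 1 + r / a" using assms r by simp
   hence "(a * (1 + r / a)) powr (- al) = a powr (- al) * (1 + r / a) powr (- al)" "0 <= a * (1 + r / a)"
    using assms by (simp_all only: powr_mult) simp_all
   thus ?thesis using powr_mult[of "1 / 2" "a * (1 + r / a)" "- al"] half by simp
  qed
  also have "... <= 2 powr al * (((1 + r) powr (- (1 - th))) powr (1 - th) * (1 + r / a) powr (- al)
   + a powr (- al) * (1 + r / a) powr (- al))" by (intro mult_left_mono) auto
  finally show ?thesis .
 qed
 thus ?thesis by (simp only: r_def)
qed

lemma scaled_weight_le:
 assumes "0 <= al" "a >= 1"
 shows "(1 + norm x / a) powr (- al) <= a powr al * (1 + norm x) powr (- al)"
proof -
 have "1 + norm x <= a * (1 + norm x / a)" using assms by (simp add: distrib_left)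
 hence "(a * (1 + norm x / a)) powr (- al) <= (1 + norm x) powr (- al)"
  using assms by (intro powr_mono2') (auto simp: add_pos_nonneg)
 moreover have "(a * (1 + norm x / a)) powr (- al) = a powr (- al) * (1 + norm x / a) powr (- al)"
  using assms by (subst powr_mult) auto
 ultimately have "a powr al * (a powr (- al) * (1 + norm x / a) powr (- al)) <= a powr al * (1 + norm x) powr (- al)"
  by (intro mult_left_mono) auto
 thus ?thesis using assms by (simp add: mult.assoc[symmetric] flip: powr_add)
qed

text \<open>The near part pays a powr al for returning from the scaled weight to the original one;
  in the far part this cancels against a powr (- al), which leaves the summand 1.\<close>

lemma sqf_block:
 assumes "even m" "1 <= al" "al < 2 * real m" and th: "th = al / (2 * real m)"
 obtains C where "C > 0" "!!g M dl Y K a i (f :: 'n::finite cfun). profile m M g ==> M > 0 ==> 0 < dl ==> dl <= 1 / 2 ==>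
  Y \<in> sets borel ==> Y \<subseteq> (upto_deg K CARD('n)) ==> Y \<subseteq> {real i..real i + 1} ==> a >= 1 ==>
  scale_ok dl a Y ==> tempered_L2 f ==>
  sqle K (br_cut (g 0) dl CARD('n) Y) f al (C * M^2 * dl * (((1 + dl * exp (real i)) * exp (real i) powr (- (1 - th) / 2)) powr (1 - th) * a powr al + 1))"
proof -
 have al0: "0 < al" using assms by simp
 have th01: "0 <= th" "th <= 1" using assms al0 by (auto simp: th)
 obtain C1 where C1: "C1 > 0" "!!g M dl Y K a (f :: 'n::finite cfun). profile m M g ==> M > 0 ==> 0 < dl ==> dl <= 1 / 2 ==>
  Y \<in> sets borel ==> Y \<subseteq> (upto_deg K CARD('n)) ==> a >= 1 ==>
  scale_ok dl a Y ==> tempered_L2 f ==>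
  sqle_a K (br_cut (g 0) dl CARD('n) Y) f a al (C1 * M^2 * dl)"
  using sqf_movement_weighted[OF assms(1) al0 assms(3), where ?'n = 'n] by blast
 obtain C0 where C0: "C0 > 0" "!!g M dl Y K a i (f :: 'n::finite cfun). profile m M g ==> M > 0 ==> 0 < dl ==> dl <= 1 / 2 ==>
  Y \<in> sets borel ==> Y \<subseteq> (upto_deg K CARD('n)) ==> Y \<subseteq> {real i..real i + 1} ==> a >= 1 ==>
  scale_ok dl a Y ==> tempered_L2 f ==>
  (NN x. sqf K (br_cut (g 0) dl CARD('n) Y) f x * ennreal (((1 + norm x) powr (- (1 - th))) powr (1 - th) * (1 + norm x / a) powr (- al)))
   <= ennreal (C0 * M^2 * dl * ((1 + dl * exp (real i)) * exp (real i) powr (- (1 - th) / 2)) powr (1 - th))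
    * (NN x. csqw (f x) ((1 + norm x / a) powr (- al)))"
  using sqf_trace_weighted[OF assms(1) al0 assms(3,4), where ?'n = 'n] by blast
 define D where "D = 2 powr al * (C1 + C0)"
 show ?thesis
 proof (rule that)
  show "D > 0" using C1(1) C0(1) by (simp add: D_def)
  fix g M Y K i and a dl :: real and f :: "'n cfun"
  assume g: "profile m M g" and M: "M > 0" and dl: "0 < dl" "dl <= 1 / 2" and Y: "Y \<in> sets borel" "Y \<subseteq> (upto_deg K CARD('n))"
   and Yi: "Y \<subseteq> {real i..real i + 1}"
   and a: "a >= 1" and alt: "scale_ok dl a Y" and f: "tempered_L2 f"
  define q where "q = sqf K (br_cut (g 0) dl CARD('n) Y) f"
  have [measurable]: "q \<in> borel_measurable borel" unfolding q_def by (intro measurable_sqf measurable_br_cut[OF g Y(1)])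
  note [measurable] = f
  define w1 where "w1 x = (1 + norm x / a) powr (- al)" for x :: "real^'n"
  define w0 where "w0 x = ((1 + norm x) powr (- (1 - th))) powr (1 - th) * w1 x" for x :: "real^'n"
  have [measurable]: "w1 \<in> borel_measurable borel" "w0 \<in> borel_measurable borel" unfolding w0_def w1_def by measurable
  have w: "w1 x >= 0" "w0 x >= 0" for x by (auto simp: w0_def w1_def)
  define X where "X = ((1 + dl * exp (real i)) * exp (real i) powr (- (1 - th) / 2)) powr (1 - th)"
  have X: "X >= 0" unfolding X_def by simp
  define F where "F = (NN x. csqw (f x) (w1 x))"
  define G where "G = (wnorm al f)"
  have FG: "F <= ennreal (a powr al) * G"
  proof -
   have "F <= (NN x. ennreal (a powr al) * csqw (f x) ((1 + norm x) powr (- al)))"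
    unfolding F_def
   proof (rule nn_integral_mono)
    fix x :: "real^'n"
    have "(cmod (f x))^2 * w1 x <= (cmod (f x))^2 * (a powr al * (1 + norm x) powr (- al))"
     unfolding w1_def using scaled_weight_le[of al a x] al0 a by (intro mult_left_mono) auto
    thus "csqw (f x) (w1 x) <= ennreal (a powr al) * csqw (f x) ((1 + norm x) powr (- al))"
     by (subst ennreal_mult[symmetric]) (auto intro!: ennreal_leI simp: mult_ac)
   qed
   thus ?thesis unfolding G_def by (simp add: nn_integral_cmult)
  qed
  have "(NN x. q x * ennreal ((1 + norm x) powr (- al)))
    <= (NN x. ennreal (2 powr al) * (q x * ennreal (w0 x)) + ennreal (2 powr al * a powr (- al)) * (q x * ennreal (w1 x)))"
  proof (rule nn_integral_mono)
   fix x :: "real^'n"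
   have "ennreal ((1 + norm x) powr (- al)) <= ennreal (2 powr al * w0 x + 2 powr al * a powr (- al) * w1 x)"
    using weight_le_local_far[OF assms(2) th01 a, of x] unfolding w0_def w1_def
    by (intro ennreal_leI) (simp add: distrib_left mult_ac)
   also have "... = ennreal (2 powr al) * ennreal (w0 x) + ennreal (2 powr al * a powr (- al)) * ennreal (w1 x)"
    using w[of x] by (simp add: ennreal_plus ennreal_mult)
   finally have "q x * ennreal ((1 + norm x) powr (- al)) <= q x * (ennreal (2 powr al) * ennreal (w0 x) + ennreal (2 powr al * a powr (- al)) * ennreal (w1 x))"
    by (rule mult_left_mono) simp
   thus "q x * ennreal ((1 + norm x) powr (- al)) <= ennreal (2 powr al) * (q x * ennreal (w0 x)) + ennreal (2 powr al * a powr (- al)) * (q x * ennreal (w1 x))"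
    by (simp only: distrib_left mult_ac)
  qed
  also have "... = ennreal (2 powr al) * (NN x. q x * ennreal (w0 x)) + ennreal (2 powr al * a powr (- al)) * (NN x. q x * ennreal (w1 x))"
   by (subst nn_integral_add, measurable, subst (1 2) nn_integral_cmult, measurable)
  also have "... <= ennreal (2 powr al) * (ennreal (C0 * M^2 * dl * X) * F) + ennreal (2 powr al * a powr (- al)) * (ennreal (C1 * M^2 * dl) * F)"
   using C0(2)[OF g M dl Y Yi a alt f] C1(2)[OF g M dl Y a alt f]
   unfolding q_def F_def w0_def w1_def X_def by (intro add_mono mult_left_mono) auto
  also have "... = ennreal (2 powr al * (C0 * M^2 * dl * X) + 2 powr al * a powr (- al) * (C1 * M^2 * dl)) * F"
   using C0(1) C1(1) dl X by (simp add: ennreal_plus ennreal_mult distrib_right mult.assoc)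
  also have "... <= ennreal (2 powr al * (C0 * M^2 * dl * X) + 2 powr al * a powr (- al) * (C1 * M^2 * dl)) * (ennreal (a powr al) * G)"
   by (intro mult_left_mono FG) simp
  also have "... = ennreal ((2 powr al * (C0 * M^2 * dl * X) + 2 powr al * a powr (- al) * (C1 * M^2 * dl)) * a powr al) * G"
   by (simp add: ennreal_mult'' mult.assoc)
  also have "(2 powr al * (C0 * M^2 * dl * X) + 2 powr al * a powr (- al) * (C1 * M^2 * dl)) * a powr al
    = (2 powr al * M^2 * dl) * (C0 * (X * a powr al) + C1)"
  proof -
   have "a powr (- al) * a powr al = 1" using a by (simp flip: powr_add)
   thus ?thesis by algebra
  qed
  also have "ennreal ... * G <= ennreal (D * M^2 * dl * (X * a powr al + 1)) * G"
  proof (intro mult_right_mono ennreal_leI)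
   have "C0 * (X * a powr al) + C1 <= (C1 + C0) * (X * a powr al + 1)"
    using C0(1) C1(1) X by (simp add: algebra_simps)
   hence "(2 powr al * M^2 * dl) * (C0 * (X * a powr al) + C1) <= (2 powr al * M^2 * dl) * ((C1 + C0) * (X * a powr al + 1))"
    using dl by (intro mult_left_mono) auto
   thus "(2 powr al * M^2 * dl) * (C0 * (X * a powr al) + C1) <= D * M^2 * dl * (X * a powr al + 1)"
    unfolding D_def by (simp only: mult_ac)
  qed simp
  finally show "sqle K (br_cut (g 0) dl CARD('n) Y) f al (D * M^2 * dl * (((1 + dl * exp (real i)) * exp (real i) powr (- (1 - th) / 2)) powr (1 - th) * a powr al + 1))"
   unfolding q_def X_def G_def .
 qed
qed

section \<open>Choice of the distance a and summation over blocks\<close>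

lemma sqf_le_sum:
 fixes f :: "'n::finite cfun"
 assumes g: "profile m M g" and dl: "dl > 0" and n: "n >= 1" and J: "finite J" and Z: "!!j. Z j \<in> sets borel"
  and cov: "!!y. y \<in> Y ==> y > 0 ==> \<exists>j\<in>J. y \<in> Z j"
 shows "sqf K (br_cut (g 0) dl n Y) f x <= (\<Sum>j\<in>J. sqf K (br_cut (g 0) dl n (Z j)) f x)"
proof -
 have ht: "hmult K (br_cut (g 0) dl n Y y) f x = cx (indicator Y y) * hmult K (br_mult (g 0) dl n y) f x" for Y y
  unfolding hmult_def br_cut_def by (simp add: sum_distrib_left mult_ac)
 have [measurable]: "(%y. csq (hmult K (br_cut (g 0) dl n (Z j) y) f x)) \<in> borel_measurable borel" for j
  unfolding hmult_def using measurable_br_cut[OF g Z] by measurable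
 have "sqf K (br_cut (g 0) dl n Y) f x <= (NN y. (\<Sum>j\<in>J. csq (hmult K (br_cut (g 0) dl n (Z j) y) f x)))"
  unfolding sqf_def
 proof (rule nn_integral_mono)
  fix y
  show "csq (hmult K (br_cut (g 0) dl n Y y) f x) <= (\<Sum>j\<in>J. csq (hmult K (br_cut (g 0) dl n (Z j) y) f x))"
  proof (cases "y \<in> Y \<and> y > 0")
   case True
   then obtain j where j: "j \<in> J" "y \<in> Z j" using cov by blast
   have "hmult K (br_cut (g 0) dl n Y y) f x = hmult K (br_cut (g 0) dl n (Z j) y) f x"
    unfolding ht using True j by simp
   thus ?thesis using member_le_sum[of j J "%j. csq (hmult K (br_cut (g 0) dl n (Z j) y) f x)"] j J by simp
  next
   case False
   \<comment> \<open>All eigenvalues are at least 1, so nothing happens while exp y <= 1, and the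
     blocks need to cover positive y only.\<close>
   have "br_mult (g 0) dl n y k = 0" if "y <= 0" for k
   proof (rule ccontr)
    assume "br_mult (g 0) dl n y k \<noteq> 0"
    from br_mult_support(1)[OF g dl this] have "2 * real k + real n < exp y" .
    also have "... <= 1" using that by simp
    finally show False using n by simp
   qed
   hence "hmult K (br_cut (g 0) dl n Y y) f x = 0"
    using False by (cases "y \<in> Y") (auto simp: hmult_def br_cut_def)
   thus ?thesis by simp
  qed
 qed
 also have "... = (\<Sum>j\<in>J. sqf K (br_cut (g 0) dl n (Z j)) f x)"
  unfolding sqf_def by (rule nn_integral_sum) measurable
 finally show ?thesis .
qed

text \<open>The regime E <= 1 / dl with a^2 = e E, the largest energy on the block. The power of E
  is nonnegative, so E = 1 / dl is the worst case.\<close>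

lemma block_low:
 fixes dl E th al :: real
 assumes "0 < dl" "E >= 1" "dl * E <= 1" "0 <= th" "th <= 1" "al >= 1"
 shows "((1 + dl * E) * E powr (- (1 - th) / 2)) powr (1 - th) * (exp 1 * E) powr (al / 2)
  <= 2 * exp (al / 2) * (1 / dl) powr ((al - (1 - th) * (1 - th)) / 2)"
proof -
 define \<sigma> where "\<sigma> = (1 - th) * (1 - th)"
 have \<sigma>: "0 <= \<sigma>" "\<sigma> <= 1" using assms mult_mono[of "1 - th" 1 "1 - th" 1] by (auto simp: \<sigma>_def)
 have "(1 + dl * E) powr (1 - th) <= 2 powr (1 - th)" using assms by (intro powr_mono2) auto
 also have "... <= 2 powr 1" using assms by (intro powr_mono) auto
 finally have 1: "(1 + dl * E) powr (1 - th) <= 2" by simp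
 have "(E powr (- (1 - th) / 2)) powr (1 - th) = E powr (- \<sigma> / 2)" by (simp add: powr_powr \<sigma>_def algebra_simps)
 moreover have "(exp 1 * E) powr (al / 2) = exp (al / 2) * E powr (al / 2)" by (simp add: powr_mult exp_powr_real)
 ultimately have "((1 + dl * E) * E powr (- (1 - th) / 2)) powr (1 - th) * (exp 1 * E) powr (al / 2)
   = (1 + dl * E) powr (1 - th) * (exp (al / 2) * (E powr (- \<sigma> / 2) * E powr (al / 2)))"
  by (simp only: powr_mult mult_ac)
 also have "E powr (- \<sigma> / 2) * E powr (al / 2) = E powr ((al - \<sigma>) / 2)"
  using assms by (simp add: diff_divide_distrib flip: powr_add)
 also have "(1 + dl * E) powr (1 - th) * (exp (al / 2) * E powr ((al - \<sigma>) / 2)) <= 2 * (exp (al / 2) * (1 / dl) powr ((al - \<sigma>) / 2))"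
 proof (rule mult_mono[OF 1])
  have "E <= 1 / dl" using assms by (simp add: field_simps)
  thus "exp (al / 2) * E powr ((al - \<sigma>) / 2) <= exp (al / 2) * (1 / dl) powr ((al - \<sigma>) / 2)"
   using assms \<sigma> by (intro mult_left_mono powr_mono2) auto
 qed auto
 finally show ?thesis by (simp add: \<sigma>_def mult.assoc)
qed

text \<open>The regime E >= 1 / dl with a^2 = (1 / dl)^2 / E. Now 1 + dl E is of order dl E and the
  total power of E is nonpositive, so again E = 1 / dl is the worst case.\<close>

lemma block_mid:
 fixes dl E th al :: real
 assumes "0 < dl" "E >= 1 / dl" "0 <= th" "th <= 1" "al >= 1"
 shows "((1 + dl * E) * E powr (- (1 - th) / 2)) powr (1 - th) * ((1 / dl)^2 / E) powr (al / 2)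
  <= 2 * (1 / dl) powr ((al - (1 - th) * (1 - th)) / 2)"
proof -
 define \<sigma> where "\<sigma> = (1 - th) * (1 - th)"
 define U where "U = 1 / dl"
 have U: "U > 0" "dl = 1 / U" "U <= E" using assms by (auto simp: U_def)
 have E: "E > 0" using U by simp
 have "1 + dl * E <= 2 * (E / U)" using U by (simp add: field_simps)
 hence "(1 + dl * E) powr (1 - th) <= (2 * (E / U)) powr (1 - th)" using assms E by (intro powr_mono2) auto
 also have "... = 2 powr (1 - th) * (E / U) powr (1 - th)" by (rule powr_mult)
 also have "... <= 2 powr 1 * (E / U) powr (1 - th)" using assms by (intro mult_right_mono powr_mono) auto
 also have "(E / U) powr (1 - th) = E powr (1 - th) * U powr (- (1 - th))"
  by (simp only: powr_divide powr_minus) (simp only: divide_inverse)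
 finally have 1: "(1 + dl * E) powr (1 - th) <= 2 * (E powr (1 - th) * U powr (- (1 - th)))" by simp
 have 2: "(E powr (- (1 - th) / 2)) powr (1 - th) = E powr (- \<sigma> / 2)" by (simp add: powr_powr \<sigma>_def algebra_simps)
 have 3: "(U^2 / E) powr (al / 2) = U powr al * E powr (- al / 2)"
 proof -
  have "U^2 = U powr 2" using U by (simp add: powr_numeral)
  thus ?thesis by (simp add: powr_divide powr_minus_divide powr_powr)
 qed
 have "((1 + dl * E) * E powr (- (1 - th) / 2)) powr (1 - th) * (U^2 / E) powr (al / 2)
   = (1 + dl * E) powr (1 - th) * (E powr (- \<sigma> / 2) * (U powr al * E powr (- al / 2)))"
  unfolding 3 powr_mult 2 by (simp only: mult.assoc)
 also have "... <= (2 * (E powr (1 - th) * U powr (- (1 - th)))) * (E powr (- \<sigma> / 2) * (U powr al * E powr (- al / 2)))"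
  by (rule mult_right_mono[OF 1]) simp
 also have "... = 2 * ((E powr (1 - th) * E powr (- \<sigma> / 2) * E powr (- al / 2)) * (U powr al * U powr (- (1 - th))))"
  by (simp only: mult_ac)
 also have "... = 2 * (E powr ((1 - th) - \<sigma> / 2 - al / 2) * U powr (al - (1 - th)))"
  using E U by (simp add: algebra_simps flip: powr_add)
 also have "... <= 2 * (U powr ((1 - th) - \<sigma> / 2 - al / 2) * U powr (al - (1 - th)))"
 proof (intro mult_left_mono mult_right_mono powr_mono2')
  \<comment> \<open>With \<sigma> = (1 - th)^2 the exponent equals (1 - th^2 - al) / 2.\<close>
  have "0 <= th * th" "\<sigma> = 1 - 2 * th + th * th" by (auto simp: \<sigma>_def algebra_simps)
  thus "(1 - th) - \<sigma> / 2 - al / 2 <= 0" using assms(5) by argo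
 qed (use U in auto)
 also have "U powr ((1 - th) - \<sigma> / 2 - al / 2) * U powr (al - (1 - th)) = U powr ((al - \<sigma>) / 2)"
  using U by (simp add: diff_divide_distrib flip: powr_add)
 finally show ?thesis unfolding \<sigma>_def U_def .
qed

lemma sqf_weighted_ge1:
 assumes al: "1 <= al" and \<epsilon>: "0 < \<epsilon>"
 obtains m C where "C > 0" "!!g M dl K (f :: 'n::finite cfun). profile m M g ==> M > 0 ==> 0 < dl ==> dl <= 1 / 2 ==> tempered_L2 f ==>
  sqle K (br_cut (g 0) dl CARD('n) (upto_deg K CARD('n))) f al (C * M^2 * dl * (1 / dl) powr ((al - 1) / 2 + \<epsilon>))"
proof -
 \<comment> \<open>p >= al / \<epsilon> makes th at most \<epsilon> / 2, p >= al gives al < 2 m, and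
   m = 2 p is even.\<close>
 define p where "p = nat \<lceil>al / \<epsilon>\<rceil> + nat \<lceil>al\<rceil> + 1"
 define m where "m = 2 * p"
 have p: "real p >= al / \<epsilon>" "real p >= al" "p > 0"
  using real_nat_ceiling_ge[of "al / \<epsilon>"] real_nat_ceiling_ge[of al] by (auto simp: p_def)
 have m: "even m" "al < 2 * real m" using p al by (auto simp: m_def)
 define th where "th = al / (2 * real m)"
 have "al <= \<epsilon> * real p" using p(1) \<epsilon> by (simp add: field_simps)
 hence th: "0 <= th" "th <= 1" "th <= \<epsilon> / 2"
  using al m p \<epsilon> mult_pos_pos[of \<epsilon> "real p"] by (auto simp: th_def m_def field_simps)
 have ex: "(al - (1 - th) * (1 - th)) / 2 <= (al - 1) / 2 + \<epsilon> / 2"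
 proof -
  have "1 - 2 * th <= (1 - th) * (1 - th)" using zero_le_square[of th] by (simp add: algebra_simps)
  moreover have "(al - s) / 2 <= (al - 1) / 2 + \<epsilon> / 2" if "1 - 2 * th <= s" for s
   using that th(3) by argo
  ultimately show ?thesis by blast
 qed
 have al0: "0 < al" using al by simp
 obtain C0 where C0: "C0 > 0" "!!g M dl Y K a i (f :: 'n::finite cfun). profile m M g ==> M > 0 ==> 0 < dl ==> dl <= 1 / 2 ==>
  Y \<in> sets borel ==> Y \<subseteq> (upto_deg K CARD('n)) ==> Y \<subseteq> {real i..real i + 1} ==> a >= 1 ==>
  scale_ok dl a Y ==> tempered_L2 f ==>
  sqle K (br_cut (g 0) dl CARD('n) Y) f al (C0 * M^2 * dl * (((1 + dl * exp (real i)) * exp (real i) powr (- (1 - th) / 2)) powr (1 - th) * a powr al + 1))"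
  using sqf_block[OF m(1) al m(2) th_def, where ?'n = 'n] by blast
 obtain C1 where C1: "C1 > 0" "!!g M dl Y K a (f :: 'n::finite cfun). profile m M g ==> M > 0 ==> 0 < dl ==> dl <= 1 / 2 ==>
  Y \<in> sets borel ==> Y \<subseteq> (upto_deg K CARD('n)) ==> a >= 1 ==>
  scale_ok dl a Y ==> tempered_L2 f ==>
  sqle_a K (br_cut (g 0) dl CARD('n) Y) f a al (C1 * M^2 * dl)"
  using sqf_movement_weighted[OF m(1) al0 m(2), where ?'n = 'n] by blast
 define B where "B = C0 * (2 * exp (al / 2) + 1) + C1"
 have B: "B > 0" using C0(1) C1(1) by (simp add: B_def add_pos_pos)
 show ?thesis
 proof (rule that)
  show "B * (4 / \<epsilon> + 2) > 0" using B \<epsilon> by (intro mult_pos_pos add_pos_pos) auto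
  fix g M K and dl :: real and f :: "'n cfun"
  assume g: "profile m M g" and M: "M > 0" and dl: "0 < dl" "dl <= 1 / 2" and f: "tempered_L2 f"
  define U where "U = 1 / dl"
  have U: "U >= 2" using dl by (simp add: U_def field_simps)
  define e where "e = (al - 1) / 2 + \<epsilon> / 2"
  have Ue: "1 <= U powr e" using U al \<epsilon> by (intro ge_one_powr_ge_zero) (auto simp: e_def)
  have Us: "U powr ((al - (1 - th) * (1 - th)) / 2) <= U powr e" using U ex by (intro powr_mono) (auto simp: e_def)
  define Y where "Y = (upto_deg K CARD('n))"
  \<comment> \<open>From y = 2 ln U on, exp (- y) / dl^2 <= 1, so the distance 1 is admissible
    there.\<close>
  define I where "I = nat \<lceil>2 * ln U\<rceil>"
  have lnU: "ln U >= 0" using U by simp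
  have I: "2 * ln U <= real I" "real I <= 2 * ln U + 1"
   using lnU real_nat_ceiling_ge[of "2 * ln U"] by (auto simp: I_def of_nat_nat)
  define Z where "Z i = (if i < I then {real i..real i + 1} else {real I..}) \<inter> Y" for i
  define G where "G = (wnorm al f)"
  have Zb: "Z i \<in> sets borel" for i by (auto simp: Z_def Y_def)
  have ZY: "Z i \<subseteq> (upto_deg K CARD('n))" for i by (auto simp: Z_def Y_def)
  have expU: "exp (2 * ln U) = U^2" using U by (simp add: exp_double)
  have blk: "(NN x. sqf K (br_cut (g 0) dl CARD('n) (Z i)) f x * ennreal ((1 + norm x) powr (- al)))
    <= ennreal (B * M^2 * dl * U powr e) * G" if "i <= I" for i
  proof (cases "i < I")
   case True
   define E where "E = exp (real i)"
   have Zi: "Z i \<subseteq> {real i..real i + 1}" using True by (auto simp: Z_def)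
   define X where "X = ((1 + dl * E) * E powr (- (1 - th) / 2)) powr (1 - th)"
   have "\<exists>a\<ge>1. ((\<forall>y\<in>Z i. exp y <= a^2) \<or> (\<forall>y\<in>Z i. 1 / dl <= exp y \<and> exp (- y) / dl^2 <= a^2))
     \<and> X * a powr al <= 2 * exp (al / 2) * U powr e"
   proof (cases "E <= U")
    case low: True
    have ge: "exp 1 * E >= 1" unfolding E_def exp_add[symmetric] by simp
    have "X * (exp 1 * E) powr (al / 2) <= 2 * exp (al / 2) * (1 / dl) powr ((al - (1 - th) * (1 - th)) / 2)"
     unfolding X_def
    proof (rule block_low)
     show "dl * E <= 1" using low dl by (simp add: U_def field_simps)
     show "1 <= E" by (simp add: E_def)
    qed (use dl th al in auto)
    also have "... <= 2 * exp (al / 2) * U powr e" using Us unfolding U_def by (intro mult_left_mono) auto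
    finally have "X * sqrt (exp 1 * E) powr al <= 2 * exp (al / 2) * U powr e"
     using ge by (simp add: powr_half_sqrt[symmetric] powr_powr)
    moreover have "\<forall>y\<in>Z i. exp y <= (sqrt (exp 1 * E))^2"
    proof
     fix y assume "y \<in> Z i"
     hence "exp y <= exp (1 + real i)" using Zi by auto
     thus "exp y <= (sqrt (exp 1 * E))^2" using ge by (simp add: E_def exp_add)
    qed
    moreover have "1 <= sqrt (exp 1 * E)" using ge by (simp only: real_sqrt_ge_1_iff)
    ultimately show ?thesis by blast
   next
    case mid: False
    have "real i <= 2 * ln U" using True I by linarith
    hence "E <= U^2" unfolding E_def expU[symmetric] by simp
    hence ge: "U^2 / E >= 1" by (simp add: E_def field_simps)
    have "X * ((1 / dl)^2 / E) powr (al / 2) <= 2 * (1 / dl) powr ((al - (1 - th) * (1 - th)) / 2)"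
     unfolding X_def by (rule block_mid) (use dl th al mid in \<open>auto simp: U_def\<close>)
    also have "... <= 2 * U powr e" using Us unfolding U_def by (intro mult_left_mono) auto
    also have "... <= 2 * exp (al / 2) * U powr e" using al by (intro mult_right_mono) auto
    finally have "X * sqrt (U^2 / E) powr al <= 2 * exp (al / 2) * U powr e"
     using ge by (simp add: powr_half_sqrt[symmetric] powr_powr U_def)
    moreover have "\<forall>y\<in>Z i. 1 / dl <= exp y \<and> exp (- y) / dl^2 <= (sqrt (U^2 / E))^2"
    proof
     fix y assume "y \<in> Z i"
     hence y: "real i <= y" using Zi by auto
     hence "E <= exp y" by (simp add: E_def)
     moreover have "exp (- y) <= 1 / E" unfolding E_def using y by (simp add: exp_minus[symmetric] divide_inverse)
     hence "U^2 * exp (- y) <= U^2 * (1 / E)" by (rule mult_left_mono) simp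
     moreover have "(sqrt (U^2 / E))^2 = U^2 / E" using ge by simp
     ultimately show "1 / dl <= exp y \<and> exp (- y) / dl^2 <= (sqrt (U^2 / E))^2"
      using mid by (simp add: U_def power_divide)
    qed
    moreover have "1 <= sqrt (U^2 / E)" using ge by (simp only: real_sqrt_ge_1_iff)
    ultimately show ?thesis by blast
   qed
   then obtain a where a: "a >= 1" "(\<forall>y\<in>Z i. exp y <= a^2) \<or> (\<forall>y\<in>Z i. 1 / dl <= exp y \<and> exp (- y) / dl^2 <= a^2)"
    "X * a powr al <= 2 * exp (al / 2) * U powr e" by blast
   have "(NN x. sqf K (br_cut (g 0) dl CARD('n) (Z i)) f x * ennreal ((1 + norm x) powr (- al)))
     <= ennreal (C0 * M^2 * dl * (X * a powr al + 1)) * G"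
    using C0(2)[OF g M dl Zb ZY Zi a(1,2) f] unfolding G_def X_def E_def .
   also have "... <= ennreal (B * M^2 * dl * U powr e) * G"
   proof (intro mult_right_mono ennreal_leI)
    have "C0 * (X * a powr al + 1) <= C0 * ((2 * exp (al / 2) + 1) * U powr e)"
     using a(3) Ue C0(1) by (intro mult_left_mono) (auto simp: distrib_right)
    also have "... <= B * U powr e" unfolding B_def using C1(1) by (simp add: algebra_simps)
    finally have "(M^2 * dl) * (C0 * (X * a powr al + 1)) <= (M^2 * dl) * (B * U powr e)"
     using dl by (intro mult_left_mono) auto
    thus "C0 * M^2 * dl * (X * a powr al + 1) <= B * M^2 * dl * U powr e" by (simp only: mult_ac)
   qed simp
   finally show ?thesis .
  next
   case False
   have alt: "(\<forall>y\<in>Z i. exp y <= 1^2) \<or> (\<forall>y\<in>Z i. 1 / dl <= exp y \<and> exp (- y) / dl^2 <= 1^2)"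
   proof (intro disjI2 ballI)
    fix y assume "y \<in> Z i"
    hence "2 * ln U <= y" using False I by (auto simp: Z_def)
    hence ey: "U^2 <= exp y" unfolding expU[symmetric] by simp
    moreover have "U <= U^2" using U by (simp add: power2_eq_square)
    moreover have "exp (- y) * U^2 <= exp (- y) * exp y" using ey by (rule mult_left_mono) simp
    ultimately show "1 / dl <= exp y \<and> exp (- y) / dl^2 <= 1^2"
     by (simp add: U_def power_divide exp_add[symmetric])
   qed
   have "(NN x. sqf K (br_cut (g 0) dl CARD('n) (Z i)) f x * ennreal ((1 + norm x) powr (- al)))
     <= ennreal (C1 * M^2 * dl) * G"
    using C1(2)[OF g M dl Zb ZY order_refl alt f] unfolding G_def by simp
   also have "... <= ennreal (B * M^2 * dl * U powr e) * G"
   proof (intro mult_right_mono ennreal_leI)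
    have "C1 * 1 <= B * U powr e" using C0(1) C1(1) Ue by (intro mult_mono) (auto simp: B_def)
    hence "(M^2 * dl) * (C1 * 1) <= (M^2 * dl) * (B * U powr e)" using dl by (intro mult_left_mono) auto
    thus "C1 * M^2 * dl <= B * M^2 * dl * U powr e" by (simp only: mult_ac mult_1)
   qed simp
   finally show ?thesis .
  qed
  have n: "CARD('n) >= 1" by (simp add: Suc_leI)
  have cov: "\<exists>j\<in>{..I}. y \<in> Z j" if "y \<in> Y" "y > 0" for y
  proof (cases "y < real I")
   case True
   define j where "j = nat \<lfloor>y\<rfloor>"
   have "real j <= y" "y <= real j + 1" using that(2) by (auto simp: j_def of_nat_nat intro: less_imp_le)
   moreover have "j < I" using True \<open>real j <= y\<close> by linarith
   ultimately show ?thesis using that(1) by (intro bexI[of _ j]) (auto simp: Z_def)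
  next
   case False
   thus ?thesis using that(1) by (intro bexI[of _ I]) (auto simp: Z_def)
  qed
  have [measurable]: "sqf K (br_cut (g 0) dl CARD('n) (Z i)) f \<in> borel_measurable borel" for i
   by (intro measurable_sqf measurable_br_cut[OF g Zb])
  have "(NN x. sqf K (br_cut (g 0) dl CARD('n) Y) f x * ennreal ((1 + norm x) powr (- al)))
    <= (NN x. (\<Sum>i\<le>I. sqf K (br_cut (g 0) dl CARD('n) (Z i)) f x * ennreal ((1 + norm x) powr (- al))))"
   unfolding sum_distrib_right[symmetric]
   by (intro nn_integral_mono mult_right_mono sqf_le_sum[OF g dl(1) n _ Zb cov]) auto
  also have "... = (\<Sum>i\<le>I. (NN x. sqf K (br_cut (g 0) dl CARD('n) (Z i)) f x * ennreal ((1 + norm x) powr (- al))))"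
   by (rule nn_integral_sum) measurable
  also have "... <= (\<Sum>i\<le>I. ennreal (B * M^2 * dl * U powr e) * G)"
   by (intro sum_mono blk) simp
  also have "... = ennreal ((real I + 1) * (B * M^2 * dl * U powr e)) * G"
  proof -
   have "(\<Sum>i\<le>I. ennreal (B * M^2 * dl * U powr e) * G) = of_nat (Suc I) * (ennreal (B * M^2 * dl * U powr e) * G)" by simp
   also have "of_nat (Suc I) = ennreal (real I + 1)" using ennreal_of_nat_eq_real_of_nat[of "Suc I"] by (simp add: add.commute)
   also have "... * (ennreal (B * M^2 * dl * U powr e) * G) = ennreal ((real I + 1) * (B * M^2 * dl * U powr e)) * G"
    using ennreal_mult'[of "real I + 1" "B * M^2 * dl * U powr e"] by (simp only: mult.assoc)
   finally show ?thesis .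
  qed
  also have "... <= ennreal (B * (4 / \<epsilon> + 2) * M^2 * dl * U powr ((al - 1) / 2 + \<epsilon>)) * G"
  proof (intro mult_right_mono ennreal_leI)
   \<comment> \<open>Half of \<epsilon> pays for the number of blocks; the other half was spent on
     th.\<close>
   have "ln U <= U powr (\<epsilon> / 2) / (\<epsilon> / 2)" using U \<epsilon> by (intro ln_powr_bound) auto
   moreover have "1 <= U powr (\<epsilon> / 2)" using U \<epsilon> by (intro ge_one_powr_ge_zero) auto
   ultimately have "real I + 1 <= (4 / \<epsilon> + 2) * U powr (\<epsilon> / 2)" using I by (simp add: distrib_right)
   hence "(real I + 1) * (B * M^2 * dl * U powr e) <= ((4 / \<epsilon> + 2) * U powr (\<epsilon> / 2)) * (B * M^2 * dl * U powr e)"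
    using B dl by (intro mult_right_mono) auto
   also have "... = B * (4 / \<epsilon> + 2) * M^2 * dl * (U powr (\<epsilon> / 2) * U powr e)" by (simp only: mult_ac)
   also have "U powr (\<epsilon> / 2) * U powr e = U powr ((al - 1) / 2 + \<epsilon>)" using U by (simp add: e_def add.commute flip: powr_add)
   finally show "(real I + 1) * (B * M^2 * dl * U powr e) <= B * (4 / \<epsilon> + 2) * M^2 * dl * U powr ((al - 1) / 2 + \<epsilon>)" .
  qed simp
  finally show "sqle K (br_cut (g 0) dl CARD('n) (upto_deg K CARD('n))) f al (B * (4 / \<epsilon> + 2) * M^2 * dl * (1 / dl) powr ((al - 1) / 2 + \<epsilon>))"
   unfolding Y_def U_def G_def .
 qed
qed

text \<open>For 0 < al < 1 interpolate between al = 0, which loses nothing, and al = 1, which loses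
  only (1 / dl) powr \<epsilon>.\<close>

theorem sqf_weighted:
 assumes al: "0 <= al" and \<epsilon>: "0 < \<epsilon>"
 obtains m C where "C > 0" "!!g M dl K (f :: 'n::finite cfun). profile m M g ==> M > 0 ==> 0 < dl ==> dl <= 1 / 2 ==> tempered_L2 f ==>
  sqle K (br_cut (g 0) dl CARD('n) (upto_deg K CARD('n))) f al (C * M^2 * dl * (1 / dl) powr (max ((al - 1) / 2) 0 + \<epsilon>))"
proof (cases "al >= 1")
 case True
 hence mx: "max ((al - 1) / 2) 0 = (al - 1) / 2" by simp
 obtain m C where C: "C > 0" "!!g M dl K (f :: 'n::finite cfun). profile m M g ==> M > 0 ==> 0 < dl ==> dl <= 1 / 2 ==> tempered_L2 f ==>
  sqle K (br_cut (g 0) dl CARD('n) (upto_deg K CARD('n))) f al (C * M^2 * dl * (1 / dl) powr ((al - 1) / 2 + \<epsilon>))"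
  by (rule sqf_weighted_ge1[OF True \<epsilon>, where ?'n = 'n]) (rule that, assumption, assumption)
 show ?thesis by (rule that[of C m, unfolded mx]) (rule C(1), rule C(2))
next
 case False
 hence mx: "max ((al - 1) / 2) 0 + \<epsilon> = \<epsilon>" by simp
 obtain m C where C: "C > 0" "!!g M dl K (f :: 'n::finite cfun). profile m M g ==> M > 0 ==> 0 < dl ==> dl <= 1 / 2 ==> tempered_L2 f ==>
  (NN x. sqf K (br_cut (g 0) dl CARD('n) (upto_deg K CARD('n))) f x * ennreal ((1 + norm x) powr (- 1)))
   <= ennreal (C * M^2 * dl * (1 / dl) powr ((1 - 1) / 2 + \<epsilon>)) * (NN x. csqw (f x) ((1 + norm x) powr (- 1)))"
  by (rule sqf_weighted_ge1[OF order_refl \<epsilon>, where ?'n = 'n]) (rule that, assumption, assumption)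
 define D where "D = C + 2"
 show ?thesis
 proof (rule that[of "2 * D" m])
  show "2 * D > 0" using C by (simp add: D_def)
  fix g M K and dl :: real and f :: "'n cfun"
  assume g: "profile m M g" and M: "M > 0" and dl: "0 < dl" "dl <= 1 / 2" and f: "tempered_L2 f"
  define Y where "Y = (upto_deg K CARD('n))"
  have Y: "Y \<in> sets borel" by (simp add: Y_def)
  define p X where "p = D * M^2 * dl" and "X = (1 / dl) powr \<epsilon>"
  have p: "p > 0" using C(1) M dl by (simp add: p_def D_def)
  have X: "X >= 1" unfolding X_def using dl \<epsilon> by (intro ge_one_powr_ge_zero) auto
  have pX: "2 * M^2 * dl <= p" "(C * M^2 * dl) * X <= p * X"
   unfolding p_def D_def using C(1) dl X by (auto intro!: mult_right_mono)
  have goal_le: "2 * p * X = 2 * D * M^2 * dl * (1 / dl) powr (max ((al - 1) / 2) 0 + \<epsilon>)"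
   unfolding mx p_def X_def by simp
  have pp: "2 * M^2 * dl <= 2 * p * X" using pX(1) p mult_left_le_le[OF X, of "2 * p"] by linarith
  have bd0: "(NN x. sqf K (br_cut (g 0) dl CARD('n) Y) f x) <= ennreal (2 * M^2 * dl) * (NN x. csq (f x))"
   if "tempered_L2 f" for f :: "'n cfun" by (rule sqf_L2[OF g dl Y that])
  have "sqle K (br_cut (g 0) dl CARD('n) Y) f al (2 * p * X)"
  proof (cases "al = 0")
   case True
   have one: "(1 + norm x) powr 0 = 1" for x :: "real^'n"
   proof -
    have "1 + norm x > 0" by (simp add: add_pos_nonneg)
    thus ?thesis by simp
   qed
   show ?thesis using ennreal_mult_right_mono_le[OF bd0[OF f] pp] unfolding True minus_zero one by simp
  next
   case al0: False
   have pos: "0 < (1 + norm x) powr (- 1)" for x :: "real^'n" by (simp add: add_pos_nonneg less_imp_neq[symmetric])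
   have "(NN x. sqf K (br_cut (g 0) dl CARD('n) Y) f x * ennreal (1 powr (1 - al) * ((1 + norm x) powr (- 1)) powr al))
    <= ennreal (2 * (p powr (1 - al) * (p * X) powr al)) * (NN x. csqw (f x) (1 powr (1 - al) * ((1 + norm x) powr (- 1)) powr al))"
   proof (rule sqf_interpolation[where ?v0.0 = "%_. 1" and ?w0.0 = "%_. 1"])
    show "(%y. br_cut (g 0) dl CARD('n) Y y k) \<in> borel_measurable borel" for k by (rule measurable_br_cut[OF g Y])
    fix f :: "'n cfun" assume f: "tempered_L2 f"
    show "(NN x. sqf K (br_cut (g 0) dl CARD('n) Y) f x * ennreal 1) <= ennreal p * (NN x. csqw (f x) 1)"
     using ennreal_mult_right_mono_le[OF bd0[OF f] pX(1)] by (simp only: ennreal_1 mult_1_right)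
    have le: "C * M^2 * dl * (1 / dl) powr ((1 - 1) / 2 + \<epsilon>) <= p * X" using pX(2) unfolding X_def by simp
    show "(NN x. sqf K (br_cut (g 0) dl CARD('n) Y) f x * ennreal ((1 + norm x) powr (- 1)))
     <= ennreal (p * X) * (NN x. csqw (f x) ((1 + norm x) powr (- 1)))"
     using ennreal_mult_right_mono_le[OF C(2)[OF g M dl f, of K] le] unfolding Y_def .
   qed (use al al0 False p X pos f in auto)
   moreover have "((1 + norm x) powr (- 1)) powr al = (1 + norm x) powr (- al)" for x :: "real^'n" by (simp only: powr_powr mult_minus1)
   ultimately have "sqle K (br_cut (g 0) dl CARD('n) Y) f al (2 * (p powr (1 - al) * (p * X) powr al))"
    by (simp only: powr_one_eq_one mult_1)
   moreover have "2 * (p powr (1 - al) * (p * X) powr al) <= 2 * p * X"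
   proof -
    have "p powr (1 - al) * (p * X) powr al = p * X powr al"
     using powr_interpolate[OF p, of X "1 - al"] X by (simp add: mult.commute)
    also have "... <= p * X powr 1" using p X False by (intro mult_left_mono powr_mono) auto
    finally show ?thesis using X by simp
   qed
   ultimately show ?thesis by (rule ennreal_mult_right_mono_le)
  qed
  thus "sqle K (br_cut (g 0) dl CARD('n) (upto_deg K CARD('n))) f al (2 * D * M^2 * dl * (1 / dl) powr (max ((al - 1) / 2) 0 + \<epsilon>))"
   unfolding goal_le Y_def .
 qed
qed

section \<open>Smooth multipliers\<close>

text \<open>Degrees are below R^2 and l-th differences of size M / R ^ (2 l), so the kernel with r =
  2 l - j raisings has size M R ^ (r - 2 l + n) = M R ^ (n - j); the factor R ^ j makes up for
  this.\<close>

lemma herm_ker_power_bound: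
 fixes x y :: "real^'n::finite"
 assumes van: "!!k. k >= K ==> \<psi> k = 0" and R: "R >= 1" "real K <= R^2" and M: "M >= 0"
  and d: "!!l k. l <= j ==> \<bar>(fdiff ^^ l) \<psi> k\<bar> <= M / R ^ (2 * l)"
 shows "\<bar>(R * (x $ i - y $ i)) ^ j * herm_ker K i 0 \<psi> x y\<bar>
  <= (\<Sum>l\<le>j. \<bar>ker_coeff j l\<bar> * (2 ^ j * real (j + 1) ^ (j + CARD('n)) * 2 ^ CARD('n))) * M * R ^ CARD('n)"
proof -
 let ?n = "CARD('n)"
 have term_le: "R ^ j * \<bar>ker_coeff j l * herm_ker K i (2 * l - j) ((fdiff ^^ l) \<psi>) x y\<bar>
   <= \<bar>ker_coeff j l\<bar> * (2 ^ j * real (j + 1) ^ (j + ?n) * 2 ^ ?n) * (M * R ^ ?n)" if l: "l <= j" for l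
 proof (cases "2 * l < j")
  case True
  thus ?thesis using R M by (simp add: ker_coeff_eq_0)
 next
  case False
  define r where "r = 2 * l - j"
  have r: "2 * l = r + j" "r <= j" using False l by (auto simp: r_def)
  define s where "s = real (j + 1) * R"
  have R2: "R^2 >= 1" using R by simp
  have "real (K + r) <= R^2 + real j * R^2"
   using R(2) r(2) R2 mult_mono[of "real r" "real j" 1 "R^2"] by auto
  also have "... = real (j + 1) * R^2" by (simp add: algebra_simps)
  also have "... <= real (j + 1) * (real (j + 1) * R^2)" using mult_right_mono[of 1 "real (j + 1)" "R^2"] by (intro mult_left_mono) auto
  finally have Kr: "real (K + r) <= s^2" by (simp add: s_def power_mult_distrib power2_eq_square mult_ac)
  have s: "s >= 1" "0 <= s" unfolding s_def using R mult_mono[of 1 "real (j + 1)" 1 R] by auto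
  have 1: "sqrt (real (K + r) ^ r) <= s ^ r"
  proof -
   have "real (K + r) ^ r <= (s^2) ^ r" by (rule power_mono[OF Kr]) simp
   also have "(s^2) ^ r = (s ^ r)^2" by (simp add: power_mult[symmetric] mult.commute)
   finally show ?thesis using s by (intro real_le_lsqrt) auto
  qed
  have 2: "sqrt (2 * real (K + r)) <= 2 * s"
  proof (rule real_le_lsqrt)
   show "2 * real (K + r) <= (2 * s)^2" using Kr s by (simp add: power_mult_distrib)
  qed (use s in auto)
  have "\<bar>herm_ker K i r ((fdiff ^^ l) \<psi>) x y\<bar> <= 2 ^ r * (M / R ^ (2 * l)) * sqrt (real (K + r) ^ r) * sqrt (2 * real (K + r)) ^ ?n"
   by (rule herm_ker_bound) (use d l M R in auto)
  also have "... <= 2 ^ r * (M / R ^ (2 * l)) * s ^ r * (2 * s) ^ ?n"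
   using M R s 1 2 by (intro mult_mono power_mono mult_nonneg_nonneg) auto
  also have "... = (2 ^ r * real (j + 1) ^ (r + ?n) * 2 ^ ?n) * (M * R ^ ?n / R ^ j)"
  proof -
   define J1 where "J1 = real (j + 1)"
   have s1: "s = J1 * R" by (simp add: s_def J1_def)
   show ?thesis using R unfolding s1 r(1) J1_def[symmetric] by (simp add: power_mult_distrib power_add field_simps)
  qed
  also have "... <= (2 ^ j * real (j + 1) ^ (j + ?n) * 2 ^ ?n) * (M * R ^ ?n / R ^ j)"
   using r M R by (intro mult_right_mono mult_mono power_increasing) auto
  finally have "R ^ j * \<bar>herm_ker K i r ((fdiff ^^ l) \<psi>) x y\<bar> <= R ^ j * ((2 ^ j * real (j + 1) ^ (j + ?n) * 2 ^ ?n) * (M * R ^ ?n / R ^ j))"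
   using R by (intro mult_left_mono) auto
  also have "... = (2 ^ j * real (j + 1) ^ (j + ?n) * 2 ^ ?n) * (M * R ^ ?n)" using R by simp
  finally have "\<bar>ker_coeff j l\<bar> * (R ^ j * \<bar>herm_ker K i r ((fdiff ^^ l) \<psi>) x y\<bar>)
   <= \<bar>ker_coeff j l\<bar> * ((2 ^ j * real (j + 1) ^ (j + ?n) * 2 ^ ?n) * (M * R ^ ?n))"
   by (rule mult_left_mono) simp
  thus ?thesis unfolding r_def abs_mult by (simp only: mult_ac)
 qed
 have "\<bar>(R * (x $ i - y $ i)) ^ j * herm_ker K i 0 \<psi> x y\<bar> = R ^ j * \<bar>(x $ i - y $ i) ^ j * herm_ker K i 0 \<psi> x y\<bar>"
  using R by (simp add: abs_mult power_mult_distrib mult.assoc)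
 also have "... <= R ^ j * (\<Sum>l\<le>j. \<bar>ker_coeff j l * herm_ker K i (2 * l - j) ((fdiff ^^ l) \<psi>) x y\<bar>)"
 proof (rule mult_left_mono)
  have "(x $ i - y $ i) ^ j * herm_ker K i 0 \<psi> x y = (\<Sum>l\<le>j. ker_coeff j l * herm_ker K i (2 * l - j) ((fdiff ^^ l) \<psi>) x y)"
   by (rule herm_ker_power) (rule van)
  thus "\<bar>(x $ i - y $ i) ^ j * herm_ker K i 0 \<psi> x y\<bar> <= (\<Sum>l\<le>j. \<bar>ker_coeff j l * herm_ker K i (2 * l - j) ((fdiff ^^ l) \<psi>) x y\<bar>)"
   by (simp only: sum_abs)
 qed (use R in simp)
 also have "... <= (\<Sum>l\<le>j. \<bar>ker_coeff j l\<bar> * (2 ^ j * real (j + 1) ^ (j + ?n) * 2 ^ ?n) * (M * R ^ ?n))"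
  unfolding sum_distrib_left by (intro sum_mono term_le) simp
 finally show ?thesis by (simp only: sum_distrib_right mult.assoc)
qed

lemma herm_ker_decay:
 assumes "even m"
 obtains C where "C > 0" "!!K \<psi> R M i (x :: real^'n::finite) y. (!!k. k >= K ==> \<psi> k = 0) ==> R >= 1 ==> real K <= R^2 ==> M >= 0 ==>
  (!!l k. l <= m ==> \<bar>(fdiff ^^ l) \<psi> k\<bar> <= M / R ^ (2 * l)) ==>
  \<bar>herm_ker K i 0 \<psi> x y\<bar> <= C * M * (R ^ CARD('n) / (1 + R * norm (x - y)) ^ m)"
proof -
 let ?n = "CARD('n)"
 define c where "c j = (\<Sum>l\<le>j. \<bar>ker_coeff j l\<bar> * (2 ^ j * real (j + 1) ^ (j + ?n) * 2 ^ ?n))" for j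
 have c: "c j >= 0" for j by (simp add: c_def sum_nonneg)
 define C where "C = real (?n + 1) ^ m * (c 0 + real ?n * c m) + 1"
 show ?thesis
 proof (rule that)
  show "C > 0" unfolding C_def using c by (intro add_nonneg_pos mult_nonneg_nonneg add_nonneg_nonneg) auto
  fix K \<psi> and R M :: real and i and x y :: "real^'n"
  assume van: "!!k. k >= K ==> \<psi> k = 0" and R: "R >= 1" "real K <= R^2" and M: "M >= 0"
   and d: "!!l k. l <= m ==> \<bar>(fdiff ^^ l) \<psi> k\<bar> <= M / R ^ (2 * l)"
  define k where "k = herm_ker K i 0 \<psi> x y"
  \<comment> \<open>For \<open>r = 0\<close> no coordinate is singled out, so the bounds for all
    coordinates concern one and the same kernel.\<close>
  have indep: "herm_ker K i' 0 \<psi> x y = k" for i' unfolding k_def by (simp add: herm_ker_expand herm_rho_def)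
  have b: "(R * (x $ i' - y $ i')) ^ j * \<bar>k\<bar> <= c j * M * R ^ ?n" if "j <= m" for i' j
  proof -
   have "\<bar>(R * (x $ i' - y $ i')) ^ j * herm_ker K i' 0 \<psi> x y\<bar> <= c j * M * R ^ ?n"
    unfolding c_def by (rule herm_ker_power_bound[OF van R M]) (use that d in auto)
   thus ?thesis unfolding indep abs_mult by (meson abs_ge_self abs_ge_zero mult_right_mono order_trans)
  qed
  have e: "1 + norm (x - y) / (1 / R) = 1 + R * norm (x - y)" "(x - y) $ i' / (1 / R) = R * (x $ i' - y $ i')" for i' by (auto simp: mult.commute)
  have pos: "0 < (1 + R * norm (x - y)) ^ m" using R by (intro zero_less_power add_pos_nonneg) auto
  have "(1 + R * norm (x - y)) ^ m <= real (?n + 1) ^ m * (1 + (\<Sum>i\<in>UNIV. (R * (x $ i - y $ i)) ^ m))"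
   using power_one_plus_norm_le[of "1 / R" m "x - y"] R assms unfolding e by simp
  hence "(1 + R * norm (x - y)) ^ m * \<bar>k\<bar> <= real (?n + 1) ^ m * (1 + (\<Sum>i\<in>UNIV. (R * (x $ i - y $ i)) ^ m)) * \<bar>k\<bar>"
   by (rule mult_right_mono) simp
  also have "... = real (?n + 1) ^ m * (\<bar>k\<bar> + (\<Sum>i\<in>UNIV. (R * (x $ i - y $ i)) ^ m * \<bar>k\<bar>))"
   by (simp only: distrib_right distrib_left mult_1 mult.assoc sum_distrib_right)
  also have "... <= real (?n + 1) ^ m * (c 0 * M * R ^ ?n + (\<Sum>i\<in>(UNIV::'n set). c m * M * R ^ ?n))"
   using b[of 0] by (intro mult_left_mono add_mono sum_mono b) auto
  also have "... = (real (?n + 1) ^ m * (c 0 + real ?n * c m)) * (M * R ^ ?n)" by (simp add: algebra_simps)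
  also have "... <= C * (M * R ^ ?n)" unfolding C_def using M R by (intro mult_right_mono) auto
  finally show "\<bar>herm_ker K i 0 \<psi> x y\<bar> <= C * M * (R ^ ?n / (1 + R * norm (x - y)) ^ m)"
   using pos unfolding k_def by (simp add: field_simps)
 qed
qed

text \<open>A Peetre-type inequality: the change of the weight from x to y is paid by powers of 1 +
  R |x - y|, that is by kernel decay, and afterwards the weight is merely a factor of f.\<close>

lemma weight_ratio:
 assumes "0 <= al" "al <= real n" "R >= 1"
 shows "sqrt ((1 + norm x) powr (- al)) <= (1 + R * norm (x - y)) ^ n * sqrt ((1 + norm y) powr (- al))"
proof -
 define b where "b = 1 + R * norm (x - y)"
 have b: "b >= 1" using assms by (simp add: b_def)
 have "norm (x - y) <= R * norm (x - y)" using assms mult_right_mono[of 1 R "norm (x - y)"] by simp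
 hence "1 + norm y <= (1 + norm x) + R * norm (x - y)" using norm_triangle_ineq2[of y x] norm_minus_commute[of x y] by simp
 also have "... <= b * (1 + norm x)" using assms by (simp add: b_def algebra_simps mult_nonneg_nonneg)
 finally have "(b * (1 + norm x)) powr (- al) <= (1 + norm y) powr (- al)" using assms by (intro powr_mono2') (auto simp: add_pos_nonneg)
 hence "b powr al * (b powr (- al) * (1 + norm x) powr (- al)) <= b powr al * (1 + norm y) powr (- al)"
  unfolding powr_mult by (intro mult_left_mono) auto
 moreover have "b powr al * (b powr (- al) * u) = u" for u using b by (simp add: mult.assoc[symmetric] flip: powr_add)
 ultimately have "(1 + norm x) powr (- al) <= b powr al * (1 + norm y) powr (- al)" by simp
 also have "... <= b powr (real (2 * n)) * (1 + norm y) powr (- al)" using b assms by (intro mult_right_mono powr_mono) auto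
 also have "b powr (real (2 * n)) = (b ^ n)^2" using b by (simp only: powr_realpow) (simp add: power_mult[symmetric] mult.commute)
 finally have "sqrt ((1 + norm x) powr (- al)) <= sqrt ((b ^ n)^2 * (1 + norm y) powr (- al))" by (rule real_sqrt_le_mono)
 thus ?thesis using b by (simp add: real_sqrt_mult b_def)
qed

lemma hmult_change_bound:
 assumes "!!k. k >= K' ==> \<psi> k = 0" "!!k. k >= K ==> \<psi> k = 0"
 shows "hmult K \<psi> f x = hmult K' \<psi> f x"
proof -
 have "(\<Sum>k<K. cx (\<psi> k) * herm_proj k f x) = (\<Sum>k<min K K'. cx (\<psi> k) * herm_proj k f x)"
  by (rule sum.mono_neutral_right) (use assms in auto)
 moreover have "(\<Sum>k<K'. cx (\<psi> k) * herm_proj k f x) = (\<Sum>k<min K K'. cx (\<psi> k) * herm_proj k f x)"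
  by (rule sum.mono_neutral_right) (use assms in auto)
 ultimately show ?thesis by (simp add: hmult_herm_proj)
qed

text \<open>The kernel decays with exponent 4 n. The change of the weight takes n of these powers,
  and what remains is ample for the exponent 2 n of \<open>pker\<close> at a dyadic scale next to
  R.\<close>

lemma smooth_multiplier_pointwise:
 assumes al: "0 <= al" "al < real CARD('n::finite)"
 obtains C where "C > 0" "!!K \<psi> R M J (f :: 'n cfun) x. (!!k. k >= K ==> \<psi> k = 0) ==> (!!k. R^2 < real (Suc k) ==> \<psi> k = 0) ==>
  R >= 1 ==> R <= 2 ^ J ==> M >= 0 ==> (!!l k. l <= 4 * CARD('n) ==> \<bar>(fdiff ^^ l) \<psi> k\<bar> <= M / R ^ (2 * l)) ==> tempered_L2 f ==>
  ennreal (sqrt (weight al x) * cmod (hmult K \<psi> f x)) <= ennreal (C * M) * pmax J (%y. ennreal (sqrt (weight al y) * cmod (f y))) x"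
proof -
 let ?n = "CARD('n)"
 have ev: "even (4 * ?n)" by simp
 obtain C where C: "C > 0" "!!K \<psi> R M i (x :: real^'n::finite) y. (!!k. k >= K ==> \<psi> k = 0) ==> R >= 1 ==> real K <= R^2 ==> M >= 0 ==>
  (!!l k. l <= 4 * ?n ==> \<bar>(fdiff ^^ l) \<psi> k\<bar> <= M / R ^ (2 * l)) ==>
  \<bar>herm_ker K i 0 \<psi> x y\<bar> <= C * M * (R ^ CARD('n) / (1 + R * norm (x - y)) ^ (4 * ?n))"
  using herm_ker_decay[OF ev, where ?'n = 'n] by blast
 show ?thesis
 proof (rule that)
  show "C * 2 ^ ?n > 0" using C(1) by simp
  fix K0 \<psi> and R M :: real and J and f :: "'n cfun" and x
  assume van0: "!!k. k >= K0 ==> \<psi> k = 0" and van: "!!k. R^2 < real (Suc k) ==> \<psi> k = 0" and R: "R >= 1" "R <= 2 ^ J" and M: "M >= 0"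
   and d: "!!l k. l <= 4 * ?n ==> \<bar>(fdiff ^^ l) \<psi> k\<bar> <= M / R ^ (2 * l)" and f: "tempered_L2 f"
  note [measurable] = f
  \<comment> \<open>The kernel bound needs a cutoff of at most R^2, whereas \<open>K0\<close> may be
    arbitrarily large.\<close>
  define K where "K = nat \<lfloor>R^2\<rfloor>"
  have KR: "real K <= R^2" using R by (simp add: K_def of_nat_nat)
  have vanK: "\<psi> k = 0" if "k >= K" for k
  proof (rule van)
   have "R^2 < real K + 1" unfolding K_def using real_of_int_floor_add_one_gt[of "R^2"] R by (simp add: of_nat_nat)
   thus "R^2 < real (Suc k)" using that by simp
  qed
  define j where "j = (LEAST j. R <= 2 ^ Suc j)"
  have ex: "R <= 2 ^ Suc J" using R by (simp add: order_trans[OF R(2)])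
  have j1: "R <= 2 ^ Suc j" unfolding j_def by (rule LeastI[of "%j. R <= 2 ^ Suc j", OF ex])
  have jJ: "j <= J" unfolding j_def by (rule Least_le[of "%j. R <= 2 ^ Suc j", OF ex])
  have j2: "2 ^ j <= R"
  proof (cases j)
   case (Suc i)
   hence "i < j" by simp
   hence "\<not> R <= 2 ^ Suc i" unfolding j_def by (rule not_less_Least)
   thus ?thesis using Suc by simp
  qed (use R in simp)
  obtain i :: 'n where True by simp
  have hm: "hmult K0 \<psi> f x = (LI y. f y * cx (herm_ker K i 0 \<psi> x y))"
  proof -
   have "hmult K0 \<psi> f x = hmult K \<psi> f x" by (rule hmult_change_bound) (use vanK van0 in auto)
   thus ?thesis unfolding hmult_eq_hker_op[of K \<psi> f x i] by (simp add: integral_herm_ker[OF f])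
  qed
  have "ennreal (cmod (hmult K0 \<psi> f x)) <= (NN y. ennreal (cmod (f y * cx (herm_ker K i 0 \<psi> x y))))"
   unfolding hm by (rule integral_norm_bound_ennreal) (rule integrable_herm_ker[OF f])
  hence "ennreal (sqrt (weight al x)) * ennreal (cmod (hmult K0 \<psi> f x))
   <= ennreal (sqrt (weight al x)) * (NN y. ennreal (cmod (f y * cx (herm_ker K i 0 \<psi> x y))))"
   by (rule mult_left_mono) simp
  also have "... = (NN y. ennreal (sqrt (weight al x)) * ennreal (cmod (f y * cx (herm_ker K i 0 \<psi> x y))))"
   by (rule nn_integral_cmult[symmetric]) (use borel_measurable_integrable[OF integrable_herm_ker[OF f]] in measurable)
  also have "... <= (NN y. ennreal (C * M * 2 ^ ?n) * (ennreal (pker (2 ^ j) (x - y)) * ennreal (sqrt (weight al y) * cmod (f y))))"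
  proof (rule nn_integral_mono)
   fix y
   define b where "b = 1 + R * norm (x - y)"
   have b: "b >= 1" using R by (simp add: b_def)
   have w: "0 <= weight al z" for z :: "real^'n" by (simp add: weight_def)
   have bb: "(1 + 2 ^ j * norm (x - y)) ^ (2 * ?n) <= b ^ (2 * ?n)"
    unfolding b_def using j2 by (intro power_mono add_left_mono mult_right_mono) auto
   have "sqrt (weight al x) * \<bar>herm_ker K i 0 \<psi> x y\<bar> <= (b ^ ?n * sqrt (weight al y)) * (C * M * (R ^ ?n / b ^ (4 * ?n)))"
   proof (rule mult_mono)
    show "sqrt (weight al x) <= b ^ ?n * sqrt (weight al y)" unfolding weight_def b_def using al R by (intro weight_ratio) auto
    show "\<bar>herm_ker K i 0 \<psi> x y\<bar> <= C * M * (R ^ ?n / b ^ (4 * ?n))"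
     unfolding b_def by (rule C(2)[OF vanK R(1) KR M d]) auto
   qed (use b w in auto)
   also have "... <= (C * M) * (sqrt (weight al y) * (R ^ ?n / b ^ (2 * ?n)))"
   proof -
    have "b ^ ?n * (R ^ ?n / b ^ (4 * ?n)) <= b ^ (2 * ?n) * (R ^ ?n / b ^ (4 * ?n))"
     using b R by (intro mult_right_mono power_increasing) auto
    also have "... = R ^ ?n / b ^ (2 * ?n)"
    proof -
     have "b ^ (4 * ?n) = b ^ (2 * ?n) * b ^ (2 * ?n)" by (simp flip: power_add)
     thus ?thesis using b by simp
    qed
    finally have "(C * M * sqrt (weight al y)) * (b ^ ?n * (R ^ ?n / b ^ (4 * ?n))) <= (C * M * sqrt (weight al y)) * (R ^ ?n / b ^ (2 * ?n))"
     using C(1) M w[of y] by (intro mult_left_mono) auto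
    thus ?thesis by (simp only: mult_ac)
   qed
   also have "... <= (C * M) * (sqrt (weight al y) * (2 ^ ?n * pker (2 ^ j) (x - y)))"
   proof (intro mult_left_mono)
    have "R ^ ?n / b ^ (2 * ?n) <= (2 * 2 ^ j) ^ ?n / (1 + 2 ^ j * norm (x - y)) ^ (2 * ?n)"
     using bb j1 R b by (intro frac_le power_mono) (auto intro!: zero_less_power add_pos_nonneg)
    thus "R ^ ?n / b ^ (2 * ?n) <= 2 ^ ?n * pker (2 ^ j) (x - y)" by (simp add: pker_def power_mult_distrib)
   qed (use C(1) M w[of y] in auto)
   finally have "sqrt (weight al x) * \<bar>herm_ker K i 0 \<psi> x y\<bar> * cmod (f y)
     <= (C * M) * (sqrt (weight al y) * (2 ^ ?n * pker (2 ^ j) (x - y))) * cmod (f y)"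
    by (rule mult_right_mono) simp
   hence "ennreal (sqrt (weight al x) * cmod (f y * cx (herm_ker K i 0 \<psi> x y)))
     <= ennreal ((C * M * 2 ^ ?n) * (pker (2 ^ j) (x - y) * (sqrt (weight al y) * cmod (f y))))"
    by (intro ennreal_leI) (simp add: norm_mult mult_ac)
   thus "ennreal (sqrt (weight al x)) * ennreal (cmod (f y * cx (herm_ker K i 0 \<psi> x y)))
     <= ennreal (C * M * 2 ^ ?n) * (ennreal (pker (2 ^ j) (x - y)) * ennreal (sqrt (weight al y) * cmod (f y)))"
    using C(1) M w by (simp add: ennreal_mult pker_nonneg)
  qed
  also have "... = ennreal (C * M * 2 ^ ?n) * pavg j (%y. ennreal (sqrt (weight al y) * cmod (f y))) x"
   unfolding pavg_def weight_def by (rule nn_integral_cmult) measurable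
  also have "... <= ennreal (C * M * 2 ^ ?n) * pmax J (%y. ennreal (sqrt (weight al y) * cmod (f y))) x"
   by (intro mult_left_mono pavg_le_pmax jJ) simp
  also have "C * M * 2 ^ ?n = C * 2 ^ ?n * M" by simp
  finally show "ennreal (sqrt (weight al x) * cmod (hmult K0 \<psi> f x))
   <= ennreal (C * 2 ^ ?n * M) * pmax J (%y. ennreal (sqrt (weight al y) * cmod (f y))) x"
   by (simp add: ennreal_mult weight_def)
 qed
qed

section \<open>Decomposition of the Riesz power\<close>

lemma has_real_derivative_max0_power:
 assumes "L >= 2"
 shows "((%u. (max 0 u) ^ L) has_real_derivative real L * (max 0 u) ^ (L - 1)) (at u)"
proof -
 consider "u > 0" | "u < 0" | "u = 0" by linarith
 thus ?thesis
 proof cases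
  case 1
  show ?thesis
  proof (rule has_field_derivative_transform_within_open[where S = "{0<..}"])
   show "((%u. u ^ L) has_real_derivative real L * (max 0 u) ^ (L - 1)) (at u)"
    using 1 by (auto intro!: derivative_eq_intros)
  qed (use 1 in auto)
 next
  case 2
  show ?thesis
  proof (rule has_field_derivative_transform_within_open[where S = "{..<0}"])
   show "((%u. 0) has_real_derivative real L * (max 0 u) ^ (L - 1)) (at u)"
    using 2 assms by (simp add: zero_power)
  qed (use 2 assms in auto)
 next
  case 3
  have "((%h::real. ((max 0 (0 + h)) ^ L - (max 0 0) ^ L) / h) \<longlongrightarrow> 0) (at 0)"
  proof (rule Lim_null_comparison)
   show "\<forall>\<^sub>F h in at (0::real). norm (((max 0 (0 + h)) ^ L - (max 0 0) ^ L) / h) <= \<bar>h\<bar>"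
    unfolding eventually_at
   proof (intro exI[of _ 1] conjI ballI impI)
    fix h :: real assume "h \<noteq> 0 \<and> dist h 0 < 1"
    hence h: "h \<noteq> 0" "\<bar>h\<bar> < 1" by auto
    have "(max 0 h) ^ L <= \<bar>h\<bar> ^ L" by (intro power_mono) auto
    also have "... <= \<bar>h\<bar> ^ 2" using h assms by (intro power_decreasing) auto
    finally have "(max 0 h) ^ L <= \<bar>h\<bar> * \<bar>h\<bar>" by (simp add: power2_eq_square)
    thus "norm (((max 0 (0 + h)) ^ L - (max 0 0) ^ L) / h) <= \<bar>h\<bar>"
     using h assms by (simp add: divide_le_eq zero_power)
   qed simp
   show "((%h::real. \<bar>h\<bar>) \<longlongrightarrow> 0) (at 0)" by (rule tendsto_rabs_zero) (rule tendsto_ident_at)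
  qed
  thus ?thesis using 3 assms by (simp add: DERIV_def zero_power)
 qed
qed

text \<open>Supported in the unit interval and of class C^(L - 1). The polynomial factor closes the
  family under differentiation: a derivative lowers L by one and replaces the polynomial by
  \<open>bump_step\<close>.\<close>

definition bump :: "nat => real poly => real => real" where
 "bump L r v = poly r v * (max 0 (v * (1 - v))) ^ L"

definition bump_step :: "nat => real poly => real poly" where
 "bump_step L r = [:0, 1, - 1:] * pderiv r + smult (real L) ([:1, - 2:] * r)"

lemma bump_has_derivative:
 assumes "L >= 2"
 shows "(bump L r has_real_derivative bump (L - 1) (bump_step L r) v) (at v)"
proof -
 define w where "w = max 0 (v * (1 - v))"
 have "((%v. v * (1 - v)) has_real_derivative 1 - 2 * v) (at v)"
  by (auto intro!: derivative_eq_intros)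
 from DERIV_chain2[OF has_real_derivative_max0_power[OF assms] this]
 have "((%v. (max 0 (v * (1 - v))) ^ L) has_real_derivative real L * w ^ (L - 1) * (1 - 2 * v)) (at v)"
  unfolding w_def .
 from DERIV_mult[OF poly_DERIV[of r v] this]
 have "((%v. poly r v * (max 0 (v * (1 - v))) ^ L) has_real_derivative
   poly (pderiv r) v * w ^ L + real L * w ^ (L - 1) * (1 - 2 * v) * poly r v) (at v)"
  unfolding w_def .
 moreover have "w ^ L = v * (1 - v) * w ^ (L - 1)"
 proof -
  have L': "L = Suc (Suc (L - 2))" using assms by simp
  show ?thesis
  proof (cases "v * (1 - v) <= 0")
   case True
   hence "w = 0" by (simp add: w_def)
   thus ?thesis using assms by (simp add: zero_power)
  next
   case False
   hence "w = v * (1 - v)" by (simp add: w_def)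
   thus ?thesis by (subst (1 2) L') (simp only: diff_Suc_1 power_Suc mult.assoc)
  qed
 qed
 ultimately show ?thesis
  unfolding bump_def[abs_def] bump_step_def w_def[symmetric] by (simp add: algebra_simps)
qed

lemma bump_eq_0: "L >= 1 ==> v <= 0 \<or> 1 <= v ==> bump L r v = 0"
proof -
 assume L: "L >= 1" and v: "v <= 0 \<or> 1 <= v"
 have "v * (1 - v) <= 0" using v by (auto intro: mult_nonpos_nonneg mult_nonneg_nonpos)
 thus ?thesis using L by (simp add: bump_def max_absorb1)
qed

lemma profile_bump:
 assumes "L >= m + 1"
 shows "\<exists>g M. M > 0 \<and> profile m M g \<and> g 0 = bump L r"
proof -
 \<comment> \<open>The polynomials of the successive derivatives; at stage l the exponent has
   dropped to L - l.\<close>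
 define q where "q = rec_nat r (%l r. bump_step (L - l) r)"
 define g where "g l = bump (L - l) (q l)" for l
 have cont: "continuous_on UNIV (bump k s)" for k s
  unfolding bump_def by (intro continuous_intros)
 have "\<exists>B. \<forall>v. \<bar>g l v\<bar> <= B" if "l <= m" for l
 proof -
  have "compact (g l ` {0..1})"
   unfolding g_def by (intro compact_continuous_image continuous_on_subset[OF cont]) auto
  from compact_imp_bounded[OF this] obtain B where "\<forall>x\<in>g l ` {0..1}. norm x <= B" unfolding bounded_iff by blast
  hence B: "!!v. v \<in> {0..1} ==> \<bar>g l v\<bar> <= B" by auto
  have "\<bar>g l v\<bar> <= max B 0" for v
  proof (cases "v \<in> {0..1}")
   case False
   hence "g l v = 0" unfolding g_def using that assms by (intro bump_eq_0) auto
   thus ?thesis by simp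
  qed (use B[of v] in auto)
  thus ?thesis by blast
 qed
 then obtain B where B: "!!l v. l <= m ==> \<bar>g l v\<bar> <= B l" by metis
 define M where "M = (\<Sum>l\<le>m. \<bar>B l\<bar>) + 1"
 have "M > 0" unfolding M_def by (intro add_nonneg_pos sum_nonneg) auto
 moreover have "profile m M g"
  unfolding profile_def
 proof (intro conjI allI impI)
  show "M >= 0" using \<open>M > 0\<close> by simp
  show "(g l has_real_derivative g (Suc l) v) (at v)" if "l < m" for l v
  proof -
   have "(bump (L - l) (q l) has_real_derivative bump (L - l - 1) (bump_step (L - l) (q l)) v) (at v)"
    using that assms by (intro bump_has_derivative) auto
   moreover have "g (Suc l) = bump (L - l - 1) (bump_step (L - l) (q l))" by (simp add: g_def q_def)
   ultimately show ?thesis by (simp add: g_def)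
  qed
  show "\<bar>g l v\<bar> <= M" if "l <= m" for l v
  proof -
   have "\<bar>B l\<bar> <= (\<Sum>l\<le>m. \<bar>B l\<bar>)" using that by (intro member_le_sum) auto
   thus ?thesis using B[OF that, of v] by (simp add: M_def)
  qed
  show "g l v = 0" if "l <= m" "v <= 0 \<or> 1 <= v" for l v
   unfolding g_def using that assms by (intro bump_eq_0) auto
  show "continuous_on UNIV (g 0)" unfolding g_def by (rule cont)
 qed
 moreover have "g 0 = bump L r" by (simp add: g_def q_def)
 ultimately show ?thesis by blast
qed

text \<open>An i-th power is smooth enough for l < i differences, each costing a constant over R^2;
  so the polynomial part of the decomposition consists of smooth symbols at scale R.\<close>

lemma fdiff_max0_power_bound:
 assumes l: "l < i" and R: "R > 0" and c: "c >= 0"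
 shows "\<bar>(fdiff ^^ l) (%k. (max 0 (1 - (2 * real k + c) / R^2)) ^ i) k\<bar> <= (2 * real i) ^ l / R ^ (2 * l)"
proof -
 define a where "a j = (\<Prod>q<j. real (i - q))" for j
 define G where "G j x = a j * (- 1 / R^2) ^ j * (max 0 (1 - x / R^2)) ^ (i - j)" for j x
 have D: "(G j has_real_derivative G (Suc j) x) (at x)" if "j < l" for j x
 proof -
  have "i - j >= 2" using that l by simp
  moreover have "((%x. 1 - x / R^2) has_real_derivative - 1 / R^2) (at x)"
  proof -
   have "((%x. 1 - (1 / R^2) * x) has_real_derivative 0 - (1 / R^2) * 1) (at x)"
    by (intro DERIV_diff DERIV_const DERIV_cmult DERIV_ident)
   thus ?thesis by simp
  qed
  ultimately have "((%x. (max 0 (1 - x / R^2)) ^ (i - j)) has_real_derivative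
    real (i - j) * (max 0 (1 - x / R^2)) ^ (i - j - 1) * (- 1 / R^2)) (at x)"
   by (intro DERIV_chain2[OF has_real_derivative_max0_power])
  from DERIV_cmult[OF this, of "a j * (- 1 / R^2) ^ j"]
  have "(G j has_real_derivative a j * (- 1 / R^2) ^ j * (real (i - j) * (max 0 (1 - x / R^2)) ^ (i - j - 1) * (- 1 / R^2))) (at x)"
   unfolding G_def[abs_def] .
  moreover have "G (Suc j) x = a j * (- 1 / R^2) ^ j * (real (i - j) * (max 0 (1 - x / R^2)) ^ (i - j - 1) * (- 1 / R^2))"
   unfolding G_def a_def by simp
  ultimately show ?thesis by simp
 qed
 have "\<bar>(fdiff ^^ l) (%k. G 0 (2 * real k + c)) k\<bar> <= 2 ^ l * (real i ^ l / R ^ (2 * l))"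
 proof (rule fdiff_power_bound[where G = G, OF D])
  fix x assume "2 * real k + c <= x"
  hence x: "0 <= x" using c by simp
  have 1: "\<bar>a l\<bar> <= real i ^ l"
  proof -
   have "(\<Prod>q<l. real (i - q)) <= (\<Prod>q<l. real i)" by (intro prod_mono) auto
   thus ?thesis by (simp add: a_def abs_prod)
  qed
  have "(max 0 (1 - x / R^2)) ^ (i - l) <= 1" using x R by (intro power_le_one) auto
  hence "\<bar>a l\<bar> * (1 / R ^ (2 * l)) * (max 0 (1 - x / R^2)) ^ (i - l) <= real i ^ l * (1 / R ^ (2 * l)) * 1"
   using 1 R by (intro mult_mono) auto
  moreover have "\<bar>(- 1 / R^2) ^ l\<bar> = 1 / R ^ (2 * l)" using R by (simp add: power_abs power_divide power_mult)
  ultimately show "\<bar>G l x\<bar> <= real i ^ l / R ^ (2 * l)" unfolding G_def abs_mult by simp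
 qed
 moreover have "(%k. G 0 (2 * real k + c)) = (%k. (max 0 (1 - (2 * real k + c) / R^2)) ^ i)" by (simp add: G_def a_def)
 ultimately show ?thesis by (simp add: power_mult_distrib)
qed

lemma bump_one_expand:
 assumes "0 <= v" "v <= 1"
 shows "bump p 1 v = (\<Sum>j\<le>p. real (p choose j) * (- 1) ^ j * v ^ (p + j))"
proof -
 have "0 <= v * (1 - v)" using assms by simp
 hence "bump p 1 v = v ^ p * (- v + 1) ^ p" by (simp add: bump_def max_absorb2 power_mult_distrib)
 also have "... = (\<Sum>j\<le>p. real (p choose j) * (- 1) ^ j * v ^ (p + j))"
  unfolding binomial_ring sum_distrib_left
  by (intro sum.cong refl) (simp add: power_minus[of v] power_add)
 finally show ?thesis .
qed

text \<open>The Beta integral of u powr (p - lam - 1) * (1 - u) ^ p over the unit interval, expanded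
  by the binomial theorem and integrated termwise.\<close>

definition br_const :: "real => nat => real" where
 "br_const lam p = (\<Sum>j\<le>p. real (p choose j) * (- 1) ^ j / (real (p + j) - lam))"

lemma br_const_pos:
 assumes "0 < lam" "lam < real p"
 shows "br_const lam p > 0"
proof -
 define b where "b j = real (p choose j) * (- 1) ^ j" for j
 define \<phi> where "\<phi> u = (\<Sum>j\<le>p. b j / (real (p + j) - lam) * u powr (real (p + j) - lam))" for u
 have e: "real (p + j) - lam > 0" for j using assms by simp
 have "\<phi> 0 < \<phi> 1"
 proof (rule DERIV_pos_imp_increasing_open[of 0 1 \<phi>])
  fix u :: real assume u: "0 < u" "u < 1"
  have "(\<phi> has_real_derivative (\<Sum>j\<le>p. b j / (real (p + j) - lam) * ((real (p + j) - lam) * u powr (real (p + j) - lam - 1)))) (at u)"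
   unfolding \<phi>_def[abs_def] using u by (intro DERIV_sum DERIV_cmult has_real_derivative_powr)
  also have "(\<Sum>j\<le>p. b j / (real (p + j) - lam) * ((real (p + j) - lam) * u powr (real (p + j) - lam - 1)))
    = (\<Sum>j\<le>p. u powr (- lam - 1) * (b j * u ^ (p + j)))"
  proof (rule sum.cong[OF refl])
   fix j
   have "u powr (real (p + j) - lam - 1) = u powr (- lam - 1) * u ^ (p + j)"
    using u by (simp add: powr_realpow[symmetric] flip: powr_add) (simp add: algebra_simps)
   thus "b j / (real (p + j) - lam) * ((real (p + j) - lam) * u powr (real (p + j) - lam - 1)) = u powr (- lam - 1) * (b j * u ^ (p + j))"
    using e[of j] by simp
  qed
  also have "... = u powr (- lam - 1) * bump p 1 u"
   using u by (subst bump_one_expand) (auto simp: sum_distrib_left b_def)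
  finally have "(\<phi> has_real_derivative u powr (- lam - 1) * bump p 1 u) (at u)" .
  moreover have "u powr (- lam - 1) * bump p 1 u > 0" using u by (simp add: bump_def)
  ultimately show "\<exists>y. (\<phi> has_real_derivative y) (at u) \<and> y > 0" by blast
 next
  show "continuous_on {0..1} \<phi>" unfolding \<phi>_def using e
   by (intro continuous_on_sum continuous_on_mult continuous_on_const continuous_on_powr' continuous_on_id) auto
 qed simp
 thus ?thesis by (simp add: \<phi>_def b_def br_const_def)
qed

text \<open>For t > 0 the substitution u = t / dl turns the average into t powr lam times the
  integral of u powr (- lam - 1) * bump p 1 u over [t, 1]. Over the full interval this would be
  \<open>br_const\<close>; the missing piece over [0, t] is the polynomial, whose terms start at
  degree p.\<close>

lemma br_power_decomposition:
 assumes lam: "0 < lam" "lam < real p" and t: "t <= 1"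
 shows "has_bochner_integral lborel (%dl. indicator {0<..1} dl * (dl powr (lam - 1) * bump p 1 (t / dl)))
  (br_const lam p * (max 0 t) powr lam - (\<Sum>j\<le>p. real (p choose j) * (- 1) ^ j / (real (p + j) - lam) * (max 0 t) ^ (p + j)))"
proof (cases "t <= 0")
 case True
 have p: "p >= 1" using lam by (cases p) auto
 have z: "(%dl. indicator {0<..1} dl * (dl powr (lam - 1) * bump p 1 (t / dl))) = (%_. 0)"
 proof
  fix dl
  show "indicator {0<..1} dl * (dl powr (lam - 1) * bump p 1 (t / dl)) = 0"
   using bump_eq_0[OF p, of "t / dl" 1] True by (cases "dl > 0") (auto simp: indicator_def divide_nonpos_pos)
 qed
 have "max 0 t = 0" "p \<noteq> 0" using True p by auto
 thus ?thesis unfolding z by (simp add: power_0_left has_bochner_integral_zero)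
next
 case False
 hence t0: "0 < t" by simp
 have p: "p >= 1" using lam by (cases p) auto
 define b where "b j = real (p choose j) * (- 1) ^ j" for j
 have e: "real (p + j) - lam > 0" for j using lam by simp
 define F where "F dl = (\<Sum>j\<le>p. - (b j / (real (p + j) - lam) * t ^ (p + j)) * dl powr (lam - real (p + j)))" for dl
 define h where "h dl = (\<Sum>j\<le>p. b j * t ^ (p + j) * dl powr (lam - real (p + j) - 1))" for dl
 have "has_bochner_integral lborel (%dl. h dl * indicator {t..1} dl) (F 1 - F t)"
 proof (rule has_bochner_integral_FTC_Icc_real[OF t])
  fix dl assume "t <= dl"
  hence dl: "dl > 0" using t0 by simp
  have "(F has_real_derivative (\<Sum>j\<le>p. - (b j / (real (p + j) - lam) * t ^ (p + j)) * ((lam - real (p + j)) * dl powr (lam - real (p + j) - 1)))) (at dl)"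
   unfolding F_def[abs_def] using dl by (intro DERIV_sum DERIV_cmult has_real_derivative_powr)
  also have "(\<Sum>j\<le>p. - (b j / (real (p + j) - lam) * t ^ (p + j)) * ((lam - real (p + j)) * dl powr (lam - real (p + j) - 1))) = h dl"
   unfolding h_def
  proof (rule sum.cong[OF refl])
   fix j
   have "- (b j / (real (p + j) - lam) * t ^ (p + j)) * ((lam - real (p + j)) * u) = b j * t ^ (p + j) * u" for u
    using e[of j] by (simp add: field_simps)
   thus "- (b j / (real (p + j) - lam) * t ^ (p + j)) * ((lam - real (p + j)) * dl powr (lam - real (p + j) - 1))
    = b j * t ^ (p + j) * dl powr (lam - real (p + j) - 1)" .
  qed
  finally show "(F has_real_derivative h dl) (at dl)" .
  show "isCont h dl" unfolding h_def using dl by (intro continuous_intros) auto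
 qed
 also have "(%dl. h dl * indicator {t..1} dl) = (%dl. indicator {0<..1} dl * (dl powr (lam - 1) * bump p 1 (t / dl)))"
 proof
  fix dl
  show "h dl * indicator {t..1} dl = indicator {0<..1} dl * (dl powr (lam - 1) * bump p 1 (t / dl))"
  proof (cases "dl \<in> {t..1}")
   case True
   hence dl: "dl > 0" "t <= dl" using t0 by auto
   have "bump p 1 (t / dl) = (\<Sum>j\<le>p. b j * (t / dl) ^ (p + j))"
    unfolding b_def using dl t0 by (intro bump_one_expand) auto
   hence "dl powr (lam - 1) * bump p 1 (t / dl) = (\<Sum>j\<le>p. dl powr (lam - 1) * (b j * (t / dl) ^ (p + j)))"
    by (simp add: sum_distrib_left)
   also have "... = h dl" unfolding h_def
   proof (rule sum.cong[OF refl])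
    fix j
    have "dl powr (lam - real (p + j) - 1) = dl powr (lam - 1) / dl ^ (p + j)"
     using dl by (simp add: powr_realpow[symmetric] flip: powr_diff) (simp add: algebra_simps)
    thus "dl powr (lam - 1) * (b j * (t / dl) ^ (p + j)) = b j * t ^ (p + j) * dl powr (lam - real (p + j) - 1)"
     by (simp add: power_divide)
   qed
   finally show ?thesis using True dl by simp
  next
   case False
   hence "dl \<in> {0<..1} ==> 1 <= t / dl" using t0 by auto
   thus ?thesis using False bump_eq_0[OF p, of "t / dl"] by (auto simp: indicator_def)
  qed
 qed
 also have "F 1 - F t = br_const lam p * (max 0 t) powr lam - (\<Sum>j\<le>p. real (p choose j) * (- 1) ^ j / (real (p + j) - lam) * (max 0 t) ^ (p + j))"
 proof -
  have m: "max 0 t = t" using t0 by simp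
  have F1: "F 1 = - (\<Sum>j\<le>p. b j / (real (p + j) - lam) * t ^ (p + j))"
   by (simp add: F_def sum_negf)
  have "F t = (\<Sum>j\<le>p. - (b j / (real (p + j) - lam)) * t powr lam)"
   unfolding F_def
  proof (rule sum.cong[OF refl])
   fix j
   have "t ^ (p + j) * t powr (lam - real (p + j)) = t powr lam"
    using t0 by (simp add: powr_realpow[symmetric] flip: powr_add)
   thus "- (b j / (real (p + j) - lam) * t ^ (p + j)) * t powr (lam - real (p + j)) = - (b j / (real (p + j) - lam)) * t powr lam"
    by (metis (no_types, lifting) minus_mult_left mult.assoc)
  qed
  hence "F t = - (br_const lam p * t powr lam)"
   by (simp add: br_const_def b_def sum_negf sum_distrib_right)
  thus ?thesis unfolding F1 m b_def by simp
 qed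
 finally show ?thesis .
qed

section \<open>Sufficiency\<close>

abbreviation bump_deriv :: "nat => real => real" where
 "bump_deriv p \<equiv> bump (p - 1) (bump_step p 1)"

text \<open>\<open>pCons 0\<close> multiplies by the variable, so this is v times the derivative of
  the bump at v.\<close>

abbreviation bump_euler :: "nat => real => real" where
 "bump_euler p \<equiv> bump (p - 1) (pCons 0 (bump_step p 1))"

abbreviation sqf3 :: "nat => nat => real => nat => real set => 'n::finite cfun => real^'n => ennreal" where
 "sqf3 p K dl n Y f x \<equiv> sqf K (br_cut (bump p 1) dl n Y) f x + 2 * sqf K (br_cut (bump_deriv p) dl n Y) f x
  + 2 * sqf K (br_cut (bump_euler p) dl n Y) f x"

lemma continuous_bump: "continuous_on S (bump L r)"
 unfolding bump_def by (intro continuous_intros)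

lemma measurable_bump [measurable]: "bump L r \<in> borel_measurable borel"
 by (rule borel_measurable_continuous_onI[OF continuous_bump])

lemma continuous_hmult_br_mult:
 assumes "dl \<noteq> 0" "continuous_on UNIV g"
 shows "continuous_on S (%y. hmult K (br_mult g dl n y) f x)"
 unfolding hmult_def br_mult_def
 using assms(1) by (intro continuous_intros continuous_on_compose2[OF assms(2)]) auto

text \<open>If v is the argument of the bump, its y-derivative is (2 k + n) exp (- y) / dl = (1 - dl
  v) / dl. So one derivative costs 1 / dl and produces only bumps of the same kind.\<close>

lemma hmult_br_mult_has_vector_derivative:
 assumes p: "p >= 2" and dl: "dl > 0"
 shows "((%y. hmult K (br_mult (bump p 1) dl n y) f x) has_vector_derivative
  (1 / dl) *\<^sub>R (hmult K (br_mult (bump_deriv p) dl n y) f x - dl *\<^sub>R hmult K (br_mult (bump_euler p) dl n y) f x)) (at y)"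
proof -
 have d: "((%y. br_mult (bump p 1) dl n y k) has_real_derivative
   (1 / dl) * (br_mult (bump_deriv p) dl n y k - dl * br_mult (bump_euler p) dl n y k)) (at y)" for k
 proof -
  define l where "l = 2 * real k + real n"
  define v where "v = (1 - l * exp (- y)) / dl"
  have "((%y. (1 - l * exp (- y)) / dl) has_real_derivative (l * exp (- y)) / dl) (at y)"
   by (rule derivative_eq_intros refl | simp add: dl less_imp_neq[symmetric])+
  from DERIV_chain2[OF bump_has_derivative[OF p] this]
  have "((%y. bump p 1 ((1 - l * exp (- y)) / dl)) has_real_derivative bump_deriv p v * (l * exp (- y) / dl)) (at y)"
   unfolding v_def .
  moreover have "bump_deriv p v * (l * exp (- y) / dl) = (1 / dl) * (bump_deriv p v - dl * bump_euler p v)"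
  proof -
   have e1: "l * exp (- y) = 1 - dl * v" using dl by (simp add: v_def)
   have e2: "bump_euler p v = v * bump_deriv p v" by (simp add: bump_def)
   show ?thesis unfolding e1 e2 using dl by (simp add: field_simps)
  qed
  ultimately show ?thesis unfolding br_mult_def l_def v_def by (simp only:)
 qed
 have "((%y. \<Sum>\<mu>\<in>midx K. br_mult (bump p 1) dl n y (sum \<mu> UNIV) *\<^sub>R (hcoef f \<mu> * cx (Phi \<mu> x)))
  has_vector_derivative (\<Sum>\<mu>\<in>midx K. ((1 / dl) * (br_mult (bump_deriv p) dl n y (sum \<mu> UNIV) - dl * br_mult (bump_euler p) dl n y (sum \<mu> UNIV)))
    *\<^sub>R (hcoef f \<mu> * cx (Phi \<mu> x)))) (at y)"
  by (intro has_vector_derivative_sum)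
   (use has_vector_derivative_scaleR[OF d has_vector_derivative_const] in simp)
 moreover have "hmult K \<psi> f x = (\<Sum>\<mu>\<in>midx K. \<psi> (sum \<mu> UNIV) *\<^sub>R (hcoef f \<mu> * cx (Phi \<mu> x)))" for \<psi>
  unfolding hmult_def by (intro sum.cong refl) (simp add: scaleR_conv_of_real)
 ultimately show ?thesis
  by (simp add: scaleR_diff_left scaleR_diff_right scaleR_sum_right sum_subtractf diff_divide_distrib left_diff_distrib right_diff_distrib)
qed

text \<open>Sobolev in y: the function vanishes for y <= 0, so its square is the integral of its
  derivative, at most 1 / dl times three square functions. The factor dl in their bounds makes up
  for this.\<close>

lemma hmult_br_mult_le_sqf:
 fixes f :: "'n::finite cfun"
 assumes p: "p >= 2" and dl: "0 < dl" "dl <= 1" and n: "n >= 1" and y: "y <= Y"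
 shows "csq (hmult K (br_mult (bump p 1) dl n y) f x) <= ennreal (1 / dl) *
  (sqf3 p K dl n {..Y} f x)"
proof -
 define F where "F y = hmult K (br_mult (bump p 1) dl n y) f x" for y
 define G where "G y = hmult K (br_mult (bump_deriv p) dl n y) f x" for y
 define E where "E y = hmult K (br_mult (bump_euler p) dl n y) f x" for y
 have cF: "continuous_on S F" and cG: "continuous_on S G" and cE: "continuous_on S E" for S
  unfolding F_def G_def E_def using dl by (intro continuous_hmult_br_mult continuous_bump; simp)+
 have F0: "F y = 0" if "y <= 0" for y
 proof -
  have "br_mult (bump p 1) dl n y k = 0" for k
  proof -
   have "1 <= exp (- y)" using that by simp
   hence "1 * 1 <= (2 * real k + real n) * exp (- y)" using n by (intro mult_mono) auto
   hence "(1 - (2 * real k + real n) * exp (- y)) / dl <= 0" using dl by (simp add: divide_nonpos_pos)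
   thus ?thesis unfolding br_mult_def using p by (intro bump_eq_0) auto
  qed
  thus ?thesis by (simp add: F_def hmult_def)
 qed
 show ?thesis
 proof (cases "y <= 0")
  case True
  thus ?thesis using F0[OF True] by (simp add: F_def)
 next
  case False
  define D where "D y = (1 / dl) *\<^sub>R (G y - dl *\<^sub>R E y)" for y
  define h where "h y = F y \<bullet> D y + D y \<bullet> F y" for y
  have ch: "continuous_on S h" for S unfolding h_def D_def by (intro continuous_intros cF cG cE)
  have "has_bochner_integral lborel (%z. indicator {0..y} z *\<^sub>R h z) (F y \<bullet> F y - F 0 \<bullet> F 0)"
  proof (rule has_bochner_integral_FTC_Icc)
   fix z
   have "(F has_vector_derivative D z) (at z)"
    unfolding F_def[abs_def] D_def G_def E_def by (rule hmult_br_mult_has_vector_derivative[OF p dl(1)])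
   hence "(F has_vector_derivative D z) (at z within {0..y})" by (rule has_vector_derivative_at_within)
   from bounded_bilinear.has_vector_derivative[OF bounded_bilinear_inner this this]
   show "((%z. F z \<bullet> F z) has_vector_derivative h z) (at z within {0..y})" unfolding h_def .
  qed (use False ch in auto)
  hence int: "integrable lborel (%z. indicator {0..y} z *\<^sub>R h z)" and "(LI z. indicator {0..y} z *\<^sub>R h z) = (cmod (F y))^2"
   using F0[of 0] by (auto simp: has_bochner_integral_iff power2_norm_eq_inner)
  hence "csq (F y) <= (NN z. ennreal (norm (indicator {0..y} z *\<^sub>R h z)))"
   using integral_norm_bound_ennreal[OF int] by simp
  also have "... <= (NN z. ennreal (1 / dl) * (csq (hmult K (br_cut (bump p 1) dl n {..Y} z) f x)
    + 2 * csq (hmult K (br_cut (bump_deriv p) dl n {..Y} z) f x) + 2 * csq (hmult K (br_cut (bump_euler p) dl n {..Y} z) f x)))"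
  proof (rule nn_integral_mono)
   fix z
   show "ennreal (norm (indicator {0..y} z *\<^sub>R h z)) <= ennreal (1 / dl) * (csq (hmult K (br_cut (bump p 1) dl n {..Y} z) f x)
    + 2 * csq (hmult K (br_cut (bump_deriv p) dl n {..Y} z) f x) + 2 * csq (hmult K (br_cut (bump_euler p) dl n {..Y} z) f x))"
   proof (cases "z \<in> {0..y}")
    case True
    hence zY: "z \<in> {..Y}" using y by simp
    have cut: "br_cut g dl n {..Y} z = br_mult g dl n z" for g unfolding br_cut_def using zY by (simp add: fun_eq_iff)
    define a b c where "a = cmod (F z)" and "b = cmod (G z)" and "c = cmod (E z)"
    have abc: "0 <= a" "0 <= b" "0 <= c" by (auto simp: a_def b_def c_def)
    have "\<bar>h z\<bar> = 2 * \<bar>F z \<bullet> D z\<bar>" unfolding h_def by (simp add: inner_commute)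
    also have "... <= 2 * (a * cmod (D z))" unfolding a_def using Cauchy_Schwarz_ineq2[of "F z" "D z"] by simp
    also have "cmod (D z) <= (1 / dl) * (b + c)"
    proof -
     have "cmod (G z - dl *\<^sub>R E z) <= b + dl * c" unfolding b_def c_def
      using norm_triangle_ineq4[of "G z" "dl *\<^sub>R E z"] dl by simp
     also have "... <= b + c" using abc dl mult_right_mono[of dl 1 c] by simp
     finally show ?thesis unfolding D_def using dl by (simp add: divide_right_mono)
    qed
    also have "2 * (a * ((1 / dl) * (b + c))) = (1 / dl) * (2 * a * (b + c))" by simp
    also have "2 * a * (b + c) <= a^2 + (b + c)^2" by (rule sum_squares_bound)
    also have "(b + c)^2 <= 2 * b^2 + 2 * c^2" using sum_squares_bound[of b c] by (simp add: power2_sum)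
    finally have "\<bar>h z\<bar> <= (1 / dl) * (a^2 + 2 * b^2 + 2 * c^2)" using abc dl by (simp add: mult_left_mono divide_right_mono add.assoc)
    hence "ennreal \<bar>h z\<bar> <= ennreal ((1 / dl) * (a^2 + 2 * b^2 + 2 * c^2))" by (rule ennreal_leI)
    also have "... = ennreal (1 / dl) * (ennreal (a^2) + 2 * ennreal (b^2) + 2 * ennreal (c^2))"
     using dl by (subst ennreal_mult) (auto simp: ennreal_plus ennreal_mult')
    finally show ?thesis using True unfolding cut a_def b_def c_def F_def G_def E_def by simp
   qed simp
  qed
  also have "... = ennreal (1 / dl) * (sqf3 p K dl n {..Y} f x)"
  proof -
   have [measurable]: "(%z. csq (hmult K (br_cut (bump k r) dl n {..Y} z) f x)) \<in> borel_measurable borel" for k r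
    unfolding hmult_def br_cut_def br_mult_def by measurable
   show ?thesis unfolding sqf_def
    by (subst nn_integral_cmult, measurable, subst nn_integral_add, measurable, subst nn_integral_add, measurable,
      subst (1 2) nn_integral_cmult, measurable)
  qed
  finally show ?thesis unfolding F_def .
 qed
qed

lemma measurable_sqf_param:
 assumes [measurable]: "g \<in> borel_measurable borel" "Y \<in> sets borel"
 shows "(%(dl, x). sqf K (br_cut g dl n Y) f x) \<in> borel_measurable (borel \<Otimes>\<^sub>M borel)"
 unfolding sqf_def hmult_def br_cut_def br_mult_def by measurable

lemma nn_integral_powr_0:
 fixes s c :: real
 assumes "s > 0" "c >= 0"
 shows "(NN dl. ennreal (indicator {0<..c} dl * dl powr (s - 1))) = ennreal (c powr s / s)"
proof (rule nn_integral_has_integral_lborel)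
 have "((%dl. dl powr (s - 1)) has_integral c powr s / s) {0..c}"
  using has_integral_powr_from_0[of "s - 1" c] assms by simp
 hence "((%dl. if dl \<in> {0..c} then dl powr (s - 1) else 0) has_integral c powr s / s) UNIV"
  by (simp only: has_integral_restrict_UNIV)
 also have "(%dl. if dl \<in> {0..c} then dl powr (s - 1) else 0) = (%dl. indicator {0<..c} dl * dl powr (s - 1))"
  by (auto simp: indicator_def fun_eq_iff)
 finally show "((%dl. indicator {0<..c} dl * dl powr (s - 1)) has_integral c powr s / s) UNIV" .
qed auto

text \<open>The square functions of all small bumps, averaged over their widths. R no longer occurs,
  which is what allows a supremum over R.\<close>

definition sing_part :: "nat => nat => real => (real^'n::finite => complex) => real^'n => ennreal" where
 "sing_part p K s f x = (NN dl. ennreal (indicator {0<..1/2} dl * dl powr s) *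
  (let Y = (upto_deg K CARD('n)) in sqf3 p K dl CARD('n) Y f x))"

lemma measurable_sing_part [measurable]: "sing_part p K s f \<in> borel_measurable borel"
proof -
 have m: "(%(dl, x). sqf K (br_cut (bump k r) dl n {..Y}) f x) \<in> borel_measurable (borel \<Otimes>\<^sub>M borel)" for k r n Y
  by (rule measurable_sqf_param) measurable
 have [measurable]: "(%(x, dl). sqf K (br_cut (bump k r) dl n {..Y}) f x) \<in> borel_measurable (borel \<Otimes>\<^sub>M borel)" for k r n Y
  using measurable_compose[OF measurable_pair_swap' m[of k r n Y]] by (simp add: split_beta')
 show ?thesis unfolding sing_part_def Let_def by measurable
qed

text \<open>Cauchy--Schwarz against \<open>dl powr (\<rho> - 1)\<close> costs only \<open>\<rho>\<close> in the exponent.\<close>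

lemma singular_integral_le:
 fixes f :: "'n::finite cfun"
 assumes p: "p >= 2" and \<rho>: "\<rho> > 0" and y: "y <= ln (2 * real K + real CARD('n))"
 shows "(NN dl. ennreal (indicator {0<..1/2} dl * (dl powr (lam - 1) * cmod (hmult K (br_mult (bump p 1) dl CARD('n) y) f x))))^2
  <= ennreal (1 / \<rho>) * sing_part p K (2 * lam - 2 - \<rho>) f x"
proof -
 have n: "CARD('n) >= 1" by (simp add: Suc_leI)
 define F where "F dl = cmod (hmult K (br_mult (bump p 1) dl CARD('n) y) f x)" for dl
 have [measurable]: "F \<in> borel_measurable borel" unfolding F_def hmult_def br_mult_def by measurable
 define I where "I dl = (indicator {0<..1/2} dl :: real)" for dl :: real
 have [measurable]: "I \<in> borel_measurable borel" unfolding I_def by measurable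
 have I: "0 <= I dl" for dl by (simp add: I_def)
 have split: "ennreal (I dl * (dl powr (lam - 1) * F dl)) = ennreal (I dl * dl powr ((\<rho> - 1) / 2)) * ennreal (I dl * (dl powr (lam - 1 - (\<rho> - 1) / 2) * F dl))" for dl
 proof -
  have "dl powr (lam - 1) = dl powr ((\<rho> - 1) / 2) * dl powr (lam - 1 - (\<rho> - 1) / 2)" by (simp flip: powr_add)
  thus ?thesis
   by (subst ennreal_mult[symmetric]) (auto simp: I_def indicator_def F_def)
 qed
 have "(NN dl. ennreal (I dl * (dl powr (lam - 1) * F dl)))^2
   <= (NN dl. ennreal (I dl * dl powr ((\<rho> - 1) / 2)) ^ 2) * (NN dl. ennreal (I dl * (dl powr (lam - 1 - (\<rho> - 1) / 2) * F dl)) ^ 2)"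
  unfolding split by (rule Cauchy_Schwarz_nn_integral) measurable
 also have "(NN dl. ennreal (I dl * dl powr ((\<rho> - 1) / 2)) ^ 2) = (NN dl. ennreal (indicator {0<..1/2} dl * dl powr (\<rho> - 1)))"
 proof (rule nn_integral_cong)
  fix dl :: real
  have "(dl powr ((\<rho> - 1) / 2))^2 = dl powr (\<rho> - 1)" by (simp add: power2_eq_square flip: powr_add)
  thus "ennreal (I dl * dl powr ((\<rho> - 1) / 2)) ^ 2 = ennreal (indicator {0<..1/2} dl * dl powr (\<rho> - 1))"
   by (simp add: ennreal_power I power_mult_distrib) (simp add: I_def indicator_def)
 qed
 also have "... = ennreal ((1 / 2) powr \<rho> / \<rho>)" by (rule nn_integral_powr_0) (use \<rho> in auto)
 also have "... <= ennreal (1 / \<rho>)"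
 proof (rule ennreal_leI, rule divide_right_mono)
  show "(1 / 2) powr \<rho> <= 1" using \<rho> powr_mono2[of \<rho> "1 / 2" 1] by simp
 qed (use \<rho> in simp)
 also have "(NN dl. ennreal (I dl * (dl powr (lam - 1 - (\<rho> - 1) / 2) * F dl)) ^ 2) <= sing_part p K (2 * lam - 2 - \<rho>) f x"
  unfolding sing_part_def Let_def
 proof (rule nn_integral_mono)
  fix dl :: real
  define H where "H = sqf3 p K dl CARD('n) (upto_deg K CARD('n)) f x"
  have "ennreal (I dl * (dl powr (lam - 1 - (\<rho> - 1) / 2) * F dl)) ^ 2 <= ennreal (indicator {0<..1/2} dl * dl powr (2 * lam - 2 - \<rho>)) * H"
  proof (cases "dl \<in> {0<..1/2}")
   case True
   hence dl: "0 < dl" "dl <= 1" by auto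
   \<comment> \<open>One factor dl is split off to cancel the 1 / dl of the Sobolev step.\<close>
   have "(dl powr (lam - 1 - (\<rho> - 1) / 2))^2 = dl powr (2 * lam - 2 - \<rho>) * dl"
   proof -
    have "(dl powr (lam - 1 - (\<rho> - 1) / 2))^2 = dl powr (2 * (lam - 1 - (\<rho> - 1) / 2))"
     by (simp only: power2_eq_square powr_add[symmetric] mult_2)
    also have "2 * (lam - 1 - (\<rho> - 1) / 2) = (2 * lam - 2 - \<rho>) + 1" by (simp add: field_simps)
    finally show ?thesis using dl(1) by (simp only: powr_add powr_one less_imp_le)
   qed
   hence "ennreal (I dl * (dl powr (lam - 1 - (\<rho> - 1) / 2) * F dl)) ^ 2 = ennreal (dl powr (2 * lam - 2 - \<rho>) * dl * (F dl)^2)"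
    using True by (simp add: ennreal_power F_def power_mult_distrib I_def)
   also have "... = ennreal (dl powr (2 * lam - 2 - \<rho>)) * (ennreal dl * ennreal ((F dl)^2))"
    using dl by (simp add: ennreal_mult mult.assoc)
   also have "... <= ennreal (dl powr (2 * lam - 2 - \<rho>)) * (ennreal dl * (ennreal (1 / dl) * H))"
    unfolding H_def F_def by (intro mult_left_mono hmult_br_mult_le_sqf[OF p dl n y]) auto
   also have "ennreal dl * (ennreal (1 / dl) * H) = H"
    using dl by (simp add: mult.assoc[symmetric] ennreal_mult[symmetric])
   finally show ?thesis using True by simp
  qed (simp add: I_def)
  thus "ennreal (I dl * (dl powr (lam - 1 - (\<rho> - 1) / 2) * F dl)) ^ 2 <= ennreal (indicator {0<..1/2} dl * dl powr (2 * lam - 2 - \<rho>)) *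
   (sqf3 p K dl CARD('n) (upto_deg K CARD('n)) f x)"
   unfolding H_def .
 qed
 finally show ?thesis unfolding I_def F_def by (simp add: mult_mono)
qed

text \<open>Each square function contributes dl powr (1 - e), with e the exponent lost in
  \<open>sqf_weighted\<close>, and dl powr (s + 1 - e) is integrable at 0 exactly when s > e -
  2.\<close>

lemma sing_part_weighted:
 assumes al: "0 <= al" and \<epsilon>: "0 < \<epsilon>"
 obtains m where "!!p s. p >= m ==> s > max ((al - 1) / 2) 0 + \<epsilon> - 2 ==>
  \<exists>C\<ge>0. \<forall>K (f :: 'n::finite cfun). tempered_L2 f -->
   (NN x. sing_part p K s f x * ennreal (weight al x)) <= ennreal C * (wnorm' al f)"
proof -
 define e where "e = max ((al - 1) / 2) 0 + \<epsilon>"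
 obtain m C where C: "C > 0" "!!g M dl K (f :: 'n::finite cfun). profile m M g ==> M > 0 ==> 0 < dl ==> dl <= 1 / 2 ==> tempered_L2 f ==>
  sqle K (br_cut (g 0) dl CARD('n) (upto_deg K CARD('n))) f al (C * M^2 * dl * (1 / dl) powr (max ((al - 1) / 2) 0 + \<epsilon>))"
  by (rule sqf_weighted[OF al \<epsilon>, where ?'n = 'n]) (rule that, assumption, assumption)
 show ?thesis
 proof (rule that[of "m + 2"])
  fix p and s :: real assume p: "p >= m + 2" and s: "s > max ((al - 1) / 2) 0 + \<epsilon> - 2"
  have bd: "\<exists>A\<ge>0. \<forall>dl K (f :: 'n cfun). 0 < dl --> dl <= 1 / 2 --> tempered_L2 f -->
    (NN x. sqf K (br_cut (bump L r) dl CARD('n) (upto_deg K CARD('n))) f x * ennreal (weight al x))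
    <= ennreal (A * dl powr (1 - e)) * (wnorm' al f)" if L: "L >= m + 1" for L r
  proof -
   obtain g M where M: "M > 0" and g: "profile m M g" and g0: "g 0 = bump L r" using profile_bump[OF L, of r] by blast
   have "0 <= C * M^2" using C(1) by simp
   moreover have "(NN x. sqf K (br_cut (bump L r) dl CARD('n) (upto_deg K CARD('n))) f x * ennreal (weight al x))
    <= ennreal (C * M^2 * dl powr (1 - e)) * (wnorm' al f)"
    if dl: "0 < dl" "dl <= 1 / 2" and f: "tempered_L2 f" for dl K and f :: "'n cfun"
   proof -
    have "dl powr (1 - e) = dl * (1 / dl) powr e" using dl by (simp add: powr_diff powr_divide)
    hence "C * M^2 * dl powr (1 - e) = C * M^2 * dl * (1 / dl) powr e" by simp
    thus ?thesis using C(2)[OF g M dl f, of K] unfolding g0 weight_def e_def by (simp only:)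
   qed
   ultimately show ?thesis by (intro exI[of _ "C * M^2"]) blast
  qed
  \<comment> \<open>The two derivative bumps have exponent p - 1, hence the requirement p >= m +
    2.\<close>
  have pm: "m + 1 <= p" "m + 1 <= p - 1" using p by auto
  obtain A0 where A0: "A0 >= 0" "!!dl K (f :: 'n cfun). 0 < dl ==> dl <= 1 / 2 ==> tempered_L2 f ==>
    (NN x. sqf K (br_cut (bump p 1) dl CARD('n) (upto_deg K CARD('n))) f x * ennreal (weight al x))
    <= ennreal (A0 * dl powr (1 - e)) * (wnorm' al f)"
   using bd[OF pm(1), of 1] by blast
  obtain A1 where A1: "A1 >= 0" "!!dl K (f :: 'n cfun). 0 < dl ==> dl <= 1 / 2 ==> tempered_L2 f ==>
    (NN x. sqf K (br_cut (bump_deriv p) dl CARD('n) (upto_deg K CARD('n))) f x * ennreal (weight al x))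
    <= ennreal (A1 * dl powr (1 - e)) * (wnorm' al f)"
   using bd[OF pm(2), of "bump_step p 1"] by blast
  obtain A2 where A2: "A2 >= 0" "!!dl K (f :: 'n cfun). 0 < dl ==> dl <= 1 / 2 ==> tempered_L2 f ==>
    (NN x. sqf K (br_cut (bump_euler p) dl CARD('n) (upto_deg K CARD('n))) f x * ennreal (weight al x))
    <= ennreal (A2 * dl powr (1 - e)) * (wnorm' al f)"
   using bd[OF pm(2), of "pCons 0 (bump_step p 1)"] by blast
  define A where "A = A0 + 2 * A1 + 2 * A2"
  have A: "A >= 0" using A0(1) A1(1) A2(1) by (simp add: A_def)
  define t where "t = s + 2 - e"
  have t: "t > 0" using s by (simp add: t_def e_def)
  define B where "B = A * ((1 / 2) powr t / t)"
  have B: "B >= 0" using A t by (simp add: B_def)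
  have "(NN x. sing_part p K s f x * ennreal (weight al x)) <= ennreal B * (wnorm' al f)"
   if f: "tempered_L2 f" for K and f :: "'n cfun"
  proof -
   define Y where "Y = (upto_deg K CARD('n))"
   define W where "W = (wnorm' al f)"
   define q0 where "q0 dl x = sqf K (br_cut (bump p 1) dl CARD('n) Y) f x" for dl x
   define q1 where "q1 dl x = sqf K (br_cut (bump_deriv p) dl CARD('n) Y) f x" for dl x
   define q2 where "q2 dl x = sqf K (br_cut (bump_euler p) dl CARD('n) Y) f x" for dl x
   have [measurable]: "(%(dl, x). q0 dl x) \<in> borel_measurable (borel \<Otimes>\<^sub>M borel)" "(%(dl, x). q1 dl x) \<in> borel_measurable (borel \<Otimes>\<^sub>M borel)"
    "(%(dl, x). q2 dl x) \<in> borel_measurable (borel \<Otimes>\<^sub>M borel)"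
    unfolding q0_def q1_def q2_def Y_def by (rule measurable_sqf_param; measurable)+
   have m1[measurable]: "q0 dl \<in> borel_measurable borel" "q1 dl \<in> borel_measurable borel" "q2 dl \<in> borel_measurable borel" for dl
    by measurable
   have m2[measurable]: "(%dl. q0 dl x) \<in> borel_measurable borel" "(%dl. q1 dl x) \<in> borel_measurable borel" "(%dl. q2 dl x) \<in> borel_measurable borel" for x
    by measurable
   have mw[measurable]: "weight al \<in> borel_measurable borel" unfolding weight_def[abs_def] by measurable
   have "(NN x. sing_part p K s f x * ennreal (weight al x))
     = (NN x. (NN dl. ennreal (indicator {0<..1/2} dl * dl powr s) * (q0 dl x + 2 * q1 dl x + 2 * q2 dl x) * ennreal (weight al x)))"
    unfolding sing_part_def Let_def Y_def[symmetric] q0_def[symmetric] q1_def[symmetric] q2_def[symmetric]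
    by (intro nn_integral_cong nn_integral_multc[symmetric]) measurable
   also have "... = (NN dl. (NN x. ennreal (indicator {0<..1/2} dl * dl powr s) * (q0 dl x + 2 * q1 dl x + 2 * q2 dl x) * ennreal (weight al x)))"
    by (rule lborel_pair.Fubini') measurable
   also have "... <= (NN dl. (ennreal A * W) * ennreal (indicator {0<..1/2} dl * dl powr (t - 1)))"
   proof (rule nn_integral_mono)
    fix dl :: real
    show "(NN x. ennreal (indicator {0<..1/2} dl * dl powr s) * (q0 dl x + 2 * q1 dl x + 2 * q2 dl x) * ennreal (weight al x))
      <= (ennreal A * W) * ennreal (indicator {0<..1/2} dl * dl powr (t - 1))"
    proof (cases "dl \<in> {0<..1/2}")
     case True
     hence dl: "0 < dl" "dl <= 1 / 2" by auto
     define c where "c = dl powr (1 - e)"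
     have c: "c >= 0" by (simp add: c_def)
     have "(NN x. ennreal (dl powr s) * (q0 dl x + 2 * q1 dl x + 2 * q2 dl x) * ennreal (weight al x))
      = (NN x. ennreal (dl powr s) * (q0 dl x * ennreal (weight al x) + 2 * (q1 dl x * ennreal (weight al x)) + 2 * (q2 dl x * ennreal (weight al x))))"
      by (intro nn_integral_cong) (simp only: distrib_right distrib_left mult.assoc)
     also have "... = ennreal (dl powr s) * ((NN x. q0 dl x * ennreal (weight al x)) + 2 * (NN x. q1 dl x * ennreal (weight al x)) + 2 * (NN x. q2 dl x * ennreal (weight al x)))"
      by (subst nn_integral_cmult, measurable, subst nn_integral_add, measurable, subst nn_integral_add, measurable,
       subst (1 2) nn_integral_cmult, measurable)
     also have "... <= ennreal (dl powr s) * (ennreal (A0 * c) * W + 2 * (ennreal (A1 * c) * W) + 2 * (ennreal (A2 * c) * W))"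
      unfolding q0_def q1_def q2_def W_def Y_def c_def
      by (intro mult_left_mono add_mono A0(2) A1(2) A2(2) dl f) auto
     also have "ennreal (A0 * c) * W + 2 * (ennreal (A1 * c) * W) + 2 * (ennreal (A2 * c) * W) = ennreal (A * c) * W"
     proof -
      have "ennreal (A * c) = ennreal (A0 * c) + 2 * ennreal (A1 * c) + 2 * ennreal (A2 * c)"
       unfolding A_def using A0(1) A1(1) A2(1) c by (simp add: distrib_right ennreal_plus ennreal_mult' mult.assoc)
      thus ?thesis by (simp only: distrib_right mult.assoc)
     qed
     also have "ennreal (dl powr s) * (ennreal (A * c) * W) = (ennreal A * W) * ennreal (dl powr s * c)"
      using A c by (simp add: ennreal_mult mult_ac)
     also have "dl powr s * c = dl powr (t - 1)" unfolding c_def t_def by (simp add: algebra_simps flip: powr_add)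
     finally show ?thesis using True by simp
    qed simp
   qed
   also have "... = (ennreal A * W) * ennreal ((1 / 2) powr t / t)"
    by (subst nn_integral_cmult, measurable) (subst nn_integral_powr_0, use t in auto)
   also have "... = ennreal B * W"
   proof -
    have "ennreal B = ennreal A * ennreal ((1 / 2) powr t / t)" unfolding B_def using A t by (intro ennreal_mult) auto
    thus ?thesis by (simp only: mult_ac)
   qed
   finally show ?thesis unfolding W_def .
  qed
  thus "\<exists>C\<ge>0. \<forall>K (f :: 'n::finite cfun). tempered_L2 f -->
   (NN x. sing_part p K s f x * ennreal (weight al x)) <= ennreal C * (wnorm' al f)"
   using B by blast
 qed
qed

section \<open>Pointwise domination of the means, and the supremum over R\<close>

abbreviation br_sym :: "nat => real => nat => real" where
 "br_sym n R k \<equiv> max 0 (1 - (2 * real k + real n) / R^2)"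

lemma BR_mean_hmult:
 fixes f :: "'n::finite cfun"
 assumes "R^2 <= 2 * real K + real CARD('n)" "R > 0"
 shows "BR_mean lam R f x = hmult K (%k. (br_sym CARD('n) R k) powr lam) f x"
 unfolding BR_mean_def hmult_herm_proj
proof (rule sum.mono_neutral_cong_left)
 show "{k. real (2 * k + CARD('n)) < R^2} \<subseteq> {..<K}" using assms by auto
 show "\<forall>k\<in>{..<K} - {k. real (2 * k + CARD('n)) < R^2}.
   cx ((br_sym CARD('n) R k) powr lam) * herm_proj k f x = 0"
 proof
  fix k assume "k \<in> {..<K} - {k. real (2 * k + CARD('n)) < R^2}"
  hence "R^2 <= 2 * real k + real CARD('n)" by auto
  hence "1 - (2 * real k + real CARD('n)) / R^2 <= 0" using assms(2) by (simp add: field_simps)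
  thus "cx ((br_sym CARD('n) R k) powr lam) * herm_proj k f x = 0"
   by (simp add: max_absorb1)
 qed
qed (auto simp: algebra_simps)

text \<open>The average over widths is cut at 1 / 2: the square-function bounds require widths up to
  1 / 2, while the wider bumps, like the integer powers, are smooth symbols at scale R.\<close>

lemma BR_mean_pointwise:
 fixes f :: "'n::finite cfun" and x :: "real^'n"
 assumes lam: "0 < lam" "lam < real p" and R: "R > 0" "R^2 <= 2 * real K + real CARD('n)"
 defines "F \<equiv> %dl. cmod (hmult K (br_mult (bump p 1) dl CARD('n) (ln (R^2))) f x)"
 shows "ennreal (br_const lam p * cmod (BR_mean lam R f x))
  <= (NN dl. ennreal (indicator {0<..1/2} dl * (dl powr (lam - 1) * F dl)))
   + (NN dl. ennreal (indicator {1/2<..1} dl * (dl powr (lam - 1) * F dl)))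
   + (\<Sum>j\<le>p. ennreal (\<bar>real (p choose j) * (- 1) ^ j / (real (p + j) - lam)\<bar>
     * cmod (hmult K (%k. (br_sym CARD('n) R k) ^ (p + j)) f x)))"
proof -
 define n where "n = real CARD('n)"
 define t where "t k = 1 - (2 * real k + n) / R^2" for k
 have t1: "t k <= 1" for k by (simp add: t_def n_def)
 define P where "P k = herm_proj k f x" for k
 define e where "e j = real (p choose j) * (- 1) ^ j / (real (p + j) - lam)" for j
 define h where "h k dl = indicator {0<..1} dl * (dl powr (lam - 1) * bump p 1 (t k / dl))" for k dl
 define v where "v k = br_const lam p * (max 0 (t k)) powr lam - (\<Sum>j\<le>p. e j * (max 0 (t k)) ^ (p + j))" for k
 have hb: "has_bochner_integral lborel (h k) (v k)" for k
  unfolding h_def v_def e_def using br_power_decomposition[OF lam t1] .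
 define H where "H dl = (\<Sum>k<K. cx (h k dl) * P k)" for dl
 have HB: "has_bochner_integral lborel H (\<Sum>k<K. cx (v k) * P k)"
  unfolding H_def
  by (intro has_bochner_integral_sum has_bochner_integral_mult_left has_bochner_integral_bounded_linear[OF bounded_linear_of_real] hb)
 have "cx (br_const lam p) * BR_mean lam R f x = (\<Sum>k<K. cx (br_const lam p * (max 0 (t k)) powr lam) * P k)"
  unfolding BR_mean_hmult[OF R(2,1)] hmult_herm_proj t_def P_def n_def by (simp add: sum_distrib_left mult.assoc)
 also have "... = (\<Sum>k<K. cx (v k) * P k + (\<Sum>j\<le>p. cx (e j) * (cx ((max 0 (t k)) ^ (p + j)) * P k)))"
 proof (rule sum.cong[OF refl])
  fix k
  have "br_const lam p * (max 0 (t k)) powr lam = v k + (\<Sum>j\<le>p. e j * (max 0 (t k)) ^ (p + j))" by (simp add: v_def)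
  thus "cx (br_const lam p * (max 0 (t k)) powr lam) * P k
   = cx (v k) * P k + (\<Sum>j\<le>p. cx (e j) * (cx ((max 0 (t k)) ^ (p + j)) * P k))"
   by (simp only: of_real_add of_real_sum of_real_mult distrib_right sum_distrib_right mult.assoc)
 qed
 also have "... = (LI dl. H dl) + (\<Sum>j\<le>p. cx (e j) * hmult K (%k. (max 0 (t k)) ^ (p + j)) f x)"
  unfolding sum.distrib has_bochner_integral_integral_eq[OF HB] hmult_herm_proj P_def[symmetric] sum_distrib_left
  by (subst (2) sum.swap) (rule refl)
 finally have main: "cx (br_const lam p) * BR_mean lam R f x
   = (LI dl. H dl) + (\<Sum>j\<le>p. cx (e j) * hmult K (%k. (max 0 (t k)) ^ (p + j)) f x)" .
 have "br_const lam p * cmod (BR_mean lam R f x) = cmod (cx (br_const lam p) * BR_mean lam R f x)"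
  using br_const_pos[OF lam] by (simp add: norm_mult)
 also have "... <= cmod (LI dl. H dl) + (\<Sum>j\<le>p. \<bar>e j\<bar> * cmod (hmult K (%k. (max 0 (t k)) ^ (p + j)) f x))"
  unfolding main
  by (rule order_trans[OF norm_triangle_ineq add_left_mono[OF order_trans[OF norm_sum]]]) (simp add: norm_mult)
 finally have "ennreal (br_const lam p * cmod (BR_mean lam R f x))
   <= ennreal (cmod (LI dl. H dl) + (\<Sum>j\<le>p. \<bar>e j\<bar> * cmod (hmult K (%k. (max 0 (t k)) ^ (p + j)) f x)))"
  by (rule ennreal_leI)
 also have "... = ennreal (cmod (LI dl. H dl)) + (\<Sum>j\<le>p. ennreal (\<bar>e j\<bar> * cmod (hmult K (%k. (max 0 (t k)) ^ (p + j)) f x)))"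
  by (subst sum_ennreal) (auto simp: sum_nonneg ennreal_plus)
 also have "ennreal (cmod (LI dl. H dl)) <= (NN dl. ennreal (cmod (H dl)))"
  using HB by (intro integral_norm_bound_ennreal) (simp add: has_bochner_integral_iff)
 also have "(NN dl. ennreal (cmod (H dl)))
   = (NN dl. ennreal (indicator {0<..1/2} dl * (dl powr (lam - 1) * F dl)) + ennreal (indicator {1/2<..1} dl * (dl powr (lam - 1) * F dl)))"
 proof (rule nn_integral_cong)
  fix dl :: real
  have "bump p 1 (t k / dl) = br_mult (bump p 1) dl CARD('n) (ln (R^2)) k" for k
   unfolding br_mult_def t_def n_def using R by (simp add: exp_minus divide_inverse)
  hence "H dl = cx (indicator {0<..1} dl * dl powr (lam - 1)) * hmult K (br_mult (bump p 1) dl CARD('n) (ln (R^2))) f x"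
   unfolding H_def h_def hmult_herm_proj P_def sum_distrib_left by (intro sum.cong refl) simp
  hence "cmod (H dl) = indicator {0<..1} dl * (dl powr (lam - 1) * F dl)"
   by (simp add: norm_mult F_def indicator_def)
  thus "ennreal (cmod (H dl)) = ennreal (indicator {0<..1/2} dl * (dl powr (lam - 1) * F dl)) + ennreal (indicator {1/2<..1} dl * (dl powr (lam - 1) * F dl))"
   by (auto simp: indicator_def)
 qed
 also have "... = (NN dl. ennreal (indicator {0<..1/2} dl * (dl powr (lam - 1) * F dl))) + (NN dl. ennreal (indicator {1/2<..1} dl * (dl powr (lam - 1) * F dl)))"
  unfolding F_def hmult_def br_mult_def by (rule nn_integral_add) measurable
 finally show ?thesis unfolding e_def t_def n_def by (simp add: add_mono)
qed

lemma ennreal_square_sum_le: "(a + b)^2 <= 2 * a^2 + 2 * b^2" for a b :: ennreal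
proof (cases "a = \<infinity> \<or> b = \<infinity>")
 case True
 thus ?thesis by (auto simp: power2_eq_square ennreal_mult_eq_top_iff)
next
 case False
 then obtain x y where xy: "a = ennreal x" "b = ennreal y" "0 <= x" "0 <= y"
  by (metis ennreal_cases infinity_ennreal_def)
 have "(x + y)^2 <= 2 * x^2 + 2 * y^2" using sum_squares_bound[of x y] by (simp add: power2_sum)
 hence "ennreal ((x + y)^2) <= ennreal (2 * x^2 + 2 * y^2)" by (rule ennreal_leI)
 thus ?thesis using xy by (simp add: ennreal_plus ennreal_mult' flip: ennreal_power)
qed

lemma ennreal_SUP_square_le:
 fixes g :: "'a => ennreal"
 assumes le: "!!i. i \<in> I ==> (g i)^2 <= B" and "I \<noteq> {}"
 shows "(SUP i\<in>I. g i)^2 <= B"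
proof (cases "B = \<infinity>")
 case False
 then obtain b where b: "B = ennreal b" "b >= 0" by (metis ennreal_cases infinity_ennreal_def)
 have "g i <= ennreal (sqrt b)" if "i \<in> I" for i
 proof -
  have "(g i)^2 \<noteq> \<infinity>" using le[OF that] b by (auto simp: top_unique)
  then obtain x where x: "g i = ennreal x" "x >= 0" by (cases "g i") (auto simp: power2_eq_square)
  hence "x^2 <= b" using le[OF that] b by (simp add: ennreal_power)
  thus ?thesis using x by (simp add: ennreal_leI real_le_rsqrt)
 qed
 hence "(SUP i\<in>I. g i) <= ennreal (sqrt b)" by (intro SUP_least)
 hence "(SUP i\<in>I. g i)^2 <= (ennreal (sqrt b))^2" by (intro power_mono) auto
 thus ?thesis using b by (simp add: ennreal_power)
qed simp

text \<open>The dominating function depends on R only through the constraint R^2 <= 2 K + n, so the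
  supremum over R can be taken pointwise before integrating.\<close>

lemma BR_mean_dominated:
 assumes al: "0 <= al" "al < real CARD('n::finite)" and lam: "0 < lam" "lam < real p" and p: "p >= 4 * CARD('n) + 2" and \<rho>: "\<rho> > 0"
 obtains C where "C > 0" "!!K R (f :: 'n cfun) x. R > 0 ==> R^2 <= 2 * real K + real CARD('n) ==> tempered_L2 f ==>
  (ennreal (cmod (BR_mean lam R f x)))^2 * ennreal (weight al x) <= ennreal C * (sing_part p K (2 * lam - 2 - \<rho>) f x * ennreal (weight al x)
   + (pmax (2 * K + CARD('n)) (%y. ennreal (sqrt (weight al y) * cmod (f y))) x)^2)"
proof -
 let ?n = "CARD('n)"
 obtain C0 where C0: "C0 > 0" "!!K \<psi> R M J (f :: 'n cfun) x. (!!k. k >= K ==> \<psi> k = 0) ==> (!!k. R^2 < real (Suc k) ==> \<psi> k = 0) ==>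
  R >= 1 ==> R <= 2 ^ J ==> M >= 0 ==> (!!l k. l <= 4 * CARD('n) ==> \<bar>(fdiff ^^ l) \<psi> k\<bar> <= M / R ^ (2 * l)) ==> tempered_L2 f ==>
  ennreal (sqrt (weight al x) * cmod (hmult K \<psi> f x)) <= ennreal (C0 * M) * pmax J (%y. ennreal (sqrt (weight al y) * cmod (f y))) x"
  using smooth_multiplier_pointwise[OF al] by blast
 have "p >= 4 * ?n + 1" using p by simp
 then obtain g M where M: "M > 0" and g: "profile (4 * ?n) M g" and g0: "g 0 = bump p 1" using profile_bump by blast
 have "?n >= 1" by (simp add: Suc_leI)
 hence n1: "real ?n >= 1" by (simp only: of_nat_1_eq_iff real_of_nat_ge_one_iff)
 define \<kappa> where "\<kappa> = br_const lam p"
 have \<kappa>: "\<kappa> > 0" unfolding \<kappa>_def by (rule br_const_pos[OF lam])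
 define M1 where "M1 = 4 ^ (4 * ?n) * M"
 define M2 where "M2 = (2 * real (2 * p)) ^ (4 * ?n)"
 define E where "E = (\<Sum>j\<le>p. \<bar>real (p choose j) * (- 1) ^ j / (real (p + j) - lam)\<bar>)"
 define C1 where "C1 = C0 * (2 * M1 + E * M2)"
 have M1: "M1 >= 0" and M2: "M2 >= 0" and E: "E >= 0" using M by (auto simp: M1_def M2_def E_def sum_nonneg)
 have C1: "C1 >= 0" unfolding C1_def using C0(1) M1 M2 E by simp
 show ?thesis
 proof (rule that[of "(2 / \<rho> + 2 * C1^2 + 1) / \<kappa>^2"])
  show "(2 / \<rho> + 2 * C1^2 + 1) / \<kappa>^2 > 0" using \<kappa> \<rho> by (intro divide_pos_pos add_nonneg_pos add_nonneg_nonneg) auto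
  fix K and R :: real and f :: "'n cfun" and x
  assume R: "R > 0" "R^2 <= 2 * real K + real ?n" and f: "tempered_L2 f"
  define y where "y = ln (R^2)"
  have ey: "exp y = R^2" "exp (- y) = 1 / R^2" using R by (auto simp: y_def exp_minus divide_inverse)
  have yle: "y <= ln (2 * real K + real ?n)" unfolding y_def using R by (intro ln_mono) auto
  define J where "J = 2 * K + ?n"
  define PM where "PM = pmax J (%y. ennreal (sqrt (weight al y) * cmod (f y))) x"
  define w where "w = sqrt (weight al x)"
  have w: "w >= 0" "w^2 = weight al x" by (auto simp: w_def weight_def)
  have smooth: "ennreal (w * cmod (hmult K \<psi> f x)) <= ennreal (C0 * B) * PM"
   if B: "B >= 0" and van: "!!k. R^2 <= 2 * real k + real ?n ==> \<psi> k = 0"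
    and d: "!!l k. l <= 4 * ?n ==> \<bar>(fdiff ^^ l) \<psi> k\<bar> <= B / R ^ (2 * l)" for \<psi> B
  proof (cases "R >= 1")
   case True
   have "R * 1 <= R * R" using True by (intro mult_left_mono) auto
   also have "... <= real J" using R by (simp add: J_def power2_eq_square)
   also have "... <= 2 ^ J" using of_nat_less_two_power[of J, where ?'a = real] by simp
   finally have RJ: "R <= 2 ^ J" by simp
   show ?thesis unfolding w_def PM_def
   proof (rule C0(2)[OF _ _ True RJ B d f])
    show "\<psi> k = 0" if "k >= K" for k by (rule van) (use that R(2) in auto)
    show "\<psi> k = 0" if "R^2 < real (Suc k)" for k
    proof (rule van)
     have "real (Suc k) <= 2 * real k + real ?n" using n1 of_nat_0_le_iff[of k, where ?'a = real] unfolding of_nat_Suc by linarith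
     thus "R^2 <= 2 * real k + real ?n" using that by simp
    qed
   qed
  next
   \<comment> \<open>For R < 1 the smallest eigenvalue n >= 1 already exceeds R^2, so the symbol
     vanishes.\<close>
   case False
   have "\<psi> k = 0" for k
   proof (rule van)
    have "R^2 <= 1" using False R(1) by (simp add: power_le_one)
    also have "1 <= 2 * real k + real ?n" using n1 of_nat_0_le_iff[of k, where ?'a = real] unfolding of_nat_Suc by linarith
    finally show "R^2 <= 2 * real k + real ?n" .
   qed
   thus ?thesis by (simp add: hmult_def)
  qed
  define F where "F dl = cmod (hmult K (br_mult (bump p 1) dl ?n y) f x)" for dl
  define S where "S = (NN dl. ennreal (indicator {0<..1/2} dl * (dl powr (lam - 1) * F dl)))"
  define T where "T = (NN dl. ennreal (indicator {1/2<..1} dl * (dl powr (lam - 1) * F dl)))"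
  define Q where "Q j = cmod (hmult K (%k. (br_sym ?n R k) ^ (p + j)) f x)" for j
  define c where "c j = \<bar>real (p choose j) * (- 1) ^ j / (real (p + j) - lam)\<bar>" for j
  have p2: "p >= 2" using p by simp
  have S2: "S^2 <= ennreal (1 / \<rho>) * sing_part p K (2 * lam - 2 - \<rho>) f x"
   unfolding S_def F_def by (rule singular_integral_le[OF p2 \<rho> yle])
  have Fw: "ennreal (w * F dl) <= ennreal (C0 * M1) * PM" if dl: "1 / 2 < dl" "dl <= 1" for dl
   unfolding F_def
  proof (rule smooth[OF M1])
   fix k assume k: "R^2 <= 2 * real k + real ?n"
   have "(1 - (2 * real k + real ?n) * exp (- y)) / dl <= 0"
    using k R dl by (intro divide_nonpos_pos) (auto simp: ey field_simps)
   thus "br_mult (bump p 1) dl ?n y k = 0" unfolding br_mult_def using p2 by (intro bump_eq_0) auto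
  next
   fix l k assume l: "l <= 4 * ?n"
   have "\<bar>(fdiff ^^ l) (br_mult (g 0) dl ?n y) k\<bar> <= (2 * exp (- y) / dl) ^ l * M"
    by (rule fdiff_br_mult_bound(1)[OF g _ l]) (use dl in simp)
   also have "... <= (4 / R^2) ^ l * M"
   proof (intro mult_right_mono power_mono)
    have "2 / dl <= 4" using dl by (simp add: field_simps)
    hence "(2 / dl) * (1 / R^2) <= 4 * (1 / R^2)" by (rule mult_right_mono) simp
    thus "2 * exp (- y) / dl <= 4 / R^2" by (simp add: ey mult.commute)
   qed (use M dl in auto)
   also have "... = 4 ^ l * M / R ^ (2 * l)" by (simp add: power_divide power_mult)
   also have "... <= M1 / R ^ (2 * l)"
    unfolding M1_def using l M R by (intro divide_right_mono mult_right_mono power_increasing) auto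
   finally show "\<bar>(fdiff ^^ l) (br_mult (bump p 1) dl ?n y) k\<bar> <= M1 / R ^ (2 * l)" unfolding g0 .
  qed
  have "ennreal w * T <= ennreal (2 * (C0 * M1)) * PM"
  proof -
   have "ennreal w * T = (NN dl. ennreal w * ennreal (indicator {1/2<..1} dl * (dl powr (lam - 1) * F dl)))"
    unfolding T_def F_def hmult_def br_mult_def by (rule nn_integral_cmult[symmetric]) measurable
   also have "... <= (NN dl. (ennreal (2 * (C0 * M1)) * PM) * indicator {1/2<..1::real} dl)"
   proof (rule nn_integral_mono)
    fix dl :: real
    show "ennreal w * ennreal (indicator {1/2<..1} dl * (dl powr (lam - 1) * F dl)) <= (ennreal (2 * (C0 * M1)) * PM) * indicator {1/2<..1} dl"
    proof (cases "dl \<in> {1/2<..1}")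
     case True
     hence dl: "1 / 2 < dl" "dl <= 1" by auto
     have "dl powr (lam - 1) <= dl powr (- 1)" using dl lam by (intro powr_mono') auto
     also have "... <= 2" using dl by (simp add: powr_minus_divide field_simps)
     finally have "ennreal (dl powr (lam - 1)) <= 2" using ennreal_leI[of "dl powr (lam - 1)" 2] by simp
     hence "ennreal (dl powr (lam - 1)) * ennreal (w * F dl) <= 2 * (ennreal (C0 * M1) * PM)"
      by (intro mult_mono Fw dl) auto
     moreover have "ennreal (dl powr (lam - 1)) * ennreal (w * F dl) = ennreal w * ennreal (dl powr (lam - 1) * F dl)"
      using w by (simp add: ennreal_mult F_def mult_ac)
     moreover have "2 * (ennreal (C0 * M1) * PM) = ennreal (2 * (C0 * M1)) * PM"
      using C0(1) M1 by (simp add: ennreal_mult mult.assoc)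
     ultimately show ?thesis using True by simp
    qed simp
   qed
   also have "... = (ennreal (2 * (C0 * M1)) * PM) * ennreal (1 / 2)" by (simp add: nn_integral_cmult)
   also have "... <= (ennreal (2 * (C0 * M1)) * PM) * 1"
   proof -
    have "ennreal (1 / 2) <= ennreal 1" by (rule ennreal_leI) simp
    thus ?thesis unfolding ennreal_1 by (rule mult_left_mono) simp
   qed
   finally show ?thesis by simp
  qed
  moreover have "ennreal w * (\<Sum>j\<le>p. ennreal (c j * Q j)) <= ennreal (C0 * (E * M2)) * PM"
  proof -
   have Qw: "ennreal (w * Q j) <= ennreal (C0 * M2) * PM" if "j <= p" for j
    unfolding Q_def
   proof (rule smooth[OF M2])
    fix k assume "R^2 <= 2 * real k + real ?n"
    hence "1 - (2 * real k + real ?n) / R^2 <= 0" using R by (simp add: field_simps)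
    thus "(br_sym ?n R k) ^ (p + j) = 0" using p2 by (simp add: max_absorb1)
   next
    fix l k assume l: "l <= 4 * ?n"
    have "\<bar>(fdiff ^^ l) (%k. (br_sym ?n R k) ^ (p + j)) k\<bar> <= (2 * real (p + j)) ^ l / R ^ (2 * l)"
     by (rule fdiff_max0_power_bound) (use l p R in auto)
    also have "... <= M2 / R ^ (2 * l)"
    proof (rule divide_right_mono)
     have "(2 * real (p + j)) ^ l <= (2 * real (2 * p)) ^ l" using that by (intro power_mono) auto
     also have "... <= M2" unfolding M2_def using l p2 by (intro power_increasing) auto
     finally show "(2 * real (p + j)) ^ l <= M2" .
    qed (use R in simp)
    finally show "\<bar>(fdiff ^^ l) (%k. (br_sym ?n R k) ^ (p + j)) k\<bar> <= M2 / R ^ (2 * l)" .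
   qed
   have c: "c j >= 0" for j by (simp add: c_def)
   have "ennreal w * (\<Sum>j\<le>p. ennreal (c j * Q j)) = (\<Sum>j\<le>p. ennreal (c j) * ennreal (w * Q j))"
    unfolding sum_distrib_left using w c by (intro sum.cong refl) (simp add: ennreal_mult Q_def mult_ac)
   also have "... <= (\<Sum>j\<le>p. ennreal (c j) * (ennreal (C0 * M2) * PM))"
    by (intro sum_mono mult_left_mono Qw) auto
   also have "... = ennreal E * (ennreal (C0 * M2) * PM)"
    unfolding E_def c_def[symmetric] using c by (simp add: sum_distrib_right[symmetric])
   also have "... = ennreal (C0 * (E * M2)) * PM"
    using C0(1) M2 E by (simp add: ennreal_mult mult_ac)
   finally show ?thesis .
  qed
  ultimately have TQ: "ennreal w * (T + (\<Sum>j\<le>p. ennreal (c j * Q j))) <= ennreal C1 * PM"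
  proof -
   assume a: "ennreal w * T <= ennreal (2 * (C0 * M1)) * PM" and b: "ennreal w * (\<Sum>j\<le>p. ennreal (c j * Q j)) <= ennreal (C0 * (E * M2)) * PM"
   have "ennreal C1 = ennreal (2 * (C0 * M1)) + ennreal (C0 * (E * M2))"
    unfolding C1_def using C0(1) M1 M2 E by (subst ennreal_plus[symmetric]) (auto simp: algebra_simps)
   thus ?thesis using add_mono[OF a b] by (simp only: distrib_left distrib_right)
  qed
  have "ennreal (\<kappa> * cmod (BR_mean lam R f x)) <= S + (T + (\<Sum>j\<le>p. ennreal (c j * Q j)))"
   using BR_mean_pointwise[OF lam R, of f x] unfolding \<kappa>_def S_def T_def F_def Q_def c_def y_def by (simp only: add.assoc)
  hence "ennreal w * ennreal (\<kappa> * cmod (BR_mean lam R f x)) <= ennreal w * (S + (T + (\<Sum>j\<le>p. ennreal (c j * Q j))))"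
   by (rule mult_left_mono) simp
  also have "... <= ennreal w * S + ennreal C1 * PM" using TQ by (simp only: distrib_left add_left_mono)
  finally have "(ennreal w * ennreal (\<kappa> * cmod (BR_mean lam R f x)))^2 <= (ennreal w * S + ennreal C1 * PM)^2"
   by (intro power_mono) auto
  also have "... <= 2 * (ennreal w * S)^2 + 2 * (ennreal C1 * PM)^2" by (rule ennreal_square_sum_le)
  also have "... = 2 * (ennreal (weight al x) * S^2) + 2 * (ennreal (C1^2) * PM^2)"
   using w C1 by (simp add: power_mult_distrib ennreal_power)
  also have "... <= 2 * (ennreal (weight al x) * (ennreal (1 / \<rho>) * sing_part p K (2 * lam - 2 - \<rho>) f x)) + 2 * (ennreal (C1^2) * PM^2)"
   using S2 by (intro add_mono mult_left_mono) auto
  also have "... = ennreal (2 / \<rho>) * (sing_part p K (2 * lam - 2 - \<rho>) f x * ennreal (weight al x)) + ennreal (2 * C1^2) * PM^2"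
  proof -
   have "ennreal (2 / \<rho>) = 2 * ennreal (1 / \<rho>)" using \<rho> ennreal_mult[of 2 "1 / \<rho>"] by simp
   moreover have "ennreal (2 * C1^2) = 2 * ennreal (C1^2)" using ennreal_mult[of 2 "C1^2"] by simp
   ultimately show ?thesis by (simp only: mult_ac)
  qed
  also have "... <= ennreal (2 / \<rho> + 2 * C1^2 + 1) * (sing_part p K (2 * lam - 2 - \<rho>) f x * ennreal (weight al x)) + ennreal (2 / \<rho> + 2 * C1^2 + 1) * PM^2"
   using \<rho> by (intro add_mono mult_right_mono ennreal_leI) auto
  finally have bnd: "(ennreal w * ennreal (\<kappa> * cmod (BR_mean lam R f x)))^2
   <= ennreal (2 / \<rho> + 2 * C1^2 + 1) * (sing_part p K (2 * lam - 2 - \<rho>) f x * ennreal (weight al x) + PM^2)"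
   by (simp only: distrib_left)
  have "(ennreal (cmod (BR_mean lam R f x)))^2 * ennreal (weight al x) = ennreal (1 / \<kappa>^2) * (ennreal w * ennreal (\<kappa> * cmod (BR_mean lam R f x)))^2"
  proof -
   have "(cmod (BR_mean lam R f x))^2 * weight al x = (1 / \<kappa>^2) * (w * (\<kappa> * cmod (BR_mean lam R f x)))^2"
    using \<kappa> w by (simp add: power_mult_distrib)
   moreover have "0 <= weight al x" by (simp add: weight_def)
   ultimately show ?thesis using \<kappa> w
    by (simp add: ennreal_mult[symmetric] ennreal_power)
  qed
  also have "... <= ennreal (1 / \<kappa>^2) * (ennreal (2 / \<rho> + 2 * C1^2 + 1) * (sing_part p K (2 * lam - 2 - \<rho>) f x * ennreal (weight al x) + PM^2))"
   by (intro mult_left_mono bnd) simp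
  also have "... = ennreal ((2 / \<rho> + 2 * C1^2 + 1) / \<kappa>^2) * (sing_part p K (2 * lam - 2 - \<rho>) f x * ennreal (weight al x) + PM^2)"
  proof -
   have "ennreal ((2 / \<rho> + 2 * C1^2 + 1) / \<kappa>^2) = ennreal (1 / \<kappa>^2) * ennreal (2 / \<rho> + 2 * C1^2 + 1)"
    using \<rho> by (subst ennreal_mult[symmetric]) auto
   thus ?thesis by (simp only: mult.assoc)
  qed
  finally show "(ennreal (cmod (BR_mean lam R f x)))^2 * ennreal (weight al x) <= ennreal ((2 / \<rho> + 2 * C1^2 + 1) / \<kappa>^2) *
   (sing_part p K (2 * lam - 2 - \<rho>) f x * ennreal (weight al x) + (pmax (2 * K + ?n) (%y. ennreal (sqrt (weight al y) * cmod (f y))) x)^2)"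
   unfolding PM_def J_def .
 qed
qed

theorem BR_max_bounded_sufficient:
 assumes al: "0 <= al" "al < real CARD('n::finite)" and lam: "lam > max ((al - 1) / 4) 0"
 shows "BR_max_bounded TYPE('n) lam al"
proof -
 define b where "b = max ((al - 1) / 2) 0"
 have b: "2 * lam > b" "b >= 0" using lam by (auto simp: b_def max_def split: if_splits)
 \<comment> \<open>A quarter of the gap: one \<epsilon> is lost in \<open>sqf_weighted\<close> and
   one in the Cauchy-Schwarz step, and both must fit into 2 lam - b.\<close>
 define \<epsilon> where "\<epsilon> = (2 * lam - b) / 4"
 have \<epsilon>: "\<epsilon> > 0" using b by (simp add: \<epsilon>_def)
 have lam0: "lam > 0" using lam by simp
 obtain m where m: "!!p s. p >= m ==> s > max ((al - 1) / 2) 0 + \<epsilon> - 2 ==>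
  \<exists>C\<ge>0. \<forall>K (f :: 'n::finite cfun). tempered_L2 f -->
   (NN x. sing_part p K s f x * ennreal (weight al x)) <= ennreal C * (wnorm' al f)"
  by (rule sing_part_weighted[OF al(1) \<epsilon>, where ?'n = 'n]) (rule that, assumption)
 define p where "p = m + 4 * CARD('n) + 2 + nat \<lceil>lam\<rceil>"
 have p: "p >= m" "p >= 4 * CARD('n) + 2" "lam < real p"
  using real_nat_ceiling_ge[of lam] by (auto simp: p_def)
 define s where "s = 2 * lam - 2 - \<epsilon>"
 have "s > max ((al - 1) / 2) 0 + \<epsilon> - 2" unfolding s_def b_def[symmetric] using b by (simp add: \<epsilon>_def field_simps)
 from m[OF p(1) this] obtain C1 where C1: "C1 >= 0" "!!K (f :: 'n cfun). tempered_L2 f ==>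
   (NN x. sing_part p K s f x * ennreal (weight al x)) <= ennreal C1 * (wnorm' al f)"
  by blast
 obtain C2 where C2: "C2 > 0" "!!J (f :: real^'n => ennreal). f \<in> borel_measurable borel ==>
  (NN x. (pmax J f x)^2) <= ennreal C2 * (NN x. (f x)^2)"
  using pmax_L2[where ?'n = 'n] by blast
 obtain C where C: "C > 0" "!!K R (f :: 'n cfun) x. R > 0 ==> R^2 <= 2 * real K + real CARD('n) ==> tempered_L2 f ==>
  (ennreal (cmod (BR_mean lam R f x)))^2 * ennreal (weight al x) <= ennreal C * (sing_part p K (2 * lam - 2 - \<epsilon>) f x * ennreal (weight al x)
   + (pmax (2 * K + CARD('n)) (%y. ennreal (sqrt (weight al y) * cmod (f y))) x)^2)"
  by (rule BR_mean_dominated[OF al lam0 p(3,2) \<epsilon>]) (rule that, assumption, assumption)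
 have mw[measurable]: "weight al \<in> borel_measurable (borel :: (real^'n) measure)" unfolding weight_def[abs_def] by measurable
 show ?thesis
  unfolding BR_max_bounded_def
 proof (intro exI allI impI)
  fix f :: "'n cfun" assume fL: "f \<in> L2w al"
  define W where "W = (wnorm' al f)"
  have [measurable]: "f \<in> borel_measurable borel" and fin: "W < \<infinity>" using fL by (auto simp: L2w_def W_def)
  have f: "tempered_L2 f"
   unfolding tempered_L2_def
  proof (intro conjI exI)
   have "(NN x. ennreal ((norm (f x))^2 / (1 + norm x) ^ CARD('n))) <= W"
    unfolding W_def
   proof (intro nn_integral_mono ennreal_leI)
    fix x :: "real^'n"
    have "1 / (1 + norm x) ^ CARD('n) = (1 + norm x) powr (- real CARD('n))"
     by (subst powr_minus_divide, subst powr_realpow) (auto simp: add_pos_nonneg)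
    also have "... <= weight al x" unfolding weight_def using al by (intro powr_mono) auto
    finally have "(norm (f x))^2 * (1 / (1 + norm x) ^ CARD('n)) <= (norm (f x))^2 * weight al x" by (rule mult_left_mono) simp
    thus "(norm (f x))^2 / (1 + norm x) ^ CARD('n) <= (norm (f x))^2 * weight al x" by simp
   qed
   thus "(NN x. ennreal ((norm (f x))^2 / (1 + norm x) ^ CARD('n))) < \<infinity>" using fin by (rule le_less_trans)
  qed simp
  define D where "D K x = ennreal C * (sing_part p K s f x * ennreal (weight al x)
   + (pmax (2 * K + CARD('n)) (%y. ennreal (sqrt (weight al y) * cmod (f y))) x)^2)" for K x
  have [measurable]: "D K \<in> borel_measurable borel" for K unfolding D_def by measurable
  have int: "(NN x. D K x) <= ennreal (C * (C1 + C2)) * W" for K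
  proof -
   have "(NN x. D K x) = ennreal C * ((NN x. sing_part p K s f x * ennreal (weight al x))
     + (NN x. (pmax (2 * K + CARD('n)) (%y. ennreal (sqrt (weight al y) * cmod (f y))) x)^2))"
    unfolding D_def by (subst nn_integral_cmult, measurable, subst nn_integral_add, measurable)
   also have "... <= ennreal C * (ennreal C1 * W + ennreal C2 * (NN x. (ennreal (sqrt (weight al x) * cmod (f x)))^2))"
    unfolding W_def by (intro mult_left_mono add_mono C1(2) C2(2) f) auto
   also have "(NN x. (ennreal (sqrt (weight al x) * cmod (f x)))^2) = W"
    unfolding W_def by (intro nn_integral_cong) (simp add: ennreal_power power_mult_distrib weight_def mult.commute)
   also have "ennreal C * (ennreal C1 * W + ennreal C2 * W) = ennreal (C * (C1 + C2)) * W"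
    using C(1) C1(1) C2(1) by (simp add: ennreal_mult ennreal_plus distrib_right mult.assoc)
   finally show ?thesis .
  qed
  \<comment> \<open>For each R the bound \<open>D K x\<close> is available for all large K; the
    lower limit therefore bounds every R at once and is suited to Fatou's lemma.\<close>
  have ptw: "(BR_max lam f x)^2 * ennreal (weight al x) <= liminf (%K. D K x)" for x
  proof -
   have wpos: "weight al x > 0" by (simp add: weight_def add_pos_nonneg less_imp_neq[symmetric])
   define w where "w = ennreal (sqrt (weight al x))"
   have w2: "w^2 = ennreal (weight al x)" using wpos by (simp add: w_def ennreal_power)
   have each: "(ennreal (norm (BR_mean lam R f x)) * w)^2 <= liminf (%K. D K x)" if R: "R > 0" for R
   proof (rule Liminf_bounded)
    have "(ennreal (norm (BR_mean lam R f x)) * w)^2 <= D K x" if "K >= nat \<lceil>R^2\<rceil>" for K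
    proof -
     have "R^2 <= real K" using that real_nat_ceiling_ge[of "R^2"] by linarith
     hence "R^2 <= 2 * real K + real CARD('n)" by simp
     from C(2)[OF R this f, of x] show ?thesis unfolding D_def s_def power_mult_distrib w2 .
    qed
    thus "\<forall>\<^sub>F K in sequentially. (ennreal (norm (BR_mean lam R f x)) * w)^2 <= D K x"
     unfolding eventually_sequentially by blast
   qed
   have "(BR_max lam f x)^2 * ennreal (weight al x) = (SUP R\<in>{0<..}. ennreal (norm (BR_mean lam R f x)) * w)^2"
    unfolding BR_max_def w2[symmetric] power_mult_distrib[symmetric] by (simp add: SUP_mult_right_ennreal)
   also have "... <= liminf (%K. D K x)" by (rule ennreal_SUP_square_le[OF each]) auto
   finally show ?thesis .
  qed
  have "(NN x. (BR_max lam f x)^2 * ennreal (weight al x)) <= (NN x. liminf (%K. D K x))"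
   by (intro nn_integral_mono ptw)
  also have "... <= liminf (%K. (NN x. D K x))" by (rule nn_integral_liminf) measurable
  also have "... <= liminf (%K. ennreal (C * (C1 + C2)) * W)" by (intro Liminf_mono always_eventually allI int)
  also have "... = ennreal (C * (C1 + C2)) * W" by (rule Liminf_const) simp
  finally show "(NN x. (BR_max lam f x)^2 * ennreal (weight al x)) <= ennreal (C * (C1 + C2)) * (wnorm' al f)"
   unfolding W_def .
 qed
qed

section \<open>Necessity\<close>

text \<open>Each factor t moves the index by one, so t ^ m lowers it by at most m. At the bottom K -
  m only the pure lowering path contributes, a product of m factors sqrt (i / 2) with i > K -
  m.\<close>

lemma hermite_power_coefficient:
 fixes K :: nat
 defines "A \<equiv> %m j. LINT t|lborel. t ^ m * (hermite_fun K t * hermite_fun j t)"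
 shows "j + m < K ==> A m j = 0" and "m <= K ==> sqrt (real (K - m) / 2) ^ m <= A m (K - m)"
proof -
 have int: "integrable lborel (%t. t ^ m * (hermite_fun K t * hermite_fun j t))" for m j
  by (intro rapid_integrable rapid_power rapid_times rapid_hermite)
 have step: "A (Suc m) j = sqrt (real (Suc j) / 2) * A m (Suc j) + sqrt (real j / 2) * A m (j - 1)" for m j
 proof -
  have "t ^ Suc m * (hermite_fun K t * hermite_fun j t)
    = sqrt (real (Suc j) / 2) * (t ^ m * (hermite_fun K t * hermite_fun (Suc j) t)) + sqrt (real j / 2) * (t ^ m * (hermite_fun K t * hermite_fun (j - 1) t))" for t
  proof -
   have "t ^ Suc m * (hermite_fun K t * hermite_fun j t) = t ^ m * hermite_fun K t * (t * hermite_fun j t)" by simp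
   thus ?thesis unfolding hermite_fun_rec by (simp only: distrib_left mult_ac)
  qed
  thus ?thesis unfolding A_def
   by (simp only: Bochner_Integration.integral_add[OF integrable_mult_right[OF int] integrable_mult_right[OF int]] integral_mult_right_zero)
 qed
 show z: "j + m < K ==> A m j = 0" for j m
 proof (induction m arbitrary: j)
  case 0
  thus ?case using hermite_orthonormal[of K j] by (simp add: A_def)
 next
  case (Suc m)
  thus ?case using Suc.IH[of "Suc j"] Suc.IH[of "j - 1"] by (simp add: step del: of_nat_Suc)
 qed
 show "m <= K ==> sqrt (real (K - m) / 2) ^ m <= A m (K - m)"
 proof (induction m)
  case 0
  thus ?case using hermite_orthonormal[of K K] by (simp add: A_def)
 next
  case (Suc m)
  define j where "j = K - Suc m"
  have j: "Suc j = K - m" using Suc.prems by (simp add: j_def)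
  have "sqrt (real j / 2) * A m (j - 1) = 0"
  proof (cases "j = 0")
   case False
   hence "j - 1 + m < K" using j by simp
   thus ?thesis by (simp add: z)
  qed simp
  hence eq: "A (Suc m) j = sqrt (real (K - m) / 2) * A m (K - m)" unfolding step j by simp
  have "sqrt (real j / 2) ^ Suc m <= sqrt (real (K - m) / 2) ^ Suc m"
   using j by (intro power_mono real_sqrt_le_mono divide_right_mono) auto
  also have "... <= sqrt (real (K - m) / 2) * A m (K - m)"
   unfolding power_Suc using Suc by (intro mult_left_mono) auto
  finally show ?case unfolding eq[symmetric] j_def .
 qed
qed

definition axis_midx :: "'n => nat => 'n::finite => nat" where
 "axis_midx i k = (%j. if j = i then k else 0)"

lemma sum_axis_midx: "sum (axis_midx i k) UNIV = k"
 by (simp add: axis_midx_def)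

lemma axis_midx_eq: "(\<forall>j. j \<noteq> i --> \<mu> j = 0) ==> \<mu> = axis_midx i (sum \<mu> UNIV)"
proof -
 assume a: "\<forall>j. j \<noteq> i --> \<mu> j = 0"
 hence "sum \<mu> UNIV = \<mu> i" by (subst sum.remove[of _ i]) auto
 thus ?thesis using a by (auto simp: axis_midx_def)
qed

text \<open>The factor x_i ^ m suppresses the mass near the origin, which would otherwise dominate
  the weighted norm once al > 1. The norm squared is then of order at most K powr (m - al / 2), as
  if all mass sat at |x| ~ sqrt K.\<close>

definition axis_test :: "'n => nat => nat => real^'n::finite => complex" where
 "axis_test i m K x = cx ((x $ i) ^ m * Phi (axis_midx i K) x)"

text \<open>R^2 = 2 k + n + 1 lies between the eigenvalues of degrees k and k + 1, and the test
  function has no component of degree below k; the one surviving term carries the factor (1 / R^2)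
  powr lam.\<close>

lemma BR_mean_axis_test:
 fixes x :: "real^'n::finite"
 assumes K: "K = k + m"
 shows "BR_mean lam (sqrt (2 * real k + real CARD('n) + 1)) (axis_test i m K) x
  = cx ((1 / (2 * real k + real CARD('n) + 1)) powr lam * (LI t. t ^ m * (hermite_fun K t * hermite_fun k t)) * Phi (axis_midx i k) x)"
proof -
 define n where "n = real CARD('n)"
 define A where "A j = (LI t. t ^ m * (hermite_fun K t * hermite_fun j t))" for j
 have hc: "hcoef (axis_test i m K) \<mu> = cx (if \<forall>j. j \<noteq> i --> \<mu> j = 0 then A (\<mu> i) else 0)" for \<mu>
 proof -
  have "hcoef (axis_test i m K) \<mu> = (LI y. cx ((y $ i) ^ m * (Phi (axis_midx i K) y * Phi \<mu> y)))"
   unfolding hcoef_def axis_test_def by (simp add: mult.assoc)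
  also have "... = cx (LI y. (y $ i) ^ m * (Phi (axis_midx i K) y * Phi \<mu> y))"
   by (rule integral_complex_of_real)
  also have "(LI y. (y $ i) ^ m * (Phi (axis_midx i K) y * Phi \<mu> y))
    = (if \<forall>j. j \<noteq> i --> axis_midx i K j = \<mu> j then (LI t. t ^ m * (hermite_fun (axis_midx i K i) t * hermite_fun (\<mu> i) t)) else 0)"
   by (rule integral_coordinate_weight(2)[where C = 1 and m = m]) (auto intro!: continuous_intros power_mono simp: power_abs)
  finally show ?thesis by (auto simp: axis_midx_def A_def)
 qed
 have van: "hcoef (axis_test i m K) \<mu> = 0" if "sum \<mu> UNIV < k \<or> \<mu> \<noteq> axis_midx i (sum \<mu> UNIV)" for \<mu>
 proof (cases "\<forall>j. j \<noteq> i --> \<mu> j = 0")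
  case True
  hence \<mu>: "\<mu> = axis_midx i (sum \<mu> UNIV)" by (rule axis_midx_eq)
  hence "\<mu> i < k" using that by (metis axis_midx_def)
  hence "A (\<mu> i) = 0" unfolding A_def by (intro hermite_power_coefficient(1)) (simp add: K)
  thus ?thesis by (simp add: hc)
 qed (auto simp: hc)
 have fin: "finite {\<mu>::'n => nat. sum \<mu> UNIV = k'}" for k'
  by (rule finite_subset[OF _ finite_midx[of "Suc k'"]]) (auto simp: midx_def)
 have P0: "herm_proj k' (axis_test i m K) x = 0" if "k' < k" for k'
  unfolding herm_proj_def hcoef_def[symmetric] using that van by (intro sum.neutral) auto
 have Pk: "herm_proj k (axis_test i m K) x = cx (A k) * cx (Phi (axis_midx i k) x)"
 proof -
  have "herm_proj k (axis_test i m K) x = (\<Sum>\<mu>\<in>{axis_midx i k}. hcoef (axis_test i m K) \<mu> * cx (Phi \<mu> x))"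
   unfolding herm_proj_def hcoef_def[symmetric]
   by (rule sum.mono_neutral_right[OF fin]) (use van in \<open>auto simp: sum_axis_midx\<close>)
  thus ?thesis by (simp add: hc axis_midx_def)
 qed
 have R2: "(sqrt (2 * real k + n + 1))^2 = 2 * real k + n + 1" by (simp add: n_def)
 have "BR_mean lam (sqrt (2 * real k + n + 1)) (axis_test i m K) x
   = (\<Sum>k'\<in>{k}. cx ((max 0 (1 - real (2 * k' + CARD('n)) / (2 * real k + n + 1))) powr lam) * herm_proj k' (axis_test i m K) x)"
  unfolding BR_mean_def R2
 proof (rule sum.mono_neutral_right)
  have sub: "{k'. real (2 * k' + CARD('n)) < 2 * real k + n + 1} \<subseteq> {..k}"
  proof
   fix k' assume "k' \<in> {k'. real (2 * k' + CARD('n)) < 2 * real k + n + 1}"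
   hence "2 * real k' < 2 * real k + 1" by (simp add: n_def)
   thus "k' \<in> {..k}" by simp
  qed
  thus "finite {k'. real (2 * k' + CARD('n)) < 2 * real k + n + 1}" by (rule finite_subset) simp
  show "{k} \<subseteq> {k'. real (2 * k' + CARD('n)) < 2 * real k + n + 1}" by (simp add: n_def)
  show "\<forall>k'\<in>{k'. real (2 * k' + CARD('n)) < 2 * real k + n + 1} - {k}.
   cx ((max 0 (1 - real (2 * k' + CARD('n)) / (2 * real k + n + 1))) powr lam) * herm_proj k' (axis_test i m K) x = 0"
  proof
   fix k' assume "k' \<in> {k'. real (2 * k' + CARD('n)) < 2 * real k + n + 1} - {k}"
   hence "k' < k" using sub by auto
   thus "cx ((max 0 (1 - real (2 * k' + CARD('n)) / (2 * real k + n + 1))) powr lam) * herm_proj k' (axis_test i m K) x = 0"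
    by (simp add: P0)
  qed
 qed
 also have "... = cx ((max 0 (1 - real (2 * k + CARD('n)) / (2 * real k + n + 1))) powr lam) * herm_proj k (axis_test i m K) x" by simp
 also have "max 0 (1 - real (2 * k + CARD('n)) / (2 * real k + n + 1)) = 1 / (2 * real k + n + 1)"
 proof -
  have "2 * real k + n + 1 > 0" by (simp add: n_def add_nonneg_pos)
  hence "1 - real (2 * k + CARD('n)) / (2 * real k + n + 1) = 1 / (2 * real k + n + 1)" by (simp add: n_def field_simps)
  thus ?thesis by (simp add: n_def)
 qed
 finally show ?thesis unfolding n_def A_def[symmetric] by (simp add: Pk mult.assoc)
qed

lemma axis_test_norm:
 fixes i :: "'n::finite"
 assumes al: "0 <= al" "al <= 2 * real m" and K: "K >= 1" "m <= K"
 shows "(NN x. csqw (axis_test i m K x) (weight al x)) <= ennreal ((5 ^ m + 4 ^ m) * real K powr (real m - al / 2))"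
proof -
 define \<mu> where "\<mu> = axis_midx i K"
 define a where "a = real K powr (- al / 2)"
 define b where "b = 4 ^ m * real K powr (real m - al / 2)"
 have ab: "a >= 0" "b >= 0" by (auto simp: a_def b_def)
 have cond: "continuous_on UNIV (%t::real. t ^ (2 * m))" "\<bar>t ^ (2 * m)\<bar> <= 1 * (1 + \<bar>t\<bar>) ^ (2 * m)" for t :: real
  by (auto intro!: continuous_intros power_mono simp: power_abs)
 have i1: "integrable lborel (%x. (x $ i) ^ (2 * m) * (Phi \<mu> x * Phi \<mu> x))"
  and e1: "(LI x. (x $ i) ^ (2 * m) * (Phi \<mu> x * Phi \<mu> x)) = (LI t. t ^ (2 * m) * (hermite_fun K t * hermite_fun K t))"
  using integral_coordinate_weight[OF cond, of i \<mu> \<mu>] by (simp_all add: \<mu>_def axis_midx_def)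
 have i2: "integrable lborel (%x. 1 * (Phi \<mu> x * Phi \<mu> x))" and e2: "(LI x. 1 * (Phi \<mu> x * Phi \<mu> x)) = 1"
  using integral_coordinate_weight[of "%t. 1" 1 0 i \<mu> \<mu>] hermite_orthonormal[of "\<mu> i" "\<mu> i"] by auto
 have pw: "(x $ i) ^ (2 * m) * weight al x <= a * (x $ i) ^ (2 * m) + b" for x :: "real^'n"
 proof -
  define t where "t = \<bar>x $ i\<bar>"
  have t: "t >= 0" "t <= norm x" "(x $ i) ^ (2 * m) = t ^ (2 * m)"
   using component_le_norm_cart[of x i] by (auto simp: t_def power_even_abs)
  have w: "weight al x <= (1 + t) powr (- al)" unfolding weight_def using t al by (intro powr_mono2') auto
  \<comment> \<open>Split at |x_i| = sqrt K: outside, the weight is at most K powr (- al / 2);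
    inside, 2 m >= al makes the bound on x_i ^ (2 m) times the weight largest at the
    boundary.\<close>
  show ?thesis
  proof (cases "real K <= t^2")
   case True
   have K0: "real K > 0" using K by simp
   have "sqrt (real K) <= 1 + t" using True t real_le_lsqrt[of t "real K"] by simp
   hence "(1 + t) powr (- al) <= sqrt (real K) powr (- al)" using K0 al by (intro powr_mono2') auto
   also have "... = a" using K0 by (simp add: a_def powr_half_sqrt[symmetric] powr_powr)
   finally have "weight al x <= a" using w by simp
   hence "t ^ (2 * m) * weight al x <= t ^ (2 * m) * a" using t by (intro mult_left_mono) auto
   thus ?thesis using ab t by (simp add: mult.commute)
  next
   case False
   have K1: "sqrt (real K) >= 1" using K by simp
   have "t <= sqrt (real K)" using False t by (intro real_le_rsqrt) simp
   hence t1: "1 + t <= 2 * sqrt (real K)" using K1 by linarith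
   have "t ^ (2 * m) * weight al x <= (1 + t) ^ (2 * m) * (1 + t) powr (- al)"
    using t w by (intro mult_mono power_mono) (auto simp: weight_def)
   also have "... = (1 + t) powr (2 * real m - al)"
    using t by (simp add: powr_realpow[symmetric] flip: powr_add)
   also have "... <= (2 * sqrt (real K)) powr (2 * real m - al)" using t t1 al by (intro powr_mono2) auto
   also have "... = 2 powr (2 * real m - al) * sqrt (real K) powr (2 * real m - al)" by (rule powr_mult)
   also have "sqrt (real K) powr (2 * real m - al) = real K powr (real m - al / 2)"
    by (simp add: powr_half_sqrt[symmetric] powr_powr diff_divide_distrib)
   also have "2 powr (2 * real m - al) <= (2::real) powr (2 * real m)" using al by (intro powr_mono) auto
   also have "(2::real) powr (2 * real m) = 4 ^ m"
   proof -
    have "(2::real) powr (2 * real m) = (2 powr 2) powr real m" by (simp only: powr_powr)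
    thus ?thesis by (simp add: powr_realpow)
   qed
   finally have "t ^ (2 * m) * weight al x <= b" by (simp add: b_def mult_right_mono)
   thus ?thesis using ab t by (simp add: add_increasing)
  qed
 qed
 have "(NN x. csqw (axis_test i m K x) (weight al x))
   <= (NN x. ennreal (a * ((x $ i) ^ (2 * m) * (Phi \<mu> x * Phi \<mu> x)) + b * (1 * (Phi \<mu> x * Phi \<mu> x))))"
 proof (intro nn_integral_mono ennreal_leI)
  fix x :: "real^'n"
  have "(norm (axis_test i m K x))^2 * weight al x = ((x $ i) ^ (2 * m) * weight al x) * (Phi \<mu> x * Phi \<mu> x)"
  proof -
   have "norm (axis_test i m K x) = \<bar>(x $ i) ^ m * Phi \<mu> x\<bar>" unfolding axis_test_def \<mu>_def by (rule norm_of_real)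
   hence "(norm (axis_test i m K x))^2 = ((x $ i) ^ m * Phi \<mu> x)^2" by (simp only: power2_abs)
   also have "... = (x $ i) ^ (2 * m) * (Phi \<mu> x * Phi \<mu> x)" by (simp add: power_mult_distrib power_even_eq power2_eq_square)
   finally show ?thesis by simp
  qed
  also have "... <= (a * (x $ i) ^ (2 * m) + b) * (Phi \<mu> x * Phi \<mu> x)" by (intro mult_right_mono pw) simp
  finally show "(norm (axis_test i m K x))^2 * weight al x <= a * ((x $ i) ^ (2 * m) * (Phi \<mu> x * Phi \<mu> x)) + b * (1 * (Phi \<mu> x * Phi \<mu> x))"
   by (simp add: distrib_right mult.assoc)
 qed
 also have "... = ennreal (LI x. a * ((x $ i) ^ (2 * m) * (Phi \<mu> x * Phi \<mu> x)) + b * (1 * (Phi \<mu> x * Phi \<mu> x)))"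
  using ab i1 i2 by (intro nn_integral_eq_integral Bochner_Integration.integrable_add integrable_mult_right AE_I2) (auto simp: zero_le_even_power)
 also have "(LI x. a * ((x $ i) ^ (2 * m) * (Phi \<mu> x * Phi \<mu> x)) + b * (1 * (Phi \<mu> x * Phi \<mu> x)))
   = a * (LI t. t ^ (2 * m) * (hermite_fun K t * hermite_fun K t)) + b * 1"
  unfolding Bochner_Integration.integral_add[OF integrable_mult_right[OF i1] integrable_mult_right[OF i2]] integral_mult_right_zero e1 using e2 by simp
 also have "... <= a * (5 * real K) ^ m + b * 1"
 proof (intro add_mono mult_left_mono order_refl ab)
  have "(LI t. t ^ (2 * m) * (hermite_fun K t * hermite_fun K t)) <= (2 * real (K + m) + 1) ^ m"
   using hermite_moment_bound[of m K] by (simp add: power2_eq_square)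
  also have "... <= (5 * real K) ^ m" using K by (intro power_mono) auto
  finally show "(LI t. t ^ (2 * m) * (hermite_fun K t * hermite_fun K t)) <= (5 * real K) ^ m" .
 qed
 also have "a * (5 * real K) ^ m + b * 1 = (5 ^ m + 4 ^ m) * real K powr (real m - al / 2)"
 proof -
  have "a * real K ^ m = real K powr (real m - al / 2)"
   unfolding a_def using K by (simp add: powr_realpow[symmetric] flip: powr_add)
  thus ?thesis by (simp add: b_def power_mult_distrib distrib_right)
 qed
 finally show ?thesis by (simp add: ennreal_leI)
qed

lemma hermite_weighted_pos: "0 < (LI t. (1 + \<bar>t\<bar>) powr (- a) * (hsq k t))" if "a >= 0"
proof -
 have int: "integrable lborel (%t. (1 + \<bar>t\<bar>) powr (- a) * (hsq k t))"
 proof (rule Bochner_Integration.integrable_bound[OF rapid_integrable[OF rapid_hermite_square[of k]]])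
  have "(1 + \<bar>t\<bar>) powr (- a) <= 1" for t :: real using powr_mono2'[of "- a" 1 "1 + \<bar>t\<bar>"] that by simp
  thus "AE t in lborel. norm ((1 + \<bar>t\<bar>) powr (- a) * (hsq k t)) <= norm ((hsq k t))"
   by (auto simp: mult_left_le_one_le)
 qed (use rapid_measurable[OF rapid_hermite[of k]] in measurable)
 have "(LI t. (1 + \<bar>t\<bar>) powr (- a) * (hsq k t)) \<noteq> 0"
 proof
  assume "(LI t. (1 + \<bar>t\<bar>) powr (- a) * (hsq k t)) = 0"
  hence "AE t in lborel. (1 + \<bar>t\<bar>) powr (- a) * (hsq k t) = 0"
   using integral_nonneg_eq_0_iff_AE[OF int] by simp
  hence "AE t in lborel. (hsq k t) = 0" by (rule AE_mp) (auto intro!: AE_I2 simp: add_nonneg_eq_0_iff)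
  hence "(LI t. (hsq k t)) = 0" by (rule integral_eq_zero_AE)
  thus False by (simp add: integral_hermite_square)
 qed
 moreover have "0 <= (LI t. (1 + \<bar>t\<bar>) powr (- a) * (hsq k t))" by (rule Bochner_Integration.integral_nonneg) simp
 ultimately show ?thesis by (metis order_le_less)
qed

text \<open>1 + |x| is at most the product of the 1 + |x_j|, so the weight dominates a product
  weight and the integral factors; the coordinates other than i contribute a fixed positive
  constant.\<close>

lemma axis_Phi_norm:
 fixes i :: "'n::finite"
 assumes al: "0 <= al"
 shows "ennreal ((LI t. (1 + \<bar>t\<bar>) powr (- al) * (hsq k t)) * (LI t. (1 + \<bar>t\<bar>) powr (- al) * (hsq 0 t)) ^ (CARD('n) - 1))
  <= (NN x. ennreal ((Phi (axis_midx i k) x)^2 * weight al x))"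
proof -
 define \<mu> where "\<mu> = axis_midx i k"
 define F where "F j t = (1 + \<bar>t\<bar>) powr (- al) * (hsq (\<mu> j) t)" for j t
 have int: "integrable lborel (F j)" for j
  using hermite_weighted_pos[OF al, of "\<mu> j"] not_integrable_integral_eq[of lborel "F j"] unfolding F_def by force
 have "(LI t. (1 + \<bar>t\<bar>) powr (- al) * (hsq k t)) * (LI t. (1 + \<bar>t\<bar>) powr (- al) * (hsq 0 t)) ^ (CARD('n) - 1)
   = (\<Prod>j\<in>UNIV. LINT t|lborel. F j t)"
 proof -
  have "(\<Prod>j\<in>UNIV. LINT t|lborel. F j t) = (LI t. F i t) * (\<Prod>j\<in>UNIV - {i}. LINT t|lborel. F j t)"
   by (rule prod.remove) auto
  also have "(\<Prod>j\<in>UNIV - {i}. LINT t|lborel. F j t) = (\<Prod>j\<in>UNIV - {i}. LINT t|lborel. (1 + \<bar>t\<bar>) powr (- al) * (hsq 0 t))"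
   by (intro prod.cong refl) (auto simp: F_def \<mu>_def axis_midx_def)
  also have "... = (LI t. (1 + \<bar>t\<bar>) powr (- al) * (hsq 0 t)) ^ (CARD('n) - 1)" by simp
  also have "(LI t. F i t) = (LI t. (1 + \<bar>t\<bar>) powr (- al) * (hsq k t))" by (simp add: F_def \<mu>_def axis_midx_def)
  finally show ?thesis ..
 qed
 also have "... = (LI x. (\<Prod>j\<in>UNIV. F j ((x::real^'n) $ j)))" using integral_cart_prod[of F] int by simp
 also have "ennreal ... = (NN x. ennreal (\<Prod>j\<in>UNIV. F j ((x::real^'n) $ j)))"
  by (rule nn_integral_eq_integral[OF integrable_cart_prod[OF int], symmetric]) (intro AE_I2 prod_nonneg ballI, simp add: F_def)
 also have "... <= (NN x. ennreal ((Phi \<mu> x)^2 * weight al x))"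
 proof (intro nn_integral_mono ennreal_leI)
  fix x :: "real^'n"
  have "(\<Prod>j\<in>UNIV. F j (x $ j)) = (\<Prod>j\<in>UNIV. 1 + \<bar>x $ j\<bar>) powr (- al) * (Phi \<mu> x)^2"
  proof -
   have "(\<Prod>j\<in>UNIV. (1 + \<bar>x $ j\<bar>) powr (- al)) = (\<Prod>j\<in>UNIV. 1 + \<bar>x $ j\<bar>) powr (- al)"
    by (rule prod_powr_distrib[symmetric])
   thus ?thesis by (simp add: F_def prod.distrib Phi_def prod_power_distrib)
  qed
  also have "... <= weight al x * (Phi \<mu> x)^2"
   unfolding weight_def using norm_le_prod_coordinates[of x] al
   by (intro mult_right_mono powr_mono2') (auto simp: add_pos_nonneg)
  finally show "(\<Prod>j\<in>UNIV. F j (x $ j)) <= (Phi \<mu> x)^2 * weight al x" by (simp add: mult.commute)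
 qed
 finally show ?thesis unfolding \<mu>_def .
qed

text \<open>Compare powers of k: the surviving term contributes at least k powr (- 2 lam + m - 1 /
  2), the test function at most k powr (m - al / 2), up to constants. So boundedness bounds k powr e
  with e = (al - 1) / 2 - 2 lam, which excludes e > 0.\<close>

theorem BR_max_bounded_necessary:
 assumes al: "0 <= al" and lam: "lam >= 0" and bd: "BR_max_bounded TYPE('n::finite) lam al"
 shows "(al - 1) / 4 <= lam"
proof (rule ccontr)
 assume "\<not> (al - 1) / 4 <= lam"
 define e where "e = (al - 1) / 2 - 2 * lam"
 have e: "e > 0" using \<open>\<not> (al - 1) / 4 <= lam\<close> by (simp add: e_def field_simps)
 define n where "n = real CARD('n)"
 have n: "n >= 0" by (simp add: n_def)
 obtain i :: 'n where True by simp
 define m where "m = nat \<lceil>al\<rceil>"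
 have "al <= real m" unfolding m_def by (rule real_nat_ceiling_ge)
 hence m: "al <= 2 * real m" by simp
 obtain C where C: "!!f::real^'n => complex. f \<in> L2w al ==>
    (NN  x. (BR_max lam f x)^2 * ennreal (weight al x)) <= ennreal C * (NN  x. csqw (f x) (weight al x))"
  using bd unfolding BR_max_bounded_def by blast
 obtain c where c: "c > 0" "!!k. k >= 6400 ==> c * real (k + 1) powr (- 1 / 2) <= (LI t. (1 + \<bar>t\<bar>) powr (- al) * (hsq k t))"
  using hermite_weighted_lower by blast
 define c0 where "c0 = (LI t. (1 + \<bar>t\<bar>) powr (- al) * (hsq 0 t)) ^ (CARD('n) - 1)"
 have c0: "c0 > 0" unfolding c0_def by (intro zero_less_power hermite_weighted_pos al)
 define D where "D = max C 0 * (5 ^ m + 4 ^ m)"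
 have D: "D >= 0" by (simp add: D_def)
 have main: "(1 / (2 * real k + n + 1)) powr (2 * lam) * (real k / 2) ^ m * (c * real (k + 1) powr (- 1 / 2) * c0) <= D * real (k + m) powr (real m - al / 2)"
  if k: "k >= 6400" for k
 proof -
  define K where "K = k + m"
  define R where "R = sqrt (2 * real k + n + 1)"
  have R: "R > 0" using n by (simp add: R_def add_nonneg_pos)
  define A where "A = (LI t. t ^ m * (hermite_fun K t * hermite_fun k t))"
  have A: "sqrt (real k / 2) ^ m <= A"
   unfolding A_def using hermite_power_coefficient(2)[of m K] by (simp add: K_def)
  define B where "B = (1 / (2 * real k + n + 1)) powr lam * A"
  have A0: "A >= 0" by (rule order_trans[OF _ A]) simp
  define f where "f = axis_test i m K"
  have [measurable]: "f \<in> borel_measurable borel" unfolding f_def axis_test_def[abs_def] by measurable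
  have nf: "(wnorm' al f) <= ennreal ((5 ^ m + 4 ^ m) * real K powr (real m - al / 2))"
   unfolding f_def by (rule axis_test_norm) (use al m k in \<open>auto simp: K_def\<close>)
  have "f \<in> L2w al" unfolding L2w_def using nf by (auto intro: le_less_trans)
  note Cf = C[OF this]
  have "ennreal (B^2 * (c * real (k + 1) powr (- 1 / 2) * c0)) <= ennreal (B^2) * (NN x. ennreal ((Phi (axis_midx i k) x)^2 * weight al x))"
  proof -
   have "ennreal (c * real (k + 1) powr (- 1 / 2) * c0) <= ennreal ((LI t. (1 + \<bar>t\<bar>) powr (- al) * (hsq k t)) * c0)"
    using c(2)[OF k] c0 by (intro ennreal_leI mult_right_mono) auto
   also have "... <= (NN x. ennreal ((Phi (axis_midx i k) x)^2 * weight al x))"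
    unfolding c0_def by (rule axis_Phi_norm[OF al])
   finally show ?thesis by (simp add: ennreal_mult' mult_left_mono)
  qed
  also have "... = (NN x. ennreal (B^2) * ennreal ((Phi (axis_midx i k) x)^2 * weight al x))"
   unfolding weight_def by (rule nn_integral_cmult[symmetric]) measurable
  also have "... <= (NN  x. (BR_max lam f x)^2 * ennreal (weight al x))"
  proof (rule nn_integral_mono)
   fix x :: "real^'n"
   have "BR_mean lam R f x = cx (B * Phi (axis_midx i k) x)"
    unfolding R_def f_def B_def A_def n_def by (rule BR_mean_axis_test) (simp add: K_def)
   moreover have "ennreal (norm (BR_mean lam R f x)) <= BR_max lam f x"
    unfolding BR_max_def using R by (intro SUP_upper) simp
   ultimately have "ennreal \<bar>B * Phi (axis_midx i k) x\<bar> <= BR_max lam f x" by (simp only: norm_of_real)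
   hence "(ennreal \<bar>B * Phi (axis_midx i k) x\<bar>)^2 * ennreal (weight al x) <= (BR_max lam f x)^2 * ennreal (weight al x)"
    by (intro mult_right_mono power_mono) auto
   moreover have "(ennreal \<bar>B * Phi (axis_midx i k) x\<bar>)^2 * ennreal (weight al x) = ennreal (B^2) * ennreal ((Phi (axis_midx i k) x)^2 * weight al x)"
    by (simp add: ennreal_power power_mult_distrib ennreal_mult weight_def mult.assoc)
   ultimately show "ennreal (B^2) * ennreal ((Phi (axis_midx i k) x)^2 * weight al x) <= (BR_max lam f x)^2 * ennreal (weight al x)" by simp
  qed
  also note Cf
  also have "ennreal C * (NN  x. csqw (f x) (weight al x)) <= ennreal (max C 0) * ennreal ((5 ^ m + 4 ^ m) * real K powr (real m - al / 2))"
   by (intro mult_mono nf ennreal_leI) auto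
  also have "... = ennreal (D * real K powr (real m - al / 2))" unfolding D_def by (simp add: ennreal_mult' mult.assoc)
  finally have "B^2 * (c * real (k + 1) powr (- 1 / 2) * c0) <= D * real K powr (real m - al / 2)"
   using D by (simp add: ennreal_le_iff)
  moreover have "(1 / (2 * real k + n + 1)) powr (2 * lam) * (real k / 2) ^ m * (c * real (k + 1) powr (- 1 / 2) * c0) <= B^2 * (c * real (k + 1) powr (- 1 / 2) * c0)"
  proof (rule mult_right_mono)
   have "(sqrt (real k / 2) ^ m)^2 <= A^2" using A by (intro power_mono) auto
   moreover have "(sqrt (real k / 2) ^ m)^2 = (real k / 2) ^ m"
   proof -
    have "(sqrt (real k / 2) ^ m)^2 = ((sqrt (real k / 2))^2) ^ m" by (simp only: power_mult[symmetric] mult.commute)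
    thus ?thesis by simp
   qed
   moreover have "B^2 = (1 / (2 * real k + n + 1)) powr (2 * lam) * A^2"
   proof -
    have "((1 / (2 * real k + n + 1)) powr lam)^2 = (1 / (2 * real k + n + 1)) powr (2 * lam)"
     by (simp only: power2_eq_square powr_add[symmetric] mult_2)
    thus ?thesis by (simp only: B_def power_mult_distrib)
   qed
   ultimately show "(1 / (2 * real k + n + 1)) powr (2 * lam) * (real k / 2) ^ m <= B^2" by (simp add: mult_left_mono)
  qed (use c(1) c0 in simp)
  ultimately show ?thesis unfolding K_def by simp
 qed
 \<comment> \<open>Chosen so that q / k <= 1 / (2 k + n + 1) for k >= 1, which reduces the
   comparison to pure powers of k.\<close>
 define q where "q = 1 / (n + 3)"
 have q: "q > 0" using n by (simp add: q_def)
 define L where "L = q powr (2 * lam) * (1 / 2) ^ m * (c * 2 powr (- 1 / 2) * c0)"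
 have L: "L > 0" using q c(1) c0 by (simp add: L_def)
 define U where "U = D * real (m + 1) powr (real m - al / 2)"
 have upper: "real k powr e <= U / L" if k: "k >= 6400" for k
 proof -
  have k0: "real k > 0" "real k >= 1" using k by auto
  have 1: "(q / real k) powr (2 * lam) <= (1 / (2 * real k + n + 1)) powr (2 * lam)"
  proof (rule powr_mono2)
   have "2 * real k + n + 1 <= (n + 3) * real k" using k0 n mult_left_mono[OF k0(2) n] by (simp add: algebra_simps)
   thus "q / real k <= 1 / (2 * real k + n + 1)" unfolding q_def using k0 n by (simp add: frac_le add_nonneg_pos)
  qed (use lam q k0 in auto)
  have 2: "(2 * real k) powr (- 1 / 2) <= real (k + 1) powr (- 1 / 2)" using k0 by (intro powr_mono2') auto
  have "(q / real k) powr (2 * lam) * (real k / 2) ^ m * (c * (2 * real k) powr (- 1 / 2) * c0)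
    <= (1 / (2 * real k + n + 1)) powr (2 * lam) * (real k / 2) ^ m * (c * real (k + 1) powr (- 1 / 2) * c0)"
   using 1 2 c(1) c0 by (intro mult_mono mult_right_mono mult_left_mono mult_nonneg_nonneg) auto
  also have "... <= D * real (k + m) powr (real m - al / 2)" by (rule main[OF k])
  also have "... <= D * (real (m + 1) * real k) powr (real m - al / 2)"
  proof (intro mult_left_mono powr_mono2 D)
   have "real m * 1 <= real m * real k" using k0 by (intro mult_left_mono) auto
   thus "real (k + m) <= real (m + 1) * real k" by (simp add: algebra_simps)
  qed (use m in auto)
  also have "... = U * real k powr (real m - al / 2)" by (simp only: U_def powr_mult mult.assoc)
  finally have le: "(q / real k) powr (2 * lam) * (real k / 2) ^ m * (c * (2 * real k) powr (- 1 / 2) * c0) <= U * real k powr (real m - al / 2)" .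
  have eqL: "(q / real k) powr (2 * lam) * (real k / 2) ^ m * (c * (2 * real k) powr (- 1 / 2) * c0)
    = L * (real k powr e * real k powr (real m - al / 2))"
  proof -
   have a: "(q / real k) powr (2 * lam) = q powr (2 * lam) * real k powr (- (2 * lam))"
    by (simp add: powr_divide powr_minus_divide)
   have b: "(real k / 2) ^ m = (1 / 2) ^ m * real k powr (real m)" using k0 by (simp add: power_divide powr_realpow)
   have d: "(2 * real k) powr (- 1 / 2) = 2 powr (- 1 / 2) * real k powr (- 1 / 2)" by (rule powr_mult)
   have s: "real k powr (- (2 * lam)) * real k powr (real m) * real k powr (- 1 / 2) = real k powr e * real k powr (real m - al / 2)"
   proof -
    have "- (2 * lam) + real m + (- 1 / 2) = e + (real m - al / 2)" by (simp add: e_def field_simps)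
    thus ?thesis by (simp only: powr_add[symmetric])
   qed
   have "(q / real k) powr (2 * lam) * (real k / 2) ^ m * (c * (2 * real k) powr (- 1 / 2) * c0)
    = L * (real k powr (- (2 * lam)) * real k powr (real m) * real k powr (- 1 / 2))"
    unfolding a b d L_def by (simp only: mult_ac)
   thus ?thesis unfolding s .
  qed
  have pk: "real k powr (real m - al / 2) > 0" using k0 by simp
  have "(L * real k powr e) * real k powr (real m - al / 2) <= U * real k powr (real m - al / 2)" using le unfolding eqL by (simp only: mult.assoc)
  hence "L * real k powr e <= U" using pk by (rule mult_right_le_imp_le)
  thus ?thesis using L by (simp add: field_simps)
 qed
 have "filterlim (%k::nat. real k powr e) at_top sequentially" using e by real_asymp
 hence "\<forall>\<^sub>F k in sequentially. U / L + 1 <= real k powr e" by (simp add: filterlim_at_top)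
 then obtain k0 where "!!k. k >= k0 ==> U / L + 1 <= real k powr e" unfolding eventually_sequentially by blast
 from this[of "max k0 6400"] upper[of "max k0 6400"] show False by simp
qed

theorem theorem1p2:
  fixes \<alpha> lam :: real
  assumes "0 \<le> \<alpha>" and "\<alpha> < real CARD('n::finite)"
  shows "(lam > max ((\<alpha> - 1) / 4) 0 \<longrightarrow> BR_max_bounded TYPE('n) lam \<alpha>)
       \<and> (lam \<ge> 0 \<and> BR_max_bounded TYPE('n) lam \<alpha> \<longrightarrow> lam \<ge> max ((\<alpha> - 1) / 4) 0)"
  using BR_max_bounded_sufficient[OF assms, of lam] BR_max_bounded_necessary[OF assms(1), of lam, where ?'n = 'n] by auto

end
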